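(* Let $M$ be a manifold. The assignment $$B\mapsto\mathrm{Fr}(B),\qquad \alpha\mapsto\alpha!$$ defines a covariant functor $\mathrm{SPrin}(M)\to\mathrm{Prin}(M)$ from the category of semi-principal bundles over $M$ to the category of principal bundles over $M$. Moreover, this functor is essentially constant on the subcategory $\mathrm{Prin}(M)$, i.e. it leaves principal bundles unchanged up to the canonical isomorphism $\mathrm{Fr}(B)=B^{X}\cong B$ (where $X$ is a single point when $B$ is principal).
   Context: A $G$-manifold is a manifold with a smooth left $G$-action ($G$ a finite-dimensional Lie group). A $G$-semi-torsor is a $G$-manifold $F$ whose action is free and whose orbit space $F/G$ is discrete. A semi-principal $G$-bundle over $M$ with model fiber a $G$-semi-torsor $F$ is a smooth fiber bundle $\pi\colon B\to M$ with a fiber-preserving smooth left $G$-action, admitting around each point of $M$ local trivializations $\phi\colon U\times F\to\pi^{-1}(U)$ that restrict to isomorphisms of $G$-manifolds $F\to B_u$ for all $u\in U$. It is principal if $F$ is a torsor (free and transitive). The index set $X$ is a set bijective to $F/G$ (index sets of equal cardinality are identified). An equivariant bundle map $\alpha\colon B_1\to B_2$ over $\mathrm{id}_M$, from a semi-principal $G_1$-bundle to a semi-principal $G_2$-bundle, is a smooth fiber-preserving map with $\alpha(gb)=\xi(g)\alpha(b)$ for some homomorphism $\xi\colon G_1\to G_2$; it induces a bundle map $\alpha/\colon B_1/G_1\to B_2/G_2$ over $M$. $\mathrm{SPrin}(M)$ has as objects all semi-principal bundles over $M$ and as morphisms all equivariant bundle maps $\alpha$ such that $\alpha/$ is an isomorphism.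 $\mathrm{Prin}(M)$ is the category of principal bundles over $M$ with equivariant bundle maps; it is a full subcategory of $\mathrm{SPrin}(M)$. A basis of a $G$-set $E$ is a function $\tilde f\colon X\to E$ for which $G\times X\to E$, $(g,x)\mapsto g\tilde f(x)$, is an isomorphism of $G$-sets ($g(h,x)=(gh,x)$ on $G\times X$). $B^{\odot X}\to M$ is the $X$-fold fiber-wise product, whose points are functions $X\to B$ with image in a single fiber. The frame bundle $\mathrm{Fr}(B)\subset B^{\odot X}$ consists of those $\tilde b$ that are bases of the corresponding fiber of $B$; it is a principal bundle over $M$ with group $G\wr X=G^X\rtimes\mathrm{Sym}(X)$, $(\tilde g,\sigma)(\tilde g',\sigma')=(\tilde g(\tilde g'\circ\sigma^{-1}),\sigma\sigma')$, acting by $(\tilde g,\sigma)\tilde b=\tilde g(\tilde b\circ\sigma^{-1})$. For a morphism $\alpha$ of $\mathrm{SPrin}(M)$, $\alpha!\colon\mathrm{Fr}(B_1)\to\mathrm{Fr}(B_2)$ is $\tilde b\mapsto\alpha\circ\tilde b$, equivariant with respect to $\xi!=(\xi^X,\mathrm{id}_{\mathrm{Sym}(X)})\colon G_1\wr X\to G_2\wr X$.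
   Formalization: The semi-principal bundles are required to have finite orbit space F/G (finite X); for infinite X the group G≀X is not a finite-dimensional second countable Lie group (e.g. Sym(ℤ) for M a point, G trivial, F=ℤ), so Fr(B) is not an object of Prin(M). *)

theory Defs
  imports "HOL-Analysis.Analysis" "HOL-Algebra.Group_Action" "HOL-Combinatorics.Permutations"
begin

section \<open>Smooth maps between open subsets of Euclidean spaces\<close>

text \<open>
  Here R^n is the topological space \<^term>\<open>Euclidean_space n\<close> of the library, i.e. the set of
  those \<open>x :: nat \<Rightarrow> real\<close> with \<open>x i = 0\<close> for all \<open>i \<ge> n\<close>; dimensions are thus ordinary numbers.
\<close>

definition partial :: "nat \<Rightarrow> ((nat \<Rightarrow> real) \<Rightarrow> real) \<Rightarrow> (nat \<Rightarrow> real) \<Rightarrow> real" where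
  "partial i f = (\<lambda>x. deriv (\<lambda>t. f (x(i := t))) (x i))"

text \<open>\<open>Ck n k S f\<close>: the function \<open>f\<close> is k times continuously differentiable on the open set
  \<open>S\<close> of R^n.\<close>

primrec Ck :: "nat \<Rightarrow> nat \<Rightarrow> (nat \<Rightarrow> real) set \<Rightarrow> ((nat \<Rightarrow> real) \<Rightarrow> real) \<Rightarrow> bool" where
  "Ck n 0 S f \<longleftrightarrow> continuous_on S f"
| "Ck n (Suc k) S f \<longleftrightarrow> continuous_on S f \<and>
     (\<forall>i<n. (\<forall>x\<in>S. (\<lambda>t. f (x(i := t))) field_differentiable at (x i)) \<and> Ck n k S (partial i f))"

definition smooth_euclidean ::
    "nat \<Rightarrow> nat \<Rightarrow> (nat \<Rightarrow> real) set \<Rightarrow> ((nat \<Rightarrow> real) \<Rightarrow> nat \<Rightarrow> real) \<Rightarrow> bool" where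
  "smooth_euclidean m n S f \<longleftrightarrow> (\<forall>j<n. \<forall>k. Ck m k S (\<lambda>x. f x j))"


section \<open>Smooth manifolds\<close>

type_synonym 'a chart = "'a set \<times> ('a \<Rightarrow> nat \<Rightarrow> real)"

record 'a mfd =
  mtop :: "'a topology"
  mdim :: nat
  atlas :: "'a chart set"

abbreviation pts :: "'a mfd \<Rightarrow> 'a set" where
  "pts M \<equiv> topspace (mtop M)"

definition is_chart :: "'a topology \<Rightarrow> nat \<Rightarrow> 'a set \<Rightarrow> ('a \<Rightarrow> nat \<Rightarrow> real) \<Rightarrow> bool" where
  "is_chart T n U c \<longleftrightarrow> openin T U \<and> openin (Euclidean_space n) (c ` U) \<and>
     homeomorphic_map (subtopology T U) (subtopology (Euclidean_space n) (c ` U)) c"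

definition smooth_manifold :: "'a mfd \<Rightarrow> bool" where
  "smooth_manifold M \<longleftrightarrow>
     Hausdorff_space (mtop M) \<and> second_countable (mtop M) \<and>
     (\<forall>(U, c)\<in>atlas M. is_chart (mtop M) (mdim M) U c) \<and>
     (\<Union>(U, c)\<in>atlas M. U) = pts M \<and>
     (\<forall>(U, c)\<in>atlas M. \<forall>(V, d)\<in>atlas M.
        smooth_euclidean (mdim M) (mdim M) (c ` (U \<inter> V)) (d \<circ> inv_into U c))"

text \<open>Smooth maps defined on an open subset \<open>S\<close> of \<open>M\<close>.\<close>

definition smooth_map_on :: "'a mfd \<Rightarrow> 'b mfd \<Rightarrow> 'a set \<Rightarrow> ('a \<Rightarrow> 'b) \<Rightarrow> bool" where
  "smooth_map_on M N S f \<longleftrightarrow>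
     openin (mtop M) S \<and> continuous_map (subtopology (mtop M) S) (mtop N) f \<and>
     (\<forall>(U, c)\<in>atlas M. \<forall>(V, d)\<in>atlas N.
        smooth_euclidean (mdim M) (mdim N) (c ` (U \<inter> S \<inter> f -` V)) (d \<circ> f \<circ> inv_into U c))"

abbreviation smooth_map :: "'a mfd \<Rightarrow> 'b mfd \<Rightarrow> ('a \<Rightarrow> 'b) \<Rightarrow> bool" where
  "smooth_map M N f \<equiv> smooth_map_on M N (pts M) f"

definition diffeomorphism :: "'a mfd \<Rightarrow> 'b mfd \<Rightarrow> ('a \<Rightarrow> 'b) \<Rightarrow> bool" where
  "diffeomorphism M N f \<longleftrightarrow>
     bij_betw f (pts M) (pts N) \<and> smooth_map M N f \<and> smooth_map N M (inv_into (pts M) f)"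

definition euclidean_mfd :: "nat \<Rightarrow> (nat \<Rightarrow> real) mfd" where
  "euclidean_mfd n = \<lparr>mtop = Euclidean_space n, mdim = n,
     atlas = {(topspace (Euclidean_space n), \<lambda>x. x)}\<rparr>"

definition discrete_mfd :: "'a set \<Rightarrow> 'a mfd" where
  "discrete_mfd A = \<lparr>mtop = discrete_topology A, mdim = 0, atlas = {({a}, \<lambda>_ _. 0) |a. a \<in> A}\<rparr>"

definition prod_mfd :: "'a mfd \<Rightarrow> 'b mfd \<Rightarrow> ('a \<times> 'b) mfd" where
  "prod_mfd M N = \<lparr>mtop = prod_topology (mtop M) (mtop N), mdim = mdim M + mdim N,
     atlas = {(U \<times> V, \<lambda>(x, y) i. if i < mdim M then c x i else d y (i - mdim M)) |U c V d.
                (U, c) \<in> atlas M \<and> (V, d) \<in> atlas N}\<rparr>"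

text \<open>The power of \<open>M\<close> with index set \<open>{..<n}\<close>; the coordinates of the factors are concatenated,
  so that factor \<open>a\<close> occupies the positions from \<open>a * mdim M\<close> to \<open>a * mdim M + mdim M - 1\<close>.\<close>

definition power_mfd :: "nat \<Rightarrow> 'a mfd \<Rightarrow> (nat \<Rightarrow> 'a) mfd" where
  "power_mfd n M = \<lparr>mtop = product_topology (\<lambda>_. mtop M) {..<n}, mdim = n * mdim M,
     atlas = {(\<Pi>\<^sub>E a\<in>{..<n}. U a,
               \<lambda>x i. if i < n * mdim M then c (i div mdim M) (x (i div mdim M)) (i mod mdim M) else 0)
              |U c. \<forall>a<n. (U a, c a) \<in> atlas M}\<rparr>"

text \<open>
  The smooth structure induced by \<open>N\<close> on an embedded submanifold \<open>A\<close> of dimension \<open>d\<close>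
  (for instance on an open subset \<open>A\<close>, with \<open>d = mdim N\<close>).  Its charts are the homeomorphisms
  \<open>c\<close> from open subsets \<open>V\<close> of \<open>A\<close> onto open subsets of R^d such that \<open>c\<close> is the restriction
  of a smooth map defined on an open subset of \<open>N\<close>, and the inverse of \<open>c\<close> is smooth as a map
  into \<open>N\<close>.  That \<open>A\<close> is covered by such charts is a property of \<open>A\<close>.
\<close>

definition submfd :: "'a mfd \<Rightarrow> 'a set \<Rightarrow> nat \<Rightarrow> 'a mfd" where
  "submfd N A d = \<lparr>mtop = subtopology (mtop N) A, mdim = d,
     atlas = {(V, c). is_chart (subtopology (mtop N) A) d V c \<and>
        (\<exists>W c'. V = W \<inter> A \<and> smooth_map_on N (euclidean_mfd d) W c' \<and> (\<forall>x\<in>V. c' x = c x)) \<and>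
        smooth_map_on (euclidean_mfd d) N (c ` V) (inv_into V c)}\<rparr>"


section \<open>Lie groups, semi-torsors and torsors\<close>

record 'g lie_group =
  grp :: "'g monoid"
  gmfd :: "'g mfd"

definition lie_group :: "'g lie_group \<Rightarrow> bool" where
  "lie_group G \<longleftrightarrow> group (grp G) \<and> smooth_manifold (gmfd G) \<and> pts (gmfd G) = carrier (grp G) \<and>
     smooth_map (prod_mfd (gmfd G) (gmfd G)) (gmfd G) (\<lambda>(g, h). g \<otimes>\<^bsub>grp G\<^esub> h) \<and>
     smooth_map (gmfd G) (gmfd G) (\<lambda>g. inv\<^bsub>grp G\<^esub> g)"

definition lie_hom :: "'g lie_group \<Rightarrow> 'h lie_group \<Rightarrow> ('g \<Rightarrow> 'h) \<Rightarrow> bool" where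
  "lie_hom G H \<xi> \<longleftrightarrow> \<xi> \<in> hom (grp G) (grp H) \<and> smooth_map (gmfd G) (gmfd H) \<xi>"

definition G_manifold :: "'g lie_group \<Rightarrow> 'a mfd \<Rightarrow> ('g \<Rightarrow> 'a \<Rightarrow> 'a) \<Rightarrow> bool" where
  "G_manifold G E \<phi> \<longleftrightarrow> lie_group G \<and> smooth_manifold E \<and> group_action (grp G) (pts E) \<phi> \<and>
     smooth_map (prod_mfd (gmfd G) E) E (\<lambda>(g, x). \<phi> g x)"

text \<open>The quotient topology on the set of orbits of an action on \<open>T\<close>.\<close>

definition orbit_topology ::
    "('g, 'r) monoid_scheme \<Rightarrow> 'a topology \<Rightarrow> ('g \<Rightarrow> 'a \<Rightarrow> 'a) \<Rightarrow> 'a set topology" where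
  "orbit_topology G T \<phi> = topology (\<lambda>V. V \<subseteq> orbits G (topspace T) \<phi> \<and> openin T (\<Union>V))"

definition semi_torsor :: "'g lie_group \<Rightarrow> 'a mfd \<Rightarrow> ('g \<Rightarrow> 'a \<Rightarrow> 'a) \<Rightarrow> bool" where
  "semi_torsor G F \<phi> \<longleftrightarrow> G_manifold G F \<phi> \<and>
     (\<forall>x\<in>pts F. stabilizer (grp G) \<phi> x = {\<one>\<^bsub>grp G\<^esub>}) \<and>
     orbit_topology (grp G) (mtop F) \<phi> = discrete_topology (orbits (grp G) (pts F) \<phi>)"

definition torsor :: "'g lie_group \<Rightarrow> 'a mfd \<Rightarrow> ('g \<Rightarrow> 'a \<Rightarrow> 'a) \<Rightarrow> bool" where
  "torsor G F \<phi> \<longleftrightarrow> semi_torsor G F \<phi> \<and> pts F \<noteq> {} \<and> transitive_action (grp G) (pts F) \<phi>"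

text \<open>Isomorphisms of G-sets and bases of G-sets.\<close>

definition gset_iso ::
    "('g, 'r) monoid_scheme \<Rightarrow> 'a set \<Rightarrow> ('g \<Rightarrow> 'a \<Rightarrow> 'a) \<Rightarrow> 'b set \<Rightarrow> ('g \<Rightarrow> 'b \<Rightarrow> 'b) \<Rightarrow> ('a \<Rightarrow> 'b) \<Rightarrow> bool"
  where
  "gset_iso G E \<phi> E' \<phi>' f \<longleftrightarrow>
     bij_betw f E E' \<and> (\<forall>g\<in>carrier G. \<forall>x\<in>E. f (\<phi> g x) = \<phi>' g (f x))"

definition gset_basis ::
    "('g, 'r) monoid_scheme \<Rightarrow> 'a set \<Rightarrow> ('g \<Rightarrow> 'a \<Rightarrow> 'a) \<Rightarrow> 'x set \<Rightarrow> ('x \<Rightarrow> 'a) \<Rightarrow> bool" where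
  "gset_basis G E \<phi> X f \<longleftrightarrow> f \<in> X \<rightarrow>\<^sub>E E \<and>
     gset_iso G (carrier G \<times> X) (\<lambda>g (h, x). (g \<otimes>\<^bsub>G\<^esub> h, x)) E \<phi> (\<lambda>(g, x). \<phi> g (f x))"


section \<open>Semi-principal bundles\<close>

record ('m, 'b, 'g, 'f) gbundle =
  tot :: "'b mfd"
  proj :: "'b \<Rightarrow> 'm"
  sgrp :: "'g lie_group"
  act :: "'g \<Rightarrow> 'b \<Rightarrow> 'b"
  fib :: "'f mfd"
  fibact :: "'g \<Rightarrow> 'f \<Rightarrow> 'f"

abbreviation bgrp :: "('m, 'b, 'g, 'f) gbundle \<Rightarrow> 'g monoid" where
  "bgrp B \<equiv> grp (sgrp B)"

definition tot_over :: "('m, 'b, 'g, 'f) gbundle \<Rightarrow> 'm set \<Rightarrow> 'b set" where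
  "tot_over B U = {b \<in> pts (tot B). proj B b \<in> U}"

definition local_trivialization ::
    "'m mfd \<Rightarrow> ('m, 'b, 'g, 'f) gbundle \<Rightarrow> 'm set \<Rightarrow> ('m \<times> 'f \<Rightarrow> 'b) \<Rightarrow> bool" where
  "local_trivialization M B U \<phi> \<longleftrightarrow> openin (mtop M) U \<and>
     diffeomorphism (prod_mfd (submfd M U (mdim M)) (fib B))
       (submfd (tot B) (tot_over B U) (mdim (tot B))) \<phi> \<and>
     (\<forall>u\<in>U. \<forall>x\<in>pts (fib B). proj B (\<phi> (u, x)) = u) \<and>
     (\<forall>u\<in>U.
        diffeomorphism (fib B) (submfd (tot B) (tot_over B {u}) (mdim (fib B))) (\<lambda>x. \<phi> (u, x)) \<and>
        gset_iso (bgrp B) (pts (fib B)) (fibact B) (tot_over B {u}) (act B) (\<lambda>x. \<phi> (u, x)))"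

definition semi_principal :: "'m mfd \<Rightarrow> ('m, 'b, 'g, 'f) gbundle \<Rightarrow> bool" where
  "semi_principal M B \<longleftrightarrow>
     semi_torsor (sgrp B) (fib B) (fibact B) \<and>
     G_manifold (sgrp B) (tot B) (act B) \<and>
     smooth_map (tot B) M (proj B) \<and>
     (\<forall>g\<in>carrier (bgrp B). \<forall>b\<in>pts (tot B). proj B (act B g b) = proj B b) \<and>
     (\<forall>m\<in>pts M. \<exists>U \<phi>. m \<in> U \<and> local_trivialization M B U \<phi>)"

definition principal :: "'m mfd \<Rightarrow> ('m, 'b, 'g, 'f) gbundle \<Rightarrow> bool" where
  "principal M B \<longleftrightarrow> semi_principal M B \<and> torsor (sgrp B) (fib B) (fibact B)"

text \<open>
  \<open>index_size B\<close> is the cardinality of \<open>F/G\<close>.  Index sets matter only up to bijection, and for finite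
  \<open>F/G\<close> the index set \<open>X\<close> is taken to be \<open>{..<index_size B}\<close>.
\<close>

definition fiber_orbits :: "('m, 'b, 'g, 'f) gbundle \<Rightarrow> 'f set set" where
  "fiber_orbits B = orbits (bgrp B) (pts (fib B)) (fibact B)"

definition index_size :: "('m, 'b, 'g, 'f) gbundle \<Rightarrow> nat" where
  "index_size B = card (fiber_orbits B)"

text \<open>
  The orbit bundle \<open>B/G\<close> over \<open>M\<close>.  It has discrete fibers, so its smooth structure is the one
  that makes the projection to \<open>M\<close> a local diffeomorphism: the charts are the charts of \<open>M\<close>
  composed with the projection, on open sets mapped homeomorphically onto open subsets of \<open>M\<close>.
\<close>

definition orbit_proj :: "('m, 'b, 'g, 'f) gbundle \<Rightarrow> 'b set \<Rightarrow> 'm" where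
  "orbit_proj B W = the_elem (proj B ` W)"

definition orbit_mfd :: "'m mfd \<Rightarrow> ('m, 'b, 'g, 'f) gbundle \<Rightarrow> 'b set mfd" where
  "orbit_mfd M B =
     (let T = orbit_topology (bgrp B) (mtop (tot B)) (act B); p = orbit_proj B in
      \<lparr>mtop = T, mdim = mdim M,
       atlas = {(V, c \<circ> p) |V U c. (U, c) \<in> atlas M \<and> openin T V \<and> openin (mtop M) (p ` V) \<and>
                  p ` V \<subseteq> U \<and>
                  homeomorphic_map (subtopology T V) (subtopology (mtop M) (p ` V)) p}\<rparr>)"

text \<open>Equivariant bundle maps over the identity of \<open>M\<close>.  As in \<^theory>\<open>HOL-Library.FuncSet\<close>, maps
  are made extensional, so that equality of maps is equality on the total space.\<close>

definition equivariant_along ::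
    "('m, 'b, 'g, 'f) gbundle \<Rightarrow> ('m, 'c, 'h, 'e) gbundle \<Rightarrow> ('g \<Rightarrow> 'h) \<Rightarrow> ('b \<Rightarrow> 'c) \<Rightarrow> bool" where
  "equivariant_along A B \<xi> \<alpha> \<longleftrightarrow> lie_hom (sgrp A) (sgrp B) \<xi> \<and>
     (\<forall>g\<in>carrier (bgrp A). \<forall>b\<in>pts (tot A). \<alpha> (act A g b) = act B (\<xi> g) (\<alpha> b))"

definition equivariant_maps ::
    "('m, 'b, 'g, 'f) gbundle \<Rightarrow> ('m, 'c, 'h, 'e) gbundle \<Rightarrow> ('b \<Rightarrow> 'c) set" where
  "equivariant_maps A B = {\<alpha>. \<alpha> \<in> extensional (pts (tot A)) \<and>
     smooth_map (tot A) (tot B) \<alpha> \<and>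
     (\<forall>b\<in>pts (tot A). proj B (\<alpha> b) = proj A b) \<and>
     (\<exists>\<xi>. equivariant_along A B \<xi> \<alpha>)}"

text \<open>The induced map on orbits; it sends the orbit of \<open>b\<close> to the orbit of \<open>\<alpha> b\<close>.\<close>

definition orbit_map ::
    "('m, 'c, 'h, 'e) gbundle \<Rightarrow> ('b \<Rightarrow> 'c) \<Rightarrow> 'b set \<Rightarrow> 'c set" where
  "orbit_map B \<alpha> W = (\<Union>b\<in>W. orbit (bgrp B) (act B) (\<alpha> b))"

definition orbit_bundle_iso ::
    "'m mfd \<Rightarrow> ('m, 'b, 'g, 'f) gbundle \<Rightarrow> ('m, 'c, 'h, 'e) gbundle \<Rightarrow> ('b set \<Rightarrow> 'c set) \<Rightarrow> bool" where
  "orbit_bundle_iso M A B \<beta> \<longleftrightarrow> diffeomorphism (orbit_mfd M A) (orbit_mfd M B) \<beta> \<and>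
     (\<forall>W\<in>pts (orbit_mfd M A). orbit_proj B (\<beta> W) = orbit_proj A W)"


section \<open>Categories\<close>

text \<open>\<open>Comp C A B D g f\<close> is the composite of \<open>f : A \<rightarrow> B\<close> and \<open>g : B \<rightarrow> D\<close>.\<close>

record ('o, 'a) cat =
  Ob :: "'o set"
  Hom :: "'o \<Rightarrow> 'o \<Rightarrow> 'a set"
  Id :: "'o \<Rightarrow> 'a"
  Comp :: "'o \<Rightarrow> 'o \<Rightarrow> 'o \<Rightarrow> 'a \<Rightarrow> 'a \<Rightarrow> 'a"

definition category :: "('o, 'a) cat \<Rightarrow> bool" where
  "category C \<longleftrightarrow>
     (\<forall>A\<in>Ob C. Id C A \<in> Hom C A A) \<and>
     (\<forall>A\<in>Ob C. \<forall>B\<in>Ob C. \<forall>D\<in>Ob C. \<forall>f\<in>Hom C A B. \<forall>g\<in>Hom C B D.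
        Comp C A B D g f \<in> Hom C A D) \<and>
     (\<forall>A\<in>Ob C. \<forall>B\<in>Ob C. \<forall>f\<in>Hom C A B.
        Comp C A A B f (Id C A) = f \<and> Comp C A B B (Id C B) f = f) \<and>
     (\<forall>A\<in>Ob C. \<forall>B\<in>Ob C. \<forall>D\<in>Ob C. \<forall>E\<in>Ob C. \<forall>f\<in>Hom C A B. \<forall>g\<in>Hom C B D. \<forall>h\<in>Hom C D E.
        Comp C A D E h (Comp C A B D g f) = Comp C A B E (Comp C B D E h g) f)"

definition full_subcategory :: "('o, 'a) cat \<Rightarrow> ('o, 'a) cat \<Rightarrow> bool" where
  "full_subcategory D C \<longleftrightarrow> category D \<and> category C \<and> Ob D \<subseteq> Ob C \<and>
     (\<forall>A\<in>Ob D. \<forall>B\<in>Ob D. Hom D A B = Hom C A B) \<and>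
     (\<forall>A\<in>Ob D. Id D A = Id C A) \<and>
     (\<forall>A\<in>Ob D. \<forall>B\<in>Ob D. \<forall>E\<in>Ob D. \<forall>f\<in>Hom D A B. \<forall>g\<in>Hom D B E.
        Comp D A B E g f = Comp C A B E g f)"

definition covariant_functor ::
    "('o, 'a) cat \<Rightarrow> ('p, 'c) cat \<Rightarrow> ('o \<Rightarrow> 'p) \<Rightarrow> ('o \<Rightarrow> 'o \<Rightarrow> 'a \<Rightarrow> 'c) \<Rightarrow> bool" where
  "covariant_functor C D Fo Fm \<longleftrightarrow> category C \<and> category D \<and>
     (\<forall>A\<in>Ob C. Fo A \<in> Ob D) \<and>
     (\<forall>A\<in>Ob C. \<forall>B\<in>Ob C. \<forall>f\<in>Hom C A B. Fm A B f \<in> Hom D (Fo A) (Fo B)) \<and>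
     (\<forall>A\<in>Ob C. Fm A A (Id C A) = Id D (Fo A)) \<and>
     (\<forall>A\<in>Ob C. \<forall>B\<in>Ob C. \<forall>E\<in>Ob C. \<forall>f\<in>Hom C A B. \<forall>g\<in>Hom C B E.
        Fm A E (Comp C A B E g f) = Comp D (Fo A) (Fo B) (Fo E) (Fm B E g) (Fm A B f))"

text \<open>
  The objects of \<open>SPrin M\<close> are required to have a finite index set: otherwise \<open>G wr X\<close> is not a
  (finite-dimensional, second countable) Lie group, as \<open>Sym X\<close> is then an uncountable discrete
  quotient, and there is no principal bundle \<open>Fr B\<close>.
\<close>

definition SPrin :: "'m mfd \<Rightarrow> (('m, 'b, 'g, 'f) gbundle, 'b \<Rightarrow> 'b) cat" where
  "SPrin M = \<lparr>Ob = {B. semi_principal M B \<and> finite (fiber_orbits B)},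
     Hom = (\<lambda>A B. {\<alpha> \<in> equivariant_maps A B. orbit_bundle_iso M A B (orbit_map B \<alpha>)}),
     Id = (\<lambda>A. \<lambda>b\<in>pts (tot A). b),
     Comp = (\<lambda>A B D. compose (pts (tot A)))\<rparr>"

definition Prin :: "'m mfd \<Rightarrow> (('m, 'b, 'g, 'f) gbundle, 'b \<Rightarrow> 'b) cat" where
  "Prin M = \<lparr>Ob = {B. principal M B},
     Hom = equivariant_maps,
     Id = (\<lambda>A. \<lambda>b\<in>pts (tot A). b),
     Comp = (\<lambda>A B D. compose (pts (tot A)))\<rparr>"

text \<open>Isomorphism of principal bundles.  The two carriers may have different HOL types, so
  this cannot be phrased inside a single instance of \<^const>\<open>Prin\<close>.\<close>

definition bundle_iso ::
    "('m, 'b, 'g, 'f) gbundle \<Rightarrow> ('m, 'c, 'h, 'e) gbundle \<Rightarrow> ('b \<Rightarrow> 'c) \<Rightarrow> bool" where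
  "bundle_iso A B \<alpha> \<longleftrightarrow> \<alpha> \<in> equivariant_maps A B \<and>
     (\<exists>\<beta>\<in>equivariant_maps B A. compose (pts (tot A)) \<beta> \<alpha> = (\<lambda>b\<in>pts (tot A). b) \<and>
        compose (pts (tot B)) \<alpha> \<beta> = (\<lambda>b\<in>pts (tot B). b))"


section \<open>The frame bundle\<close>

text \<open>The wreath product \<open>G wr X\<close> for \<open>X = {..<n}\<close>.\<close>

definition wreath_group :: "nat \<Rightarrow> ('g, 'r) monoid_scheme \<Rightarrow> ((nat \<Rightarrow> 'g) \<times> (nat \<Rightarrow> nat)) monoid" where
  "wreath_group n G =
     \<lparr>carrier = ({..<n} \<rightarrow>\<^sub>E carrier G) \<times> {\<sigma>. \<sigma> permutes {..<n}},
      mult = (\<lambda>(g, \<sigma>) (h, \<tau>). (\<lambda>x\<in>{..<n}. g x \<otimes>\<^bsub>G\<^esub> h (inv_into UNIV \<sigma> x), \<sigma> \<circ> \<tau>)),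
      one = (\<lambda>x\<in>{..<n}. \<one>\<^bsub>G\<^esub>, id)\<rparr>"

definition wreath :: "nat \<Rightarrow> 'g lie_group \<Rightarrow> ((nat \<Rightarrow> 'g) \<times> (nat \<Rightarrow> nat)) lie_group" where
  "wreath n G = \<lparr>grp = wreath_group n (grp G),
     gmfd = prod_mfd (power_mfd n (gmfd G)) (discrete_mfd {\<sigma>. \<sigma> permutes {..<n}})\<rparr>"

text \<open>
  The points of the fiber-wise power are functions \<open>X \<rightarrow> B\<close> with image in a single fiber.  They are
  stored together with the base point of that fiber; this is redundant unless \<open>X\<close> is empty, in
  which case the fiber-wise power is \<open>M\<close> itself.
\<close>

definition fiber_power :: "'m mfd \<Rightarrow> ('m, 'b, 'g, 'f) gbundle \<Rightarrow> nat \<Rightarrow> ('m \<times> (nat \<Rightarrow> 'b)) set" where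
  "fiber_power M B n = {(m, b). m \<in> pts M \<and> b \<in> {..<n} \<rightarrow>\<^sub>E tot_over B {m}}"

definition frames :: "'m mfd \<Rightarrow> ('m, 'b, 'g, 'f) gbundle \<Rightarrow> ('m \<times> (nat \<Rightarrow> 'b)) set" where
  "frames M B = {(m, b) \<in> fiber_power M B (index_size B).
     gset_basis (bgrp B) (tot_over B {m}) (act B) {..<index_size B} b}"

text \<open>The group \<open>G wr X\<close>, acting on itself by left multiplication, serves as the model fiber.\<close>

definition frame_bundle ::
    "'m mfd \<Rightarrow> ('m, 'b, 'g, 'f) gbundle \<Rightarrow>
     ('m, 'm \<times> (nat \<Rightarrow> 'b), (nat \<Rightarrow> 'g) \<times> (nat \<Rightarrow> nat), (nat \<Rightarrow> 'g) \<times> (nat \<Rightarrow> nat)) gbundle" where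
  "frame_bundle M B = (let n = index_size B; W = wreath n (sgrp B) in
     \<lparr>tot = submfd (prod_mfd M (power_mfd n (tot B))) (frames M B) (mdim M + n * mdim (fib B)),
      proj = fst,
      sgrp = W,
      act = (\<lambda>(g, \<sigma>). \<lambda>(m, b)\<in>frames M B.
               (m, \<lambda>x\<in>{..<n}. act B (g x) (b (inv_into UNIV \<sigma> x)))),
      fib = gmfd W,
      fibact = (\<lambda>w. \<lambda>v\<in>carrier (grp W). w \<otimes>\<^bsub>grp W\<^esub> v)\<rparr>)"

definition frame_map ::
    "'m mfd \<Rightarrow> ('m, 'b, 'g, 'f) gbundle \<Rightarrow> ('m, 'c, 'h, 'e) gbundle \<Rightarrow> ('b \<Rightarrow> 'c) \<Rightarrow>
     'm \<times> (nat \<Rightarrow> 'b) \<Rightarrow> 'm \<times> (nat \<Rightarrow> 'c)" where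
  "frame_map M A B \<alpha> = (\<lambda>(m, b)\<in>frames M A. (m, compose {..<index_size A} \<alpha> b))"

text \<open>The canonical map \<open>Fr B = B^X \<rightarrow> B\<close> for a principal bundle, where \<open>X = {0}\<close>.\<close>

definition frame_eval :: "'m mfd \<Rightarrow> ('m, 'b, 'g, 'f) gbundle \<Rightarrow> 'm \<times> (nat \<Rightarrow> 'b) \<Rightarrow> 'b" where
  "frame_eval M B = (\<lambda>(m, b)\<in>frames M B. b 0)"

end

theory Submission
  imports Defs
begin

text \<open>
  Functoriality and the compatibility with the canonical isomorphism are pointwise computations
  with \<open>b \<mapsto> \<alpha> \<circ> b\<close>.  The content of the theorem is that \<open>Fr B\<close> is a principal bundle and that
  \<open>\<alpha> \<circ> b\<close> is again a frame.

  \<^bold>\<open>Frames form a principal bundle.\<close>  Over an open set on which \<open>B\<close> is trivial, a frame in the fiber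
  over \<open>u\<close> is the same as a basis of the model fiber \<open>F\<close>.  Fix one basis \<open>e\<close> of \<open>F\<close>.  Then
  \<open>w \<mapsto> w e\<close> identifies \<open>G wr X\<close> with the set of all bases of \<open>F\<close>, so the frames over \<open>U\<close> are
  \<open>U \<times> (G wr X)\<close> (\<open>local_product_frames\<close>, \<open>principal_frame_bundle\<close>).  The bases form an open
  subset of \<open>F^X\<close>, because the orbits in \<open>F\<close> are open.  The one point that is not formal is that the
  identification is smooth in both directions: to recover \<open>w\<close> from \<open>w e\<close> one has to recover \<open>g\<close>
  from \<open>g x\<close>, i.e. the inverse of the orbit map \<open>G \<rightarrow> G x\<close> onto a free open orbit has to be smooth.

  \<^bold>\<open>The inverse of the orbit map is smooth\<close> (\<open>smooth_\<tau>\<close>).  A smooth bijection need not have a smooth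
  inverse; here equivariance helps three times.  (1) Countably many translates of a compact
  neighbourhood of the unit cover \<open>G\<close>, so by the Baire category theorem one of them, hence each of
  them, has an image with nonempty interior; therefore the orbit map is open
  (\<open>orbit_map_open_at_unit\<close>).  (2) Near the unit the orbit map multiplies distances from the
  unit by at least a positive constant.  Otherwise some \<open>g\<close> close to the unit moves \<open>x\<close> much less than it moves the
  unit; a suitable power of \<open>g\<close> then lies at a fixed distance from the unit and still moves \<open>x\<close>
  arbitrarily little, which contradicts injectivity on a compact shell
  (\<open>iterated_translation_lower_bound\<close>).  With this bound the inverse \<open>\<tau>\<close> is differentiable at \<open>x\<close>
  (\<open>has_gradient_of_inverse\<close>).  (3) Since \<open>\<tau> v = g (\<tau> (g\<inverse> v))\<close>, the derivative of \<open>\<tau>\<close> at every other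
  point \<open>g x\<close> is obtained from the one at \<open>x\<close>, by a formula that is smooth in the point and in the
  value \<open>g\<close> of \<open>\<tau>\<close> there.  So if \<open>\<tau>\<close> is of class C^k, its derivatives are of class C^k and \<open>\<tau>\<close> is
  of class C^(k+1) (\<open>Ck_bootstrap\<close>).

  \<^bold>\<open>Morphisms.\<close>  The projection of an orbit bundle to \<open>M\<close> is a local homeomorphism that defines the
  smooth structure, so continuous maps over \<open>M\<close> between orbit bundles are smooth
  (\<open>smooth_map_orbit_mfd\<close>) and the condition on \<open>\<alpha>/\<close> is a topological one
  (\<open>orbit_bundle_iso_iff\<close>).  It makes \<open>\<alpha>\<close> induce a bijection between the orbits of corresponding
  fibers.  A family is a basis exactly if it meets every orbit once (\<open>basis_iff_orbits\<close>), hence \<open>\<alpha> \<circ> b\<close>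
  is a frame (\<open>frame_map_basis\<close>), and the two index sets have equal size provided that \<open>M\<close> has a
  point.  If \<open>M\<close> is empty, the sizes may differ; but then the frame bundles are empty and
  equivariance holds along the trivial homomorphism.

  \<^bold>\<open>Principal bundles.\<close>  If \<open>B\<close> is principal, then \<open>B/G\<close> is homeomorphic to \<open>M\<close>, so every equivariant
  bundle map satisfies the condition on \<open>\<alpha>/\<close> (\<open>principal_orbit_bundle_iso\<close>).  The index set is a
  point, every point of a fiber is a basis of it, and \<open>b \<mapsto> (0 \<mapsto> b)\<close> inverts the canonical map.
\<close>


section \<open>Calculus on open subsets of Euclidean space\<close>

abbreviation espace :: "nat \<Rightarrow> (nat \<Rightarrow> real) set" where
  "espace n \<equiv> topspace (Euclidean_space n)"

text \<open>
  The estimates below are made in the sum norm: the sum of componentwise estimates is then again an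
  estimate, and juxtaposing two vectors adds their norms.
\<close>

definition l1 :: "nat \<Rightarrow> (nat \<Rightarrow> real) \<Rightarrow> (nat \<Rightarrow> real) \<Rightarrow> real" where
  "l1 n x y = (\<Sum>i<n. \<bar>x i - y i\<bar>)"

lemma l1_nonneg [simp]: "0 \<le> l1 n x y"
  by (simp add: l1_def sum_nonneg)

lemma l1_same [simp]: "l1 n x x = 0"
  by (simp add: l1_def)

lemma l1_triangle: "l1 n x z \<le> l1 n x y + l1 n y z"
  unfolding l1_def sum.distrib [symmetric] by (intro sum_mono) auto

lemma component_le_l1: "i < n \<Longrightarrow> \<bar>x i - y i\<bar> \<le> l1 n x y"
  unfolding l1_def by (rule member_le_sum [of i "{..<n}" "\<lambda>i. \<bar>x i - y i\<bar>"]) auto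

lemma espace_eqI: "\<lbrakk>x \<in> espace n; y \<in> espace n; \<And>i. i < n \<Longrightarrow> x i = y i\<rbrakk> \<Longrightarrow> x = y"
  by (rule ext) (simp add: topspace_Euclidean_space, metis not_less)

lemma l1_eq_0_iff: "\<lbrakk>x \<in> espace n; y \<in> espace n\<rbrakk> \<Longrightarrow> l1 n x y = 0 \<longleftrightarrow> x = y"
  by (auto simp: l1_def sum_nonneg_eq_0_iff intro!: espace_eqI)

lemma espace_upd: "\<lbrakk>x \<in> espace n; i < n\<rbrakk> \<Longrightarrow> x(i := t) \<in> espace n"
  by (simp add: topspace_Euclidean_space)

lemma l1_upd: "i < n \<Longrightarrow> l1 n (x(i := t)) x = \<bar>t - x i\<bar>"
proof -
  assume "i < n"
  then have "l1 n (x(i := t)) x = (\<Sum>j<n. if j = i then \<bar>t - x i\<bar> else 0)"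
    unfolding l1_def by (intro sum.cong) auto
  then show ?thesis using \<open>i < n\<close> by simp
qed

lemma Euclidean_space_top_of_set: "Euclidean_space n = top_of_set (espace n)"
  by (simp add: Euclidean_space_def euclidean_product_topology)

lemma openin_Euclidean_space_open:
  "openin (Euclidean_space n) T \<longleftrightarrow> (\<exists>W. open W \<and> T = espace n \<inter> W)"
  by (metis Euclidean_space_top_of_set openin_open)

lemma continuous_on_l1: "continuous_on UNIV (\<lambda>z. l1 n z y)"
  unfolding l1_def by (intro continuous_intros) auto

text \<open>
  \<open>Euclidean_space n\<close> carries the topology of pointwise convergence of functions on \<^typ>\<open>nat\<close>; as its
  points are supported in the first \<open>n\<close> coordinates, this is the topology of the norm.
\<close>

lemma openin_Euclidean_space_l1:
  "openin (Euclidean_space n) T \<longleftrightarrow>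
     T \<subseteq> espace n \<and> (\<forall>y\<in>T. \<exists>\<delta>>0. \<forall>z\<in>espace n. l1 n z y < \<delta> \<longrightarrow> z \<in> T)"
proof (intro iffI conjI ballI)
  assume T: "openin (Euclidean_space n) T"
  show "T \<subseteq> espace n" using T by (rule openin_subset)
  fix y assume y: "y \<in> T"
  obtain W where W: "open W" "T = espace n \<inter> W"
    using T unfolding openin_Euclidean_space_open by auto
  have "openin (product_topology (\<lambda>i. euclidean) UNIV) W"
    using W(1) by (simp add: euclidean_product_topology)
  then obtain X where X: "y \<in> (\<Pi>\<^sub>E i\<in>UNIV. X i)" "\<And>i. open (X i)" "(\<Pi>\<^sub>E i\<in>UNIV. X i) \<subseteq> W"
    using product_topology_open_contains_basis [of "\<lambda>i::nat. euclideanreal" UNIV W y] y W(2)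
    by auto
  have "\<exists>e>0. \<forall>t. \<bar>t - y i\<bar> < e \<longrightarrow> t \<in> X i" for i
    using X(1) X(2)[of i] unfolding open_dist by (auto simp: dist_real_def PiE_iff)
  then obtain e where e: "\<And>i. e i > 0" "\<And>i t. \<bar>t - y i\<bar> < e i \<Longrightarrow> t \<in> X i" by metis
  define \<delta> where "\<delta> = Min (insert 1 (e ` {..<n}))"
  have "\<delta> > 0" unfolding \<delta>_def using e(1) by auto
  moreover have "z \<in> T" if z: "z \<in> espace n" "l1 n z y < \<delta>" for z
  proof -
    have "z i \<in> X i" for i
    proof (cases "i < n")
      case True
      then have "\<delta> \<le> e i" unfolding \<delta>_def by (intro Min_le) auto
      then show ?thesis using component_le_l1[OF True, of z y] z e(2) by force
    next
      case False
      then have "z i = y i" using z y W(2) by (auto simp: topspace_Euclidean_space)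
      then show ?thesis using X(1) by (auto simp: PiE_iff)
    qed
    then show ?thesis using X(3) z W(2) by auto
  qed
  ultimately show "\<exists>\<delta>>0. \<forall>z\<in>espace n. l1 n z y < \<delta> \<longrightarrow> z \<in> T" by blast
next
  assume *: "T \<subseteq> espace n \<and> (\<forall>y\<in>T. \<exists>\<delta>>0. \<forall>z\<in>espace n. l1 n z y < \<delta> \<longrightarrow> z \<in> T)"
  then obtain \<delta> where d: "\<And>y. y \<in> T \<Longrightarrow> \<delta> y > 0"
    "\<And>y z. \<lbrakk>y \<in> T; z \<in> espace n; l1 n z y < \<delta> y\<rbrakk> \<Longrightarrow> z \<in> T"
    by metis
  have "open (\<Union>y\<in>T. {z. l1 n z y < \<delta> y})"
    by (intro open_UN ballI open_Collect_less continuous_on_l1 continuous_intros)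
  moreover have "T = espace n \<inter> (\<Union>y\<in>T. {z. l1 n z y < \<delta> y})"
    using * d by force
  ultimately show "openin (Euclidean_space n) T"
    unfolding openin_Euclidean_space_open by blast
qed

lemma openin_Euclidean_space_ball:
  "openin (Euclidean_space n) {z \<in> espace n. l1 n z y < \<delta>}"
proof -
  have "{z \<in> espace n. l1 n z y < \<delta>} = espace n \<inter> {z. l1 n z y < \<delta>}" by auto
  then show ?thesis
    unfolding openin_Euclidean_space_open
    using open_Collect_less[OF continuous_on_l1 continuous_on_const] by blast
qed

lemma continuous_on_openin_l1:
  fixes f :: "(nat \<Rightarrow> real) \<Rightarrow> real"
  assumes S: "openin (Euclidean_space n) S" and f: "continuous_on S f" and y: "y \<in> S" and e: "e > 0"
  shows "\<exists>\<delta>>0. \<forall>z\<in>espace n. l1 n z y < \<delta> \<longrightarrow> z \<in> S \<and> \<bar>f z - f y\<bar> < e"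
proof -
  have "openin (top_of_set S) (S \<inter> f -` ball (f y) e)"
    using f by (intro continuous_openin_preimage_gen) auto
  then have "openin (Euclidean_space n) (S \<inter> f -` ball (f y) e)"
    using S unfolding openin_Euclidean_space_open openin_open by (metis Int_assoc open_Int)
  moreover have "y \<in> S \<inter> f -` ball (f y) e" using y e by auto
  ultimately obtain \<delta> where "\<delta> > 0" "\<forall>z\<in>espace n. l1 n z y < \<delta> \<longrightarrow> z \<in> S \<inter> f -` ball (f y) e"
    unfolding openin_Euclidean_space_l1 by meson
  then show ?thesis by (intro exI[of _ \<delta>]) (auto simp: dist_real_def abs_minus_commute)
qed

lemma continuous_on_local:
  assumes loc: "\<And>x. x \<in> S \<Longrightarrow> \<exists>S'. openin (Euclidean_space n) S' \<and> x \<in> S' \<and> continuous_on S' f"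
    and S: "S \<subseteq> espace n"
  shows "continuous_on S f"
  unfolding continuous_on_eq_continuous_within
proof
  fix x assume x: "x \<in> S"
  obtain S' where S': "openin (Euclidean_space n) S'" "x \<in> S'" "continuous_on S' f"
    using loc[OF x] by blast
  obtain W where W: "open W" "S' = espace n \<inter> W"
    using S'(1) unfolding openin_Euclidean_space_open by auto
  have "continuous (at x within S') f" using S' by (simp add: continuous_on_eq_continuous_within)
  then have "continuous (at x within (S \<inter> S')) f" by (rule continuous_within_subset) auto
  moreover have "at x within (S \<inter> S') = at x within S"
    by (rule at_within_nhd[of x W]) (use W S S' x in auto)
  ultimately show "continuous (at x within S) f" by simp
qed

lemma eventually_upd_in:
  assumes "openin (Euclidean_space n) S" "x \<in> S" "i < n"
  shows "\<forall>\<^sub>F t in nhds (x i). x(i := t) \<in> S"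
proof -
  obtain \<delta> where d: "\<delta> > 0" "\<forall>z\<in>espace n. l1 n z x < \<delta> \<longrightarrow> z \<in> S"
    using assms unfolding openin_Euclidean_space_l1 by blast
  have "x \<in> espace n" using assms openin_subset by blast
  show ?thesis
    unfolding eventually_nhds_metric
    by (intro exI[of _ \<delta>])
      (use d assms \<open>x \<in> espace n\<close> in \<open>auto simp: l1_upd dist_real_def espace_upd\<close>)
qed


text \<open>
  Openness matters: \<^const>\<open>Ck\<close> uses partial derivatives, which look at \<open>f\<close> outside of \<open>S\<close> unless
  a small interval through every point of \<open>S\<close> stays in \<open>S\<close>.
\<close>

lemma Ck_cong:
  assumes "openin (Euclidean_space n) S"
  shows "(\<And>x. x \<in> S \<Longrightarrow> f x = g x) \<Longrightarrow> Ck n k S f \<Longrightarrow> Ck n k S g"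
proof (induction k arbitrary: f g)
  case 0
  then show ?case using continuous_on_cong[of S S f g] by auto
next
  case (Suc k)
  have ev: "\<forall>\<^sub>F t in nhds (x i). f (x(i := t)) = g (x(i := t))" if "x \<in> S" "i < n" for x i
    using eventually_upd_in[OF assms that] by eventually_elim (use Suc.prems in auto)
  have "continuous_on S g" using Suc.prems continuous_on_cong[of S S f g] by auto
  moreover have "(\<lambda>t. g (x(i := t))) field_differentiable at (x i)" if xi: "x \<in> S" "i < n" for x i
  proof -
    obtain d where "((\<lambda>t. f (x(i := t))) has_field_derivative d) (at (x i))"
      using Suc.prems(2) xi unfolding Ck.simps field_differentiable_def by blast
    then have "((\<lambda>t. g (x(i := t))) has_field_derivative d) (at (x i))"
      using DERIV_cong_ev[OF refl ev[OF that] refl, of d] by blast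
    then show ?thesis by (auto simp: field_differentiable_def)
  qed
  moreover have "Ck n k S (partial i g)" if "i < n" for i
  proof (rule Suc.IH)
    show "Ck n k S (partial i f)" using Suc.prems that by auto
    show "partial i f x = partial i g x" if "x \<in> S" for x
      unfolding partial_def by (rule deriv_cong_ev[OF ev]) (use \<open>i < n\<close> that in auto)
  qed
  ultimately show ?case by auto
qed

lemma Ck_Suc_imp: "Ck n (Suc k) S f \<Longrightarrow> Ck n k S f"
  by (induction k arbitrary: f) auto

lemma Ck_continuous: "Ck n k S f \<Longrightarrow> continuous_on S f"
  by (cases k) auto

lemma Ck_subset: "Ck n k S f \<Longrightarrow> S' \<subseteq> S \<Longrightarrow> Ck n k S' f"
  by (induction k arbitrary: f) (auto intro: continuous_on_subset)

lemma Ck_local: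
  assumes S: "S \<subseteq> espace n"
    and "\<And>x. x \<in> S \<Longrightarrow> \<exists>S'. openin (Euclidean_space n) S' \<and> x \<in> S' \<and> Ck n k S' f"
  shows "Ck n k S f"
  using assms(2)
proof (induction k arbitrary: f)
  case 0
  then show ?case using continuous_on_local[OF _ S, of f] by simp
next
  case (Suc k)
  have "continuous_on S f"
    by (rule continuous_on_local[OF _ S]) (use Suc.prems in fastforce)
  moreover have "(\<lambda>t. f (x(i := t))) field_differentiable at (x i)" if "x \<in> S" "i < n" for x i
    using Suc.prems[OF that(1)] that by auto
  moreover have "Ck n k S (partial i f)" if "i < n" for i
    by (rule Suc.IH) (use Suc.prems that in fastforce)
  ultimately show ?case by auto
qed

lemma Ck_const: "Ck n k S (\<lambda>x. c)"
  by (induction k arbitrary: c) (auto simp: partial_def)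

lemma Ck_coordinate: "Ck n k S (\<lambda>x. x j)"
proof (cases k)
  case (Suc k')
  have "(\<lambda>t. (x(i := t)) j) = (if i = j then (\<lambda>t. t) else (\<lambda>t. x j))" for i and x :: "nat \<Rightarrow> real" by auto
  then have *: "partial i (\<lambda>x. x j) = (\<lambda>x. if i = j then 1 else 0)" for i
    unfolding partial_def by (intro ext) simp
  have "continuous_on S (\<lambda>x. x j)" by (rule continuous_on_subset[of UNIV]) auto
  moreover have "(\<lambda>t. (x(i := t)) j) field_differentiable at (x i)" for i and x :: "nat \<Rightarrow> real"
    by (cases "i = j") (auto)
  ultimately show ?thesis using Suc by (auto simp: * Ck_const)
qed (auto intro: continuous_on_subset[of UNIV])

lemma Ck_add:
  assumes S: "openin (Euclidean_space n) S"
  shows "Ck n k S f \<Longrightarrow> Ck n k S g \<Longrightarrow> Ck n k S (\<lambda>x. f x + g x)"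
proof (induction k arbitrary: f g)
  case (Suc k)
  have "Ck n k S (partial i (\<lambda>x. f x + g x))" if "i < n" for i
  proof (rule Ck_cong[OF S])
    show "Ck n k S (\<lambda>x. partial i f x + partial i g x)"
      by (rule Suc.IH) (use Suc.prems that in auto)
    show "partial i f x + partial i g x = partial i (\<lambda>x. f x + g x) x" if "x \<in> S" for x
      unfolding partial_def using Suc.prems \<open>i < n\<close> that by (subst deriv_add) auto
  qed
  then show ?case using Suc.prems by (auto intro!: continuous_intros field_differentiable_add)
qed (auto intro: continuous_intros)

lemma Ck_mult:
  assumes S: "openin (Euclidean_space n) S"
  shows "Ck n k S f \<Longrightarrow> Ck n k S g \<Longrightarrow> Ck n k S (\<lambda>x. f x * g x)"
proof (induction k arbitrary: f g)
  case (Suc k)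
  have "Ck n k S (partial i (\<lambda>x. f x * g x))" if "i < n" for i
  proof (rule Ck_cong[OF S])
    have "Ck n k S f" "Ck n k S g" using Suc.prems by (auto intro: Ck_Suc_imp)
    then show "Ck n k S (\<lambda>x. f x * partial i g x + partial i f x * g x)"
      by (intro Ck_add[OF S] Suc.IH) (use Suc.prems that in auto)
    show "f x * partial i g x + partial i f x * g x = partial i (\<lambda>x. f x * g x) x" if "x \<in> S" for x
      unfolding partial_def using Suc.prems \<open>i < n\<close> that by (subst deriv_mult) auto
  qed
  then show ?case using Suc.prems by (auto intro!: continuous_intros field_differentiable_mult)
qed (auto intro: continuous_intros)

lemma Ck_sum:
  assumes S: "openin (Euclidean_space n) S"
  shows "(\<And>j. j \<in> J \<Longrightarrow> Ck n k S (f j)) \<Longrightarrow> Ck n k S (\<lambda>x. \<Sum>j\<in>J. f j x)"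
  by (induction J rule: infinite_finite_induct) (auto intro: Ck_const Ck_add[OF S])


text \<open>
  Total differentiability at a single point, with \<open>L\<close> the vector of partial derivatives.  It is kept
  apart from \<^const>\<open>Ck\<close> because the inverse of the orbit map is first known to be differentiable at
  one point only.
\<close>

definition has_gradient :: "nat \<Rightarrow> ((nat \<Rightarrow> real) \<Rightarrow> real) \<Rightarrow> (nat \<Rightarrow> real) \<Rightarrow> (nat \<Rightarrow> real) \<Rightarrow> bool" where
  "has_gradient n f L y \<longleftrightarrow> (\<forall>e>0. \<exists>\<delta>>0. \<forall>z\<in>espace n. l1 n z y < \<delta> \<longrightarrow>
     \<bar>f z - f y - (\<Sum>j<n. L j * (z j - y j))\<bar> \<le> e * l1 n z y)"

text \<open>
  Moving from \<open>y2\<close> to \<open>y1\<close> by changing one coordinate after the other stays close to \<open>y\<close>, and on each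
  piece the mean value theorem applies to the function minus its linear part, whose derivative is
  small because the partial derivatives are continuous.  That both points vary is what gives
  Lipschitz bounds and the comparison of a group law with a translation.
\<close>

lemma strict_differentiability:
  assumes S: "openin (Euclidean_space n) S" and f: "Ck n (Suc 0) S f" and y: "y \<in> S" and e: "e > 0"
  shows "\<exists>\<delta>>0. \<forall>y1\<in>espace n. \<forall>y2\<in>espace n. l1 n y1 y < \<delta> \<longrightarrow> l1 n y2 y < \<delta> \<longrightarrow>
     \<bar>f y1 - f y2 - (\<Sum>j<n. partial j f y * (y1 j - y2 j))\<bar> \<le> e * l1 n y1 y2"
proof -
  have "\<exists>\<delta>>0. \<forall>z\<in>espace n. l1 n z y < \<delta> \<longrightarrow> z \<in> S \<and> \<bar>partial j f z - partial j f y\<bar> < e"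
    if "j < n" for j
    by (rule continuous_on_openin_l1[OF S _ y e]) (use f that in auto)
  then obtain d where d: "\<And>j. j < n \<Longrightarrow> d j > 0"
    "\<And>j z. \<lbrakk>j < n; z \<in> espace n; l1 n z y < d j\<rbrakk> \<Longrightarrow> z \<in> S \<and> \<bar>partial j f z - partial j f y\<bar> < e"
    by metis
  define \<delta> where "\<delta> = Min (insert 1 (d ` {..<n})) / 2"
  have "\<delta> > 0" unfolding \<delta>_def using d(1) by auto
  have \<delta>_le: "2 * \<delta> \<le> d j" if "j < n" for j
    unfolding \<delta>_def using that by (auto intro: Min_le)
  have "\<bar>f y1 - f y2 - (\<Sum>j<n. partial j f y * (y1 j - y2 j))\<bar> \<le> e * l1 n y1 y2"
    if y12: "y1 \<in> espace n" "y2 \<in> espace n" "l1 n y1 y < \<delta>" "l1 n y2 y < \<delta>" for y1 y2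
  proof -
    \<comment> \<open>the corners of a path from \<open>y2\<close> to \<open>y1\<close> that follows one coordinate direction after the other\<close>
    define z where "z k = (\<lambda>j. if j < k then y1 j else y2 j)" for k :: nat
    have z0: "z 0 = y2" by (simp add: z_def)
    have zn: "z n = y1"
      using y12(1,2) by (intro ext) (auto simp: z_def topspace_Euclidean_space)
    have step: "\<bar>f (z (Suc k)) - f (z k) - partial k f y * (y1 k - y2 k)\<bar> \<le> e * \<bar>y1 k - y2 k\<bar>"
      if k: "k < n" for k
    proof -
      define g where "g t = f ((z k)(k := t)) - partial k f y * t" for t
      let ?I = "closed_segment (y1 k) (y2 k)"
      have der: "(g has_field_derivative (partial k f ((z k)(k := t)) - partial k f y)) (at t within ?I)
            \<and> \<bar>partial k f ((z k)(k := t)) - partial k f y\<bar> < e" if t: "t \<in> ?I" for t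
      proof -
        have tm: "\<bar>t - y k\<bar> \<le> \<bar>y1 k - y k\<bar> + \<bar>y2 k - y k\<bar>"
          using t by (auto simp: closed_segment_eq_real_ivl split: if_splits)
        have "l1 n ((z k)(k := t)) y \<le> l1 n y1 y + l1 n y2 y"
          unfolding l1_def sum.distrib[symmetric] by (rule sum_mono) (use tm in \<open>auto simp: z_def\<close>)
        then have "l1 n ((z k)(k := t)) y < d k" using y12 \<delta>_le[OF k] by linarith
        moreover have esp: "(z k)(k := t) \<in> espace n"
          using y12 k by (auto simp: z_def topspace_Euclidean_space)
        ultimately have S1: "(z k)(k := t) \<in> S" "\<bar>partial k f ((z k)(k := t)) - partial k f y\<bar> < e"
          using d(2)[OF k] by auto
        have "(\<lambda>s. f (((z k)(k := t))(k := s))) field_differentiable at (((z k)(k := t)) k)"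
          using f k S1(1) unfolding Ck.simps by blast
        then have "((\<lambda>s. f ((z k)(k := s))) has_field_derivative partial k f ((z k)(k := t))) (at t)"
          by (simp add: field_differentiable_derivI partial_def)
        then have "(g has_field_derivative (partial k f ((z k)(k := t)) - partial k f y * 1)) (at t)"
          unfolding g_def by (intro DERIV_diff DERIV_cmult DERIV_ident)
        then show ?thesis using S1(2) has_field_derivative_at_within by fastforce
      qed
      have "norm (g (y1 k) - g (y2 k)) \<le> e * norm (y1 k - y2 k)"
        by (rule field_differentiable_bound[of ?I]) (use der in \<open>auto intro!: less_imp_le\<close>)
      moreover have "(z k)(k := y1 k) = z (Suc k)" "(z k)(k := y2 k) = z k"
        by (auto simp: z_def fun_eq_iff)
      ultimately show ?thesis by (simp add: g_def algebra_simps)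
    qed
    have "f y1 - f y2 = (\<Sum>k<n. f (z (Suc k)) - f (z k))"
      using sum_lessThan_telescope[of "\<lambda>k. f (z k)" n] z0 zn by simp
    then have "\<bar>f y1 - f y2 - (\<Sum>j<n. partial j f y * (y1 j - y2 j))\<bar>
       = \<bar>\<Sum>k<n. f (z (Suc k)) - f (z k) - partial k f y * (y1 k - y2 k)\<bar>"
      by (simp add: sum_subtractf)
    also have "\<dots> \<le> (\<Sum>k<n. e * \<bar>y1 k - y2 k\<bar>)"
      by (rule order_trans[OF sum_abs]) (auto intro!: sum_mono step)
    finally show ?thesis by (simp add: l1_def sum_distrib_left)
  qed
  with \<open>\<delta> > 0\<close> show ?thesis by blast
qed

lemma Ck_has_gradient:
  assumes "openin (Euclidean_space n) S" "Ck n (Suc k) S f" "y \<in> S"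
  shows "has_gradient n f (\<lambda>j. partial j f y) y"
  unfolding has_gradient_def
proof (intro allI impI)
  fix e :: real assume e: "e > 0"
  have "Ck n (Suc 0) S f" using assms(2) by (auto dest: Ck_continuous)
  then obtain \<delta> where "\<delta> > 0" and d: "\<forall>y1\<in>espace n. \<forall>y2\<in>espace n. l1 n y1 y < \<delta> \<longrightarrow> l1 n y2 y < \<delta> \<longrightarrow>
     \<bar>f y1 - f y2 - (\<Sum>j<n. partial j f y * (y1 j - y2 j))\<bar> \<le> e * l1 n y1 y2"
    using strict_differentiability[OF assms(1) _ assms(3) e] by blast
  moreover have "y \<in> espace n" using assms(1,3) openin_subset by blast
  ultimately show "\<exists>\<delta>>0. \<forall>z\<in>espace n. l1 n z y < \<delta> \<longrightarrow>
     \<bar>f z - f y - (\<Sum>j<n. partial j f y * (z j - y j))\<bar> \<le> e * l1 n z y"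
    by (intro exI[of _ \<delta>]) auto
qed

text \<open>
  The chain rule along a curve.  The curve needs to be differentiable at \<open>t0\<close> only, and \<open>f\<close> at the
  single point \<open>\<gamma> t0\<close>; this generality is used for the inverse of the orbit map.
\<close>

lemma has_gradient_curve:
  fixes \<gamma> :: "real \<Rightarrow> nat \<Rightarrow> real"
  assumes f: "has_gradient n f L (\<gamma> t0)"
    and ev: "\<forall>\<^sub>F t in nhds t0. \<gamma> t \<in> espace n"
    and der: "\<And>j. j < n \<Longrightarrow> ((\<lambda>t. \<gamma> t j) has_field_derivative d j) (at t0)"
  shows "((\<lambda>t. f (\<gamma> t)) has_field_derivative (\<Sum>j<n. L j * d j)) (at t0)"
proof -
  define r where "r t = f (\<gamma> t) - f (\<gamma> t0) - (\<Sum>j<n. L j * (\<gamma> t j - \<gamma> t0 j))" for t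
  have q: "((\<lambda>t. (\<gamma> t j - \<gamma> t0 j) / (t - t0)) \<longlongrightarrow> d j) (at t0)" if "j < n" for j
    using der[OF that] by (simp add: has_field_derivative_iff)
  have quot: "((\<lambda>t. l1 n (\<gamma> t) (\<gamma> t0) / \<bar>t - t0\<bar>) \<longlongrightarrow> (\<Sum>j<n. \<bar>d j\<bar>)) (at t0)"
  proof -
    have "((\<lambda>t. \<Sum>j<n. \<bar>(\<gamma> t j - \<gamma> t0 j) / (t - t0)\<bar>) \<longlongrightarrow> (\<Sum>j<n. \<bar>d j\<bar>)) (at t0)"
      by (intro tendsto_intros q) auto
    then show ?thesis by (simp add: l1_def sum_divide_distrib abs_divide)
  qed
  have cont: "((\<lambda>t. l1 n (\<gamma> t) (\<gamma> t0)) \<longlongrightarrow> 0) (at t0)"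
  proof -
    have "((\<lambda>t. \<Sum>j<n. \<bar>\<gamma> t j - \<gamma> t0 j\<bar>) \<longlongrightarrow> (\<Sum>j<n. \<bar>\<gamma> t0 j - \<gamma> t0 j\<bar>)) (at t0)"
      by (intro tendsto_intros) (use der DERIV_isCont in \<open>auto simp: isCont_def\<close>)
    then show ?thesis by (simp add: l1_def)
  qed
  have r0: "((\<lambda>t. r t / (t - t0)) \<longlongrightarrow> 0) (at t0)"
    unfolding tendsto_iff
  proof (intro allI impI)
    fix e :: real assume e: "e > 0"
    define C where "C = (\<Sum>j<n. \<bar>d j\<bar>) + 1"
    have C: "C > 0" unfolding C_def by (simp add: add_nonneg_pos sum_nonneg)
    obtain \<delta> where d: "\<delta> > 0" "\<And>z. z\<in>espace n \<Longrightarrow> l1 n z (\<gamma> t0) < \<delta> \<Longrightarrow>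
       \<bar>f z - f (\<gamma> t0) - (\<Sum>j<n. L j * (z j - \<gamma> t0 j))\<bar> \<le> e / C * l1 n z (\<gamma> t0)"
      using f[unfolded has_gradient_def, rule_format, of "e / C"] e C by auto
    have "\<forall>\<^sub>F t in at t0. l1 n (\<gamma> t) (\<gamma> t0) < \<delta>"
      using cont d(1) by (auto dest: order_tendstoD)
    moreover have "\<forall>\<^sub>F t in at t0. l1 n (\<gamma> t) (\<gamma> t0) / \<bar>t - t0\<bar> < C"
      using quot by (rule order_tendstoD) (simp add: C_def)
    moreover have "\<forall>\<^sub>F t in at t0. \<gamma> t \<in> espace n"
      using ev by (simp add: eventually_nhds_conv_at)
    moreover have "\<forall>\<^sub>F t in at t0. t \<noteq> t0" by (simp add: eventually_at_filter)
    ultimately show "\<forall>\<^sub>F t in at t0. dist (r t / (t - t0)) 0 < e"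
    proof eventually_elim
      case (elim t)
      have "\<bar>r t\<bar> \<le> e / C * l1 n (\<gamma> t) (\<gamma> t0)" unfolding r_def using elim d(2) by auto
      then have "\<bar>r t\<bar> / \<bar>t - t0\<bar> \<le> e / C * (l1 n (\<gamma> t) (\<gamma> t0) / \<bar>t - t0\<bar>)"
        using divide_right_mono[of _ _ "\<bar>t - t0\<bar>"] by (metis abs_ge_zero times_divide_eq_right)
      also have "\<dots> < e / C * C" using elim e C by (intro mult_strict_left_mono) auto
      finally show ?case using C by (simp add: abs_divide)
    qed
  qed
  have "((\<lambda>t. r t / (t - t0) + (\<Sum>j<n. L j * ((\<gamma> t j - \<gamma> t0 j) / (t - t0)))) \<longlongrightarrow> 0 + (\<Sum>j<n. L j * d j)) (at t0)"
    by (intro tendsto_intros r0 q) auto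
  moreover have "r t / (t - t0) + (\<Sum>j<n. L j * ((\<gamma> t j - \<gamma> t0 j) / (t - t0))) = (f (\<gamma> t) - f (\<gamma> t0)) / (t - t0)" for t
    by (simp add: r_def diff_divide_distrib[of _ _ "t - t0"] sum_divide_distrib right_diff_distrib)
  ultimately show ?thesis by (simp add: has_field_derivative_iff)
qed

lemma continuous_on_espace:
  assumes "\<And>x. x \<in> S \<Longrightarrow> F x \<in> espace n" "\<And>j. j < n \<Longrightarrow> continuous_on S (\<lambda>x. F x j)"
  shows "continuous_on S F"
proof (rule continuous_on_coordinatewise_then_product)
  fix j show "continuous_on S (\<lambda>x. F x j)"
  proof (cases "j < n")
    case False
    then have "continuous_on S (\<lambda>x. F x j) \<longleftrightarrow> continuous_on S (\<lambda>x. 0::real)"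
      using assms(1) by (intro continuous_on_cong) (auto simp: topspace_Euclidean_space)
    then show ?thesis by simp
  qed (use assms in auto)
qed

text \<open>
  Induction on \<open>k\<close>: by the chain rule a partial derivative of \<open>f \<circ> F\<close> is a sum of products of
  functions to which the induction hypothesis applies, with \<open>partial j f\<close> in place of \<open>f\<close>.
\<close>

lemma Ck_compose:
  assumes S: "openin (Euclidean_space m) S" and T: "openin (Euclidean_space n) T"
    and FT: "\<And>x. x \<in> S \<Longrightarrow> F x \<in> T"
  shows "(\<And>j. j < n \<Longrightarrow> Ck m k S (\<lambda>x. F x j)) \<Longrightarrow> Ck n k T f \<Longrightarrow> Ck m k S (\<lambda>x. f (F x))"
proof (induction k arbitrary: f)
  have esp: "F x \<in> espace n" if "x \<in> S" for x using FT[OF that] T openin_subset by blast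
  {
    case 0
    have "continuous_on S F" by (rule continuous_on_espace[OF esp]) (use 0 in auto)
    then show ?case using 0 FT continuous_on_compose2[of T f S F] by auto
  next
    case (Suc k)
    have cont: "continuous_on S F" by (rule continuous_on_espace[OF esp]) (use Suc.prems in auto)
    then have "continuous_on S (\<lambda>x. f (F x))"
      using Suc.prems FT continuous_on_compose2[of T f S F] by auto
    moreover have der: "((\<lambda>t. f (F (x(i := t)))) has_field_derivative
        (\<Sum>j<n. partial j f (F x) * partial i (\<lambda>x. F x j) x)) (at (x i))" if "x \<in> S" "i < n'" "n' = m" for x i n'
    proof -
      have "((\<lambda>t. f (F (x(i := t)))) has_field_derivative
          (\<Sum>j<n. partial j f (F (x(i := x i))) * partial i (\<lambda>x. F x j) x)) (at (x i))"
      proof (rule has_gradient_curve[of n f _ "\<lambda>t. F (x(i := t))"])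
        show "has_gradient n f (\<lambda>j. partial j f (F (x(i := x i)))) (F (x(i := x i)))"
          using Ck_has_gradient[OF T Suc.prems(2) FT] that by simp
        show "\<forall>\<^sub>F t in nhds (x i). F (x(i := t)) \<in> espace n"
          using eventually_upd_in[OF S, of x i] that by (auto elim!: eventually_mono intro: esp)
        show "((\<lambda>t. F (x(i := t)) j) has_field_derivative partial i (\<lambda>x. F x j) x) (at (x i))"
          if "j < n" for j
          using Suc.prems(1)[OF that] \<open>x \<in> S\<close> \<open>i < n'\<close> \<open>n' = m\<close>
          by (auto simp: partial_def field_differentiable_derivI)
      qed
      then show ?thesis by simp
    qed
    moreover have "Ck m k S (partial i (\<lambda>x. f (F x)))" if "i < m" for i
    proof (rule Ck_cong[OF S])
      show "Ck m k S (\<lambda>x. \<Sum>j<n. partial j f (F x) * partial i (\<lambda>x. F x j) x)"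
      proof (intro Ck_sum[OF S] Ck_mult[OF S])
        fix j assume "j \<in> {..<n}"
        then have j: "j < n" by simp
        show "Ck m k S (\<lambda>x. partial j f (F x))"
          using Suc.prems(2) j by - (rule Suc.IH, rule Ck_Suc_imp[OF Suc.prems(1)], auto)
        show "Ck m k S (partial i (\<lambda>x. F x j))"
          using Suc.prems(1)[OF j] \<open>i < m\<close> by simp
      qed
      show "(\<Sum>j<n. partial j f (F x) * partial i (\<lambda>x. F x j) x) = partial i (\<lambda>x. f (F x)) x"
        if "x \<in> S" for x
        using der[OF that \<open>i < m\<close> refl] unfolding partial_def by (rule DERIV_imp_deriv[symmetric])
    qed
    ultimately show ?case by (auto simp: field_differentiable_def)
  }
qed

lemma smooth_euclidean_cong:
  assumes "openin (Euclidean_space m) S" "\<And>x. x \<in> S \<Longrightarrow> f x = g x" "smooth_euclidean m n S f"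
  shows "smooth_euclidean m n S g"
  unfolding smooth_euclidean_def
proof (intro allI impI)
  fix j k assume "j < n"
  with assms(3) have "Ck m k S (\<lambda>x. f x j)" by (auto simp: smooth_euclidean_def)
  then show "Ck m k S (\<lambda>x. g x j)" by (rule Ck_cong[OF assms(1), rotated]) (use assms(2) in auto)
qed

lemma smooth_euclidean_subset:
  "smooth_euclidean m n S f \<Longrightarrow> S' \<subseteq> S \<Longrightarrow> smooth_euclidean m n S' f"
  unfolding smooth_euclidean_def using Ck_subset by blast

lemma smooth_euclidean_local:
  assumes "S \<subseteq> espace m"
    and "\<And>x. x \<in> S \<Longrightarrow> \<exists>S'. openin (Euclidean_space m) S' \<and> x \<in> S' \<and> smooth_euclidean m n S' f"
  shows "smooth_euclidean m n S f"
  unfolding smooth_euclidean_def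
  by (intro allI impI Ck_local[OF assms(1)]) (use assms(2) in \<open>fastforce simp: smooth_euclidean_def\<close>)

lemma smooth_euclidean_compose:
  assumes "openin (Euclidean_space m) S" "openin (Euclidean_space n) T" "\<And>x. x \<in> S \<Longrightarrow> F x \<in> T"
    and "smooth_euclidean m n S F" "smooth_euclidean n p T f"
  shows "smooth_euclidean m p S (\<lambda>x. f (F x))"
  unfolding smooth_euclidean_def
proof (intro allI impI)
  fix j k assume "j < p"
  show "Ck m k S (\<lambda>x. f (F x) j)"
    by (rule Ck_compose[OF assms(1-3), where f = "\<lambda>y. f y j"])
      (use assms(4,5) \<open>j < p\<close> in \<open>auto simp: smooth_euclidean_def\<close>)
qed

lemma smooth_euclidean_linear:
  assumes "\<And>j. j < n \<Longrightarrow> \<exists>i. \<forall>x\<in>S. f x j = x i" "openin (Euclidean_space m) S"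
  shows "smooth_euclidean m n S f"
  unfolding smooth_euclidean_def
proof (intro allI impI)
  fix j k assume "j < n"
  then obtain i where "\<forall>x\<in>S. f x j = x i" using assms by blast
  then show "Ck m k S (\<lambda>x. f x j)" by (intro Ck_cong[OF assms(2) _ Ck_coordinate[of m k S i]]) auto
qed

section \<open>Smooth maps between manifolds\<close>

lemma openin_preimage_open_domain:
  assumes "continuous_map (subtopology X S) Y f" "openin X S" "openin Y V"
  shows "openin X {x \<in> S. f x \<in> V}"
proof -
  have "openin (subtopology X S) {x \<in> topspace (subtopology X S). f x \<in> V}"
    by (rule openin_continuous_map_preimage[OF assms(1,3)])
  moreover have "topspace (subtopology X S) = S"
    using openin_subset[OF assms(2)] by auto
  moreover have "{x \<in> S. f x \<in> V} \<subseteq> S" by blast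
  ultimately show ?thesis using openin_open_subtopology[OF assms(2)] by metis
qed

lemma continuous_map_open_domain:
  assumes S: "openin X S"
  shows "continuous_map (subtopology X S) Y f \<longleftrightarrow>
    f ` S \<subseteq> topspace Y \<and> (\<forall>V. openin Y V \<longrightarrow> openin X {x \<in> S. f x \<in> V})"
proof -
  have top: "topspace (subtopology X S) = S" using openin_subset[OF S] by auto
  show ?thesis
  proof (intro iffI conjI allI impI)
    assume c: "continuous_map (subtopology X S) Y f"
    show "f ` S \<subseteq> topspace Y" using c top by (auto simp: continuous_map_def)
    show "openin X {x \<in> S. f x \<in> V}" if "openin Y V" for V
      by (rule openin_preimage_open_domain[OF c S that])
  next
    assume r: "f ` S \<subseteq> topspace Y \<and> (\<forall>V. openin Y V \<longrightarrow> openin X {x \<in> S. f x \<in> V})"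
    have "openin (subtopology X S) {x \<in> S. f x \<in> V}" if "openin Y V" for V
      using r that openin_open_subtopology[OF S] by auto
    then show "continuous_map (subtopology X S) Y f"
      unfolding continuous_map_def top using r by auto
  qed
qed

lemma continuous_map_local:
  assumes S: "openin X S"
    and loc: "\<And>p. p \<in> S \<Longrightarrow> \<exists>S'. openin X S' \<and> p \<in> S' \<and> continuous_map (subtopology X S') Y f"
  shows "continuous_map (subtopology X S) Y f"
  unfolding continuous_map_open_domain[OF S]
proof (intro conjI allI impI)
  show "f ` S \<subseteq> topspace Y"
  proof clarify
    fix p assume "p \<in> S"
    then obtain S' where "openin X S'" "p \<in> S'" "continuous_map (subtopology X S') Y f"
      using loc by blast
    then show "f p \<in> topspace Y" using continuous_map_open_domain[of X S' Y f] by blast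
  qed
next
  fix V assume V: "openin Y V"
  show "openin X {x \<in> S. f x \<in> V}"
  proof (subst openin_subopen, intro ballI)
    fix p assume p: "p \<in> {x \<in> S. f x \<in> V}"
    then obtain S' where S': "openin X S'" "p \<in> S'" "continuous_map (subtopology X S') Y f"
      using loc by blast
    have "openin X ({x \<in> S'. f x \<in> V} \<inter> S)"
      using openin_preimage_open_domain[OF S'(3,1) V] S by blast
    then show "\<exists>T. openin X T \<and> p \<in> T \<and> T \<subseteq> {x \<in> S. f x \<in> V}"
      using p S' by (intro exI[of _ "{x \<in> S'. f x \<in> V} \<inter> S"]) auto
  qed
qed

lemma continuous_map_into_Euclidean_space:
  "continuous_map X (Euclidean_space n) f \<longleftrightarrow>
     (\<forall>x\<in>topspace X. f x \<in> espace n) \<and> (\<forall>i<n. continuous_map X euclideanreal (\<lambda>x. f x i))"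
proof -
  have *: "continuous_map X (Euclidean_space n) f \<longleftrightarrow>
      continuous_map X (Euclidean_space n) (\<lambda>x i. if i < n then f x i else 0)"
    if "\<forall>x\<in>topspace X. f x \<in> espace n"
  proof -
    have "f x = (\<lambda>i. if i < n then f x i else 0)" if "x \<in> topspace X" for x
      using that \<open>\<forall>x\<in>topspace X. f x \<in> espace n\<close> by (auto simp: topspace_Euclidean_space)
    then show ?thesis
      by (intro iffI; elim continuous_map_eq) auto
  qed
  show ?thesis
    using * continuous_map_componentwise_Euclidean_space[of X n f]
    by (auto simp: continuous_map_def)
qed

lemma continuous_map_Euclidean_coordinate:
  "continuous_map (Euclidean_space n) euclideanreal (\<lambda>x. x i)"
  unfolding continuous_map_Euclidean_space_iff
  by (rule continuous_on_subset[of UNIV]) auto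


lemma is_chartI:
  assumes U: "openin T U" and O: "openin (Euclidean_space n) O'"
    and c: "continuous_map (subtopology T U) (Euclidean_space n) c"
    and e: "continuous_map (subtopology (Euclidean_space n) O') T e"
    and "\<And>x. x \<in> U \<Longrightarrow> c x \<in> O'" "\<And>z. z \<in> O' \<Longrightarrow> e z \<in> U"
    and "\<And>x. x \<in> U \<Longrightarrow> e (c x) = x" "\<And>z. z \<in> O' \<Longrightarrow> c (e z) = z"
  shows "is_chart T n U c" "c ` U = O'"
proof -
  have cU: "c ` U = O'" using assms(5-8) by force
  have top: "topspace (subtopology T U) = U" "topspace (subtopology (Euclidean_space n) O') = O'"
    using openin_subset[OF U] openin_subset[OF O] by auto
  have "homeomorphic_maps (subtopology T U) (subtopology (Euclidean_space n) O') c e"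
    unfolding homeomorphic_maps_def continuous_map_in_subtopology top
    using assms by auto
  then show "is_chart T n U c"
    unfolding is_chart_def cU using U O homeomorphic_map_maps by blast
  show "c ` U = O'" by (rule cU)
qed

lemma is_chart_inj: "is_chart T n U c \<Longrightarrow> inj_on c U"
  unfolding is_chart_def using homeomorphic_imp_injective_map openin_subset
  by (metis topspace_subtopology_subset)

lemma is_chart_image_subset: "is_chart T n U c \<Longrightarrow> x \<in> U \<Longrightarrow> c x \<in> espace n"
  unfolding is_chart_def using openin_subset by blast

lemma is_chart_image_open:
  assumes "is_chart T n U c" "openin T W"
  shows "openin (Euclidean_space n) (c ` (U \<inter> W))"
proof -
  have "open_map (subtopology T U) (subtopology (Euclidean_space n) (c ` U)) c"
    using assms(1) homeomorphic_imp_open_map by (auto simp: is_chart_def)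
  then have "openin (subtopology (Euclidean_space n) (c ` U)) (c ` (U \<inter> W))"
    using assms(2) unfolding open_map_def by (simp add: openin_subtopology_Int2)
  then show ?thesis using assms(1) openin_trans_full by (auto simp: is_chart_def)
qed

lemma is_chart_continuous:
  "is_chart T n U c \<Longrightarrow> continuous_map (subtopology T U) (Euclidean_space n) c"
  unfolding is_chart_def using homeomorphic_imp_continuous_map continuous_map_in_subtopology by blast

lemma is_chart_inv_continuous:
  assumes "is_chart T n U c"
  shows "continuous_map (subtopology (Euclidean_space n) (c ` U)) T (inv_into U c)"
proof -
  have U: "openin T U" and O: "openin (Euclidean_space n) (c ` U)" using assms by (auto simp: is_chart_def)
  have inj: "inj_on c U" using assms is_chart_inj by blast
  have "{z \<in> c ` U. inv_into U c z \<in> V} = c ` (U \<inter> V)" for V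
    using inj by (auto simp: inv_into_f_f)
  then show ?thesis
    unfolding continuous_map_open_domain[OF O]
    using is_chart_image_open[OF assms] openin_subset[OF U] inj by (auto simp: inv_into_f_f)
qed

text \<open>
  The part of being a manifold that a local statement about charts uses.  It holds automatically
  for the structure induced on a subset, where covering by charts is a genuine condition.
\<close>

definition charted :: "'a mfd \<Rightarrow> bool" where
  "charted M \<longleftrightarrow> (\<forall>(U, c)\<in>atlas M. is_chart (mtop M) (mdim M) U c)"

lemma smooth_manifold_charted: "smooth_manifold M \<Longrightarrow> charted M"
  by (simp add: smooth_manifold_def charted_def)

lemma chartedD: "charted M \<Longrightarrow> (U, c) \<in> atlas M \<Longrightarrow> is_chart (mtop M) (mdim M) U c"
  by (auto simp: charted_def)

lemma chart_openin: "charted M \<Longrightarrow> (U, c) \<in> atlas M \<Longrightarrow> openin (mtop M) U"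
  using chartedD by (auto simp: is_chart_def)

lemma chart_inj: "charted M \<Longrightarrow> (U, c) \<in> atlas M \<Longrightarrow> inj_on c U"
  using chartedD is_chart_inj by blast

lemma chart_at:
  assumes "smooth_manifold M" "p \<in> pts M"
  obtains U c where "(U, c) \<in> atlas M" "p \<in> U"
  using assms unfolding smooth_manifold_def by blast

lemma smooth_map_on_openin: "smooth_map_on M N S f \<Longrightarrow> openin (mtop M) S"
  by (simp add: smooth_map_on_def)

lemma smooth_map_on_continuous:
  "smooth_map_on M N S f \<Longrightarrow> continuous_map (subtopology (mtop M) S) (mtop N) f"
  by (simp add: smooth_map_on_def)

lemma smooth_map_on_into: "smooth_map_on M N S f \<Longrightarrow> x \<in> S \<Longrightarrow> f x \<in> pts N"
  unfolding smooth_map_on_def using continuous_map_open_domain[of "mtop M" S "mtop N" f] by blast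

lemma smooth_map_on_preimage:
  "smooth_map_on M N S f \<Longrightarrow> openin (mtop N) V \<Longrightarrow> openin (mtop M) {x \<in> S. f x \<in> V}"
  unfolding smooth_map_on_def using openin_preimage_open_domain by blast

lemma smooth_map_on_chart_open:
  assumes "charted M" "(U, c) \<in> atlas M" "openin (mtop N) V" "openin (mtop M) S"
    "continuous_map (subtopology (mtop M) S) (mtop N) f"
  shows "openin (Euclidean_space (mdim M)) (c ` (U \<inter> S \<inter> f -` V))"
proof -
  have "openin (mtop M) {x \<in> S. f x \<in> V}"
    using openin_preimage_open_domain assms by blast
  moreover have "U \<inter> S \<inter> f -` V = U \<inter> {x \<in> S. f x \<in> V}" by auto
  ultimately show ?thesis using is_chart_image_open[OF chartedD[OF assms(1,2)]] by simp
qed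

lemma smooth_map_onD:
  "smooth_map_on M N S f \<Longrightarrow> (U, c) \<in> atlas M \<Longrightarrow> (V, d) \<in> atlas N \<Longrightarrow>
    smooth_euclidean (mdim M) (mdim N) (c ` (U \<inter> S \<inter> f -` V)) (d \<circ> f \<circ> inv_into U c)"
  unfolding smooth_map_on_def by blast

lemma smooth_map_on_subset:
  assumes "smooth_map_on M N S f" "openin (mtop M) S'" "S' \<subseteq> S"
  shows "smooth_map_on M N S' f"
proof -
  have "continuous_map (subtopology (mtop M) S') (mtop N) f"
    using assms(1,3) continuous_map_from_subtopology_mono unfolding smooth_map_on_def by blast
  moreover have "smooth_euclidean (mdim M) (mdim N) (c ` (U \<inter> S' \<inter> f -` V)) (d \<circ> f \<circ> inv_into U c)"
    if "(U, c) \<in> atlas M" "(V, d) \<in> atlas N" for U c V d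
    by (rule smooth_euclidean_subset[OF smooth_map_onD[OF assms(1) that]]) (use assms(3) in blast)
  ultimately show ?thesis
    using assms(2) unfolding smooth_map_on_def by blast
qed

text \<open>
  Each coordinate representation is examined near a single point, where it agrees with the
  representation on a smaller open set.
\<close>

lemma smooth_map_on_local:
  assumes M: "charted M" and N: "charted N" and S: "openin (mtop M) S"
    and loc: "\<And>p. p \<in> S \<Longrightarrow> \<exists>S'. p \<in> S' \<and> smooth_map_on M N S' f"
  shows "smooth_map_on M N S f"
  unfolding smooth_map_on_def
proof (intro conjI S)
  show "continuous_map (subtopology (mtop M) S) (mtop N) f"
  proof (rule continuous_map_local[OF S])
    fix p assume "p \<in> S"
    then obtain S' where "p \<in> S'" "smooth_map_on M N S' f" using loc by blast
    then show "\<exists>S'. openin (mtop M) S' \<and> p \<in> S' \<and> continuous_map (subtopology (mtop M) S') (mtop N) f"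
      by (intro exI[of _ S'] conjI smooth_map_on_openin smooth_map_on_continuous)
  qed
  show "\<forall>(U, c)\<in>atlas M. \<forall>(V, d)\<in>atlas N.
    smooth_euclidean (mdim M) (mdim N) (c ` (U \<inter> S \<inter> f -` V)) (d \<circ> f \<circ> inv_into U c)"
  proof clarify
    fix U c V d assume U: "(U, c) \<in> atlas M" and V: "(V, d) \<in> atlas N"
    show "smooth_euclidean (mdim M) (mdim N) (c ` (U \<inter> S \<inter> f -` V)) (d \<circ> f \<circ> inv_into U c)"
    proof (rule smooth_euclidean_local)
      show "c ` (U \<inter> S \<inter> f -` V) \<subseteq> espace (mdim M)"
        using is_chart_image_subset[OF chartedD[OF M U]] by blast
      fix x assume "x \<in> c ` (U \<inter> S \<inter> f -` V)"
      then obtain p where p: "p \<in> U" "p \<in> S" "f p \<in> V" "x = c p" by auto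
      then obtain S' where S': "p \<in> S'" "smooth_map_on M N S' f" using loc by blast
      show "\<exists>S'. openin (Euclidean_space (mdim M)) S' \<and> x \<in> S' \<and>
          smooth_euclidean (mdim M) (mdim N) S' (d \<circ> f \<circ> inv_into U c)"
      proof (intro exI conjI)
        show "smooth_euclidean (mdim M) (mdim N) (c ` (U \<inter> S' \<inter> f -` V)) (d \<circ> f \<circ> inv_into U c)"
          by (rule smooth_map_onD[OF S'(2) U V])
        show "openin (Euclidean_space (mdim M)) (c ` (U \<inter> S' \<inter> f -` V))"
          by (rule smooth_map_on_chart_open[OF M U chart_openin[OF N V]])
            (use S' in \<open>auto simp: smooth_map_on_def\<close>)
      qed (use p S' in auto)
    qed
  qed
qed

lemma smooth_map_on_cong:
  assumes M: "charted M" and N: "charted N" and f: "smooth_map_on M N S f"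
    and eq: "\<And>x. x \<in> S \<Longrightarrow> f x = g x"
  shows "smooth_map_on M N S g"
  unfolding smooth_map_on_def
proof (intro conjI)
  show S: "openin (mtop M) S" using f smooth_map_on_openin by blast
  show "continuous_map (subtopology (mtop M) S) (mtop N) g"
    by (rule continuous_map_eq[OF smooth_map_on_continuous[OF f]]) (use eq in auto)
  show "\<forall>(U, c)\<in>atlas M. \<forall>(V, d)\<in>atlas N.
    smooth_euclidean (mdim M) (mdim N) (c ` (U \<inter> S \<inter> g -` V)) (d \<circ> g \<circ> inv_into U c)"
  proof clarify
    fix U c V d assume U: "(U, c) \<in> atlas M" and V: "(V, d) \<in> atlas N"
    have *: "U \<inter> S \<inter> g -` V = U \<inter> S \<inter> f -` V" using eq by auto
    show "smooth_euclidean (mdim M) (mdim N) (c ` (U \<inter> S \<inter> g -` V)) (d \<circ> g \<circ> inv_into U c)"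
      unfolding *
    proof (rule smooth_euclidean_cong[OF _ _ smooth_map_onD[OF f U V]])
      show "openin (Euclidean_space (mdim M)) (c ` (U \<inter> S \<inter> f -` V))"
        by (rule smooth_map_on_chart_open[OF M U chart_openin[OF N V]])
          (use f in \<open>auto simp: smooth_map_on_def\<close>)
      show "(d \<circ> f \<circ> inv_into U c) x = (d \<circ> g \<circ> inv_into U c) x" if "x \<in> c ` (U \<inter> S \<inter> f -` V)" for x
        using that eq chart_inj[OF M U] by (auto simp: inv_into_f_f)
    qed
  qed
qed

text \<open>
  Charts of the middle manifold are inserted locally, so \<open>N\<close> has to be covered by its charts; for
  the outer manifolds it suffices that the charts are homeomorphisms.
\<close>

lemma smooth_map_on_compose:
  assumes M: "charted M" and N: "smooth_manifold N" and P: "charted P"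
    and f: "smooth_map_on M N S f" and g: "smooth_map_on N P T g"
    and ST: "\<And>x. x \<in> S \<Longrightarrow> f x \<in> T"
  shows "smooth_map_on M P S (\<lambda>x. g (f x))"
  unfolding smooth_map_on_def
proof (intro conjI)
  have N': "charted N" using N by (rule smooth_manifold_charted)
  show S: "openin (mtop M) S" using f smooth_map_on_openin by blast
  have "continuous_map (subtopology (mtop M) S) (subtopology (mtop N) T) f"
    using f ST by (auto simp: smooth_map_on_def continuous_map_in_subtopology)
  then have "continuous_map (subtopology (mtop M) S) (mtop P) (g \<circ> f)"
    using g continuous_map_compose unfolding smooth_map_on_def by blast
  then show cont: "continuous_map (subtopology (mtop M) S) (mtop P) (\<lambda>x. g (f x))"
    by (simp add: o_def)
  show "\<forall>(U, c)\<in>atlas M. \<forall>(W, e)\<in>atlas P.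
    smooth_euclidean (mdim M) (mdim P) (c ` (U \<inter> S \<inter> (\<lambda>x. g (f x)) -` W)) (e \<circ> (\<lambda>x. g (f x)) \<circ> inv_into U c)"
  proof clarify
    fix U c W e assume U: "(U, c) \<in> atlas M" and W: "(W, e) \<in> atlas P"
    show "smooth_euclidean (mdim M) (mdim P) (c ` (U \<inter> S \<inter> (\<lambda>x. g (f x)) -` W)) (e \<circ> (\<lambda>x. g (f x)) \<circ> inv_into U c)"
    proof (rule smooth_euclidean_local)
      show "c ` (U \<inter> S \<inter> (\<lambda>x. g (f x)) -` W) \<subseteq> espace (mdim M)"
        using is_chart_image_subset[OF chartedD[OF M U]] by blast
      fix x assume "x \<in> c ` (U \<inter> S \<inter> (\<lambda>x. g (f x)) -` W)"
      then obtain p where p: "p \<in> U" "p \<in> S" "g (f p) \<in> W" "x = c p" by auto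
      obtain V d where V: "(V, d) \<in> atlas N" "f p \<in> V"
        using chart_at[OF N] smooth_map_on_into[OF f p(2)] by blast
      define S' where "S' = {x \<in> S. f x \<in> {y \<in> T. g y \<in> W}}"
      have S': "openin (mtop M) S'" unfolding S'_def
        by (rule smooth_map_on_preimage[OF f smooth_map_on_preimage[OF g chart_openin[OF P W]]])
      let ?O = "c ` (U \<inter> S' \<inter> f -` V)"
      show "\<exists>S'. openin (Euclidean_space (mdim M)) S' \<and> x \<in> S' \<and>
          smooth_euclidean (mdim M) (mdim P) S' (e \<circ> (\<lambda>x. g (f x)) \<circ> inv_into U c)"
      proof (intro exI conjI)
        show x: "x \<in> ?O" using p V ST by (auto simp: S'_def)
        have fS': "smooth_map_on M N S' f" by (rule smooth_map_on_subset[OF f S']) (auto simp: S'_def)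
        show O: "openin (Euclidean_space (mdim M)) ?O"
          by (rule smooth_map_on_chart_open[OF M U chart_openin[OF N' V(1)] S'])
            (use fS' in \<open>auto simp: smooth_map_on_def\<close>)
        have O2: "openin (Euclidean_space (mdim N)) (d ` (V \<inter> T \<inter> g -` W))"
          by (rule smooth_map_on_chart_open[OF N' V(1) chart_openin[OF P W]])
            (use g in \<open>auto simp: smooth_map_on_def\<close>)
        have "smooth_euclidean (mdim M) (mdim P) ?O
           (\<lambda>x. (e \<circ> g \<circ> inv_into V d) ((d \<circ> f \<circ> inv_into U c) x))"
        proof (rule smooth_euclidean_compose[OF O O2 _ smooth_map_onD[OF fS' U V(1)] smooth_map_onD[OF g V(1) W]])
          show "(d \<circ> f \<circ> inv_into U c) x \<in> d ` (V \<inter> T \<inter> g -` W)" if "x \<in> ?O" for x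
            using that chart_inj[OF M U] by (auto simp: S'_def inv_into_f_f)
        qed
        then show "smooth_euclidean (mdim M) (mdim P) ?O (e \<circ> (\<lambda>x. g (f x)) \<circ> inv_into U c)"
        proof (rule smooth_euclidean_cong[OF O, rotated])
          show "(e \<circ> g \<circ> inv_into V d) ((d \<circ> f \<circ> inv_into U c) x) = (e \<circ> (\<lambda>x. g (f x)) \<circ> inv_into U c) x"
            if "x \<in> ?O" for x
            using that chart_inj[OF M U] chart_inj[OF N' V(1)] by (auto simp: inv_into_f_f)
        qed
      qed
    qed
  qed
qed

lemma smooth_map_on_const:
  assumes "openin (mtop M) S" "y \<in> pts N"
  shows "smooth_map_on M N S (\<lambda>x. y)"
  using assms by (auto simp: smooth_map_on_def smooth_euclidean_def o_def Ck_const)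

lemma smooth_map_id_iff_transitions:
  assumes M: "charted M"
  shows "smooth_map M M (\<lambda>x. x) \<longleftrightarrow>
     (\<forall>(U, c)\<in>atlas M. \<forall>(V, d)\<in>atlas M.
        smooth_euclidean (mdim M) (mdim M) (c ` (U \<inter> V)) (d \<circ> inv_into U c))"
proof -
  have "U \<inter> pts M \<inter> (\<lambda>x. x) -` V = U \<inter> V" if "(U, c) \<in> atlas M" for U c V
    using openin_subset[OF chart_openin[OF M that]] by auto
  then have "smooth_euclidean (mdim M) (mdim M) (c ` (U \<inter> pts M \<inter> (\<lambda>x. x) -` V)) (d \<circ> (\<lambda>x. x) \<circ> inv_into U c)
      \<longleftrightarrow> smooth_euclidean (mdim M) (mdim M) (c ` (U \<inter> V)) (d \<circ> inv_into U c)"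
    if "(U, c) \<in> atlas M" for U c V d
    using that by (simp add: comp_def)
  moreover have "continuous_map (subtopology (mtop M) (pts M)) (mtop M) (\<lambda>x. x)" by simp
  ultimately show ?thesis
    unfolding smooth_map_on_def by fast
qed

text \<open>
  The compatibility of charts is the smoothness of the identity map.  New manifolds are
  recognized in this way, since smoothness of the identity follows from the calculus of smooth maps
  rather than from a computation with transition maps.
\<close>

lemma smooth_manifold_iff:
  "smooth_manifold M \<longleftrightarrow> Hausdorff_space (mtop M) \<and> second_countable (mtop M) \<and> charted M \<and>
     (\<Union>(U, c)\<in>atlas M. U) = pts M \<and> smooth_map M M (\<lambda>x. x)"
proof (cases "charted M")
  case True
  show ?thesis
    unfolding smooth_manifold_def charted_def [symmetric]
    using smooth_map_id_iff_transitions[OF True] by argo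
next
  case False
  then show ?thesis unfolding smooth_manifold_def charted_def [symmetric] by argo
qed

lemma chart_transition:
  assumes M: "smooth_manifold M" and UV: "(U, c) \<in> atlas M" "(V, d) \<in> atlas M"
  shows "smooth_euclidean (mdim M) (mdim M) (c ` (U \<inter> V)) (d \<circ> inv_into U c)"
proof -
  have "smooth_map M M (\<lambda>x. x)" using M unfolding smooth_manifold_iff by argo
  then show ?thesis
    using UV unfolding smooth_map_id_iff_transitions[OF smooth_manifold_charted[OF M]] by fast
qed

lemma smooth_map_on_id:
  assumes "smooth_manifold M" "openin (mtop M) S"
  shows "smooth_map_on M M S (\<lambda>x. x)"
  using assms smooth_map_on_subset openin_subset unfolding smooth_manifold_iff by metis


lemma smooth_manifold_euclidean: "smooth_manifold (euclidean_mfd n)"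
proof -
  have "is_chart (Euclidean_space n) n (espace n) (\<lambda>x. x)"
    by (rule is_chartI(1)[of _ _ _ "espace n" _ "\<lambda>x. x"]) auto
  moreover have "smooth_euclidean n n (espace n) ((\<lambda>x. x) \<circ> inv_into (espace n) (\<lambda>x. x))"
    by (rule smooth_euclidean_linear) (auto simp: inv_into_f_f[of "\<lambda>x. x"])
  moreover have "second_countable (Euclidean_space n)"
  proof -
    obtain B :: "(nat \<Rightarrow> real) set set" where B: "countable B" "topological_basis B"
      using ex_countable_basis by blast
    have "second_countable (euclidean :: (nat \<Rightarrow> real) topology)"
      unfolding second_countable_def using B by (metis open_openin topological_basisE topological_basis_open)
    then show ?thesis
      unfolding Euclidean_space_def euclidean_product_topology by (rule second_countable_subtopology)
  qed
  ultimately show ?thesis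
    unfolding smooth_manifold_def euclidean_mfd_def
    by (simp add: Hausdorff_Euclidean_space)
qed

lemma pts_euclidean_mfd [simp]: "pts (euclidean_mfd n) = espace n"
  and mdim_euclidean_mfd [simp]: "mdim (euclidean_mfd n) = n"
  and mtop_euclidean_mfd [simp]: "mtop (euclidean_mfd n) = Euclidean_space n"
  by (simp_all add: euclidean_mfd_def)

lemma chart_smooth:
  assumes M: "smooth_manifold M" and U: "(U, c) \<in> atlas M"
  shows "smooth_map_on M (euclidean_mfd (mdim M)) U c"
    "smooth_map_on (euclidean_mfd (mdim M)) M (c ` U) (inv_into U c)"
proof -
  note M' = smooth_manifold_charted[OF M]
  note ch = chartedD[OF M' U]
  have esp: "c x \<in> espace (mdim M)" if "x \<in> U" for x using is_chart_image_subset[OF ch that] .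
  note trans = chart_transition[OF M]
  show "smooth_map_on M (euclidean_mfd (mdim M)) U c"
    unfolding smooth_map_on_def mdim_euclidean_mfd mtop_euclidean_mfd
  proof (intro conjI)
    show "\<forall>(V, e)\<in>atlas M. \<forall>(W, d)\<in>atlas (euclidean_mfd (mdim M)).
       smooth_euclidean (mdim M) (mdim M) (e ` (V \<inter> U \<inter> c -` W)) (d \<circ> c \<circ> inv_into V e)"
    proof clarify
      fix V e W d assume V: "(V, e) \<in> atlas M" and W: "(W, d) \<in> atlas (euclidean_mfd (mdim M))"
      have "V \<inter> U \<inter> c -` W = V \<inter> U" "d \<circ> c \<circ> inv_into V e = c \<circ> inv_into V e"
        using W esp by (auto simp: euclidean_mfd_def)
      then show "smooth_euclidean (mdim M) (mdim M) (e ` (V \<inter> U \<inter> c -` W)) (d \<circ> c \<circ> inv_into V e)"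
        using trans[OF V U] by simp
    qed
  qed (use chart_openin[OF M' U] is_chart_continuous[OF ch] in auto)
  show "smooth_map_on (euclidean_mfd (mdim M)) M (c ` U) (inv_into U c)"
    unfolding smooth_map_on_def mdim_euclidean_mfd mtop_euclidean_mfd
  proof (intro conjI)
    show "\<forall>(W, d)\<in>atlas (euclidean_mfd (mdim M)). \<forall>(V, e)\<in>atlas M.
       smooth_euclidean (mdim M) (mdim M) (d ` (W \<inter> c ` U \<inter> inv_into U c -` V)) (e \<circ> inv_into U c \<circ> inv_into W d)"
    proof clarify
      fix V e W d assume V: "(V, e) \<in> atlas M" and W: "(W, d) \<in> atlas (euclidean_mfd (mdim M))"
      have W': "W = espace (mdim M)" "d = (\<lambda>x. x)" using W by (auto simp: euclidean_mfd_def)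
      have *: "W \<inter> c ` U \<inter> inv_into U c -` V = c ` (U \<inter> V)"
        using chart_inj[OF M' U] esp by (auto simp: W' inv_into_f_f)
      have "smooth_euclidean (mdim M) (mdim M) (c ` (U \<inter> V)) (e \<circ> inv_into U c \<circ> inv_into W d)"
      proof (rule smooth_euclidean_cong[OF _ _ trans[OF U V]])
        show "openin (Euclidean_space (mdim M)) (c ` (U \<inter> V))"
          by (rule is_chart_image_open[OF ch chart_openin[OF M' V]])
        show "(e \<circ> inv_into U c) x = (e \<circ> inv_into U c \<circ> inv_into W d) x" if "x \<in> c ` (U \<inter> V)" for x
          using that esp by (auto simp: W' inv_into_f_f[of "\<lambda>x. x"])
      qed
      then show "smooth_euclidean (mdim M) (mdim M) (d ` (W \<inter> c ` U \<inter> inv_into U c -` V)) (e \<circ> inv_into U c \<circ> inv_into W d)"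
        unfolding * by (simp add: W')
    qed
  qed (use ch is_chart_inv_continuous[OF ch] in \<open>auto simp: is_chart_def\<close>)
qed

lemma smooth_map_on_euclidean:
  assumes "openin (Euclidean_space m) S"
  shows "smooth_map_on (euclidean_mfd m) (euclidean_mfd n) S f \<longleftrightarrow>
    (\<forall>x\<in>S. f x \<in> espace n) \<and> smooth_euclidean m n S f"
proof -
  have S: "S \<subseteq> espace m" using openin_subset assms by blast
  have *: "smooth_euclidean m n S (f \<circ> inv_into (espace m) (\<lambda>x. x)) \<longleftrightarrow> smooth_euclidean m n S f"
  proof -
    have "(f \<circ> inv_into (espace m) (\<lambda>x. x)) x = f x" if "x \<in> S" for x
      using S that by (auto simp: inv_into_f_f[of "\<lambda>x. x"])
    then show ?thesis using smooth_euclidean_cong[OF assms] by metis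
  qed
  have **: "espace m \<inter> S \<inter> f -` espace n = S" if "\<forall>x\<in>S. f x \<in> espace n" using S that by auto
  have "continuous_map (subtopology (Euclidean_space m) S) (Euclidean_space n) f"
    if "\<forall>x\<in>S. f x \<in> espace n" "smooth_euclidean m n S f"
  proof -
    have co: "continuous_on S (\<lambda>x. f x j)" if "j < n" for j
      using \<open>smooth_euclidean m n S f\<close> that Ck_continuous unfolding smooth_euclidean_def by blast
    have "continuous_on S f" by (rule continuous_on_espace[of S f n]) (use that(1) co in simp_all)
    moreover have "topspace (subtopology (Euclidean_space m) S) = S"
      by (rule topspace_subtopology_subset[OF S])
    ultimately show ?thesis using that(1)
      unfolding cm_Euclidean_space_iff_continuous_on by auto
  qed
  moreover have "\<forall>x\<in>S. f x \<in> espace n" if "continuous_map (subtopology (Euclidean_space m) S) (Euclidean_space n) f"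
    using that continuous_map_open_domain[OF assms, of "Euclidean_space n" f] by blast
  ultimately show ?thesis
    unfolding smooth_map_on_def using assms * ** by (auto simp: euclidean_mfd_def comp_def)
qed

section \<open>Products of manifolds\<close>

text \<open>
  Coordinates of products are concatenations; \<open>block s m\<close> cuts out the \<open>m\<close> coordinates that start
  at position \<open>s\<close>.
\<close>

definition block :: "nat \<Rightarrow> nat \<Rightarrow> (nat \<Rightarrow> real) \<Rightarrow> nat \<Rightarrow> real" where
  "block s m z = (\<lambda>i. if i < m then z (s + i) else 0)"

lemma block_espace [simp]: "block s m z \<in> espace m"
  by (simp add: block_def topspace_Euclidean_space)

lemma continuous_map_block: "continuous_map (Euclidean_space k) (Euclidean_space m) (block s m)"
  unfolding continuous_map_into_Euclidean_space
  by (simp add: continuous_map_Euclidean_coordinate) (simp add: block_def continuous_map_Euclidean_coordinate)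

lemma smooth_euclidean_block:
  assumes "openin (Euclidean_space k) S"
  shows "smooth_euclidean k m S (block s m)"
  by (rule smooth_euclidean_linear[OF _ assms]) (auto simp: block_def)

definition pair_chart :: "nat \<Rightarrow> ('a \<Rightarrow> nat \<Rightarrow> real) \<Rightarrow> ('b \<Rightarrow> nat \<Rightarrow> real) \<Rightarrow> 'a \<times> 'b \<Rightarrow> nat \<Rightarrow> real" where
  "pair_chart m c d = (\<lambda>(x, y) i. if i < m then c x i else d y (i - m))"

lemma prod_mfd_simps [simp]:
  "mtop (prod_mfd M N) = prod_topology (mtop M) (mtop N)"
  "mdim (prod_mfd M N) = mdim M + mdim N"
  by (simp_all add: prod_mfd_def)

lemma atlas_prod_mfd:
  "atlas (prod_mfd M N) = {(U \<times> V, pair_chart (mdim M) c d) |U c V d. (U, c) \<in> atlas M \<and> (V, d) \<in> atlas N}"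
  by (simp add: prod_mfd_def pair_chart_def)

lemma block_pair_chart:
  assumes "c x \<in> espace m" "d y \<in> espace n"
  shows "block 0 m (pair_chart m c d (x, y)) = c x" "block m n (pair_chart m c d (x, y)) = d y"
  using assms by (auto simp: block_def pair_chart_def topspace_Euclidean_space fun_eq_iff)

text \<open>
  The inverse of a product chart is the pair of the inverses, applied to the two blocks.
\<close>

lemma pair_chart_is_chart:
  assumes c: "is_chart X m U c" and d: "is_chart Y n V d"
  shows "is_chart (prod_topology X Y) (m + n) (U \<times> V) (pair_chart m c d)"
    "pair_chart m c d ` (U \<times> V) = {z \<in> espace (m + n). block 0 m z \<in> c ` U \<and> block m n z \<in> d ` V}"
proof -
  let ?O = "{z \<in> espace (m + n). block 0 m z \<in> c ` U \<and> block m n z \<in> d ` V}"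
  let ?e = "\<lambda>z. (inv_into U c (block 0 m z), inv_into V d (block m n z))"
  have U: "openin X U" "openin (Euclidean_space m) (c ` U)" and V: "openin Y V" "openin (Euclidean_space n) (d ` V)"
    using c d by (auto simp: is_chart_def)
  have cd: "c x \<in> espace m" "d y \<in> espace n" if "x \<in> U" "y \<in> V" for x y
    using that by (auto intro: is_chart_image_subset[OF c] is_chart_image_subset[OF d])
  have O: "openin (Euclidean_space (m + n)) ?O"
  proof -
    have "?O = {z \<in> espace (m + n). block 0 m z \<in> c ` U} \<inter> {z \<in> espace (m + n). block m n z \<in> d ` V}" by auto
    then show ?thesis
      using openin_continuous_map_preimage[OF continuous_map_block U(2)]
        openin_continuous_map_preimage[OF continuous_map_block V(2)] by auto
  qed
  have cc: "continuous_map (subtopology (prod_topology X Y) (U \<times> V)) (Euclidean_space m) (\<lambda>p. c (fst p))"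
    "continuous_map (subtopology (prod_topology X Y) (U \<times> V)) (Euclidean_space n) (\<lambda>p. d (snd p))"
    using continuous_map_compose[OF continuous_map_fst is_chart_continuous[OF c], of "subtopology Y V"]
      continuous_map_compose[OF continuous_map_snd is_chart_continuous[OF d], of "subtopology X U"]
    unfolding subtopology_Times by (simp_all add: o_def)
  have "is_chart (prod_topology X Y) (m + n) (U \<times> V) (pair_chart m c d) \<and> pair_chart m c d ` (U \<times> V) = ?O"
  proof (intro conjI; rule is_chartI)
    show "openin (prod_topology X Y) (U \<times> V)" using U V by (simp add: openin_prod_Times_iff)
    then show "openin (prod_topology X Y) (U \<times> V)" .
    show "openin (Euclidean_space (m + n)) ?O" by (rule O)
    then show "openin (Euclidean_space (m + n)) ?O" .
    show "continuous_map (subtopology (prod_topology X Y) (U \<times> V)) (Euclidean_space (m + n)) (pair_chart m c d)"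
      unfolding continuous_map_into_Euclidean_space
    proof (intro conjI ballI allI impI)
      fix p assume "p \<in> topspace (subtopology (prod_topology X Y) (U \<times> V))"
      then show "pair_chart m c d p \<in> espace (m + n)"
        using cd by (auto simp: pair_chart_def topspace_Euclidean_space)
    next
      fix i assume i: "i < m + n"
      show "continuous_map (subtopology (prod_topology X Y) (U \<times> V)) euclideanreal (\<lambda>p. pair_chart m c d p i)"
      proof (cases "i < m")
        case True
        then show ?thesis using cc(1)[unfolded continuous_map_into_Euclidean_space]
          by (simp add: pair_chart_def case_prod_unfold)
      next
        case False
        then have "i - m < n" using i by auto
        then show ?thesis using False cc(2)[unfolded continuous_map_into_Euclidean_space]
          by (simp add: pair_chart_def case_prod_unfold)
      qed
    qed
    then show "continuous_map (subtopology (prod_topology X Y) (U \<times> V)) (Euclidean_space (m + n)) (pair_chart m c d)" .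
    have b: "continuous_map (subtopology (Euclidean_space (m + n)) ?O) (subtopology (Euclidean_space m) (c ` U)) (block 0 m)"
      "continuous_map (subtopology (Euclidean_space (m + n)) ?O) (subtopology (Euclidean_space n) (d ` V)) (block m n)"
      by (auto simp: continuous_map_in_subtopology continuous_map_block continuous_map_from_subtopology)
    show "continuous_map (subtopology (Euclidean_space (m + n)) ?O) (prod_topology X Y) ?e"
      unfolding continuous_map_pairwise
      using continuous_map_compose[OF b(1) is_chart_inv_continuous[OF c]]
        continuous_map_compose[OF b(2) is_chart_inv_continuous[OF d]] by (simp add: o_def)
    then show "continuous_map (subtopology (Euclidean_space (m + n)) ?O) (prod_topology X Y) ?e" .
    show inO: "pair_chart m c d p \<in> ?O" if "p \<in> U \<times> V" for p
      using that cd block_pair_chart[of c _ m d _ n]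
      by (auto simp: pair_chart_def topspace_Euclidean_space)
    then show "pair_chart m c d p \<in> ?O" if "p \<in> U \<times> V" for p using that .
    show e: "?e z \<in> U \<times> V" if "z \<in> ?O" for z
      using that by (auto intro: inv_into_into)
    then show "?e z \<in> U \<times> V" if "z \<in> ?O" for z using that .
    show ec: "?e (pair_chart m c d p) = p" if pUV: "p \<in> U \<times> V" for p
    proof -
      obtain x y where p: "p = (x, y)" "x \<in> U" "y \<in> V" using pUV by auto
      show ?thesis unfolding p block_pair_chart[of c x m d y n, OF cd[OF p(2,3)]]
        using p is_chart_inj[OF c] is_chart_inj[OF d] by (simp add: inv_into_f_f)
    qed
    then show "?e (pair_chart m c d p) = p" if "p \<in> U \<times> V" for p using that .
    show ce: "pair_chart m c d (?e z) = z" if "z \<in> ?O" for z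
      using that by (auto simp: pair_chart_def f_inv_into_f block_def topspace_Euclidean_space fun_eq_iff)
    then show "pair_chart m c d (?e z) = z" if "z \<in> ?O" for z using that .
  qed
  then show "is_chart (prod_topology X Y) (m + n) (U \<times> V) (pair_chart m c d)"
    "pair_chart m c d ` (U \<times> V) = ?O" by auto
qed

lemma charted_prod: "charted M \<Longrightarrow> charted N \<Longrightarrow> charted (prod_mfd M N)"
  unfolding charted_def atlas_prod_mfd by (auto intro!: pair_chart_is_chart(1))

lemma smooth_map_on_Pair:
  assumes f: "smooth_map_on P M S f" and g: "smooth_map_on P N S g"
  shows "smooth_map_on P (prod_mfd M N) S (\<lambda>p. (f p, g p))"
  unfolding smooth_map_on_def
proof (intro conjI)
  show "openin (mtop P) S" using f smooth_map_on_openin by blast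
  show "continuous_map (subtopology (mtop P) S) (mtop (prod_mfd M N)) (\<lambda>p. (f p, g p))"
    using f g by (simp add: smooth_map_on_def continuous_map_pairwise o_def)
  show "\<forall>(U, c)\<in>atlas P. \<forall>(V, d)\<in>atlas (prod_mfd M N). smooth_euclidean (mdim P) (mdim (prod_mfd M N))
      (c ` (U \<inter> S \<inter> (\<lambda>p. (f p, g p)) -` V)) (d \<circ> (\<lambda>p. (f p, g p)) \<circ> inv_into U c)"
  proof clarify
    fix U c V d assume U: "(U, c) \<in> atlas P" and "(V, d) \<in> atlas (prod_mfd M N)"
    then obtain V1 d1 V2 d2 where V: "V = V1 \<times> V2" "d = pair_chart (mdim M) d1 d2"
      "(V1, d1) \<in> atlas M" "(V2, d2) \<in> atlas N" by (auto simp: atlas_prod_mfd)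
    let ?O = "c ` (U \<inter> S \<inter> (\<lambda>p. (f p, g p)) -` V)"
    have sub: "?O \<subseteq> c ` (U \<inter> S \<inter> f -` V1)" "?O \<subseteq> c ` (U \<inter> S \<inter> g -` V2)" using V by auto
    have s1: "Ck (mdim P) k ?O (\<lambda>x. (d1 \<circ> f \<circ> inv_into U c) x j)" if "j < mdim M" for k j
      using smooth_map_onD[OF f U V(3)] that Ck_subset[OF _ sub(1)] by (auto simp: smooth_euclidean_def)
    have s2: "Ck (mdim P) k ?O (\<lambda>x. (d2 \<circ> g \<circ> inv_into U c) x j)" if "j < mdim N" for k j
      using smooth_map_onD[OF g U V(4)] that Ck_subset[OF _ sub(2)] by (auto simp: smooth_euclidean_def)
    show "smooth_euclidean (mdim P) (mdim (prod_mfd M N)) ?O (d \<circ> (\<lambda>p. (f p, g p)) \<circ> inv_into U c)"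
      unfolding smooth_euclidean_def prod_mfd_simps
    proof (intro allI impI)
      fix j k assume j: "j < mdim M + mdim N"
      show "Ck (mdim P) k ?O (\<lambda>x. (d \<circ> (\<lambda>p. (f p, g p)) \<circ> inv_into U c) x j)"
        using s1[of j k] s2[of "j - mdim M" k] j by (cases "j < mdim M") (auto simp: V(2) pair_chart_def)
    qed
  qed
qed

lemma
  assumes M: "smooth_manifold M" and N: "charted N"
  shows smooth_map_fst: "smooth_map (prod_mfd M N) M fst"
    and smooth_map_snd: "smooth_map (prod_mfd N M) M snd"
proof -
  note M' = smooth_manifold_charted[OF M]
  note trans = chart_transition[OF M]
  have opn: "openin (Euclidean_space (mdim M)) (c ` (U \<inter> V))"
    if "(U, c) \<in> atlas M" "(V, d) \<in> atlas M" for U c V d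
    using is_chart_image_open[OF chartedD[OF M' that(1)] chart_openin[OF M' that(2)]] .
  show "smooth_map (prod_mfd M N) M fst"
    unfolding smooth_map_on_def
  proof (intro conjI)
    show c: "continuous_map (subtopology (mtop (prod_mfd M N)) (pts (prod_mfd M N))) (mtop M) fst"
      by (simp add: continuous_map_from_subtopology continuous_map_fst del: topspace_prod_topology)
    show "\<forall>(U, c)\<in>atlas (prod_mfd M N). \<forall>(V, d)\<in>atlas M. smooth_euclidean (mdim (prod_mfd M N)) (mdim M)
      (c ` (U \<inter> pts (prod_mfd M N) \<inter> fst -` V)) (d \<circ> fst \<circ> inv_into U c)"
    proof clarify
      fix U c V d assume U0: "(U, c) \<in> atlas (prod_mfd M N)" and V: "(V, d) \<in> atlas M"
      then obtain U1 c1 U2 c2 where U: "U = U1 \<times> U2" "c = pair_chart (mdim M) c1 c2"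
        "(U1, c1) \<in> atlas M" "(U2, c2) \<in> atlas N" by (auto simp: atlas_prod_mfd)
      note ch = is_chart_image_subset[OF chartedD[OF M' U(3)]] is_chart_image_subset[OF chartedD[OF N U(4)]]
      let ?O = "c ` (U \<inter> pts (prod_mfd M N) \<inter> fst -` V)"
      have O: "openin (Euclidean_space (mdim (prod_mfd M N))) ?O"
        by (rule smooth_map_on_chart_open[OF charted_prod[OF M' N] U0 chart_openin[OF M' V] openin_topspace c])
      have "smooth_euclidean (mdim (prod_mfd M N)) (mdim M) ?O (\<lambda>x. (d \<circ> inv_into U1 c1) (block 0 (mdim M) x))"
      proof (rule smooth_euclidean_compose[OF O opn[OF U(3) V] _ smooth_euclidean_block[OF O] trans[OF U(3) V]])
        show "block 0 (mdim M) x \<in> c1 ` (U1 \<inter> V)" if "x \<in> ?O" for x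
          using that ch block_pair_chart(1)[of c1 _ "mdim M" c2 _ "mdim N"] by (auto simp: U(1,2))
      qed
      then show "smooth_euclidean (mdim (prod_mfd M N)) (mdim M) ?O (d \<circ> fst \<circ> inv_into U c)"
      proof (rule smooth_euclidean_cong[OF O, rotated])
        fix x assume "x \<in> ?O"
        then obtain a b where ab: "x = c (a, b)" "a \<in> U1" "b \<in> U2" by (auto simp: U(1))
        have "inv_into U c x = (a, b)" unfolding ab(1)
          by (rule inv_into_f_f[OF chart_inj[OF charted_prod[OF M' N] U0]]) (use ab U in auto)
        moreover have "block 0 (mdim M) x = c1 a"
          unfolding ab(1) U(2) using ch ab by (intro block_pair_chart)
        ultimately show "(d \<circ> inv_into U1 c1) (block 0 (mdim M) x) = (d \<circ> fst \<circ> inv_into U c) x"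
          using chart_inj[OF M' U(3)] ab by (simp add: inv_into_f_f)
      qed
    qed
  qed (rule openin_topspace)
  show "smooth_map (prod_mfd N M) M snd"
    unfolding smooth_map_on_def
  proof (intro conjI)
    show c: "continuous_map (subtopology (mtop (prod_mfd N M)) (pts (prod_mfd N M))) (mtop M) snd"
      by (simp add: continuous_map_from_subtopology continuous_map_snd del: topspace_prod_topology)
    show "\<forall>(U, c)\<in>atlas (prod_mfd N M). \<forall>(V, d)\<in>atlas M. smooth_euclidean (mdim (prod_mfd N M)) (mdim M)
      (c ` (U \<inter> pts (prod_mfd N M) \<inter> snd -` V)) (d \<circ> snd \<circ> inv_into U c)"
    proof clarify
      fix U c V d assume U0: "(U, c) \<in> atlas (prod_mfd N M)" and V: "(V, d) \<in> atlas M"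
      then obtain U1 c1 U2 c2 where U: "U = U1 \<times> U2" "c = pair_chart (mdim N) c1 c2"
        "(U1, c1) \<in> atlas N" "(U2, c2) \<in> atlas M" by (auto simp: atlas_prod_mfd)
      note ch = is_chart_image_subset[OF chartedD[OF N U(3)]] is_chart_image_subset[OF chartedD[OF M' U(4)]]
      let ?O = "c ` (U \<inter> pts (prod_mfd N M) \<inter> snd -` V)"
      have O: "openin (Euclidean_space (mdim (prod_mfd N M))) ?O"
        by (rule smooth_map_on_chart_open[OF charted_prod[OF N M'] U0 chart_openin[OF M' V] openin_topspace c])
      have "smooth_euclidean (mdim (prod_mfd N M)) (mdim M) ?O (\<lambda>x. (d \<circ> inv_into U2 c2) (block (mdim N) (mdim M) x))"
      proof (rule smooth_euclidean_compose[OF O opn[OF U(4) V] _ smooth_euclidean_block[OF O] trans[OF U(4) V]])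
        show "block (mdim N) (mdim M) x \<in> c2 ` (U2 \<inter> V)" if "x \<in> ?O" for x
          using that ch block_pair_chart(2)[of c1 _ "mdim N" c2 _ "mdim M"] by (auto simp: U(1,2))
      qed
      then show "smooth_euclidean (mdim (prod_mfd N M)) (mdim M) ?O (d \<circ> snd \<circ> inv_into U c)"
      proof (rule smooth_euclidean_cong[OF O, rotated])
        fix x assume "x \<in> ?O"
        then obtain a b where ab: "x = c (a, b)" "a \<in> U1" "b \<in> U2" by (auto simp: U(1))
        have "inv_into U c x = (a, b)" unfolding ab(1)
          by (rule inv_into_f_f[OF chart_inj[OF charted_prod[OF N M'] U0]]) (use ab U in auto)
        moreover have "block (mdim N) (mdim M) x = c2 b"
          unfolding ab(1) U(2) using ch ab by (intro block_pair_chart)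
        ultimately show "(d \<circ> inv_into U2 c2) (block (mdim N) (mdim M) x) = (d \<circ> snd \<circ> inv_into U c) x"
          using chart_inj[OF M' U(4)] ab by (simp add: inv_into_f_f)
      qed
    qed
  qed (rule openin_topspace)
qed

lemma second_countable_prod_topology:
  assumes "second_countable X" "second_countable Y"
  shows "second_countable (prod_topology X Y)"
proof -
  obtain A where A: "countable A" "\<And>V. V \<in> A \<Longrightarrow> openin X V"
    "\<And>U x. openin X U \<Longrightarrow> x \<in> U \<Longrightarrow> \<exists>V\<in>A. x \<in> V \<and> V \<subseteq> U"
    using assms(1) unfolding second_countable_def by metis
  obtain B where B: "countable B" "\<And>V. V \<in> B \<Longrightarrow> openin Y V"
    "\<And>U x. openin Y U \<Longrightarrow> x \<in> U \<Longrightarrow> \<exists>V\<in>B. x \<in> V \<and> V \<subseteq> U"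
    using assms(2) unfolding second_countable_def by metis
  show ?thesis
    unfolding second_countable_def
  proof (intro exI conjI allI impI)
    show "countable ((\<lambda>(U, V). U \<times> V) ` (A \<times> B))" using A B by auto
    show "\<forall>V\<in>(\<lambda>(U, V). U \<times> V) ` (A \<times> B). openin (prod_topology X Y) V"
      using A B by (auto simp: openin_prod_Times_iff)
    fix W p assume "openin (prod_topology X Y) W \<and> p \<in> W"
    then obtain U V where UV: "openin X U" "openin Y V" "fst p \<in> U" "snd p \<in> V" "U \<times> V \<subseteq> W"
      unfolding openin_prod_topology_alt by (metis prod.collapse)
    obtain U' V' where "U' \<in> A" "V' \<in> B" "fst p \<in> U'" "U' \<subseteq> U" "snd p \<in> V'" "V' \<subseteq> V"
      using A(3)[OF UV(1,3)] B(3)[OF UV(2,4)] by blast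
    then show "\<exists>V\<in>(\<lambda>(U, V). U \<times> V) ` (A \<times> B). p \<in> V \<and> V \<subseteq> W"
      using UV by (intro bexI[of _ "U' \<times> V'"]) (auto simp: mem_Times_iff)
  qed
qed

lemma second_countable_finite_product_topology:
  assumes "finite I" "\<And>i. i \<in> I \<Longrightarrow> second_countable (X i)"
  shows "second_countable (product_topology X I)"
proof -
  have "\<exists>A. countable A \<and> (\<forall>V\<in>A. openin (X i) V) \<and> (\<forall>U x. openin (X i) U \<longrightarrow> x \<in> U \<longrightarrow> (\<exists>V\<in>A. x \<in> V \<and> V \<subseteq> U))"
    if "i \<in> I" for i
    using assms(2)[OF that] unfolding second_countable_def by metis
  then obtain A where A: "\<And>i. i \<in> I \<Longrightarrow> countable (A i)" "\<And>i V. i \<in> I \<Longrightarrow> V \<in> A i \<Longrightarrow> openin (X i) V"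
    "\<And>i U x. i \<in> I \<Longrightarrow> openin (X i) U \<Longrightarrow> x \<in> U \<Longrightarrow> \<exists>V\<in>A i. x \<in> V \<and> V \<subseteq> U"
    by metis
  show ?thesis
    unfolding second_countable_def
  proof (intro exI conjI allI impI)
    show "countable (PiE I ` (PiE I A))" using A(1) assms(1) by (intro countable_image countable_PiE)
    show "\<forall>V\<in>PiE I ` (PiE I A). openin (product_topology X I) V"
      using A(2) assms(1) by (auto simp: openin_PiE_gen PiE_iff)
    fix W p assume Wp: "openin (product_topology X I) W \<and> p \<in> W"
    then obtain U where U: "p \<in> PiE I U" "\<And>i. openin (X i) (U i)" "PiE I U \<subseteq> W"
      using product_topology_open_contains_basis[of X I W p] by blast
    have "\<exists>V\<in>A i. p i \<in> V \<and> V \<subseteq> U i" if "i \<in> I" for i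
      using A(3)[OF that U(2)] U(1) that by (auto simp: PiE_iff)
    then obtain V where V: "\<And>i. i \<in> I \<Longrightarrow> V i \<in> A i \<and> p i \<in> V i \<and> V i \<subseteq> U i" by metis
    have "PiE I (restrict V I) \<subseteq> PiE I U" using V by (intro PiE_mono) auto
    moreover have "p \<in> PiE I (restrict V I)" using V U(1) by (auto simp: PiE_iff)
    moreover have "restrict V I \<in> PiE I A" using V by auto
    ultimately show "\<exists>V\<in>PiE I ` (PiE I A). p \<in> V \<and> V \<subseteq> W"
      using U(3) by (intro bexI[of _ "PiE I (restrict V I)"] imageI conjI) (auto intro: subset_trans)
  qed
qed

text \<open>
  The identity of a product is the pair of the projections, so its smoothness is that of the
  projections and of pairing.
\<close>

lemma smooth_manifold_prod:
  assumes M: "smooth_manifold M" and N: "smooth_manifold N"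
  shows "smooth_manifold (prod_mfd M N)"
  unfolding smooth_manifold_iff
proof (intro conjI)
  note M' = smooth_manifold_charted[OF M] and N' = smooth_manifold_charted[OF N]
  have MN: "Hausdorff_space (mtop M)" "Hausdorff_space (mtop N)" "second_countable (mtop M)" "second_countable (mtop N)"
    "(\<Union>(U, c)\<in>atlas M. U) = pts M" "(\<Union>(U, c)\<in>atlas N. U) = pts N"
    using M N by (auto simp: smooth_manifold_iff)
  show "Hausdorff_space (mtop (prod_mfd M N))" using MN by (simp add: Hausdorff_space_prod_topology)
  show "second_countable (mtop (prod_mfd M N))" using MN by (simp add: second_countable_prod_topology)
  show "charted (prod_mfd M N)" by (rule charted_prod[OF M' N'])
  show "(\<Union>(U, c)\<in>atlas (prod_mfd M N). U) = pts (prod_mfd M N)"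
  proof -
    have "(\<Union>(U, c)\<in>atlas (prod_mfd M N). U) = (\<Union>(U, c)\<in>atlas M. U) \<times> (\<Union>(U, c)\<in>atlas N. U)"
    proof (intro equalityI subsetI)
      fix p assume "p \<in> (\<Union>(U, c)\<in>atlas M. U) \<times> (\<Union>(U, c)\<in>atlas N. U)"
      then obtain U c V d where "(U, c) \<in> atlas M" "(V, d) \<in> atlas N" "p \<in> U \<times> V" by auto
      then have "(U \<times> V, pair_chart (mdim M) c d) \<in> atlas (prod_mfd M N)" "p \<in> U \<times> V"
        by (auto simp: atlas_prod_mfd)
      then show "p \<in> (\<Union>(U, c)\<in>atlas (prod_mfd M N). U)" by blast
    qed (auto simp: atlas_prod_mfd)
    then show ?thesis unfolding MN by simp
  qed
  have "smooth_map_on (prod_mfd M N) (prod_mfd M N) (pts (prod_mfd M N)) (\<lambda>p. (fst p, snd p))"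
    by (rule smooth_map_on_Pair[OF smooth_map_fst[OF M N'] smooth_map_snd[OF N M']])
  then show "smooth_map (prod_mfd M N) (prod_mfd M N) (\<lambda>p. p)" by simp
qed

section \<open>Powers, discrete manifolds, and embedded submanifolds\<close>

definition power_chart :: "nat \<Rightarrow> nat \<Rightarrow> (nat \<Rightarrow> 'a \<Rightarrow> nat \<Rightarrow> real) \<Rightarrow> (nat \<Rightarrow> 'a) \<Rightarrow> nat \<Rightarrow> real" where
  "power_chart n m c = (\<lambda>x i. if i < n * m then c (i div m) (x (i div m)) (i mod m) else 0)"

lemma power_mfd_simps [simp]:
  "mtop (power_mfd n M) = product_topology (\<lambda>_. mtop M) {..<n}"
  "mdim (power_mfd n M) = n * mdim M"
  by (simp_all add: power_mfd_def)

lemma atlas_power_mfd: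
  "atlas (power_mfd n M) = {(\<Pi>\<^sub>E a\<in>{..<n}. U a, power_chart n (mdim M) c) |U c. \<forall>a<n. (U a, c a) \<in> atlas M}"
  by (simp add: power_mfd_def power_chart_def)

lemma block_index:
  fixes a i m n :: nat
  assumes "a < n" "i < m"
  shows "a * m + i < n * m" "(a * m + i) div m = a" "(a * m + i) mod m = i"
proof -
  have "a * m + i < Suc a * m" using assms by simp
  also have "\<dots> \<le> n * m" using assms(1) by (intro mult_le_mono1) simp
  finally show "a * m + i < n * m" .
qed (use assms in auto)

lemma index_split:
  fixes i m n :: nat
  assumes "i < n * m"
  shows "i div m < n" "i mod m < m" "i div m * m + i mod m = i"
  using assms by (auto simp: less_mult_imp_div_less) (metis mod_less_divisor mult_0_right not_gr_zero not_less_zero)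

lemma block_power_chart:
  assumes "a < n" "c a (x a) \<in> espace m"
  shows "block (a * m) m (power_chart n m c x) = c a (x a)"
  using assms(2) block_index[OF assms(1)]
  by (auto simp: block_def power_chart_def topspace_Euclidean_space fun_eq_iff)

lemma power_chart_espace: "power_chart n m c x \<in> espace (n * m)"
  by (simp add: power_chart_def topspace_Euclidean_space)

lemma power_chart_is_chart:
  assumes c: "\<And>a. a < n \<Longrightarrow> is_chart X m (U a) (c a)"
  shows "is_chart (product_topology (\<lambda>_. X) {..<n}) (n * m) (\<Pi>\<^sub>E a\<in>{..<n}. U a) (power_chart n m c)"
proof -
  let ?T = "product_topology (\<lambda>_. X) {..<n}" and ?U = "\<Pi>\<^sub>E a\<in>{..<n}. U a"
  let ?O = "{z \<in> espace (n * m). \<forall>a<n. block (a * m) m z \<in> c a ` U a}"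
  let ?e = "\<lambda>z. \<lambda>a\<in>{..<n}. inv_into (U a) (c a) (block (a * m) m z)"
  have U: "openin X (U a)" "openin (Euclidean_space m) (c a ` U a)" if "a < n" for a
    using c[OF that] by (auto simp: is_chart_def)
  have esp: "c a x \<in> espace m" if "a < n" "x \<in> U a" for a x
    using is_chart_image_subset[OF c[OF that(1)] that(2)] .
  have O: "openin (Euclidean_space (n * m)) ?O"
  proof -
    have "?O = \<Inter> (insert (espace (n * m)) ((\<lambda>a. {z \<in> espace (n * m). block (a * m) m z \<in> c a ` U a}) ` {..<n}))"
      by auto
    moreover have "openin (Euclidean_space (n * m)) {z \<in> espace (n * m). block (a * m) m z \<in> c a ` U a}" if "a < n" for a
      by (rule openin_continuous_map_preimage[OF continuous_map_block U(2)[OF that]])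
    ultimately show ?thesis by (simp only:) (rule openin_Inter; auto)
  qed
  have Uopen: "openin ?T ?U" using U by (simp add: openin_PiE_gen)
  have cc: "continuous_map (subtopology ?T ?U) (Euclidean_space m) (\<lambda>x. c a (x a))" if a: "a < n" for a
  proof -
    have "continuous_map (subtopology ?T ?U) X (\<lambda>x. x a)"
      by (rule continuous_map_from_subtopology) (use a in \<open>auto intro: continuous_map_product_projection\<close>)
    then have "continuous_map (subtopology ?T ?U) (subtopology X (U a)) (\<lambda>x. x a)"
      using a by (auto simp: continuous_map_in_subtopology PiE_iff)
    then show ?thesis using continuous_map_compose[OF _ is_chart_continuous[OF c[OF a]]] by (auto simp: o_def)
  qed
  show ?thesis
  proof (rule is_chartI(1)[OF Uopen O, where e = ?e])
    show "continuous_map (subtopology ?T ?U) (Euclidean_space (n * m)) (power_chart n m c)"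
      unfolding continuous_map_into_Euclidean_space
    proof (intro conjI ballI allI impI power_chart_espace)
      fix i assume i: "i < n * m"
      show "continuous_map (subtopology ?T ?U) euclideanreal (\<lambda>x. power_chart n m c x i)"
        using cc[OF index_split(1)[OF i]] index_split[OF i] i
        unfolding continuous_map_into_Euclidean_space by (simp add: power_chart_def)
    qed
    show "continuous_map (subtopology (Euclidean_space (n * m)) ?O) ?T ?e"
      unfolding continuous_map_componentwise
    proof (intro conjI ballI)
      fix a assume "a \<in> {..<n}"
      then have a: "a < n" by simp
      have "continuous_map (subtopology (Euclidean_space (n * m)) ?O) (subtopology (Euclidean_space m) (c a ` U a)) (block (a * m) m)"
        using a by (auto simp: continuous_map_in_subtopology continuous_map_block continuous_map_from_subtopology)
      then show "continuous_map (subtopology (Euclidean_space (n * m)) ?O) X (\<lambda>z. ?e z a)"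
        using continuous_map_compose[OF _ is_chart_inv_continuous[OF c[OF a]]] a by (auto simp: o_def)
    qed auto
    show "power_chart n m c x \<in> ?O" if "x \<in> ?U" for x
      using that esp block_power_chart[of _ n c x m] power_chart_espace by (auto simp: PiE_iff)
    show "?e z \<in> ?U" if "z \<in> ?O" for z
      using that by (auto intro: inv_into_into)
    show "?e (power_chart n m c x) = x" if x: "x \<in> ?U" for x
    proof
      fix a show "?e (power_chart n m c x) a = x a"
      proof (cases "a < n")
        case True
        then have "x a \<in> U a" using x by auto
        then show ?thesis using True block_power_chart[of a n c x m] esp is_chart_inj[OF c[OF True]]
          by (simp add: inv_into_f_f)
      qed (use x in \<open>auto simp: PiE_iff extensional_def\<close>)
    qed
    show "power_chart n m c (?e z) = z" if z: "z \<in> ?O" for z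
    proof
      fix i show "power_chart n m c (?e z) i = z i"
      proof (cases "i < n * m")
        case True
        note i = index_split[OF True]
        have "c (i div m) (inv_into (U (i div m)) (c (i div m)) (block (i div m * m) m z)) = block (i div m * m) m z"
          using z i by (intro f_inv_into_f) auto
        then show ?thesis using True i by (simp add: power_chart_def block_def)
      qed (use z in \<open>auto simp: power_chart_def topspace_Euclidean_space\<close>)
    qed
  qed
qed

lemma charted_power: "charted M \<Longrightarrow> charted (power_mfd n M)"
  unfolding charted_def atlas_power_mfd by (auto intro!: power_chart_is_chart)

lemma smooth_map_on_power:
  assumes P: "openin (mtop P) S"
    and f: "\<And>a. a < n \<Longrightarrow> smooth_map_on P M S (\<lambda>p. f p a)"
    and ext: "\<And>p. p \<in> S \<Longrightarrow> f p \<in> extensional {..<n}"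
  shows "smooth_map_on P (power_mfd n M) S f"
  unfolding smooth_map_on_def
proof (intro conjI P)
  have "topspace (subtopology (mtop P) S) = S" using openin_subset[OF P] by auto
  then show "continuous_map (subtopology (mtop P) S) (mtop (power_mfd n M)) f"
    using f ext unfolding power_mfd_simps continuous_map_componentwise by (auto simp: smooth_map_on_def)
  show "\<forall>(U, c)\<in>atlas P. \<forall>(V, d)\<in>atlas (power_mfd n M). smooth_euclidean (mdim P) (mdim (power_mfd n M))
      (c ` (U \<inter> S \<inter> f -` V)) (d \<circ> f \<circ> inv_into U c)"
  proof clarify
    fix U c V d assume U: "(U, c) \<in> atlas P" and "(V, d) \<in> atlas (power_mfd n M)"
    then obtain V' d' where V: "V = (\<Pi>\<^sub>E a\<in>{..<n}. V' a)" "d = power_chart n (mdim M) d'"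
      "\<And>a. a < n \<Longrightarrow> (V' a, d' a) \<in> atlas M" by (auto simp: atlas_power_mfd)
    let ?O = "c ` (U \<inter> S \<inter> f -` V)"
    have s: "Ck (mdim P) k ?O (\<lambda>x. (d' a \<circ> (\<lambda>p. f p a) \<circ> inv_into U c) x j)" if a: "a < n" and j: "j < mdim M" for k j a
    proof (rule Ck_subset)
      show "Ck (mdim P) k (c ` (U \<inter> S \<inter> (\<lambda>p. f p a) -` V' a)) (\<lambda>x. (d' a \<circ> (\<lambda>p. f p a) \<circ> inv_into U c) x j)"
        using smooth_map_onD[OF f[OF a] U V(3)[OF a]] j by (auto simp: smooth_euclidean_def)
      show "?O \<subseteq> c ` (U \<inter> S \<inter> (\<lambda>p. f p a) -` V' a)" using a by (auto simp: V(1) PiE_iff)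
    qed
    show "smooth_euclidean (mdim P) (mdim (power_mfd n M)) ?O (d \<circ> f \<circ> inv_into U c)"
      unfolding smooth_euclidean_def power_mfd_simps
    proof (intro allI impI)
      fix j k assume j: "j < n * mdim M"
      show "Ck (mdim P) k ?O (\<lambda>x. (d \<circ> f \<circ> inv_into U c) x j)"
        using s[OF index_split(1,2)[OF j], of k] j by (simp add: V(2) power_chart_def o_def)
    qed
  qed
qed

lemma smooth_map_power_component:
  assumes M: "smooth_manifold M" and a: "a < n"
  shows "smooth_map (power_mfd n M) M (\<lambda>x. x a)"
  unfolding smooth_map_on_def
proof (intro conjI)
  note M' = smooth_manifold_charted[OF M]
  let ?m = "mdim M"
  note trans = chart_transition[OF M]
  show "openin (mtop (power_mfd n M)) (pts (power_mfd n M))" by (rule openin_topspace)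
  show c: "continuous_map (subtopology (mtop (power_mfd n M)) (pts (power_mfd n M))) (mtop M) (\<lambda>x. x a)"
    unfolding power_mfd_simps
    by (rule continuous_map_from_subtopology) (use a in \<open>auto intro: continuous_map_product_projection\<close>)
  show "\<forall>(U, c)\<in>atlas (power_mfd n M). \<forall>(V, d)\<in>atlas M. smooth_euclidean (mdim (power_mfd n M)) ?m
    (c ` (U \<inter> pts (power_mfd n M) \<inter> (\<lambda>x. x a) -` V)) (d \<circ> (\<lambda>x. x a) \<circ> inv_into U c)"
  proof clarify
    fix U c V d assume U0: "(U, c) \<in> atlas (power_mfd n M)" and V: "(V, d) \<in> atlas M"
    then obtain U' c' where U: "U = (\<Pi>\<^sub>E a\<in>{..<n}. U' a)" "c = power_chart n ?m c'"
      "\<And>a. a < n \<Longrightarrow> (U' a, c' a) \<in> atlas M" by (auto simp: atlas_power_mfd)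
    note Ua = U(3)[OF a]
    note esp = is_chart_image_subset[OF chartedD[OF M' Ua]]
    let ?O = "c ` (U \<inter> pts (power_mfd n M) \<inter> (\<lambda>x. x a) -` V)"
    have O: "openin (Euclidean_space (mdim (power_mfd n M))) ?O"
      by (rule smooth_map_on_chart_open[OF charted_power[OF M'] U0 chart_openin[OF M' V] openin_topspace c])
    have OV: "openin (Euclidean_space ?m) (c' a ` (U' a \<inter> V))"
      by (rule is_chart_image_open[OF chartedD[OF M' Ua] chart_openin[OF M' V]])
    have bl: "block (a * ?m) ?m (c x) = c' a (x a)" if "x \<in> U" for x
      unfolding U(2) by (rule block_power_chart[of a n c' x ?m, OF a esp]) (use that a in \<open>auto simp: U(1)\<close>)
    have "smooth_euclidean (mdim (power_mfd n M)) ?m ?O (\<lambda>x. (d \<circ> inv_into (U' a) (c' a)) (block (a * ?m) ?m x))"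
    proof (rule smooth_euclidean_compose[OF O OV _ smooth_euclidean_block[OF O] trans[OF Ua V]])
      show "block (a * ?m) ?m x \<in> c' a ` (U' a \<inter> V)" if "x \<in> ?O" for x
        using that bl a by (auto simp: U(1) PiE_iff)
    qed
    then show "smooth_euclidean (mdim (power_mfd n M)) ?m ?O (d \<circ> (\<lambda>x. x a) \<circ> inv_into U c)"
    proof (rule smooth_euclidean_cong[OF O, rotated])
      fix z assume "z \<in> ?O"
      then obtain x where x: "z = c x" "x \<in> U" "x a \<in> U' a" using a by (auto simp: U(1))
      have "inv_into U c z = x" unfolding x(1)
        by (rule inv_into_f_f[OF chart_inj[OF charted_power[OF M'] U0] x(2)])
      then show "(d \<circ> inv_into (U' a) (c' a)) (block (a * ?m) ?m z) = (d \<circ> (\<lambda>x. x a) \<circ> inv_into U c) z"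
        using chart_inj[OF M' Ua] x bl[OF x(2)] by (simp add: inv_into_f_f)
    qed
  qed
qed

lemma smooth_manifold_power:
  assumes M: "smooth_manifold M"
  shows "smooth_manifold (power_mfd n M)"
  unfolding smooth_manifold_iff
proof (intro conjI)
  have MN: "Hausdorff_space (mtop M)" "second_countable (mtop M)" "charted M" "(\<Union>(U, c)\<in>atlas M. U) = pts M"
    using M by (auto simp: smooth_manifold_iff)
  show "Hausdorff_space (mtop (power_mfd n M))" using MN by (simp add: Hausdorff_space_product_topology)
  show "second_countable (mtop (power_mfd n M))"
    using MN by (simp add: second_countable_finite_product_topology)
  show C: "charted (power_mfd n M)" using MN by (intro charted_power)
  show "(\<Union>(U, c)\<in>atlas (power_mfd n M). U) = pts (power_mfd n M)"
  proof (intro equalityI subsetI)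
    fix x assume "x \<in> (\<Union>(U, c)\<in>atlas (power_mfd n M). U)"
    then obtain U c where "(U, c) \<in> atlas (power_mfd n M)" "x \<in> U" by auto
    then show "x \<in> pts (power_mfd n M)" using openin_subset[OF chart_openin[OF C]] by blast
  next
    fix x assume x: "x \<in> pts (power_mfd n M)"
    have "\<exists>U c. (U, c) \<in> atlas M \<and> x a \<in> U" if "a < n" for a
      using x that chart_at[OF M, of "x a"] by (auto simp: PiE_iff) metis
    then obtain U c where "\<And>a. a < n \<Longrightarrow> (U a, c a) \<in> atlas M \<and> x a \<in> U a" by metis
    then have "((\<Pi>\<^sub>E a\<in>{..<n}. U a), power_chart n (mdim M) c) \<in> atlas (power_mfd n M)" "x \<in> (\<Pi>\<^sub>E a\<in>{..<n}. U a)"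
      using x by (auto simp: atlas_power_mfd PiE_iff)
    then show "x \<in> (\<Union>(U, c)\<in>atlas (power_mfd n M). U)" by blast
  qed
  show "smooth_map (power_mfd n M) (power_mfd n M) (\<lambda>p. p)"
    by (rule smooth_map_on_power[OF openin_topspace smooth_map_power_component[OF M]]) (auto simp: PiE_iff)
qed

lemma discrete_mfd_simps [simp]:
  "mtop (discrete_mfd A) = discrete_topology A"
  "mdim (discrete_mfd A) = 0"
  by (simp_all add: discrete_mfd_def)

lemma smooth_map_on_discrete:
  assumes "openin (mtop M) S" "continuous_map (subtopology (mtop M) S) (discrete_topology A) f"
  shows "smooth_map_on M (discrete_mfd A) S f"
  using assms by (auto simp: smooth_map_on_def smooth_euclidean_def)

lemma espace_0: "espace 0 = {\<lambda>_. 0}"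
  by (auto simp: topspace_Euclidean_space)

lemma charted_discrete: "charted (discrete_mfd A)"
proof -
  have "is_chart (discrete_topology A) 0 {a} (\<lambda>_ _. 0)" if "a \<in> A" for a
    by (rule is_chartI(1)[where O' = "espace 0" and e = "\<lambda>_. a"]) (use that openin_topspace[of "Euclidean_space 0"] in \<open>auto simp: espace_0\<close>)
  then show ?thesis by (auto simp: charted_def discrete_mfd_def)
qed

lemma smooth_manifold_discrete: "countable A \<Longrightarrow> smooth_manifold (discrete_mfd A)"
  unfolding smooth_manifold_iff
proof (intro conjI charted_discrete)
  show "smooth_map (discrete_mfd A) (discrete_mfd A) (\<lambda>x. x)"
    by (rule smooth_map_on_discrete) (auto simp: continuous_map_from_subtopology)
qed (auto simp: Hausdorff_space_discrete_topology second_countable_discrete_topology discrete_mfd_def)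

lemma submfd_simps [simp]:
  "mtop (submfd N A d) = subtopology (mtop N) A"
  "mdim (submfd N A d) = d"
  by (simp_all add: submfd_def)

lemma charted_submfd: "charted (submfd N A d)"
  by (auto simp: charted_def submfd_def)

text \<open>
  Charts of an induced structure have by definition inverses that are smooth into \<open>N\<close>.
\<close>

lemma smooth_map_submfd_inclusion:
  assumes N: "charted N"
  shows "smooth_map (submfd N A d) N (\<lambda>x. x)"
  unfolding smooth_map_on_def
proof (intro conjI openin_topspace)
  show "continuous_map (subtopology (mtop (submfd N A d)) (pts (submfd N A d))) (mtop N) (\<lambda>x. x)"
    by (simp add: continuous_map_from_subtopology del: topspace_subtopology)
  show "\<forall>(V, c)\<in>atlas (submfd N A d). \<forall>(W, e)\<in>atlas N. smooth_euclidean (mdim (submfd N A d)) (mdim N)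
      (c ` (V \<inter> pts (submfd N A d) \<inter> (\<lambda>x. x) -` W)) (e \<circ> (\<lambda>x. x) \<circ> inv_into V c)"
  proof clarify
    fix V c W e assume V: "(V, c) \<in> atlas (submfd N A d)" and W: "(W, e) \<in> atlas N"
    have s: "smooth_map_on (euclidean_mfd d) N (c ` V) (inv_into V c)"
      and ch: "is_chart (subtopology (mtop N) A) d V c" using V by (auto simp: submfd_def)
    have VA: "V \<subseteq> pts (submfd N A d)" using ch openin_subset[of "subtopology (mtop N) A" V] by (auto simp: is_chart_def)
    have E: "(espace d, \<lambda>x. x) \<in> atlas (euclidean_mfd d)" by (simp add: euclidean_mfd_def)
    have inj: "inj_on c V" by (rule is_chart_inj[OF ch])
    note esp = is_chart_image_subset[OF ch]
    have eq: "(\<lambda>x. x) ` (espace d \<inter> c ` V \<inter> inv_into V c -` W) = c ` (V \<inter> pts (submfd N A d) \<inter> (\<lambda>x. x) -` W)"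
      using esp inj VA by (auto simp: inv_into_f_f)
    have "smooth_euclidean d (mdim N) (c ` (V \<inter> pts (submfd N A d) \<inter> (\<lambda>x. x) -` W))
       (e \<circ> inv_into V c \<circ> inv_into (espace d) (\<lambda>x. x))"
      using smooth_map_onD[OF s E W] unfolding eq by simp
    then show "smooth_euclidean (mdim (submfd N A d)) (mdim N)
      (c ` (V \<inter> pts (submfd N A d) \<inter> (\<lambda>x. x) -` W)) (e \<circ> (\<lambda>x. x) \<circ> inv_into V c)"
      unfolding submfd_simps(2)
    proof (rule smooth_euclidean_cong[rotated 2])
      have "openin (mtop (submfd N A d)) (pts (submfd N A d) \<inter> W)"
      proof -
        have "pts (submfd N A d) \<inter> W = A \<inter> W" using openin_subset[OF chart_openin[OF N W]] by auto
        then show ?thesis using chart_openin[OF N W] by (simp add: openin_subtopology_Int2)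
      qed
      then have "openin (Euclidean_space d) (c ` (V \<inter> (pts (submfd N A d) \<inter> W)))"
        using is_chart_image_open[OF ch] by simp
      then show "openin (Euclidean_space d) (c ` (V \<inter> pts (submfd N A d) \<inter> (\<lambda>x. x) -` W))"
        by (simp add: Int_assoc)
      show "(e \<circ> inv_into V c \<circ> inv_into (espace d) (\<lambda>x. x)) z = (e \<circ> (\<lambda>x. x) \<circ> inv_into V c) z"
        if "z \<in> c ` (V \<inter> pts (submfd N A d) \<inter> (\<lambda>x. x) -` W)" for z
        using that esp by (auto simp: inv_into_f_f[of "\<lambda>x. x"])
    qed
  qed
qed

lemma smooth_map_on_from_submfd:
  assumes N: "smooth_manifold N" and P: "charted P" and f: "smooth_map_on N P S f" and AN: "A \<subseteq> pts N"
  shows "smooth_map_on (submfd N A d) P (A \<inter> S) f"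
proof -
  note N' = smooth_manifold_charted[OF N]
  have "openin (mtop (submfd N A d)) (A \<inter> S)"
    using smooth_map_on_openin[OF f] by (simp add: openin_subtopology_Int2)
  then have "smooth_map_on (submfd N A d) N (A \<inter> S) (\<lambda>x. x)"
    by (rule smooth_map_on_subset[OF smooth_map_submfd_inclusion[OF N']]) (use AN in auto)
  then show ?thesis by (rule smooth_map_on_compose[OF charted_submfd N P _ f]) auto
qed

text \<open>
  Charts of an induced structure are restrictions of smooth maps on open subsets of \<open>N\<close>.  Hence
  smoothness into a submanifold is smoothness into the ambient manifold.
\<close>

lemma smooth_map_on_into_submfd:
  assumes P: "charted P" and N: "smooth_manifold N" and f: "smooth_map_on P N S f"
    and fA: "\<And>x. x \<in> S \<Longrightarrow> f x \<in> A"
  shows "smooth_map_on P (submfd N A d) S f"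
  unfolding smooth_map_on_def
proof (intro conjI)
  note N' = smooth_manifold_charted[OF N]
  show S: "openin (mtop P) S" using f smooth_map_on_openin by blast
  show cont: "continuous_map (subtopology (mtop P) S) (mtop (submfd N A d)) f"
    using f fA by (auto simp: smooth_map_on_def continuous_map_in_subtopology)
  show "\<forall>(U, e)\<in>atlas P. \<forall>(V, c)\<in>atlas (submfd N A d). smooth_euclidean (mdim P) (mdim (submfd N A d))
      (e ` (U \<inter> S \<inter> f -` V)) (c \<circ> f \<circ> inv_into U e)"
  proof clarify
    fix U e V c assume U: "(U, e) \<in> atlas P" and V: "(V, c) \<in> atlas (submfd N A d)"
    obtain W c' where W: "V = W \<inter> A" "smooth_map_on N (euclidean_mfd d) W c'" "\<And>x. x \<in> V \<Longrightarrow> c' x = c x"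
      using V by (auto simp: submfd_def)
    have E: "(espace d, \<lambda>x. x) \<in> atlas (euclidean_mfd d)" by (simp add: euclidean_mfd_def)
    let ?S = "{x \<in> S. f x \<in> W}"
    have S': "openin (mtop P) ?S" by (rule smooth_map_on_preimage[OF f smooth_map_on_openin[OF W(2)]])
    have s: "smooth_map_on P (euclidean_mfd d) ?S (\<lambda>x. c' (f x))"
      by (rule smooth_map_on_compose[OF P N smooth_manifold_charted[OF smooth_manifold_euclidean]
            smooth_map_on_subset[OF f S'] W(2)]) auto
    have "U \<inter> ?S \<inter> (\<lambda>x. c' (f x)) -` espace d = U \<inter> S \<inter> f -` V"
      using smooth_map_on_into[OF s] fA by (auto simp: W(1))
    then have "smooth_euclidean (mdim P) d (e ` (U \<inter> S \<inter> f -` V)) ((\<lambda>x. x) \<circ> (\<lambda>x. c' (f x)) \<circ> inv_into U e)"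
      using smooth_map_onD[OF s U E] by simp
    then show "smooth_euclidean (mdim P) (mdim (submfd N A d)) (e ` (U \<inter> S \<inter> f -` V)) (c \<circ> f \<circ> inv_into U e)"
      unfolding submfd_simps
    proof (rule smooth_euclidean_cong[rotated 2])
      show "openin (Euclidean_space (mdim P)) (e ` (U \<inter> S \<inter> f -` V))"
        by (rule smooth_map_on_chart_open[OF P U _ S cont])
          (use chart_openin[OF charted_submfd V] in simp)
      show "((\<lambda>x. x) \<circ> (\<lambda>x. c' (f x)) \<circ> inv_into U e) z = (c \<circ> f \<circ> inv_into U e) z"
        if "z \<in> e ` (U \<inter> S \<inter> f -` V)" for z
        using that chart_inj[OF P U] W(3) by (auto simp: inv_into_f_f)
    qed
  qed
qed

text \<open>
  A subset is a submanifold if it is locally the image of a smooth parametrization \<open>\<theta>\<close> that has a smooth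
  left inverse \<open>\<psi>\<close> on an open subset of the ambient manifold: a chart of the parameter manifold composed
  with \<open>\<psi>\<close> is then a chart of the induced structure.
\<close>

lemma submfd_smooth_manifold:
  fixes P :: "'c mfd"
  assumes N: "smooth_manifold N" and AN: "A \<subseteq> pts N"
    and P: "smooth_manifold P" "mdim P = d"
    and par: "\<And>p. p \<in> A \<Longrightarrow> \<exists>Q \<theta> \<psi> W. p \<in> W \<and> smooth_map_on P N Q \<theta> \<and> smooth_map_on N P W \<psi> \<and>
        \<theta> ` Q = W \<inter> A \<and> (\<forall>q\<in>Q. \<psi> (\<theta> q) = q)"
  shows "smooth_manifold (submfd N A d)"
  unfolding smooth_manifold_iff
proof (intro conjI charted_submfd)
  note N' = smooth_manifold_charted[OF N] and P' = smooth_manifold_charted[OF P(1)]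
  have HN: "Hausdorff_space (mtop N)" "second_countable (mtop N)" using N by (auto simp: smooth_manifold_iff)
  show "Hausdorff_space (mtop (submfd N A d))" using HN by (simp add: Hausdorff_space_subtopology)
  show "second_countable (mtop (submfd N A d))" using HN by (simp add: second_countable_subtopology)
  show "smooth_map (submfd N A d) (submfd N A d) (\<lambda>x. x)"
    by (rule smooth_map_on_into_submfd[OF charted_submfd N smooth_map_submfd_inclusion[OF N']]) auto
  have "\<exists>V c. (V, c) \<in> atlas (submfd N A d) \<and> p \<in> V" if pA: "p \<in> A" for p
  proof -
    obtain Q \<theta> \<psi> W where W: "p \<in> W" "smooth_map_on P N Q \<theta>" "smooth_map_on N P W \<psi>"
      "\<theta> ` Q = W \<inter> A" "\<And>q. q \<in> Q \<Longrightarrow> \<psi> (\<theta> q) = q" using par[OF pA] by blast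
    obtain q where q: "q \<in> Q" "p = \<theta> q" using W(1,4) pA by auto
    have Q: "openin (mtop P) Q" using smooth_map_on_openin[OF W(2)] .
    obtain V c where V: "(V, c) \<in> atlas P" "q \<in> V"
      using chart_at[OF P(1)] openin_subset[OF Q] q by blast
    have VO: "openin (mtop P) V" by (rule chart_openin[OF P' V(1)])
    have ch: "is_chart (mtop P) d V c" using chartedD[OF P' V(1)] P(2) by simp
    define W' where "W' = {x \<in> W. \<psi> x \<in> V \<inter> Q}"
    have W'O: "openin (mtop N) W'" unfolding W'_def
      by (rule smooth_map_on_preimage[OF W(3)]) (use VO Q in auto)
    have im: "\<theta> ` (V \<inter> Q) = W' \<inter> A"
    proof (intro equalityI subsetI)
      fix x assume "x \<in> \<theta> ` (V \<inter> Q)"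
      then show "x \<in> W' \<inter> A" using W(4,5) by (auto simp: W'_def)
    next
      fix x assume x: "x \<in> W' \<inter> A"
      then obtain q' where "q' \<in> Q" "x = \<theta> q'" using W(4) by (auto simp: W'_def)
      then show "x \<in> \<theta> ` (V \<inter> Q)" using x W(5) by (auto simp: W'_def)
    qed
    have recover: "\<theta> (\<psi> x) = x" if "x \<in> W' \<inter> A" for x
      using that W(5) unfolding im[symmetric] by auto
    let ?O = "c ` (V \<inter> Q)" and ?c = "\<lambda>x. c (\<psi> x)" and ?e = "\<lambda>z. \<theta> (inv_into V c z)"
    have inj: "inj_on c V" by (rule is_chart_inj[OF ch])
    have OO: "openin (Euclidean_space d) ?O" by (rule is_chart_image_open[OF ch Q])
    have sc: "smooth_map_on N (euclidean_mfd d) W' ?c"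
    proof (rule smooth_map_on_compose[OF N' P(1) smooth_manifold_charted[OF smooth_manifold_euclidean]])
      show "smooth_map_on N P W' \<psi>" by (rule smooth_map_on_subset[OF W(3) W'O]) (auto simp: W'_def)
      show "smooth_map_on P (euclidean_mfd d) V c" using chart_smooth(1)[OF P(1) V(1)] P(2) by simp
    qed (auto simp: W'_def)
    have se: "smooth_map_on (euclidean_mfd d) N ?O ?e"
    proof (rule smooth_map_on_compose[OF smooth_manifold_charted[OF smooth_manifold_euclidean] P(1) N'])
      show "smooth_map_on (euclidean_mfd d) P ?O (inv_into V c)"
        by (rule smooth_map_on_subset[OF chart_smooth(2)[OF P(1) V(1), unfolded P(2)]]) (use OO in auto)
      show "smooth_map_on P N Q \<theta>" by (rule W(2))
    qed (use inj in \<open>auto simp: inv_into_f_f\<close>)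
    have chart: "is_chart (subtopology (mtop N) A) d (W' \<inter> A) ?c" "?c ` (W' \<inter> A) = ?O"
    proof -
      have 1: "openin (subtopology (mtop N) A) (W' \<inter> A)" using W'O by (rule openin_subtopology_Int)
      have 2: "continuous_map (subtopology (subtopology (mtop N) A) (W' \<inter> A)) (Euclidean_space d) ?c"
        unfolding subtopology_subtopology
        using smooth_map_on_continuous[OF sc] continuous_map_from_subtopology_mono[of _ W' _ ?c "A \<inter> (W' \<inter> A)"] by auto
      have 3: "continuous_map (subtopology (Euclidean_space d) ?O) (subtopology (mtop N) A) ?e"
        using smooth_map_on_continuous[OF se] im inj by (auto simp: continuous_map_in_subtopology inv_into_f_f)
      have 4: "?c x \<in> ?O" if "x \<in> W' \<inter> A" for x using that by (auto simp: W'_def)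
      have 5: "?e z \<in> W' \<inter> A" if "z \<in> ?O" for z using that inj im by (auto simp: inv_into_f_f)
      have 6: "?e (?c x) = x" if "x \<in> W' \<inter> A" for x using recover[OF that] that inj by (auto simp: W'_def inv_into_f_f)
      have 7: "?c (?e z) = z" if "z \<in> ?O" for z using that inj W(5) by (auto simp: inv_into_f_f)
      note * = is_chartI[where c = ?c and e = ?e and O' = ?O and U = "W' \<inter> A", OF 1 OO 2 3 4 5 6 7]
      show "is_chart (subtopology (mtop N) A) d (W' \<inter> A) ?c" by (rule *(1))
      show "?c ` (W' \<inter> A) = ?O" by (rule *(2))
    qed
    have inverse: "inv_into (W' \<inter> A) ?c z = ?e z" if z: "z \<in> ?O" for z
    proof -
      have "?c (?e z) = z" "?e z \<in> W' \<inter> A" using z inj W(5) im by (auto simp: inv_into_f_f)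
      then show ?thesis using inv_into_f_f[OF is_chart_inj[OF chart(1)]] by metis
    qed
    have "smooth_map_on (euclidean_mfd d) N (?c ` (W' \<inter> A)) (inv_into (W' \<inter> A) ?c)"
      unfolding chart(2)
      by (rule smooth_map_on_cong[OF smooth_manifold_charted[OF smooth_manifold_euclidean] N' se]) (simp add: inverse)
    then have "(W' \<inter> A, ?c) \<in> atlas (submfd N A d)"
      using chart(1) sc by (auto simp: submfd_def)
    moreover have "p \<in> W' \<inter> A" using q V im by auto
    ultimately show ?thesis by blast
  qed
  moreover have "pts (submfd N A d) = A" using AN by auto
  ultimately show "(\<Union>(V, c)\<in>atlas (submfd N A d). V) = pts (submfd N A d)"
    using openin_subset[OF chart_openin[OF charted_submfd]] by fast
qed

lemma smooth_manifold_open_submfd: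
  assumes "smooth_manifold N" "openin (mtop N) U"
  shows "smooth_manifold (submfd N U (mdim N))"
proof (rule submfd_smooth_manifold[OF assms(1) openin_subset[OF assms(2)] assms(1) refl])
  fix p assume "p \<in> U"
  then show "\<exists>Q \<theta> \<psi> W. p \<in> W \<and> smooth_map_on N N Q \<theta> \<and> smooth_map_on N N W \<psi> \<and>
        \<theta> ` Q = W \<inter> U \<and> (\<forall>q\<in>Q. \<psi> (\<theta> q) = q)"
    using smooth_map_on_id[OF assms] by (intro exI[of _ U] exI[of _ "\<lambda>x. x"]) auto
qed

section \<open>Inverting a map in coordinates\<close>

text \<open>
  Points of a product chart, written as pairs: first \<open>m\<close> coordinates of \<open>a\<close>, then those of \<open>y\<close>.
\<close>

definition juxt :: "nat \<Rightarrow> (nat \<Rightarrow> real) \<Rightarrow> (nat \<Rightarrow> real) \<Rightarrow> nat \<Rightarrow> real" where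
  "juxt m a y = (\<lambda>i. if i < m then a i else y (i - m))"

lemma juxt_espace: "y \<in> espace n \<Longrightarrow> juxt m a y \<in> espace (m + n)"
  by (auto simp: juxt_def topspace_Euclidean_space)

lemma juxt_simps [simp]: "i < m \<Longrightarrow> juxt m a y i = a i" "juxt m a y (m + i) = y i"
  by (auto simp: juxt_def)

lemma juxt_upd: "(juxt m a y)(m + i := t) = juxt m a (y(i := t))"
  by (auto simp: juxt_def fun_eq_iff)

lemma sum_block_split:
  fixes f :: "nat \<Rightarrow> real"
  shows "(\<Sum>i<m + n. f i) = (\<Sum>i<m. f i) + (\<Sum>i<n. f (m + i))"
  by (induction n) auto

lemma l1_juxt: "l1 (m + n) (juxt m a y) (juxt m a' y') = l1 m a a' + l1 n y y'"
  by (simp add: l1_def sum_block_split)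

lemma compact_l1_cball: "compact {a \<in> espace m. l1 m a a0 \<le> R}"
proof -
  let ?I = "\<lambda>i. if i < m then {a0 i - R..a0 i + R} else {0::real}"
  have "compactin (product_topology (\<lambda>i::nat. euclideanreal) UNIV) (PiE UNIV ?I)"
    unfolding compactin_PiE by auto
  then have c: "compact (PiE UNIV ?I)" by (simp add: euclidean_product_topology)
  have "a i \<in> ?I i" if "a \<in> espace m" "l1 m a a0 \<le> R" for a i
    using component_le_l1[of i m a a0] that by (auto simp: topspace_Euclidean_space)
  then have sub: "{a \<in> espace m. l1 m a a0 \<le> R} \<subseteq> PiE UNIV ?I" by auto
  have "closed {a. l1 m a a0 \<le> R}"
    by (intro closed_Collect_le continuous_on_l1 continuous_on_const)
  moreover have "closed (espace m)" using closedin_Euclidean_space_iff[of m "espace m"] by blast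
  ultimately have "closed ({a. l1 m a a0 \<le> R} \<inter> espace m)" by (rule closed_Int)
  then have "compact (PiE UNIV ?I \<inter> ({a. l1 m a a0 \<le> R} \<inter> espace m))" by (rule compact_Int_closed[OF c])
  moreover have "PiE UNIV ?I \<inter> ({a. l1 m a a0 \<le> R} \<inter> espace m) = {a \<in> espace m. l1 m a a0 \<le> R}"
    using sub by auto
  ultimately show ?thesis by simp
qed

text \<open>
  Here \<open>\<mu>\<close> is a group law in a chart with unit \<open>a0\<close>, and \<open>f\<close> is the orbit map \<open>g \<mapsto> g x\<close> in charts.
  By \<open>near\<close>, multiplication by \<open>b\<close> is a translation by \<open>b - a0\<close> up to half of its length.  By \<open>lip\<close>, which
  expresses \<open>f (a b) = a (f b)\<close>, it moves the value of \<open>f\<close> by at most a constant times the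
  distance from \<open>f a0\<close> to \<open>f b\<close>.  If that distance is too small in comparison with the distance \<open>s\<close>
  from \<open>a0\<close> to \<open>b\<close>, then about \<open>1/s\<close> repetitions lead into a compact shell around \<open>a0\<close> while the
  value of \<open>f\<close> remains closer to \<open>f a0\<close> than injectivity permits on that shell.
\<close>

lemma iterated_translation_lower_bound:
  fixes f :: "(nat \<Rightarrow> real) \<Rightarrow> nat \<Rightarrow> real" and \<mu> and L r :: real and m n :: nat and a0 :: "nat \<Rightarrow> real"
  defines "B \<equiv> {a \<in> espace m. l1 m a a0 < r}"
  assumes a0: "a0 \<in> espace m" and r: "r > 0"
    and \<mu>: "\<And>a b. a \<in> B \<Longrightarrow> b \<in> B \<Longrightarrow> \<mu> a b \<in> espace m"
    and near: "\<And>a b. a \<in> B \<Longrightarrow> b \<in> B \<Longrightarrow> (\<Sum>j<m. \<bar>\<mu> a b j - a j - (b j - a0 j)\<bar>) \<le> l1 m b a0 / 2"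
    and cont: "\<And>j. j < n \<Longrightarrow> continuous_on (B) (\<lambda>a. f a j)"
    and inj: "\<And>a. a \<in> B \<Longrightarrow> l1 n (f a) (f a0) = 0 \<Longrightarrow> a = a0"
    and lip: "\<And>a b. a \<in> B \<Longrightarrow> b \<in> B \<Longrightarrow> \<mu> a b \<in> B \<Longrightarrow> l1 n (f (\<mu> a b)) (f a) \<le> L * l1 n (f b) (f a0)"
  shows "\<exists>\<kappa>>0. \<exists>\<delta>>0. \<forall>b\<in>espace m. l1 m b a0 < \<delta> \<longrightarrow> \<kappa> * l1 m b a0 \<le> l1 n (f b) (f a0)"
proof -
  \<comment> \<open>The shell \<open>C\<close> reaches from \<open>e / 2\<close> to \<open>3 e\<close> and so stays inside the ball of radius \<open>r\<close>.\<close>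
  define e where "e = r / 4"
  define C where "C = {a \<in> espace m. l1 m a a0 \<le> 3 * e} \<inter> {a. e / 2 \<le> l1 m a a0}"
  have e: "e > 0" "3 * e < r" using r by (auto simp: e_def)
  have CB: "C \<subseteq> B" using e by (auto simp: C_def B_def)
  have "compact C" unfolding C_def
    by (intro compact_Int_closed compact_l1_cball closed_Collect_le continuous_on_l1 continuous_on_const)
  have fc: "continuous_on C (\<lambda>a. l1 n (f a) (f a0))"
    unfolding l1_def by (intro continuous_intros continuous_on_subset[OF cont CB]) auto
  have "\<exists>\<eta>>0. \<forall>a\<in>C. \<eta> \<le> l1 n (f a) (f a0)"
  proof (cases "C = {}")
    case False
    then obtain a where a: "a \<in> C" "\<forall>b\<in>C. l1 n (f a) (f a0) \<le> l1 n (f b) (f a0)"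
      using continuous_attains_inf[OF \<open>compact C\<close> False fc] by blast
    have "l1 n (f a) (f a0) \<noteq> 0"
    proof
      assume "l1 n (f a) (f a0) = 0"
      then have "a = a0" using inj a(1) CB by blast
      then show False using a(1) e by (auto simp: C_def)
    qed
    then have "l1 n (f a) (f a0) > 0" using l1_nonneg[of n "f a" "f a0"] by linarith
    then show ?thesis using a(2) by blast
  qed (auto intro: exI[of _ 1])
  then obtain \<eta> where \<eta>: "\<eta> > 0" "\<And>a. a \<in> C \<Longrightarrow> \<eta> \<le> l1 n (f a) (f a0)" by blast
  define L' where "L' = max L 1"
  \<comment> \<open>chosen such that \<open>2 e / s\<close> steps change \<open>f\<close> by at most \<open>\<eta> / 2\<close> when a single step changes it by at most \<open>L' \<kappa> s\<close>\<close>
  define \<kappa> where "\<kappa> = \<eta> / (4 * e * L')"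
  have L': "L' > 0" "L \<le> L'" by (auto simp: L'_def)
  have \<kappa>: "\<kappa> > 0" using \<eta> e L' by (simp add: \<kappa>_def)
  have "\<kappa> * l1 m b a0 \<le> l1 n (f b) (f a0)" if b: "b \<in> espace m" "l1 m b a0 < e" for b
  proof (rule ccontr)
    assume "\<not> \<kappa> * l1 m b a0 \<le> l1 n (f b) (f a0)"
    then have less: "l1 n (f b) (f a0) < \<kappa> * l1 m b a0" by simp
    define s where "s = l1 m b a0"
    have "0 < \<kappa> * s" using less l1_nonneg[of n "f b" "f a0"] unfolding s_def by linarith
    then have s: "s > 0" "s < e" using b by (auto simp: s_def intro: zero_less_mult_pos[OF _ \<kappa>])
    \<comment> \<open>\<open>N\<close> steps of length about \<open>s\<close>: the error of each is at most \<open>s / 2\<close>, so the total displacement is at least \<open>N s / 2\<close> and at most \<open>3 N s / 2\<close>, which lies between \<open>e / 2\<close> and \<open>3 e\<close>.\<close>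
    define N where "N = nat \<lceil>e / s\<rceil>"
    have N: "e \<le> real N * s" "real N * s < 2 * e"
    proof -
      have "e / s > 0" using s e by simp
      then have "0 \<le> \<lceil>e / s\<rceil>" by linarith
      then have "real N = of_int \<lceil>e / s\<rceil>" by (simp add: N_def)
      then have N1: "e / s \<le> real N" "real N < e / s + 1" by linarith+
      show "e \<le> real N * s" using N1(1) s by (simp add: pos_divide_le_eq)
      have "real N * s < (e / s + 1) * s" using N1(2) s by (intro mult_strict_right_mono) auto
      then show "real N * s < 2 * e" using s by (simp add: distrib_right)
    qed
    define p where "p i = ((\<lambda>a. \<mu> a b) ^^ i) a0" for i
    have p0: "p 0 = a0" and pS: "p (Suc i) = \<mu> (p i) b" for i by (auto simp: p_def)
    have bB: "b \<in> B" using b e by (auto simp: B_def)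
    have bound: "l1 m (p i) a0 < r" "l1 m (p i) a0 \<le> 3 * e" "real i * s / 2 \<le> l1 m (p i) a0"
      if i: "i \<le> N" and S: "(\<Sum>j<m. \<bar>p i j - a0 j - real i * (b j - a0 j)\<bar>) \<le> real i * s / 2" for i
    proof -
      have sum_s: "(\<Sum>j<m. \<bar>real i * (b j - a0 j)\<bar>) = real i * s"
        by (simp add: s_def l1_def abs_mult sum_distrib_left)
      have "l1 m (p i) a0 \<le> (\<Sum>j<m. \<bar>p i j - a0 j - real i * (b j - a0 j)\<bar>) + (\<Sum>j<m. \<bar>real i * (b j - a0 j)\<bar>)"
        unfolding l1_def sum.distrib[symmetric] by (intro sum_mono) auto
      moreover have "real i * s \<le> real N * s" using i s by (intro mult_right_mono) auto
      ultimately show "l1 m (p i) a0 < r" "l1 m (p i) a0 \<le> 3 * e" using S sum_s N e by linarith+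
      have "(\<Sum>j<m. \<bar>real i * (b j - a0 j)\<bar>) \<le> (\<Sum>j<m. \<bar>p i j - a0 j - real i * (b j - a0 j)\<bar>) + l1 m (p i) a0"
        unfolding l1_def sum.distrib[symmetric] by (intro sum_mono) auto
      then show "real i * s / 2 \<le> l1 m (p i) a0" using S sum_s by linarith
    qed
    have iter: "p i \<in> espace m \<and> (\<Sum>j<m. \<bar>p i j - a0 j - real i * (b j - a0 j)\<bar>) \<le> real i * s / 2 \<and>
        l1 n (f (p i)) (f a0) \<le> real i * (L' * l1 n (f b) (f a0))" if "i \<le> N" for i
      using that
    proof (induction i)
      case 0
      then show ?case using a0 by (simp add: p0)
    next
      case (Suc i)
      then have IH: "p i \<in> espace m" "(\<Sum>j<m. \<bar>p i j - a0 j - real i * (b j - a0 j)\<bar>) \<le> real i * s / 2"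
        "l1 n (f (p i)) (f a0) \<le> real i * (L' * l1 n (f b) (f a0))" and iN: "i \<le> N" by auto
      have piB: "p i \<in> B" using IH(1) bound(1)[OF iN IH(2)] by (simp add: B_def)
      have 1: "p (Suc i) \<in> espace m" using \<mu>[OF piB bB] by (simp add: pS)
      have "(\<Sum>j<m. \<bar>p (Suc i) j - a0 j - real (Suc i) * (b j - a0 j)\<bar>)
        \<le> (\<Sum>j<m. \<bar>\<mu> (p i) b j - p i j - (b j - a0 j)\<bar>) + (\<Sum>j<m. \<bar>p i j - a0 j - real i * (b j - a0 j)\<bar>)"
        unfolding sum.distrib[symmetric] pS by (intro sum_mono) (auto simp: distrib_right)
      also have "\<dots> \<le> s / 2 + real i * s / 2" using near[OF piB bB] IH(2) by (simp add: s_def)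
      finally have 2: "(\<Sum>j<m. \<bar>p (Suc i) j - a0 j - real (Suc i) * (b j - a0 j)\<bar>) \<le> real (Suc i) * s / 2"
        by (simp add: field_simps)
      have "\<mu> (p i) b \<in> B" using 1 bound(1)[OF Suc.prems 2] by (simp add: B_def pS)
      then have "l1 n (f (p (Suc i))) (f (p i)) \<le> L * l1 n (f b) (f a0)"
        using lip[OF piB bB] by (simp add: pS)
      also have "\<dots> \<le> L' * l1 n (f b) (f a0)" using L' by (intro mult_right_mono) auto
      finally have "l1 n (f (p (Suc i))) (f a0) \<le> real (Suc i) * (L' * l1 n (f b) (f a0))"
        using l1_triangle[of n "f (p (Suc i))" "f a0" "f (p i)"] IH(3) by (simp add: distrib_right)
      then show ?case using 1 2 by blast
    qed
    note itN = iter[OF le_refl]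
    have "p N \<in> C" using itN bound(2,3)[OF le_refl] N by (auto simp: C_def)
    then have "\<eta> \<le> l1 n (f (p N)) (f a0)" by (rule \<eta>(2))
    also have "\<dots> \<le> real N * (L' * l1 n (f b) (f a0))" using itN by blast
    also have "\<dots> \<le> real N * (L' * (\<kappa> * s))" using less L' by (intro mult_left_mono) (auto simp: s_def)
    also have "\<dots> = (real N * s) * (L' * \<kappa>)" by simp
    also have "\<dots> \<le> 2 * e * (L' * \<kappa>)" using N L' \<kappa> by (intro mult_right_mono) auto
    also have "\<dots> = \<eta> / 2" using e L' by (simp add: \<kappa>_def)
    finally show False using \<eta>(1) by simp
  qed
  then show ?thesis using \<kappa> e(1) by blast
qed

text \<open>
  Write \<open>A\<close> for the derivative of \<open>f\<close> at \<open>a0\<close>.  The lower bound on \<open>f\<close> passes to \<open>A\<close>, which is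
  therefore injective.  \<open>A\<close> is surjective as well: \<open>f\<close> attains the values \<open>y0 + t e_k\<close>
  at points \<open>h (y0 + t e_k)\<close>, and the difference quotients of these points are bounded by the lower
  bound, so that a limit of them is mapped to \<open>e_k\<close>.  The columns of the inverse of \<open>A\<close> then form the
  derivative of \<open>h\<close>.
\<close>

lemma has_gradient_of_inverse:
  fixes f h :: "(nat \<Rightarrow> real) \<Rightarrow> nat \<Rightarrow> real"
  assumes a0: "a0 \<in> espace m" and y0: "y0 \<in> espace n" and fa0: "\<And>j. j < n \<Longrightarrow> f a0 j = y0 j"
    and grad: "\<And>j. j < n \<Longrightarrow> has_gradient m (\<lambda>a. f a j) (A j) a0"
    and \<kappa>: "\<kappa> > 0" and \<delta>: "\<delta> > 0"
    and lower: "\<And>b. b \<in> espace m \<Longrightarrow> l1 m b a0 < \<delta> \<Longrightarrow> \<kappa> * l1 m b a0 \<le> l1 n (f b) (f a0)"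
    and h: "\<And>e. e > 0 \<Longrightarrow> \<exists>\<delta>>0. \<forall>y\<in>espace n. l1 n y y0 < \<delta> \<longrightarrow>
        h y \<in> espace m \<and> l1 m (h y) a0 < e \<and> (\<forall>j<n. f (h y) j = y j)"
    and hy0: "\<And>i. i < m \<Longrightarrow> h y0 i = a0 i"
  shows "\<exists>D. \<forall>i<m. has_gradient n (\<lambda>y. h y i) (D i) y0"
proof -
  define Av where "Av v j = (\<Sum>i<m. A j i * v i)" for v j
  have Av_diff: "Av (\<lambda>i. v i - w i) j = Av v j - Av w j" for v w j
    by (simp add: Av_def right_diff_distrib sum_subtractf)
  have Av_scale: "Av (\<lambda>i. t * v i) j = t * Av v j" for t v j
    by (simp add: Av_def sum_distrib_left mult.left_commute)
  have total: "\<exists>d>0. \<forall>b\<in>espace m. l1 m b a0 < d \<longrightarrow>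
      (\<Sum>j<n. \<bar>f b j - y0 j - Av (\<lambda>i. b i - a0 i) j\<bar>) \<le> e * l1 m b a0" if e: "e > 0" for e
  proof -
    have "\<exists>d>0. \<forall>b\<in>espace m. l1 m b a0 < d \<longrightarrow>
       \<bar>f b j - y0 j - Av (\<lambda>i. b i - a0 i) j\<bar> \<le> e / (real n + 1) * l1 m b a0" if j: "j < n" for j
      using grad[OF j, unfolded has_gradient_def, rule_format, of "e / (real n + 1)"] e fa0[OF j]
      by (simp add: Av_def)
    then obtain d where d: "\<And>j. j < n \<Longrightarrow> d j > 0"
      "\<And>j b. j < n \<Longrightarrow> b \<in> espace m \<Longrightarrow> l1 m b a0 < d j \<Longrightarrow>
       \<bar>f b j - y0 j - Av (\<lambda>i. b i - a0 i) j\<bar> \<le> e / (real n + 1) * l1 m b a0" by metis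
    show ?thesis
    proof (intro exI conjI ballI impI)
      show "Min (insert 1 (d ` {..<n})) > 0" using d(1) by auto
      fix b assume b: "b \<in> espace m" "l1 m b a0 < Min (insert 1 (d ` {..<n}))"
      have "(\<Sum>j<n. \<bar>f b j - y0 j - Av (\<lambda>i. b i - a0 i) j\<bar>) \<le> (\<Sum>j<n. e / (real n + 1) * l1 m b a0)"
        by (intro sum_mono d(2)) (use b in auto)
      also have "\<dots> = (real n / (real n + 1)) * (e * l1 m b a0)" by simp
      also have "\<dots> \<le> 1 * (e * l1 m b a0)" using e by (intro mult_right_mono) auto
      finally show "(\<Sum>j<n. \<bar>f b j - y0 j - Av (\<lambda>i. b i - a0 i) j\<bar>) \<le> e * l1 m b a0" by simp
    qed
  qed
  \<comment> \<open>the lower bound for \<open>f\<close> near \<open>a0\<close>, applied to \<open>a0 + t v\<close> for small \<open>t\<close>\<close>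
  have lowerA: "\<kappa> * (\<Sum>i<m. \<bar>v i\<bar>) \<le> (\<Sum>j<n. \<bar>Av v j\<bar>)" if v: "v \<in> espace m" for v
  proof (rule field_le_epsilon)
    fix e :: real assume e: "e > 0"
    define V where "V = (\<Sum>i<m. \<bar>v i\<bar>)"
    have V: "V \<ge> 0" by (simp add: V_def sum_nonneg)
    obtain d where d: "d > 0" "\<And>b. b\<in>espace m \<Longrightarrow> l1 m b a0 < d \<Longrightarrow>
      (\<Sum>j<n. \<bar>f b j - y0 j - Av (\<lambda>i. b i - a0 i) j\<bar>) \<le> e / (V + 1) * l1 m b a0"
      using total[of "e / (V + 1)"] e V by auto
    define t where "t = min d \<delta> / 2 / (V + 1)"
    have t: "t > 0" using d(1) \<delta> V by (simp add: t_def)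
    have tV: "t * V < min d \<delta>"
    proof -
      have "t * V \<le> t * (V + 1)" using t by simp
      also have "\<dots> = min d \<delta> / 2" using V unfolding t_def by (intro nonzero_eq_divide_eq[THEN iffD1]) auto
      also have "\<dots> < min d \<delta>" using d(1) \<delta> by auto
      finally show ?thesis .
    qed
    define b where "b i = a0 i + t * v i" for i
    have b: "b \<in> espace m" using a0 v by (auto simp: b_def topspace_Euclidean_space)
    have lb: "l1 m b a0 = t * V" using t by (simp add: l1_def b_def V_def abs_mult sum_distrib_left)
    have Ab: "Av (\<lambda>i. b i - a0 i) j = t * Av v j" for j by (simp add: b_def Av_scale)
    have "\<kappa> * (t * V) \<le> l1 n (f b) (f a0)" using lower[OF b] lb tV by simp
    also have "\<dots> = (\<Sum>j<n. \<bar>f b j - y0 j\<bar>)" using fa0 by (simp add: l1_def)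
    also have "\<dots> \<le> (\<Sum>j<n. \<bar>f b j - y0 j - t * Av v j\<bar>) + (\<Sum>j<n. \<bar>t * Av v j\<bar>)"
      unfolding sum.distrib[symmetric] by (intro sum_mono) auto
    also have "(\<Sum>j<n. \<bar>t * Av v j\<bar>) = t * (\<Sum>j<n. \<bar>Av v j\<bar>)"
      using t by (simp add: abs_mult sum_distrib_left)
    also have "(\<Sum>j<n. \<bar>f b j - y0 j - t * Av v j\<bar>) \<le> e / (V + 1) * (t * V)"
      using d(2)[OF b] lb tV unfolding Ab by simp
    also have "\<dots> \<le> t * e"
    proof -
      have "e / (V + 1) * (t * V) = (t * e) * (V / (V + 1))" by simp
      also have "\<dots> \<le> (t * e) * 1" using t e V by (intro mult_left_mono) auto
      finally show ?thesis by simp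
    qed
    finally have "t * (\<kappa> * V) \<le> t * ((\<Sum>j<n. \<bar>Av v j\<bar>) + e)" by (simp add: algebra_simps)
    then show "\<kappa> * (\<Sum>i<m. \<bar>v i\<bar>) \<le> (\<Sum>j<n. \<bar>Av v j\<bar>) + e" using t by (simp add: V_def)
  qed
  have "\<exists>v\<in>espace m. \<forall>j<n. Av v j = (if j = k then 1 else 0)" if k: "k < n" for k
  proof -
    \<comment> \<open>Surjectivity: minimize the distance from \<open>A v\<close> to the unit vector over a compact set that contains all difference quotients of \<open>h\<close>.\<close>
    define K where "K = {v \<in> espace m. l1 m v (\<lambda>_. 0) \<le> 1 / \<kappa>}"
    define \<Phi> where "\<Phi> v = (\<Sum>j<n. \<bar>Av v j - (if j = k then 1 else 0)\<bar>)" for v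
    have "compact K" unfolding K_def by (rule compact_l1_cball)
    moreover have "(\<lambda>_. 0) \<in> K" using \<kappa> by (simp add: K_def topspace_Euclidean_space)
    moreover have "continuous_on K \<Phi>"
      unfolding \<Phi>_def Av_def
      by (intro continuous_intros) (auto intro: continuous_on_subset[OF continuous_on_product_coordinates])
    ultimately obtain v where v: "v \<in> K" "\<And>w. w \<in> K \<Longrightarrow> \<Phi> v \<le> \<Phi> w"
      using continuous_attains_inf[of K \<Phi>] by blast
    have "\<Phi> v \<le> 0"
    proof (rule field_le_epsilon)
      fix e :: real assume e: "e > 0"
      obtain d where d: "d > 0" "\<And>b. b\<in>espace m \<Longrightarrow> l1 m b a0 < d \<Longrightarrow>
        (\<Sum>j<n. \<bar>f b j - y0 j - Av (\<lambda>i. b i - a0 i) j\<bar>) \<le> e * \<kappa> * l1 m b a0"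
        using total[of "e * \<kappa>"] e \<kappa> by auto
      obtain d' where d': "d' > 0" "\<And>y. y\<in>espace n \<Longrightarrow> l1 n y y0 < d' \<Longrightarrow>
        h y \<in> espace m \<and> l1 m (h y) a0 < min d \<delta> \<and> (\<forall>j<n. f (h y) j = y j)"
        using h[of "min d \<delta>"] d(1) \<delta> by auto
      define t where "t = d' / 2"
      have t: "t > 0" "t < d'" using d' by (auto simp: t_def)
      define y where "y = y0(k := y0 k + t)"
      have y: "y \<in> espace n" unfolding y_def by (rule espace_upd[OF y0 k])
      have ly: "l1 n y y0 = t" unfolding y_def using t by (simp add: l1_upd[OF k])
      define b where "b = h y"
      have b: "b \<in> espace m" "l1 m b a0 < d" "l1 m b a0 < \<delta>" "\<And>j. j < n \<Longrightarrow> f b j = y j"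
        using d'(2)[OF y] ly t by (auto simp: b_def)
      have "\<kappa> * l1 m b a0 \<le> l1 n (f b) (f a0)" using lower b by blast
      also have "\<dots> = l1 n y y0" using b(4) fa0 by (simp add: l1_def)
      finally have lb: "\<kappa> * l1 m b a0 \<le> t" using ly by simp
      define w where "w i = (b i - a0 i) / t" for i
      have "l1 m w (\<lambda>_. 0) = l1 m b a0 / t" using t by (simp add: l1_def w_def sum_divide_distrib abs_divide)
      also have "\<dots> \<le> 1 / \<kappa>" using lb t \<kappa> by (simp add: field_simps)
      finally have "w \<in> K" using b(1) a0 by (auto simp: K_def w_def topspace_Euclidean_space)
      then have "\<Phi> v \<le> \<Phi> w" by (rule v(2))
      also have "\<Phi> w = (\<Sum>j<n. \<bar>f b j - y0 j - Av (\<lambda>i. b i - a0 i) j\<bar>) / t"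
        unfolding \<Phi>_def sum_divide_distrib
      proof (rule sum.cong[OF refl])
        fix j assume "j \<in> {..<n}"
        then have "f b j - y0 j = (if j = k then t else 0)" using b(4)[of j] by (simp add: y_def)
        moreover have "Av w j = Av (\<lambda>i. b i - a0 i) j / t"
          using Av_scale[of "1 / t" "\<lambda>i. b i - a0 i" j] by (simp add: w_def[abs_def])
        ultimately have "f b j - y0 j - Av (\<lambda>i. b i - a0 i) j = - (t * (Av w j - (if j = k then 1 else 0)))"
          using t by (simp add: right_diff_distrib)
        then show "\<bar>Av w j - (if j = k then 1 else 0)\<bar> = \<bar>f b j - y0 j - Av (\<lambda>i. b i - a0 i) j\<bar> / t"
          using t by (simp only: abs_minus_cancel abs_mult) simp
      qed
      also have "\<dots> \<le> e * (\<kappa> * l1 m b a0) / t"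
        using d(2)[OF b(1,2)] t by (simp add: divide_right_mono mult.assoc)
      also have "\<dots> \<le> e * t / t" using lb e t by (intro divide_right_mono mult_left_mono) auto
      finally show "\<Phi> v \<le> 0 + e" using t by simp
    qed
    then have "\<Phi> v = 0" by (simp add: \<Phi>_def order_antisym sum_nonneg)
    then have "\<forall>j<n. Av v j = (if j = k then 1 else 0)"
      unfolding \<Phi>_def by (subst (asm) sum_nonneg_eq_0_iff) auto
    moreover have "v \<in> espace m" using v(1) by (simp add: K_def)
    ultimately show ?thesis by blast
  qed
  then obtain V where V: "\<And>k. k < n \<Longrightarrow> V k \<in> espace m"
    "\<And>k j. k < n \<Longrightarrow> j < n \<Longrightarrow> Av (V k) j = (if j = k then 1 else 0)" by metis
  have "has_gradient n (\<lambda>y. h y i) (\<lambda>k. V k i) y0" if i: "i < m" for i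
    unfolding has_gradient_def
  proof (intro allI impI)
    fix e :: real assume e: "e > 0"
    obtain d where d: "d > 0" "\<And>b. b\<in>espace m \<Longrightarrow> l1 m b a0 < d \<Longrightarrow>
      (\<Sum>j<n. \<bar>f b j - y0 j - Av (\<lambda>i. b i - a0 i) j\<bar>) \<le> e * \<kappa> * \<kappa> * l1 m b a0"
      using total[of "e * \<kappa> * \<kappa>"] e \<kappa> by auto
    obtain d' where d': "d' > 0" "\<And>y. y\<in>espace n \<Longrightarrow> l1 n y y0 < d' \<Longrightarrow>
      h y \<in> espace m \<and> l1 m (h y) a0 < min d \<delta> \<and> (\<forall>j<n. f (h y) j = y j)"
      using h[of "min d \<delta>"] d(1) \<delta> by auto
    have "\<bar>h y i - h y0 i - (\<Sum>k<n. V k i * (y k - y0 k))\<bar> \<le> e * l1 n y y0"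
      if y: "y \<in> espace n" "l1 n y y0 < d'" for y
    proof -
      define b where "b = h y"
      have b: "b \<in> espace m" "l1 m b a0 < d" "l1 m b a0 < \<delta>" "\<And>j. j < n \<Longrightarrow> f b j = y j"
        using d'(2)[OF y] by (auto simp: b_def)
      have "\<kappa> * l1 m b a0 \<le> l1 n (f b) (f a0)" using lower b by blast
      also have "\<dots> = l1 n y y0" using b(4) fa0 by (simp add: l1_def)
      finally have lb: "\<kappa> * l1 m b a0 \<le> l1 n y y0" .
      define u where "u i = (\<Sum>k<n. V k i * (y k - y0 k))" for i
      have u: "u \<in> espace m" using V(1) by (auto simp: u_def topspace_Euclidean_space)
      have Au: "Av u j = y j - y0 j" if j: "j < n" for j
      proof -
        have "Av u j = (\<Sum>k<n. (\<Sum>i<m. A j i * V k i) * (y k - y0 k))"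
          unfolding Av_def u_def sum_distrib_left sum_distrib_right
          by (subst sum.swap) (simp add: mult.assoc)
        also have "\<dots> = (\<Sum>k<n. if k = j then y k - y0 k else 0)"
          using V(2) j by (intro sum.cong) (auto simp: Av_def)
        finally show ?thesis using j by simp
      qed
      define w where "w i = b i - a0 i - u i" for i
      have w: "w \<in> espace m" using b(1) a0 u by (auto simp: w_def topspace_Euclidean_space)
      have "\<kappa> * \<bar>w i\<bar> \<le> \<kappa> * (\<Sum>i<m. \<bar>w i\<bar>)"
        using \<kappa> i by (intro mult_left_mono member_le_sum) auto
      also have "\<dots> \<le> (\<Sum>j<n. \<bar>Av w j\<bar>)" by (rule lowerA[OF w])
      also have "\<dots> = (\<Sum>j<n. \<bar>f b j - y0 j - Av (\<lambda>i. b i - a0 i) j\<bar>)"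
      proof (rule sum.cong[OF refl])
        fix j assume "j \<in> {..<n}"
        then show "\<bar>Av w j\<bar> = \<bar>f b j - y0 j - Av (\<lambda>i. b i - a0 i) j\<bar>"
          using Av_diff[of "\<lambda>i. b i - a0 i" u j] Au[of j] b(4)[of j] by (simp add: w_def[abs_def] abs_minus_commute)
      qed
      also have "\<dots> \<le> e * \<kappa> * \<kappa> * l1 m b a0" using d(2) b by blast
      also have "\<dots> \<le> e * \<kappa> * l1 n y y0"
        using mult_left_mono[OF lb, of "e * \<kappa>"] e \<kappa> by (simp add: mult.assoc)
      finally have "\<kappa> * \<bar>w i\<bar> \<le> \<kappa> * (e * l1 n y y0)" by (simp add: mult_ac)
      then have "\<bar>w i\<bar> \<le> e * l1 n y y0" using \<kappa> by simp
      then show ?thesis using hy0[OF i] by (simp add: w_def u_def b_def)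
    qed
    then show "\<exists>\<delta>>0. \<forall>z\<in>espace n. l1 n z y0 < \<delta> \<longrightarrow>
        \<bar>h z i - h y0 i - (\<Sum>j<n. V j i * (z j - y0 j))\<bar> \<le> e * l1 n z y0" using d'(1) by blast
  qed
  then show ?thesis by (intro exI[of _ "\<lambda>i k. V k i"]) auto
qed

text \<open>
  The hypothesis \<open>der\<close> is a differential equation: it expresses the derivatives of \<open>h\<close> smoothly by
  \<open>h\<close> and the point.  So each class of differentiability of \<open>h\<close> gives the next one.
\<close>

lemma Ck_bootstrap:
  fixes h \<iota> :: "(nat \<Rightarrow> real) \<Rightarrow> nat \<Rightarrow> real"
  assumes T: "openin (Euclidean_space n) T" and W: "openin (Euclidean_space m) W"
    and O1: "openin (Euclidean_space (m + m)) \<Omega>1" and O2: "openin (Euclidean_space (m + n)) \<Omega>2"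
    and h: "\<And>y. y \<in> T \<Longrightarrow> h y \<in> W" "\<And>y. y \<in> T \<Longrightarrow> juxt m (h y) a0 \<in> \<Omega>1"
      "\<And>y. y \<in> T \<Longrightarrow> juxt m (\<iota> (h y)) y \<in> \<Omega>2"
    and \<iota>: "smooth_euclidean m m W \<iota>"
    and P: "\<And>j p k. j < m \<Longrightarrow> p < m \<Longrightarrow> Ck (m + m) k \<Omega>1 (P j p)"
    and Q: "\<And>i l k. i < n \<Longrightarrow> l < n \<Longrightarrow> Ck (m + n) k \<Omega>2 (Q i l)"
    and cont: "\<And>j. j < m \<Longrightarrow> continuous_on T (\<lambda>y. h y j)"
    and der: "\<And>y i j. y \<in> T \<Longrightarrow> i < n \<Longrightarrow> j < m \<Longrightarrow>
      ((\<lambda>t. h (y(i := t)) j) has_field_derivative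
        (\<Sum>p<m. P j p (juxt m (h y) a0) * (\<Sum>l<n. D p l * Q i l (juxt m (\<iota> (h y)) y)))) (at (y i))"
  shows "smooth_euclidean n m T h"
proof -
  have "\<forall>j<m. Ck n k T (\<lambda>y. h y j)" for k
  proof (induction k)
    case (Suc k)
    then have hk: "Ck n k T (\<lambda>y. h y j)" if "j < m" for j using that by blast
    have P': "Ck n k T (\<lambda>y. P j p (juxt m (h y) a0))" if "j < m" "p < m" for j p
    proof (rule Ck_compose[OF T O1 h(2) _ P[OF that]])
      fix i assume "i < m + m"
      then show "Ck n k T (\<lambda>y. juxt m (h y) a0 i)"
        using hk by (cases "i < m") (auto simp: juxt_def Ck_const)
    qed
    have \<iota>': "Ck n k T (\<lambda>y. \<iota> (h y) j)" if "j < m" for j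
      by (rule Ck_compose[OF T W h(1) hk, where f = "\<lambda>a. \<iota> a j"]) (use \<iota> that in \<open>auto simp: smooth_euclidean_def\<close>)
    have Q': "Ck n k T (\<lambda>y. Q i l (juxt m (\<iota> (h y)) y))" if "i < n" "l < n" for i l
    proof (rule Ck_compose[OF T O2 h(3) _ Q[OF that]])
      fix i assume "i < m + n"
      then show "Ck n k T (\<lambda>y. juxt m (\<iota> (h y)) y i)"
        using \<iota>' by (cases "i < m") (auto simp: juxt_def Ck_coordinate)
    qed
    show ?case
    proof (intro allI impI)
      fix j assume j: "j < m"
      have "Ck n k T (partial i (\<lambda>y. h y j))" if i: "i < n" for i
      proof (rule Ck_cong[OF T])
        show "Ck n k T (\<lambda>y. \<Sum>p<m. P j p (juxt m (h y) a0) * (\<Sum>l<n. D p l * Q i l (juxt m (\<iota> (h y)) y)))"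
          by (intro Ck_sum[OF T] Ck_mult[OF T] P' Q' Ck_const) (use i j in auto)
        show "(\<Sum>p<m. P j p (juxt m (h y) a0) * (\<Sum>l<n. D p l * Q i l (juxt m (\<iota> (h y)) y))) = partial i (\<lambda>y. h y j) y"
          if "y \<in> T" for y
          unfolding partial_def by (rule DERIV_imp_deriv[OF der[OF that i j], symmetric])
      qed
      then show "Ck n (Suc k) T (\<lambda>y. h y j)"
        using cont[OF j] der[OF _ _ j] by (auto simp: field_differentiable_def)
    qed
  qed (use cont in simp)
  then show ?thesis by (auto simp: smooth_euclidean_def)
qed

section \<open>Free open orbits: the orbit map is open\<close>

text \<open>
  A closed ball in a chart, shrunk into the given open set.
\<close>

lemma smooth_manifold_compact_neighbourhood:
  assumes M: "smooth_manifold M" and N: "openin (mtop M) N" "p \<in> N"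
  shows "\<exists>U K. openin (mtop M) U \<and> compactin (mtop M) K \<and> p \<in> U \<and> U \<subseteq> K \<and> K \<subseteq> N"
proof -
  note M' = smooth_manifold_charted[OF M]
  obtain V c where V: "(V, c) \<in> atlas M" "p \<in> V" using chart_at[OF M] openin_subset[OF N(1)] N(2) by blast
  note ch = chartedD[OF M' V(1)]
  have inj: "inj_on c V" by (rule is_chart_inj[OF ch])
  have "openin (Euclidean_space (mdim M)) (c ` (V \<inter> N))" by (rule is_chart_image_open[OF ch N(1)])
  moreover have "c p \<in> c ` (V \<inter> N)" using V N by auto
  ultimately obtain \<delta> where d: "\<delta> > 0" "\<And>z. z \<in> espace (mdim M) \<Longrightarrow> l1 (mdim M) z (c p) < \<delta> \<Longrightarrow> z \<in> c ` (V \<inter> N)"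
    unfolding openin_Euclidean_space_l1 by meson
  define K0 where "K0 = {z \<in> espace (mdim M). l1 (mdim M) z (c p) \<le> \<delta> / 2}"
  have K0: "K0 \<subseteq> c ` (V \<inter> N)" using d by (auto simp: K0_def)
  have "compact K0" unfolding K0_def by (rule compact_l1_cball)
  then have "compactin (powertop_real UNIV) K0" by (simp add: euclidean_product_topology)
  then have "compactin (subtopology (Euclidean_space (mdim M)) (c ` V)) K0"
    using K0 by (auto simp: Euclidean_space_def compactin_subtopology K0_def topspace_Euclidean_space)
  then have K: "compactin (mtop M) (inv_into V c ` K0)"
    by (rule image_compactin[OF _ is_chart_inv_continuous[OF ch]])
  define U where "U = {q \<in> V. c q \<in> {z \<in> espace (mdim M). l1 (mdim M) z (c p) < \<delta> / 2}}"
  have U: "openin (mtop M) U" unfolding U_def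
    by (rule openin_preimage_open_domain[OF is_chart_continuous[OF ch] chart_openin[OF M' V(1)] openin_Euclidean_space_ball])
  have "p \<in> U" using V d is_chart_image_subset[OF ch] by (auto simp: U_def)
  moreover have "U \<subseteq> inv_into V c ` K0"
  proof
    fix q assume "q \<in> U"
    then have "q = inv_into V c (c q)" "c q \<in> K0" using inj by (auto simp: U_def K0_def inv_into_f_f)
    then show "q \<in> inv_into V c ` K0" by blast
  qed
  moreover have "inv_into V c ` K0 \<subseteq> N" using K0 inj by (auto simp: inv_into_f_f subset_iff)
  ultimately show ?thesis using U K by blast
qed

lemma smooth_manifold_locally_compact: "smooth_manifold M \<Longrightarrow> locally_compact_space (mtop M)"
  unfolding locally_compact_space_def using smooth_manifold_compact_neighbourhood[OF _ openin_topspace] by metis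

lemma uniform_delta:
  fixes Q :: "nat \<Rightarrow> real \<Rightarrow> bool"
  assumes "\<And>j. j < n \<Longrightarrow> \<exists>\<delta>>0. Q j \<delta>" "\<And>j \<delta> \<delta>'. Q j \<delta> \<Longrightarrow> 0 < \<delta>' \<Longrightarrow> \<delta>' \<le> \<delta> \<Longrightarrow> Q j \<delta>'"
  shows "\<exists>\<delta>>0. \<forall>j<n. Q j \<delta>"
  using assms(1)
proof (induction n)
  case (Suc n)
  then obtain \<delta> where \<delta>: "\<delta> > 0" "\<forall>j<n. Q j \<delta>" by auto
  obtain \<delta>' where \<delta>': "\<delta>' > 0" "Q n \<delta>'" using Suc.prems by auto
  have "min \<delta> \<delta>' > 0" "\<forall>j<Suc n. Q j (min \<delta> \<delta>')"
    using \<delta> \<delta>' assms(2)[of _ _ "min \<delta> \<delta>'"] by (auto simp: less_Suc_eq)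
  then show ?case by blast
qed (auto intro: exI[of _ 1])

lemma smooth_euclidean_lipschitz:
  assumes S: "openin (Euclidean_space m) S" and f: "smooth_euclidean m n S f" and y: "y \<in> S"
  shows "\<exists>L. \<exists>\<delta>>0. \<forall>y1\<in>espace m. \<forall>y2\<in>espace m. l1 m y1 y < \<delta> \<longrightarrow> l1 m y2 y < \<delta> \<longrightarrow>
     l1 n (f y1) (f y2) \<le> L * l1 m y1 y2"
proof -
  define K where "K j = (\<Sum>i<m. \<bar>partial i (\<lambda>z. f z j) y\<bar>)" for j
  have "\<exists>\<delta>>0. \<forall>j<n. \<forall>y1\<in>espace m. \<forall>y2\<in>espace m. l1 m y1 y < \<delta> \<longrightarrow> l1 m y2 y < \<delta> \<longrightarrow>
     \<bar>f y1 j - f y2 j - (\<Sum>i<m. partial i (\<lambda>z. f z j) y * (y1 i - y2 i))\<bar> \<le> 1 * l1 m y1 y2"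
  proof (rule uniform_delta)
    fix j assume "j < n"
    then show "\<exists>\<delta>>0. \<forall>y1\<in>espace m. \<forall>y2\<in>espace m. l1 m y1 y < \<delta> \<longrightarrow> l1 m y2 y < \<delta> \<longrightarrow>
     \<bar>f y1 j - f y2 j - (\<Sum>i<m. partial i (\<lambda>z. f z j) y * (y1 i - y2 i))\<bar> \<le> 1 * l1 m y1 y2"
      using f by (intro strict_differentiability[OF S _ y]) (auto simp: smooth_euclidean_def simp del: Ck.simps)
  qed fastforce
  then obtain \<delta> where d: "\<delta> > 0" "\<And>j y1 y2. j < n \<Longrightarrow> y1\<in>espace m \<Longrightarrow> y2\<in>espace m \<Longrightarrow> l1 m y1 y < \<delta> \<Longrightarrow> l1 m y2 y < \<delta> \<Longrightarrow>
     \<bar>f y1 j - f y2 j - (\<Sum>i<m. partial i (\<lambda>z. f z j) y * (y1 i - y2 i))\<bar> \<le> l1 m y1 y2" by auto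
  have "l1 n (f y1) (f y2) \<le> (\<Sum>j<n. K j + 1) * l1 m y1 y2"
    if y12: "y1\<in>espace m" "y2\<in>espace m" "l1 m y1 y < \<delta>" "l1 m y2 y < \<delta>" for y1 y2
    unfolding l1_def[of n] sum_distrib_right
  proof (rule sum_mono)
    fix j assume "j \<in> {..<n}"
    then have j: "j < n" by simp
    have "\<bar>\<Sum>i<m. partial i (\<lambda>z. f z j) y * (y1 i - y2 i)\<bar> \<le> (\<Sum>i<m. \<bar>partial i (\<lambda>z. f z j) y\<bar> * l1 m y1 y2)"
      by (rule order_trans[OF sum_abs]) (auto intro!: sum_mono mult_left_mono component_le_l1 simp: abs_mult)
    then have "\<bar>\<Sum>i<m. partial i (\<lambda>z. f z j) y * (y1 i - y2 i)\<bar> \<le> K j * l1 m y1 y2"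
      by (simp add: K_def sum_distrib_right)
    then show "\<bar>f y1 j - f y2 j\<bar> \<le> (K j + 1) * l1 m y1 y2"
      using d(2)[OF j y12] by (simp add: distrib_right)
  qed
  then show ?thesis using d(1) by blast
qed

lemma has_gradient_juxt_left:
  assumes "has_gradient (m + n) F L (juxt m a0 y0)" "y0 \<in> espace n"
  shows "has_gradient m (\<lambda>a. F (juxt m a y0)) L a0"
  unfolding has_gradient_def
proof (intro allI impI)
  fix e :: real assume "e > 0"
  then obtain \<delta> where d: "\<delta> > 0" "\<And>z. z\<in>espace (m + n) \<Longrightarrow> l1 (m + n) z (juxt m a0 y0) < \<delta> \<Longrightarrow>
     \<bar>F z - F (juxt m a0 y0) - (\<Sum>j<m + n. L j * (z j - juxt m a0 y0 j))\<bar> \<le> e * l1 (m + n) z (juxt m a0 y0)"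
    using assms(1)[unfolded has_gradient_def, rule_format, OF \<open>e > 0\<close>] by blast
  show "\<exists>\<delta>>0. \<forall>z\<in>espace m. l1 m z a0 < \<delta> \<longrightarrow>
     \<bar>F (juxt m z y0) - F (juxt m a0 y0) - (\<Sum>j<m. L j * (z j - a0 j))\<bar> \<le> e * l1 m z a0"
    using d(2)[OF juxt_espace[OF assms(2)]] d(1)
    by (intro exI[of _ \<delta>]) (auto simp: l1_juxt sum_block_split)
qed

text \<open>
  A smooth map of two arguments in charts, as a function of concatenated coordinates.  Its domain
  is described pointwise, since the composites formed later must be seen to stay inside it.
\<close>

lemma local_representative:
  assumes M: "charted M" and N: "charted N" and P: "charted P"
    and f: "smooth_map (prod_mfd M N) P (\<lambda>(p, q). f p q)"
    and U: "(U, c) \<in> atlas M" and V: "(V, d) \<in> atlas N" and W: "(W, e) \<in> atlas P"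
  obtains \<Omega> R where "openin (Euclidean_space (mdim M + mdim N)) \<Omega>"
    "smooth_euclidean (mdim M + mdim N) (mdim P) \<Omega> R"
    "\<And>a y. a \<in> espace (mdim M) \<Longrightarrow> y \<in> espace (mdim N) \<Longrightarrow> juxt (mdim M) a y \<in> \<Omega> \<longleftrightarrow>
       a \<in> c ` U \<and> y \<in> d ` V \<and> f (inv_into U c a) (inv_into V d y) \<in> W"
    "\<And>a y. a \<in> c ` U \<Longrightarrow> y \<in> d ` V \<Longrightarrow> R (juxt (mdim M) a y) = e (f (inv_into U c a) (inv_into V d y))"
proof -
  let ?m = "mdim M" and ?pc = "pair_chart (mdim M) c d"
  let ?F = "\<lambda>(p, q). f p q"
  define \<Omega> where "\<Omega> = ?pc ` ((U \<times> V) \<inter> pts (prod_mfd M N) \<inter> ?F -` W)"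
  define R where "R = e \<circ> ?F \<circ> inv_into (U \<times> V) ?pc"
  have UV: "(U \<times> V, ?pc) \<in> atlas (prod_mfd M N)" using U V by (auto simp: atlas_prod_mfd)
  note ci = chart_inj[OF M U] and di = chart_inj[OF N V] and pi = chart_inj[OF charted_prod[OF M N] UV]
  have sub: "U \<subseteq> pts M" "V \<subseteq> pts N"
    using openin_subset[OF chart_openin[OF M U]] openin_subset[OF chart_openin[OF N V]] by auto
  have pc: "?pc (p, q) = juxt ?m (c p) (d q)" for p q by (simp add: pair_chart_def juxt_def)
  have "openin (Euclidean_space (mdim (prod_mfd M N))) \<Omega>" unfolding \<Omega>_def
    by (rule smooth_map_on_chart_open[OF charted_prod[OF M N] UV chart_openin[OF P W] openin_topspace
          smooth_map_on_continuous[OF f]])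
  then have 1: "openin (Euclidean_space (mdim M + mdim N)) \<Omega>" by simp
  have 2: "smooth_euclidean (mdim M + mdim N) (mdim P) \<Omega> R"
    using smooth_map_onD[OF f UV W] by (simp add: \<Omega>_def R_def)
  have 3: "juxt ?m a y \<in> \<Omega> \<longleftrightarrow> a \<in> c ` U \<and> y \<in> d ` V \<and> f (inv_into U c a) (inv_into V d y) \<in> W"
    if ay: "a \<in> espace (mdim M)" "y \<in> espace (mdim N)" for a y
  proof
    assume "juxt ?m a y \<in> \<Omega>"
    then obtain p q where pq: "p \<in> U" "q \<in> V" "f p q \<in> W" "juxt ?m a y = juxt ?m (c p) (d q)"
      by (auto simp: \<Omega>_def pc)
    have "a = c p"
    proof (rule espace_eqI[OF ay(1) is_chart_image_subset[OF chartedD[OF M U] pq(1)]])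
      show "a i = c p i" if "i < ?m" for i using fun_cong[OF pq(4), of i] that by simp
    qed
    moreover have "y = d q"
    proof (rule espace_eqI[OF ay(2) is_chart_image_subset[OF chartedD[OF N V] pq(2)]])
      show "y i = d q i" if "i < mdim N" for i using fun_cong[OF pq(4), of "?m + i"] by simp
    qed
    ultimately show "a \<in> c ` U \<and> y \<in> d ` V \<and> f (inv_into U c a) (inv_into V d y) \<in> W"
      using pq ci di by (simp add: inv_into_f_f)
  next
    assume *: "a \<in> c ` U \<and> y \<in> d ` V \<and> f (inv_into U c a) (inv_into V d y) \<in> W"
    then have "juxt ?m a y = ?pc (inv_into U c a, inv_into V d y)" by (simp add: pc f_inv_into_f)
    moreover have "inv_into U c a \<in> U" "inv_into V d y \<in> V" using * by (auto intro: inv_into_into)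
    ultimately show "juxt ?m a y \<in> \<Omega>" using * sub unfolding \<Omega>_def by auto
  qed
  have 4: "R (juxt ?m a y) = e (f (inv_into U c a) (inv_into V d y))"
    if *: "a \<in> c ` U" "y \<in> d ` V" for a y
  proof -
    have "juxt ?m a y = ?pc (inv_into U c a, inv_into V d y)" using * by (simp add: pc f_inv_into_f)
    moreover have "(inv_into U c a, inv_into V d y) \<in> U \<times> V" using * by (auto intro: inv_into_into)
    ultimately have "inv_into (U \<times> V) ?pc (juxt ?m a y) = (inv_into U c a, inv_into V d y)"
      using inv_into_f_f[OF pi] by metis
    then show ?thesis by (simp add: R_def)
  qed
  show thesis using that 1 2 3 4 by blast
qed

lemma G_manifold_facts:
  assumes "G_manifold G E \<phi>"
  shows "group (grp G)" "smooth_manifold (gmfd G)" "smooth_manifold E" "pts (gmfd G) = carrier (grp G)"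
    "smooth_map (prod_mfd (gmfd G) (gmfd G)) (gmfd G) (\<lambda>(g, h). g \<otimes>\<^bsub>grp G\<^esub> h)"
    "smooth_map (gmfd G) (gmfd G) (\<lambda>g. inv\<^bsub>grp G\<^esub> g)"
    "smooth_map (prod_mfd (gmfd G) E) E (\<lambda>(g, x). \<phi> g x)"
    "group_action (grp G) (pts E) \<phi>"
  using assms by (auto simp: G_manifold_def lie_group_def)

lemma group_action_facts:
  assumes "group_action G E \<phi>"
  shows "\<And>g y. g \<in> carrier G \<Longrightarrow> y \<in> E \<Longrightarrow> \<phi> g y \<in> E"
    "\<And>y. y \<in> E \<Longrightarrow> \<phi> \<one>\<^bsub>G\<^esub> y = y"
    "\<And>g h y. g \<in> carrier G \<Longrightarrow> h \<in> carrier G \<Longrightarrow> y \<in> E \<Longrightarrow> \<phi> (g \<otimes>\<^bsub>G\<^esub> h) y = \<phi> g (\<phi> h y)"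
proof -
  show "\<phi> g y \<in> E" if "g \<in> carrier G" "y \<in> E" for g y
    using group_action.element_image[OF assms that] by blast
  show "\<phi> \<one>\<^bsub>G\<^esub> y = y" if "y \<in> E" for y
    using fun_cong[OF group_action.id_eq_one[OF assms], of y] that by simp
  show "\<phi> (g \<otimes>\<^bsub>G\<^esub> h) y = \<phi> g (\<phi> h y)" if "g \<in> carrier G" "h \<in> carrier G" "y \<in> E" for g h y
    by (rule group_action.composition_rule[OF assms that(3,1,2)])
qed

text \<open>
  A point with trivial stabilizer whose orbit is open.  Every point of a semi-torsor is of this kind.
\<close>

locale free_open_orbit =
  fixes G :: "'g lie_group" and E :: "'a mfd" and \<phi> :: "'g \<Rightarrow> 'a \<Rightarrow> 'a" and x :: 'a
  assumes G_manifold: "G_manifold G E \<phi>" and x: "x \<in> pts E"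
    and free: "\<And>g. g \<in> carrier (grp G) \<Longrightarrow> \<phi> g x = x \<Longrightarrow> g = \<one>\<^bsub>grp G\<^esub>"
    and open_orbit: "openin (mtop E) (orbit (grp G) \<phi> x)"
begin

sublocale grp: group "grp G" using G_manifold_facts(1)[OF G_manifold] .

abbreviation C where "C \<equiv> carrier (grp G)"
abbreviation mult_G (infixl "\<odot>" 70) where "g \<odot> h \<equiv> g \<otimes>\<^bsub>grp G\<^esub> h"
abbreviation inv_G where "inv_G g \<equiv> inv\<^bsub>grp G\<^esub> g"
abbreviation one_G ("\<e>") where "\<e> \<equiv> \<one>\<^bsub>grp G\<^esub>"
abbreviation Orb where "Orb \<equiv> orbit (grp G) \<phi> x"

lemmas mfd = G_manifold_facts[OF G_manifold]
lemmas chd = smooth_manifold_charted[OF mfd(2)] smooth_manifold_charted[OF mfd(3)]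
lemmas action = group_action_facts[OF mfd(8)]

lemma action_inv: "g \<in> C \<Longrightarrow> y \<in> pts E \<Longrightarrow> \<phi> (inv_G g) (\<phi> g y) = y"
  "g \<in> C \<Longrightarrow> y \<in> pts E \<Longrightarrow> \<phi> g (\<phi> (inv_G g) y) = y"
  using action(2,3) by (metis grp.inv_closed grp.l_inv, metis grp.inv_closed grp.r_inv)

lemma free_action: "g \<in> C \<Longrightarrow> h \<in> C \<Longrightarrow> \<phi> g x = \<phi> h x \<Longrightarrow> g = h"
proof -
  assume gh: "g \<in> C" "h \<in> C" "\<phi> g x = \<phi> h x"
  then have "\<phi> (inv_G h \<odot> g) x = x" using action x action_inv(1) by simp
  then have "inv_G h \<odot> g = \<e>" using free gh by simp
  then show "g = h" using gh grp.inv_equality grp.inv_inv grp.inv_closed by metis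
qed

lemma O_iff: "y \<in> Orb \<longleftrightarrow> (\<exists>g\<in>C. y = \<phi> g x)"
  by (auto simp: orbit_def)

lemma O_subset: "Orb \<subseteq> pts E" using openin_subset[OF open_orbit] .

text \<open>
  The inverse of the orbit map, sending \<open>g x\<close> to \<open>g\<close>; outside of the orbit its values have no meaning.
\<close>

definition \<tau> where "\<tau> = inv_into C (\<lambda>g. \<phi> g x)"

lemma \<tau>_act: "g \<in> C \<Longrightarrow> \<tau> (\<phi> g x) = g"
  unfolding \<tau>_def using free_action by (intro inv_into_f_f inj_onI) auto

lemma \<tau>: "y \<in> Orb \<Longrightarrow> \<tau> y \<in> C" "y \<in> Orb \<Longrightarrow> \<phi> (\<tau> y) x = y"
  using \<tau>_act by (auto simp: O_iff)

lemma act_O: "g \<in> C \<Longrightarrow> y \<in> Orb \<Longrightarrow> \<phi> g y \<in> Orb"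
  unfolding O_iff using action(3) x grp.m_closed by metis

lemma \<tau>_equivariant: "g \<in> C \<Longrightarrow> y \<in> Orb \<Longrightarrow> \<tau> (\<phi> g y) = g \<odot> \<tau> y"
  using \<tau>_act[of "g \<odot> \<tau> y"] \<tau>[of y] action(3)[of g "\<tau> y" x] x by simp

lemma smooth_act_left: "g \<in> C \<Longrightarrow> smooth_map E E (\<phi> g)"
  using smooth_map_on_compose[OF chd(2) smooth_manifold_prod[OF mfd(2,3)] chd(2)
      smooth_map_on_Pair[OF smooth_map_on_const[OF openin_topspace, of g "gmfd G"] smooth_map_on_id[OF mfd(3) openin_topspace]]
      mfd(7)] mfd(4) by simp

lemma smooth_act_right: "y \<in> pts E \<Longrightarrow> smooth_map (gmfd G) E (\<lambda>g. \<phi> g y)"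
  using smooth_map_on_compose[OF chd(1) smooth_manifold_prod[OF mfd(2,3)] chd(2)
      smooth_map_on_Pair[OF smooth_map_on_id[OF mfd(2) openin_topspace] smooth_map_on_const[OF openin_topspace, of y E]]
      mfd(7)] by simp

lemma smooth_mult_left: "g \<in> C \<Longrightarrow> smooth_map (gmfd G) (gmfd G) (\<lambda>h. g \<odot> h)"
  using smooth_map_on_compose[OF chd(1) smooth_manifold_prod[OF mfd(2,2)] chd(1)
      smooth_map_on_Pair[OF smooth_map_on_const[OF openin_topspace, of g "gmfd G"] smooth_map_on_id[OF mfd(2) openin_topspace]]
      mfd(5)] mfd(4) by simp

lemma open_left_translate: "g \<in> C \<Longrightarrow> openin (mtop (gmfd G)) W \<Longrightarrow> openin (mtop (gmfd G)) {h \<in> C. g \<odot> h \<in> W}"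
  using smooth_map_on_preimage[OF smooth_mult_left, of g W] by (simp add: mfd(4))

lemma open_act_translate: "g \<in> C \<Longrightarrow> openin (mtop E) W \<Longrightarrow> openin (mtop E) {y \<in> pts E. \<phi> g y \<in> W}"
  using smooth_map_on_preimage[OF smooth_act_left, of g W] by simp

text \<open>
  Choose a compact neighbourhood \<open>K\<close> of the unit with \<open>k\<inverse> k' \<in> W\<close> for \<open>k, k' \<in> K\<close>.  Countably many left
  translates of \<open>K\<close> cover \<open>G\<close>, so countably many compact sets \<open>g K x\<close> cover the orbit.  As the orbit is
  open in a manifold, it is a Baire space, and some \<open>g K x\<close> contains an interior point \<open>g k x\<close>.
  Moving that point back to \<open>x\<close> yields a neighbourhood of \<open>x\<close> inside \<open>k\<inverse> K x \<subseteq> W x\<close>.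
\<close>

lemma orbit_map_open_at_unit:
  assumes W: "openin (mtop (gmfd G)) W" "\<e> \<in> W"
  shows "\<exists>V. openin (mtop E) V \<and> x \<in> V \<and> V \<subseteq> (\<lambda>g. \<phi> g x) ` W"
proof -
  let ?T = "prod_topology (mtop (gmfd G)) (mtop (gmfd G))"
  have "smooth_map (prod_mfd (gmfd G) (gmfd G)) (gmfd G) (\<lambda>p. inv_G (fst p) \<odot> snd p)"
  proof -
    have "smooth_map (prod_mfd (gmfd G) (gmfd G)) (gmfd G) (\<lambda>p. inv_G (fst p))"
      using smooth_map_on_compose[OF charted_prod[OF chd(1,1)] mfd(2) chd(1) smooth_map_fst[OF mfd(2) chd(1)] mfd(6)] by auto
    from smooth_map_on_compose[OF charted_prod[OF chd(1,1)] smooth_manifold_prod[OF mfd(2,2)] chd(1)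
      smooth_map_on_Pair[OF this smooth_map_snd[OF mfd(2) chd(1)]] mfd(5)]
    show ?thesis by (auto simp: mfd(4))
  qed
  from smooth_map_on_preimage[OF this W(1)]
  have "openin ?T {p \<in> C \<times> C. inv_G (fst p) \<odot> snd p \<in> W}" by (simp add: mfd(4))
  moreover have "(\<e>, \<e>) \<in> {p \<in> C \<times> C. inv_G (fst p) \<odot> snd p \<in> W}" using W(2) by simp
  ultimately obtain U1 U2 where U12: "openin (mtop (gmfd G)) U1" "openin (mtop (gmfd G)) U2" "\<e> \<in> U1" "\<e> \<in> U2"
    "U1 \<times> U2 \<subseteq> {p \<in> C \<times> C. inv_G (fst p) \<odot> snd p \<in> W}"
    unfolding openin_prod_topology_alt by meson
  then obtain U K where K: "openin (mtop (gmfd G)) U" "compactin (mtop (gmfd G)) K" "\<e> \<in> U" "U \<subseteq> K" "K \<subseteq> U1 \<inter> U2"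
    using smooth_manifold_compact_neighbourhood[OF mfd(2) openin_Int[OF U12(1,2)], of \<e>] by auto
  have KW: "k \<in> C" "inv_G k \<odot> k' \<in> W" if "k \<in> K" "k' \<in> K" for k k'
  proof -
    have "(k, k') \<in> U1 \<times> U2" using that K(5) by auto
    then have "(k, k') \<in> {p \<in> C \<times> C. inv_G (fst p) \<odot> snd p \<in> W}" using U12(5) by blast
    then show "k \<in> C" "inv_G k \<odot> k' \<in> W" by auto
  qed
  let ?\<U> = "(\<lambda>g. {h \<in> C. inv_G g \<odot> h \<in> U}) ` C"
  have "\<forall>A\<in>?\<U>. openin (mtop (gmfd G)) A" using open_left_translate K(1) by auto
  moreover have "\<Union> ?\<U> = pts (gmfd G)" using K(3) by (auto simp: mfd(4))
  moreover have "Lindelof_space (mtop (gmfd G))"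
    using mfd(2) by (intro second_countable_imp_Lindelof_space) (simp add: smooth_manifold_iff)
  ultimately obtain \<V> where V: "countable \<V>" "\<V> \<subseteq> ?\<U>" "\<Union>\<V> = pts (gmfd G)"
    unfolding Lindelof_space_def by meson
  obtain D where D: "countable D" "D \<subseteq> C" "\<V> = (\<lambda>g. {h \<in> C. inv_G g \<odot> h \<in> U}) ` D"
    using V(1,2) countable_subset_image[of \<V> "\<lambda>g. {h \<in> C. inv_G g \<odot> h \<in> U}" C] by blast
  define Z where "Z g = (\<lambda>h. \<phi> (g \<odot> h) x) ` K" for g
  let ?X = "subtopology (mtop E) Orb"
  have topX: "topspace ?X = Orb" using O_subset by auto
  have ZO: "Z g \<subseteq> Orb" if "g \<in> C" for g
    using KW(1) grp.m_closed[OF that] unfolding Z_def orbit_def by blast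
  have Haus: "Hausdorff_space (mtop E)" using mfd(3) by (simp add: smooth_manifold_iff)
  have Zclosed: "closedin ?X (Z g)" if g: "g \<in> C" for g
  proof -
    have "smooth_map (gmfd G) E (\<lambda>h. \<phi> (g \<odot> h) x)"
      by (rule smooth_map_on_compose[OF chd(1) mfd(2) chd(2) smooth_mult_left[OF g] smooth_act_right[OF x]])
        (use g in \<open>auto simp: mfd(4)\<close>)
    then have "compactin (mtop E) (Z g)"
      unfolding Z_def by (intro image_compactin[OF K(2)]) (simp add: smooth_map_on_def)
    then have "compactin ?X (Z g)" using ZO[OF g] by (simp add: compactin_subtopology)
    then show ?thesis by (rule compactin_imp_closedin[OF Hausdorff_space_subtopology[OF Haus]])
  qed
  \<comment> \<open>Baire category theorem in the orbit\<close>
  have "\<exists>g\<in>D. ?X interior_of Z g \<noteq> {}"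
  proof (rule ccontr)
    assume "\<not> ?thesis"
    then have "?X interior_of \<Union>(Z ` D) = {}"
    proof (intro Baire_category_alt)
      have "locally_compact_space ?X"
        using locally_compact_space_open_subset[OF _ smooth_manifold_locally_compact[OF mfd(3)] open_orbit] Haus by blast
      then show "completely_metrizable_space ?X \<or> locally_compact_space ?X \<and> regular_space ?X"
        using locally_compact_Hausdorff_imp_regular_space Hausdorff_space_subtopology[OF Haus] by blast
    qed (use D Zclosed in auto)
    moreover have "\<Union>(Z ` D) = Orb"
    proof
      show "\<Union>(Z ` D) \<subseteq> Orb" using ZO D(2) by blast
      show "Orb \<subseteq> \<Union>(Z ` D)"
      proof
        fix y assume "y \<in> Orb"
        then obtain h where h: "h \<in> C" "y = \<phi> h x" by (auto simp: O_iff)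
        then obtain g where g: "g \<in> D" "inv_G g \<odot> h \<in> U" using V(3) D(3) by (auto simp: mfd(4))
        have "g \<in> C" using g D by blast
        then have "g \<odot> (inv_G g \<odot> h) = h"
          using h(1) grp.m_assoc[of g "inv_G g" h] grp.r_inv[of g] by simp
        then have "y = \<phi> (g \<odot> (inv_G g \<odot> h)) x" using h by simp
        then show "y \<in> \<Union>(Z ` D)" using g K(4) by (auto simp: Z_def)
      qed
    qed
    ultimately show False using topX x action(2)[OF x] by (metis O_iff empty_iff grp.one_closed interior_of_topspace)
  qed
  then obtain g where g: "g \<in> D" "?X interior_of Z g \<noteq> {}" by blast
  have gC: "g \<in> C" using g D by blast
  let ?I = "?X interior_of Z g"
  have I: "openin (mtop E) ?I"
    using openin_interior_of[of ?X "Z g"] openin_open_subtopology[OF open_orbit] by blast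
  have IZ: "?I \<subseteq> Z g" by (rule interior_of_subset)
  then obtain k where k: "k \<in> K" "\<phi> (g \<odot> k) x \<in> ?I" using g(2) unfolding Z_def by blast
  have kC: "k \<in> C" "g \<odot> k \<in> C" using KW(1) k(1) gC by auto
  show ?thesis
  proof (intro exI conjI)
    show "openin (mtop E) {z \<in> pts E. \<phi> (g \<odot> k) z \<in> ?I}" by (rule open_act_translate[OF kC(2) I])
    show "x \<in> {z \<in> pts E. \<phi> (g \<odot> k) z \<in> ?I}" using x k by simp
    show "{z \<in> pts E. \<phi> (g \<odot> k) z \<in> ?I} \<subseteq> (\<lambda>g. \<phi> g x) ` W"
    proof
      fix z assume z: "z \<in> {z \<in> pts E. \<phi> (g \<odot> k) z \<in> ?I}"
      then obtain k' where k': "k' \<in> K" "\<phi> (g \<odot> k) z = \<phi> (g \<odot> k') x" using IZ by (auto simp: Z_def)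
      have k'C: "k' \<in> C" using KW(1) k' by blast
      have "\<phi> g (\<phi> k z) = \<phi> g (\<phi> k' x)" using k'(2) gC kC k'C z x by (simp add: action(3))
      then have "\<phi> k z = \<phi> k' x" using action_inv(1)[OF gC] action(1) kC k'C z x by (metis (no_types, lifting) mem_Collect_eq)
      moreover have "\<phi> (inv_G k) (\<phi> k z) = z" using action_inv(1)[OF kC(1)] z by blast
      ultimately have "z = \<phi> (inv_G k) (\<phi> k' x)" by simp
      also have "\<dots> = \<phi> (inv_G k \<odot> k') x" using kC k'C x by (simp add: action(3))
      finally show "z \<in> (\<lambda>g. \<phi> g x) ` W" using KW(2)[OF k(1) k'(1)] by blast
    qed
  qed
qed

lemma orbit_map_open:
  assumes W: "openin (mtop (gmfd G)) W"
  shows "openin (mtop E) ((\<lambda>g. \<phi> g x) ` W)"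
proof (subst openin_subopen, intro ballI)
  have WC: "W \<subseteq> C" using openin_subset[OF W] by (simp add: mfd(4))
  fix y assume "y \<in> (\<lambda>g. \<phi> g x) ` W"
  then obtain g where g: "g \<in> W" "y = \<phi> g x" by auto
  then have gC: "g \<in> C" using WC by blast
  obtain V where V: "openin (mtop E) V" "x \<in> V" "V \<subseteq> (\<lambda>g. \<phi> g x) ` {h \<in> C. g \<odot> h \<in> W}"
    using orbit_map_open_at_unit[OF open_left_translate[OF gC W]] g gC by auto
  show "\<exists>T. openin (mtop E) T \<and> y \<in> T \<and> T \<subseteq> (\<lambda>g. \<phi> g x) ` W"
  proof (intro exI conjI)
    show "openin (mtop E) {z \<in> pts E. \<phi> (inv_G g) z \<in> V}"
      by (rule open_act_translate[OF _ V(1)]) (use gC in simp)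
    show "y \<in> {z \<in> pts E. \<phi> (inv_G g) z \<in> V}" using g gC action_inv(1)[OF gC x] V(2) action(1) x by auto
    show "{z \<in> pts E. \<phi> (inv_G g) z \<in> V} \<subseteq> (\<lambda>g. \<phi> g x) ` W"
    proof
      fix z assume z: "z \<in> {z \<in> pts E. \<phi> (inv_G g) z \<in> V}"
      then obtain h where h: "h \<in> C" "g \<odot> h \<in> W" "\<phi> (inv_G g) z = \<phi> h x" using V(3) by auto
      have "\<phi> g (\<phi> (inv_G g) z) = z" using action_inv(2)[OF gC] z by blast
      then have "z = \<phi> (g \<odot> h) x" using h(3) action(3)[OF gC h(1) x] by simp
      then show "z \<in> (\<lambda>g. \<phi> g x) ` W" using h(2) by blast
    qed
  qed
qed

lemma continuous_\<tau>: "continuous_map (subtopology (mtop E) Orb) (mtop (gmfd G)) \<tau>"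
  unfolding continuous_map_open_domain[OF open_orbit]
proof (intro conjI allI impI)
  show "\<tau> ` Orb \<subseteq> pts (gmfd G)" using \<tau>(1) by (auto simp: mfd(4))
  fix V assume V: "openin (mtop (gmfd G)) V"
  then have "V \<subseteq> C" using openin_subset mfd(4) by metis
  then have "{y \<in> Orb. \<tau> y \<in> V} = (\<lambda>g. \<phi> g x) ` V"
    using \<tau> \<tau>_act by (force simp: O_iff)
  then show "openin (mtop E) {y \<in> Orb. \<tau> y \<in> V}" using orbit_map_open[OF V] by simp
qed

end

section \<open>Free open orbits: the inverse of the orbit map is smooth\<close>

lemma partial_unit_derivative:
  assumes S: "openin (Euclidean_space m) W" "a0 \<in> W"
    and unit: "\<And>b. b \<in> W \<Longrightarrow> R (juxt m' a1 b) j = b j" and k: "k < m"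
  shows "partial (m' + k) (\<lambda>z. R z j) (juxt m' a1 a0) = (if k = j then 1 else 0)"
proof -
  have "\<forall>\<^sub>F t in nhds (a0 k). R ((juxt m' a1 a0)(m' + k := t)) j = (a0(k := t)) j"
    using eventually_upd_in[OF S k] by eventually_elim (simp add: juxt_upd unit)
  then have "partial (m' + k) (\<lambda>z. R z j) (juxt m' a1 a0) = deriv (\<lambda>t. (a0(k := t)) j) (a0 k)"
    unfolding partial_def by (intro deriv_cong_ev) auto
  also have "\<dots> = (if k = j then 1 else 0)"
    by (cases "k = j") auto
  finally show ?thesis .
qed

text \<open>
  \<open>R\<close> is a group law in a chart around the unit.  Its partial derivatives with respect to the second
  argument form the identity matrix at \<open>(a0, a0)\<close>, because \<open>R (a0, b) = b\<close>; strict
  differentiability then compares \<open>R (a, b) - R (a, a0)\<close> with \<open>b - a0\<close>, and \<open>R (a, a0) = a\<close>.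
\<close>

lemma near_translation_of_unit:
  assumes Om: "openin (Euclidean_space (m + m)) \<Omega>" and R: "smooth_euclidean (m + m) m \<Omega> R"
    and W: "openin (Euclidean_space m) W" "a0 \<in> W" and a0: "juxt m a0 a0 \<in> \<Omega>"
    and lunit: "\<And>b j. b \<in> W \<Longrightarrow> j < m \<Longrightarrow> R (juxt m a0 b) j = b j"
    and runit: "\<And>a j. a \<in> W \<Longrightarrow> j < m \<Longrightarrow> R (juxt m a a0) j = a j"
  shows "\<exists>r>0. \<forall>a\<in>espace m. \<forall>b\<in>espace m. l1 m a a0 < r \<longrightarrow> l1 m b a0 < r \<longrightarrow>
     (\<Sum>j<m. \<bar>R (juxt m a b) j - a j - (b j - a0 j)\<bar>) \<le> l1 m b a0 / 2"
proof -
  let ?e = "1 / (2 * (real m + 1))" and ?z = "juxt m a0 a0"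
  have a0E: "a0 \<in> espace m" using W openin_subset by blast
  have "\<exists>\<delta>>0. \<forall>j<m. \<forall>y1\<in>espace (m + m). \<forall>y2\<in>espace (m + m). l1 (m + m) y1 ?z < \<delta> \<longrightarrow> l1 (m + m) y2 ?z < \<delta> \<longrightarrow>
     \<bar>R y1 j - R y2 j - (\<Sum>i<m + m. partial i (\<lambda>z. R z j) ?z * (y1 i - y2 i))\<bar> \<le> ?e * l1 (m + m) y1 y2"
  proof (rule uniform_delta)
    fix j assume "j < m"
    then show "\<exists>\<delta>>0. \<forall>y1\<in>espace (m + m). \<forall>y2\<in>espace (m + m). l1 (m + m) y1 ?z < \<delta> \<longrightarrow> l1 (m + m) y2 ?z < \<delta> \<longrightarrow>
     \<bar>R y1 j - R y2 j - (\<Sum>i<m + m. partial i (\<lambda>z. R z j) ?z * (y1 i - y2 i))\<bar> \<le> ?e * l1 (m + m) y1 y2"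
      using R by (intro strict_differentiability[OF Om _ a0]) (auto simp: smooth_euclidean_def simp del: Ck.simps)
  qed fastforce
  then obtain \<delta> where d: "\<delta> > 0" "\<And>j y1 y2. j < m \<Longrightarrow> y1\<in>espace (m + m) \<Longrightarrow> y2\<in>espace (m + m) \<Longrightarrow>
     l1 (m + m) y1 ?z < \<delta> \<Longrightarrow> l1 (m + m) y2 ?z < \<delta> \<Longrightarrow>
     \<bar>R y1 j - R y2 j - (\<Sum>i<m + m. partial i (\<lambda>z. R z j) ?z * (y1 i - y2 i))\<bar> \<le> ?e * l1 (m + m) y1 y2" by blast
  obtain \<delta>' where d': "\<delta>' > 0" "\<And>a. a \<in> espace m \<Longrightarrow> l1 m a a0 < \<delta>' \<Longrightarrow> a \<in> W"
    using W unfolding openin_Euclidean_space_l1 by meson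
  show ?thesis
  proof (intro exI conjI ballI impI)
    show "min (\<delta> / 2) \<delta>' > 0" using d d' by simp
    fix a b assume ab: "a \<in> espace m" "b \<in> espace m" "l1 m a a0 < min (\<delta> / 2) \<delta>'" "l1 m b a0 < min (\<delta> / 2) \<delta>'"
    have "\<bar>R (juxt m a b) j - a j - (b j - a0 j)\<bar> \<le> ?e * l1 m b a0" if j: "j < m" for j
    proof -
      have "l1 m a a0 < \<delta>" "l1 m a a0 + l1 m b a0 < \<delta>"
        using ab(3,4) l1_nonneg[of m a a0] by linarith+
      then have "\<bar>R (juxt m a b) j - R (juxt m a a0) j - (\<Sum>i<m + m. partial i (\<lambda>z. R z j) ?z * (juxt m a b i - juxt m a a0 i))\<bar>
          \<le> ?e * l1 (m + m) (juxt m a b) (juxt m a a0)"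
        using ab a0E by (intro d(2)[OF j] juxt_espace) (auto simp: l1_juxt)
      moreover have "(\<Sum>i<m + m. partial i (\<lambda>z. R z j) ?z * (juxt m a b i - juxt m a a0 i))
          = (\<Sum>k<m. (if k = j then 1 else 0) * (b k - a0 k))"
        using partial_unit_derivative[where R = R and j = j and m' = m and ?a1.0 = a0, OF W lunit[OF _ j]] by (simp add: sum_block_split)
      moreover have "\<dots> = (\<Sum>k<m. if k = j then b k - a0 k else 0)" by (intro sum.cong) auto
      ultimately show ?thesis using runit[OF d'(2)[OF ab(1)] j] ab(3) j by (simp add: l1_juxt)
    qed
    then have "(\<Sum>j<m. \<bar>R (juxt m a b) j - a j - (b j - a0 j)\<bar>) \<le> (\<Sum>j<m. ?e * l1 m b a0)"
      by (intro sum_mono) auto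
    also have "\<dots> = (real m / (real m + 1)) * (l1 m b a0 / 2)" by (simp add: field_simps)
    also have "\<dots> \<le> 1 * (l1 m b a0 / 2)" by (intro mult_right_mono) auto
    finally show "(\<Sum>j<m. \<bar>R (juxt m a b) j - a j - (b j - a0 j)\<bar>) \<le> l1 m b a0 / 2" by simp
  qed
qed

context free_open_orbit begin

lemma mult_inv_cancel: "g \<in> C \<Longrightarrow> h \<in> C \<Longrightarrow> g \<odot> (inv_G g \<odot> h) = h"
  using grp.m_assoc[of g "inv_G g" h] grp.r_inv[of g] by simp

text \<open>
  In charts around the unit and \<open>x\<close>, let \<open>R\<close> be the group law, \<open>P\<close> the action, \<open>f\<close> the orbit map
  and \<open>h\<close> its inverse.  The lower bound for \<open>f\<close> makes \<open>h\<close> differentiable at \<open>y0\<close>, the coordinates of \<open>x\<close>.  For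
  \<open>v = g x\<close> near \<open>x\<close> the equation \<open>\<tau> v' = g (\<tau> (g\<inverse> v'))\<close> holds for \<open>v'\<close> near \<open>v\<close>, where
  \<open>g\<inverse> v'\<close> is near \<open>x\<close>.  The chain rule gives the derivative of \<open>h\<close> at \<open>v\<close> from the one at \<open>y0\<close>, in the
  form to which the bootstrap lemma applies.
\<close>

lemma smooth_\<tau>_at_base_point: "\<exists>S. x \<in> S \<and> smooth_map_on E (gmfd G) S \<tau>"
proof -
  let ?m = "mdim (gmfd G)" and ?n = "mdim E"
  obtain U c where U: "(U, c) \<in> atlas (gmfd G)" "\<e> \<in> U" using chart_at[OF mfd(2), of \<e>] by (auto simp: mfd(4))
  obtain V d where V: "(V, d) \<in> atlas E" "x \<in> V" using chart_at[OF mfd(3) x] by blast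
  let ?ci = "inv_into U c" and ?di = "inv_into V d"
  note UO = chart_openin[OF chd(1) U(1)] and VO = chart_openin[OF chd(2) V(1)]
  note chc = chartedD[OF chd(1) U(1)] and chdd = chartedD[OF chd(2) V(1)]
  have UC: "U \<subseteq> C" using openin_subset[OF UO] by (simp add: mfd(4))
  have VE: "V \<subseteq> pts E" using openin_subset[OF VO] by simp
  have cinj: "inj_on c U" and dinj: "inj_on d V" using is_chart_inj chc chdd by auto
  have ci [simp]: "?ci (c g) = g" if "g \<in> U" for g using that cinj by (rule inv_into_f_f[rotated])
  have di [simp]: "?di (d v) = v" if "v \<in> V" for v using that dinj by (rule inv_into_f_f[rotated])
  have cE: "c g \<in> espace ?m" if "g \<in> U" for g using is_chart_image_subset[OF chc that] .
  have dE: "d v \<in> espace ?n" if "v \<in> V" for v using is_chart_image_subset[OF chdd that] .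
  define a0 where "a0 = c \<e>"
  define y0 where "y0 = d x"
  have a0: "a0 \<in> espace ?m" "a0 \<in> c ` U" and y0: "y0 \<in> espace ?n" "y0 \<in> d ` V"
    using U V cE dE by (auto simp: a0_def y0_def)
  have cUO: "openin (Euclidean_space ?m) (c ` U)" using chc by (simp add: is_chart_def)
  obtain \<Omega>1 R where R: "openin (Euclidean_space (?m + ?m)) \<Omega>1" "smooth_euclidean (?m + ?m) ?m \<Omega>1 R"
    "\<And>a b. a \<in> espace ?m \<Longrightarrow> b \<in> espace ?m \<Longrightarrow> juxt ?m a b \<in> \<Omega>1 \<longleftrightarrow> a \<in> c ` U \<and> b \<in> c ` U \<and> ?ci a \<odot> ?ci b \<in> U"
    "\<And>a b. a \<in> c ` U \<Longrightarrow> b \<in> c ` U \<Longrightarrow> R (juxt ?m a b) = c (?ci a \<odot> ?ci b)"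
    using local_representative[OF chd(1,1,1) mfd(5) U(1) U(1) U(1)] by blast
  obtain \<Omega>2 P where P: "openin (Euclidean_space (?m + ?n)) \<Omega>2" "smooth_euclidean (?m + ?n) ?n \<Omega>2 P"
    "\<And>a y. a \<in> espace ?m \<Longrightarrow> y \<in> espace ?n \<Longrightarrow> juxt ?m a y \<in> \<Omega>2 \<longleftrightarrow> a \<in> c ` U \<and> y \<in> d ` V \<and> \<phi> (?ci a) (?di y) \<in> V"
    "\<And>a y. a \<in> c ` U \<Longrightarrow> y \<in> d ` V \<Longrightarrow> P (juxt ?m a y) = d (\<phi> (?ci a) (?di y))"
    using local_representative[OF chd(1,2,2) mfd(7) U(1) V(1) V(1)] by blast
  have R': "juxt ?m (c g) (c h) \<in> \<Omega>1 \<longleftrightarrow> g \<odot> h \<in> U" "R (juxt ?m (c g) (c h)) = c (g \<odot> h)"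
    if "g \<in> U" "h \<in> U" for g h
    using R(3)[OF cE[OF that(1)] cE[OF that(2)]] R(4)[of "c g" "c h"] that by auto
  have P': "juxt ?m (c g) (d v) \<in> \<Omega>2 \<longleftrightarrow> \<phi> g v \<in> V" "P (juxt ?m (c g) (d v)) = d (\<phi> g v)"
    if "g \<in> U" "v \<in> V" for g v
    using P(3)[OF cE[OF that(1)] dE[OF that(2)]] P(4)[of "c g" "d v"] that by auto
  define f where "f a = P (juxt ?m a y0)" for a
  have fc: "f (c g) = d (\<phi> g x)" if "g \<in> U" for g using P'(2)[OF that V(2)] by (simp add: f_def y0_def)
  have fa0: "f a0 = y0" using fc[OF U(2)] action(2)[OF x] by (simp add: a0_def y0_def)
  have z1: "juxt ?m a0 a0 \<in> \<Omega>1" using R'(1)[OF U(2) U(2)] U(2) by (simp add: a0_def)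
  have z2: "juxt ?m a0 y0 \<in> \<Omega>2" using P'(1)[OF U(2) V(2)] action(2)[OF x] V(2) by (simp add: a0_def y0_def)

  \<comment> \<open>The radius \<open>r\<close> below is small enough that all points involved stay in the domains and that \<open>P\<close> is Lipschitz there.\<close>
  have lower: "\<exists>\<kappa>>0. \<exists>\<delta>>0. \<forall>b\<in>espace ?m. l1 ?m b a0 < \<delta> \<longrightarrow> \<kappa> * l1 ?m b a0 \<le> l1 ?n (f b) (f a0)"
  proof -
    obtain r1 where r1: "r1 > 0" "\<And>a. a \<in> espace ?m \<Longrightarrow> l1 ?m a a0 < r1 \<Longrightarrow> a \<in> c ` U"
      using cUO a0(2) unfolding openin_Euclidean_space_l1 by meson
    obtain r2 where r2: "r2 > 0" "\<And>a b. a \<in> espace ?m \<Longrightarrow> b \<in> espace ?m \<Longrightarrow> l1 ?m a a0 < r2 \<Longrightarrow> l1 ?m b a0 < r2 \<Longrightarrow>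
       (\<Sum>j<?m. \<bar>R (juxt ?m a b) j - a j - (b j - a0 j)\<bar>) \<le> l1 ?m b a0 / 2"
    proof -
      have "R (juxt ?m a0 b) j = b j" "R (juxt ?m b a0) j = b j" if "b \<in> c ` U" for b j
        using that R'(2) U(2) UC by (auto simp: a0_def)
      then show thesis using near_translation_of_unit[OF R(1,2) cUO a0(2) z1] that by blast
    qed
    obtain r3 where r3: "r3 > 0" "\<And>z. z \<in> espace (?m + ?m) \<Longrightarrow> l1 (?m + ?m) z (juxt ?m a0 a0) < r3 \<Longrightarrow> z \<in> \<Omega>1"
      using R(1) z1 unfolding openin_Euclidean_space_l1 by meson
    obtain r4 where r4: "r4 > 0" "\<And>z. z \<in> espace (?m + ?n) \<Longrightarrow> l1 (?m + ?n) z (juxt ?m a0 y0) < r4 \<Longrightarrow> z \<in> \<Omega>2"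
      using P(1) z2 unfolding openin_Euclidean_space_l1 by meson
    obtain L r5 where r5: "r5 > 0" "\<And>z1 z2. z1 \<in> espace (?m + ?n) \<Longrightarrow> z2 \<in> espace (?m + ?n) \<Longrightarrow>
        l1 (?m + ?n) z1 (juxt ?m a0 y0) < r5 \<Longrightarrow> l1 (?m + ?n) z2 (juxt ?m a0 y0) < r5 \<Longrightarrow>
        l1 ?n (P z1) (P z2) \<le> L * l1 (?m + ?n) z1 z2"
      using smooth_euclidean_lipschitz[OF P(1,2) z2] by meson
    define L' where "L' = max L 1"
    have L': "L' > 0" "L \<le> L'" by (auto simp: L'_def)
    define r where "r = min (min r1 r2) (min (r3 / 2) (min r4 (min (r5 / 2) (r5 / 2 / L'))))"
    have r: "r > 0" "r \<le> r1" "r \<le> r2" "r \<le> r3 / 2" "r \<le> r4" "r \<le> r5 / 2" "r \<le> r5 / 2 / L'"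
      using r1(1) r2(1) r3(1) r4(1) r5(1) L' by (auto simp: r_def)
    have inU: "a \<in> c ` U" if "a \<in> espace ?m" "l1 ?m a a0 < r" for a using r1(2) r that by auto
    have in1: "juxt ?m a b \<in> \<Omega>1" if "a \<in> espace ?m" "l1 ?m a a0 < r" "b \<in> espace ?m" "l1 ?m b a0 < r" for a b
      by (rule r3(2)[OF juxt_espace]) (use r that in \<open>auto simp: l1_juxt\<close>)
    have in2: "juxt ?m a y0 \<in> \<Omega>2" if "a \<in> espace ?m" "l1 ?m a a0 < r" for a
      by (rule r4(2)[OF juxt_espace]) (use r y0 that in \<open>auto simp: l1_juxt\<close>)
    have fE: "f a \<in> espace ?n" "f a \<in> d ` V" if aB: "a \<in> espace ?m" "l1 ?m a a0 < r" for a
    proof -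
      obtain g where g: "g \<in> U" "a = c g" using inU[OF aB] by blast
      have "\<phi> g x \<in> V" using in2[OF aB] P'(1)[OF g(1) V(2)] g by (simp add: y0_def)
      then show "f a \<in> espace ?n" "f a \<in> d ` V" using fc[OF g(1)] g dE by auto
    qed
    have fnear: "l1 ?n (f a) y0 < r5 / 2" if "a \<in> espace ?m" "l1 ?m a a0 < r" for a
    proof -
      have "l1 ?n (f a) (f a0) \<le> L * l1 (?m + ?n) (juxt ?m a y0) (juxt ?m a0 y0)"
        unfolding f_def using r that y0 a0 r5(1) by (intro r5(2) juxt_espace) (auto simp: l1_juxt)
      also have "\<dots> \<le> L' * l1 ?m a a0" using L' by (auto simp: l1_juxt intro!: mult_right_mono)
      also have "\<dots> < L' * (r5 / 2 / L')" using that r L' by (intro mult_strict_left_mono) auto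
      finally show ?thesis using L' by (simp add: fa0)
    qed
    show ?thesis
    proof (rule iterated_translation_lower_bound[where \<mu> = "\<lambda>a b. R (juxt ?m a b)", OF a0(1) r(1)])
      fix a b assume a: "a \<in> {a \<in> espace ?m. l1 ?m a a0 < r}" and b: "b \<in> {a \<in> espace ?m. l1 ?m a a0 < r}"
      then obtain g h where gh: "g \<in> U" "h \<in> U" "a = c g" "b = c h" using inU by blast
      have ghU: "g \<odot> h \<in> U" using in1[of a b] a b R'(1)[OF gh(1,2)] gh by auto
      show "R (juxt ?m a b) \<in> espace ?m" using gh R'(2) cE[OF ghU] by simp
      show "(\<Sum>j<?m. \<bar>R (juxt ?m a b) j - a j - (b j - a0 j)\<bar>) \<le> l1 ?m b a0 / 2"
        using r2(2)[of a b] a b r by auto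
      assume ab: "R (juxt ?m a b) \<in> {a \<in> espace ?m. l1 ?m a a0 < r}"
      have gC: "g \<in> C" "h \<in> C" using gh UC by auto
      have ab': "R (juxt ?m a b) = c (g \<odot> h)" using R'(2) gh by simp
      have hx: "\<phi> h x \<in> V" using in2[of b] b P'(1)[OF gh(2) V(2)] gh by (simp add: y0_def)
      have ghx: "\<phi> g (\<phi> h x) \<in> V"
        using in2[of "c (g \<odot> h)"] ab P'(1)[OF ghU V(2)] action(3)[OF gC x] by (simp add: y0_def ab')
      have "f (R (juxt ?m a b)) = P (juxt ?m a (f b))"
        unfolding ab' fc[OF ghU] using fc[OF gh(2)] P'(2)[OF gh(1) hx] gh action(3)[OF gC x] by simp
      moreover have "l1 ?n (P (juxt ?m a (f b))) (P (juxt ?m a y0)) \<le> L * l1 (?m + ?n) (juxt ?m a (f b)) (juxt ?m a y0)"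
        using a b fnear[of b] fE[of b] r y0 r5(1) by (intro r5(2) juxt_espace) (auto simp: l1_juxt)
      ultimately show "l1 ?n (f (R (juxt ?m a b))) (f a) \<le> L * l1 ?n (f b) (f a0)"
        by (simp add: fa0 l1_juxt) (simp add: f_def)
    next
      fix j assume j: "j < ?n"
      have "continuous_on \<Omega>2 (\<lambda>z. P z j)" using P(2) j Ck_continuous unfolding smooth_euclidean_def by blast
      moreover have "continuous_on {a \<in> espace ?m. l1 ?m a a0 < r} (\<lambda>a. juxt ?m a y0)"
      proof (rule continuous_on_espace[of _ _ "?m + ?n"])
        show "continuous_on {a \<in> espace ?m. l1 ?m a a0 < r} (\<lambda>a. juxt ?m a y0 i)" for i
          by (cases "i < ?m") (auto simp: juxt_def intro: continuous_on_subset[OF continuous_on_product_coordinates])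
      qed (use y0 juxt_espace in auto)
      ultimately show "continuous_on {a \<in> espace ?m. l1 ?m a a0 < r} (\<lambda>a. f a j)"
        unfolding f_def by (rule continuous_on_compose2) (use in2 in auto)
    next
      fix a assume a: "a \<in> {a \<in> espace ?m. l1 ?m a a0 < r}" and eq: "l1 ?n (f a) (f a0) = 0"
      obtain g where g: "g \<in> U" "a = c g" using inU a by blast
      have "\<phi> g x \<in> V" using in2[of a] a P'(1)[OF g(1) V(2)] g by (simp add: y0_def)
      moreover have "d (\<phi> g x) = d x"
        using eq l1_eq_0_iff[of "f a" ?n "f a0"] fE[of a] a y0 fc[OF g(1)] g by (simp add: fa0) (simp add: y0_def)
      ultimately have "\<phi> g x = x" using dinj V(2) by (auto dest: inj_onD)
      then have "g = \<e>" using free g UC by blast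
      then show "a = a0" using g by (simp add: a0_def)
    qed
  qed
  then obtain \<kappa> \<delta>1 where \<kappa>: "\<kappa> > 0" "\<delta>1 > 0"
    "\<And>b. b\<in>espace ?m \<Longrightarrow> l1 ?m b a0 < \<delta>1 \<Longrightarrow> \<kappa> * l1 ?m b a0 \<le> l1 ?n (f b) (f a0)" by blast

  \<comment> \<open>The formula for the derivative at \<open>g x\<close> involves \<open>g\<inverse>\<close>, which has to lie in the chart as well.\<close>
  define U' where "U' = {g \<in> U. inv_G g \<in> U}"
  have U'O: "openin (mtop (gmfd G)) U'"
  proof -
    have "openin (mtop (gmfd G)) (U \<inter> {g \<in> pts (gmfd G). inv_G g \<in> U})"
      using smooth_map_on_preimage[OF mfd(6) UO] UO by blast
    moreover have "U \<inter> {g \<in> pts (gmfd G). inv_G g \<in> U} = U'" using UC by (auto simp: U'_def mfd(4))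
    ultimately show ?thesis by simp
  qed
  define S where "S = {v \<in> Orb. \<tau> v \<in> U'} \<inter> V"
  have SO: "openin (mtop E) S" unfolding S_def
    using openin_preimage_open_domain[OF continuous_\<tau> open_orbit U'O] VO by blast
  have xO: "x \<in> Orb" using action(2)[OF x] by (metis O_iff grp.one_closed)
  have \<tau>x: "\<tau> x = \<e>" using \<tau>_act[of \<e>] action(2)[OF x] by simp
  have xS: "x \<in> S" using xO \<tau>x U(2) V(2) by (simp add: S_def U'_def)
  define T where "T = d ` S"
  have TO: "openin (Euclidean_space ?n) T"
    using is_chart_image_open[OF chdd SO] by (simp add: T_def S_def Int_absorb1 inf_commute inf_left_commute)
  define h where "h y = c (\<tau> (?di y))" for y
  have hd: "h (d v) = c (\<tau> v)" if "v \<in> V" for v using that by (simp add: h_def)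
  define \<iota> where "\<iota> = c \<circ> (\<lambda>g. inv_G g) \<circ> ?ci"
  have \<iota>c: "\<iota> (c g) = c (inv_G g)" if "g \<in> U" for g using that by (simp add: \<iota>_def)
  have hy0: "h y0 = a0" using hd[OF V(2)] \<tau>x by (simp add: y0_def a0_def)
  have y0T: "y0 \<in> T" using xS by (simp add: T_def y0_def)
  have TE: "T \<subseteq> espace ?n" using openin_subset[OF TO] .

  have hT: "h y \<in> c ` U'" "h y \<in> espace ?m" "juxt ?m (h y) a0 \<in> \<Omega>1" "juxt ?m (\<iota> (h y)) y \<in> \<Omega>2" "f (h y) = y"
    "juxt ?m (h y) y0 \<in> \<Omega>2"
    if yT: "y \<in> T" for y
  proof -
    obtain v where v: "v \<in> S" "y = d v" using yT by (auto simp: T_def)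
    define g where "g = \<tau> v"
    have g: "g \<in> U" "inv_G g \<in> U" "v \<in> V" "v \<in> Orb" "g \<in> U'" using v by (auto simp: S_def U'_def g_def)
    have gC: "g \<in> C" using g UC by blast
    have gx: "\<phi> g x = v" using \<tau>(2)[OF g(4)] by (simp add: g_def)
    have hy: "h y = c g" using hd[OF g(3)] v by (simp add: g_def)
    show "h y \<in> c ` U'" "h y \<in> espace ?m" using hy g cE by auto
    show "juxt ?m (h y) a0 \<in> \<Omega>1" using R'(1)[OF g(1) U(2)] g gC by (simp add: hy a0_def)
    show "juxt ?m (\<iota> (h y)) y \<in> \<Omega>2"
      unfolding hy \<iota>c[OF g(1)] unfolding v(2)
      using P'(1)[OF g(2,3)] action_inv(1)[OF gC x] V(2) gx by simp
    show "f (h y) = y" unfolding hy fc[OF g(1)] gx by (simp add: v(2))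
    show "juxt ?m (h y) y0 \<in> \<Omega>2" unfolding hy y0_def using P'(1)[OF g(1) V(2)] gx g by simp
  qed
  have hcont: "continuous_on T h"
  proof -
    have Sd: "continuous_map (subtopology (Euclidean_space ?n) T) (subtopology (mtop E) S) ?di"
    proof -
      have "continuous_map (subtopology (Euclidean_space ?n) T) (mtop E) ?di"
        by (rule continuous_map_from_subtopology_mono[OF is_chart_inv_continuous[OF chdd]]) (auto simp: T_def S_def)
      moreover have "?di y \<in> S" if "y \<in> T" for y using that by (auto simp: T_def S_def)
      ultimately show ?thesis by (auto simp: continuous_map_in_subtopology)
    qed
    have St: "continuous_map (subtopology (mtop E) S) (subtopology (mtop (gmfd G)) U) \<tau>"
    proof -
      have "continuous_map (subtopology (mtop E) S) (mtop (gmfd G)) \<tau>"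
        by (rule continuous_map_from_subtopology_mono[OF continuous_\<tau>]) (auto simp: S_def)
      then show ?thesis by (auto simp: continuous_map_in_subtopology S_def U'_def)
    qed
    have "continuous_map (subtopology (Euclidean_space ?n) T) (Euclidean_space ?m) (c \<circ> (\<tau> \<circ> ?di))"
      by (rule continuous_map_compose[OF continuous_map_compose[OF Sd St] is_chart_continuous[OF chc]])
    then have "continuous_on (topspace (subtopology (Euclidean_space ?n) T)) (c \<circ> (\<tau> \<circ> ?di))"
      unfolding cm_Euclidean_space_iff_continuous_on by blast
    moreover have "topspace (subtopology (Euclidean_space ?n) T) = T" by (rule topspace_subtopology_subset[OF TE])
    ultimately show ?thesis by (simp add: h_def[abs_def] o_def)
  qed
  have hcoord: "continuous_on T (\<lambda>y. h y j)" for j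
    by (rule continuous_on_product_then_coordinatewise[OF hcont])
  have hnear: "\<exists>\<delta>>0. \<forall>y\<in>espace ?n. l1 ?n y y0 < \<delta> \<longrightarrow> y \<in> T \<and> l1 ?m (h y) a0 < e" if "e > 0" for e
  proof -
    have "continuous_on T (\<lambda>y. l1 ?m (h y) a0)"
      unfolding l1_def by (intro continuous_intros hcoord)
    from continuous_on_openin_l1[OF TO this y0T that] show ?thesis by (simp add: hy0)
  qed
  have gradP: "has_gradient (?m + ?n) (\<lambda>z. P z j) (\<lambda>i. partial i (\<lambda>z. P z j) z) z" if "z \<in> \<Omega>2" "j < ?n" for z j
    by (rule Ck_has_gradient[OF P(1) _ that(1), of 0]) (use P(2) that in \<open>auto simp: smooth_euclidean_def simp del: Ck.simps\<close>)
  have gradR: "has_gradient (?m + ?m) (\<lambda>z. R z j) (\<lambda>i. partial i (\<lambda>z. R z j) z) z" if "z \<in> \<Omega>1" "j < ?m" for z j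
    by (rule Ck_has_gradient[OF R(1) _ that(1), of 0]) (use R(2) that in \<open>auto simp: smooth_euclidean_def simp del: Ck.simps\<close>)
  obtain D where D: "\<And>i. i < ?m \<Longrightarrow> has_gradient ?n (\<lambda>y. h y i) (D i) y0"
  proof -
    have "\<exists>D. \<forall>i<?m. has_gradient ?n (\<lambda>y. h y i) (D i) y0"
    proof (rule has_gradient_of_inverse[OF a0(1) y0(1) _ _ \<kappa>])
      show "has_gradient ?m (\<lambda>a. f a j) (\<lambda>i. partial i (\<lambda>z. P z j) (juxt ?m a0 y0)) a0" if "j < ?n" for j
        unfolding f_def by (rule has_gradient_juxt_left[OF gradP[OF z2 that] y0(1)])
      show "\<exists>\<delta>>0. \<forall>y\<in>espace ?n. l1 ?n y y0 < \<delta> \<longrightarrow> h y \<in> espace ?m \<and> l1 ?m (h y) a0 < e \<and> (\<forall>j<?n. f (h y) j = y j)"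
        if "e > 0" for e
        using hnear[OF that] hT(2,5) by (metis (no_types, lifting))
    qed (simp_all add: fa0 hy0)
    then show thesis using that by blast
  qed
  have der: "((\<lambda>t. h (y(i := t)) j) has_field_derivative
      (\<Sum>p<?m. partial (?m + p) (\<lambda>z. R z j) (juxt ?m (h y) a0) *
         (\<Sum>l<?n. D p l * partial (?m + i) (\<lambda>z. P z l) (juxt ?m (\<iota> (h y)) y)))) (at (y i))"
    if y: "y \<in> T" and i: "i < ?n" and j: "j < ?m" for y i j
  proof -
    obtain v where v: "v \<in> S" "y = d v" using y by (auto simp: T_def)
    define g where "g = \<tau> v"
    have g: "g \<in> U" "inv_G g \<in> U" "v \<in> V" "v \<in> Orb" using v by (auto simp: S_def U'_def g_def)
    have gC: "g \<in> C" using g UC by blast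
    have gx: "\<phi> g x = v" using \<tau>(2)[OF g(4)] by (simp add: g_def)
    have hy: "h y = c g" using hd[OF g(3)] v by (simp add: g_def)
    have iy: "\<iota> (h y) = c (inv_G g)" by (simp add: hy \<iota>c[OF g(1)])
    \<comment> \<open>\<open>t\<close> moves the point \<open>v'\<close> along a coordinate line through \<open>v\<close>; \<open>u t\<close> is \<open>g\<inverse> v'\<close> in coordinates, and \<open>R (w t)\<close> is \<open>g (\<tau> (g\<inverse> v'))\<close>.\<close>
    define u where "u t = P (juxt ?m (\<iota> (h y)) (y(i := t)))" for t
    define w where "w t = juxt ?m (h y) (h (u t))" for t
    have "u (y i) = P (juxt ?m (c (inv_G g)) (d v))" unfolding u_def iy by (simp add: v(2))
    then have uy: "u (y i) = y0"
      using P'(2)[OF g(2,3)] action_inv(1)[OF gC x] gx by (simp add: y0_def)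
    have wy: "w (y i) = juxt ?m (h y) a0" by (simp add: w_def uy hy0)
    have du: "((\<lambda>t. u t l) has_field_derivative partial (?m + i) (\<lambda>z. P z l) (juxt ?m (\<iota> (h y)) y)) (at (y i))"
      if l: "l < ?n" for l
    proof -
      have "Ck (?m + ?n) (Suc 0) \<Omega>2 (\<lambda>z. P z l)" using P(2) l unfolding smooth_euclidean_def by blast
      then have "(\<lambda>t. P ((juxt ?m (\<iota> (h y)) y)(?m + i := t)) l) field_differentiable at (juxt ?m (\<iota> (h y)) y (?m + i))"
        using hT(4)[OF y] i unfolding Ck.simps by (meson nat_add_left_cancel_less)
      then show ?thesis unfolding u_def by (simp add: partial_def juxt_upd field_differentiable_derivI)
    qed
    have evy: "\<forall>\<^sub>F t in nhds (y i). y(i := t) \<in> T" by (rule eventually_upd_in[OF TO y i])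
    have ev2: "\<forall>\<^sub>F t in nhds (y i). juxt ?m (\<iota> (h y)) (y(i := t)) \<in> \<Omega>2"
      using eventually_upd_in[OF P(1) hT(4)[OF y], of "?m + i"] i by (simp add: juxt_upd)
    have uV: "u t \<in> d ` V" "\<phi> (inv_G g) (?di (y(i := t))) \<in> V" "u t = d (\<phi> (inv_G g) (?di (y(i := t))))"
      if yt: "y(i := t) \<in> T" "juxt ?m (\<iota> (h y)) (y(i := t)) \<in> \<Omega>2" for t
    proof -
      obtain v' where v': "v' \<in> S" "y(i := t) = d v'" using yt(1) by (auto simp: T_def)
      then have v'V: "v' \<in> V" by (simp add: S_def)
      have "\<phi> (inv_G g) v' \<in> V" using yt(2) P'(1)[OF g(2) v'V] by (simp add: iy v')
      moreover have "u t = d (\<phi> (inv_G g) v')" using P'(2)[OF g(2) v'V] by (simp add: u_def iy v')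
      ultimately show "u t \<in> d ` V" "\<phi> (inv_G g) (?di (y(i := t))) \<in> V" "u t = d (\<phi> (inv_G g) (?di (y(i := t))))"
        using v'V by (auto simp: v')
    qed
    have evE: "\<forall>\<^sub>F t in nhds (y i). u t \<in> espace ?n"
      using evy ev2
    proof eventually_elim
      case (elim t)
      show ?case using uV(1)[OF elim] dE by auto
    qed
    have evT: "\<forall>\<^sub>F t in nhds (y i). u t \<in> T"
    proof -
      obtain \<delta> where \<delta>: "\<delta> > 0" "\<And>z. z \<in> espace ?n \<Longrightarrow> l1 ?n z y0 < \<delta> \<Longrightarrow> z \<in> T"
        using TO y0T unfolding openin_Euclidean_space_l1 by meson
      have "isCont (\<lambda>t. l1 ?n (u t) y0) (y i)"
        unfolding l1_def by (intro continuous_intros) (use du DERIV_isCont in auto)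
      then have "((\<lambda>t. l1 ?n (u t) y0) \<longlongrightarrow> l1 ?n (u (y i)) y0) (nhds (y i))"
        using tendsto_nhds_iff[of "\<lambda>t. l1 ?n (u t) y0"] by (simp add: isCont_def)
      then have "\<forall>\<^sub>F t in nhds (y i). l1 ?n (u t) y0 < \<delta>"
        using \<delta>(1) by (intro order_tendstoD(2)) (auto simp: uy)
      with evE show ?thesis by eventually_elim (use \<delta>(2) in blast)
    qed
    have dhu: "((\<lambda>t. h (u t) p) has_field_derivative
        (\<Sum>l<?n. D p l * partial (?m + i) (\<lambda>z. P z l) (juxt ?m (\<iota> (h y)) y))) (at (y i))" if p: "p < ?m" for p
      by (rule has_gradient_curve[of ?n "\<lambda>y. h y p"]) (use D[OF p] uy evE du in auto)
    have "((\<lambda>t. R (w t) j) has_field_derivative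
       (\<Sum>q<?m + ?m. partial q (\<lambda>z. R z j) (juxt ?m (h y) a0) *
          (if q < ?m then 0 else (\<Sum>l<?n. D (q - ?m) l * partial (?m + i) (\<lambda>z. P z l) (juxt ?m (\<iota> (h y)) y))))) (at (y i))"
    proof (rule has_gradient_curve[of "?m + ?m" "\<lambda>z. R z j" _ w])
      show "has_gradient (?m + ?m) (\<lambda>z. R z j) (\<lambda>q. partial q (\<lambda>z. R z j) (juxt ?m (h y) a0)) (w (y i))"
        unfolding wy by (rule gradR[OF hT(3)[OF y] j])
      show "\<forall>\<^sub>F t in nhds (y i). w t \<in> espace (?m + ?m)"
        using evT by eventually_elim (use hT(2) juxt_espace in \<open>auto simp: w_def\<close>)
      fix q assume q: "q < ?m + ?m"
      show "((\<lambda>t. w t q) has_field_derivative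
          (if q < ?m then 0 else (\<Sum>l<?n. D (q - ?m) l * partial (?m + i) (\<lambda>z. P z l) (juxt ?m (\<iota> (h y)) y)))) (at (y i))"
      proof (cases "q < ?m")
        case False
        then show ?thesis using dhu[of "q - ?m"] q by (auto simp: w_def juxt_def)
      qed (simp add: w_def juxt_def)
    qed
    then have main: "((\<lambda>t. R (w t) j) has_field_derivative
       (\<Sum>p<?m. partial (?m + p) (\<lambda>z. R z j) (juxt ?m (h y) a0) *
          (\<Sum>l<?n. D p l * partial (?m + i) (\<lambda>z. P z l) (juxt ?m (\<iota> (h y)) y)))) (at (y i))"
      by (simp add: sum_block_split)
    have "\<forall>\<^sub>F t in nhds (y i). h (y(i := t)) j = R (w t) j"
      using evy ev2 evT
    proof eventually_elim
      case (elim t)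
      obtain v' where v': "v' \<in> S" "y(i := t) = d v'" using elim(1) by (auto simp: T_def)
      have v'V: "v' \<in> V" "v' \<in> Orb" "\<tau> v' \<in> U" using v' by (auto simp: S_def U'_def)
      have ut: "u t = d (\<phi> (inv_G g) v')" "\<phi> (inv_G g) v' \<in> V" using uV[OF elim(1,2)] v'V by (auto simp: v')
      have "\<phi> (inv_G g) v' \<in> S" using elim(3) ut dinj by (auto simp: T_def S_def dest: inj_onD)
      then have tU: "\<tau> (\<phi> (inv_G g) v') \<in> U" by (simp add: S_def U'_def)
      have "\<tau> (\<phi> (inv_G g) v') = inv_G g \<odot> \<tau> v'" by (rule \<tau>_equivariant) (use gC v'V in auto)
      then have "g \<odot> \<tau> (\<phi> (inv_G g) v') = \<tau> v'"
        using mult_inv_cancel[OF gC \<tau>(1)[OF v'V(2)]] by simp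
      then have "R (w t) = c (\<tau> v')"
        using R'(2)[OF g(1) tU] hd[OF ut(2)] by (simp add: w_def hy ut(1))
      then show ?case using hd[OF v'V(1)] by (simp add: v')
    qed
    from DERIV_cong_ev[OF refl this refl] main show ?thesis by blast
  qed
  have "smooth_euclidean ?n ?m T h"
  proof (rule Ck_bootstrap[where W = "c ` U'" and ?\<Omega>1.0 = \<Omega>1 and ?\<Omega>2.0 = \<Omega>2 and \<iota> = \<iota> and ?a0.0 = a0 and D = D
        and P = "\<lambda>j p. partial (?m + p) (\<lambda>z. R z j)" and Q = "\<lambda>i l. partial (?m + i) (\<lambda>z. P z l)", OF TO _ R(1) P(1)])
    have U'U: "U \<inter> U' = U'" by (auto simp: U'_def)
    show "openin (Euclidean_space ?m) (c ` U')" using is_chart_image_open[OF chc U'O] by (simp add: U'U)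
    have "U \<inter> pts (gmfd G) \<inter> (\<lambda>g. inv_G g) -` U = U'" using UC by (auto simp: U'_def mfd(4))
    then show "smooth_euclidean ?m ?m (c ` U') \<iota>"
      using smooth_map_onD[OF mfd(6) U(1) U(1)] by (simp add: \<iota>_def)
    show "Ck (?m + ?m) k \<Omega>1 (partial (?m + p) (\<lambda>z. R z j))" if "j < ?m" "p < ?m" for j p k
    proof -
      have "Ck (?m + ?m) (Suc k) \<Omega>1 (\<lambda>z. R z j)" using R(2) that unfolding smooth_euclidean_def by blast
      then show ?thesis using that by simp
    qed
    show "Ck (?m + ?n) k \<Omega>2 (partial (?m + i) (\<lambda>z. P z l))" if "i < ?n" "l < ?n" for i l k
    proof -
      have "Ck (?m + ?n) (Suc k) \<Omega>2 (\<lambda>z. P z l)" using P(2) that unfolding smooth_euclidean_def by blast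
      then show ?thesis using that by simp
    qed
  qed (use hT hcoord der in auto)
  then have hs: "smooth_map_on (euclidean_mfd ?n) (euclidean_mfd ?m) T h"
    using smooth_map_on_euclidean[OF TO] hT(2) by blast
  note chE = smooth_manifold_charted[OF smooth_manifold_euclidean]
  have "smooth_map_on E (euclidean_mfd ?n) S d"
    by (rule smooth_map_on_subset[OF chart_smooth(1)[OF mfd(3) V(1)] SO]) (auto simp: S_def)
  from smooth_map_on_compose[OF chd(2) smooth_manifold_euclidean chE this hs]
  have "smooth_map_on E (euclidean_mfd ?m) S (\<lambda>v. h (d v))" by (auto simp: T_def)
  from smooth_map_on_compose[OF chd(2) smooth_manifold_euclidean chd(1) this chart_smooth(2)[OF mfd(2) U(1)]]
  have "smooth_map_on E (gmfd G) S (\<lambda>v. ?ci (h (d v)))" by (auto simp: S_def hd U'_def)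
  then have "smooth_map_on E (gmfd G) S \<tau>"
    by (rule smooth_map_on_cong[OF chd(2) chd(1)]) (auto simp: S_def hd U'_def)
  then show ?thesis using xS by blast
qed

text \<open>
  Equivariance carries smoothness from the neighbourhood of \<open>x\<close> to every point of the orbit.
\<close>

theorem smooth_\<tau>: "smooth_map_on E (gmfd G) Orb \<tau>"
proof (rule smooth_map_on_local[OF chd(2) chd(1) open_orbit])
  fix y assume y: "y \<in> Orb"
  obtain S where S: "x \<in> S" "smooth_map_on E (gmfd G) S \<tau>" using smooth_\<tau>_at_base_point by blast
  define g where "g = \<tau> y"
  have g: "g \<in> C" "\<phi> g x = y" using \<tau>[OF y] by (auto simp: g_def)
  define S' where "S' = {v \<in> pts E. \<phi> (inv_G g) v \<in> S} \<inter> Orb"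
  have S'O: "openin (mtop E) S'"
    unfolding S'_def using open_act_translate[OF _ smooth_map_on_openin[OF S(2)], of "inv_G g"] g open_orbit by auto
  have "smooth_map_on E (gmfd G) S' (\<lambda>v. \<tau> (\<phi> (inv_G g) v))"
    by (rule smooth_map_on_compose[OF chd(2) mfd(3) chd(1) smooth_map_on_subset[OF smooth_act_left S'O] S(2)])
      (use g in \<open>auto simp: S'_def\<close>)
  from smooth_map_on_compose[OF chd(2) mfd(2) chd(1) this smooth_mult_left[OF g(1)]]
  have "smooth_map_on E (gmfd G) S' (\<lambda>v. g \<odot> \<tau> (\<phi> (inv_G g) v))"
    using g \<tau>(1) act_O by (auto simp: S'_def mfd(4))
  then have "smooth_map_on E (gmfd G) S' \<tau>"
  proof (rule smooth_map_on_cong[OF chd(2) chd(1)])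
    fix v assume "v \<in> S'"
    then have v: "v \<in> Orb" by (simp add: S'_def)
    then show "g \<odot> \<tau> (\<phi> (inv_G g) v) = \<tau> v"
      using \<tau>_equivariant[of "inv_G g" v] g v mult_inv_cancel[OF g(1) \<tau>(1)[OF v]] by simp
  qed
  moreover have "y \<in> S'" using g y action_inv(1)[OF g(1) x] S(1) O_subset by (auto simp: S'_def)
  ultimately show "\<exists>S'. y \<in> S' \<and> smooth_map_on E (gmfd G) S' \<tau>" by blast
qed

end

section \<open>Bases of G-sets and local products\<close>

text \<open>
  A variant of \<^const>\<open>group_action\<close> without the demand that the operation of each element is
  extensional; invariant subsets, fibers for instance, then inherit the structure with the same
  operation.
\<close>

locale gset = group G for G :: "('g, 'r) monoid_scheme" (structure) +
  fixes E :: "'a set" and \<phi> :: "'g \<Rightarrow> 'a \<Rightarrow> 'a"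
  assumes closed: "g \<in> carrier G \<Longrightarrow> y \<in> E \<Longrightarrow> \<phi> g y \<in> E"
    and act_one: "y \<in> E \<Longrightarrow> \<phi> \<one> y = y"
    and act_mult: "g \<in> carrier G \<Longrightarrow> h \<in> carrier G \<Longrightarrow> y \<in> E \<Longrightarrow> \<phi> (g \<otimes> h) y = \<phi> g (\<phi> h y)"
begin

lemma act_inv: "g \<in> carrier G \<Longrightarrow> y \<in> E \<Longrightarrow> \<phi> (inv g) (\<phi> g y) = y"
  "g \<in> carrier G \<Longrightarrow> y \<in> E \<Longrightarrow> \<phi> g (\<phi> (inv g) y) = y"
  using act_mult[of "inv g" g y] act_mult[of g "inv g" y] act_one by simp_all

lemma orbit_refl: "y \<in> E \<Longrightarrow> y \<in> orbit G \<phi> y"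
  using act_one[of y] unfolding orbit_def by (metis (mono_tags, lifting) mem_Collect_eq one_closed)

lemma orbit_subset: "y \<in> E \<Longrightarrow> orbit G \<phi> y \<subseteq> E"
  using closed by (auto simp: orbit_def)

lemma orbit_act: "g \<in> carrier G \<Longrightarrow> y \<in> E \<Longrightarrow> orbit G \<phi> (\<phi> g y) = orbit G \<phi> y"
proof (intro equalityI subsetI)
  assume g: "g \<in> carrier G" "y \<in> E"
  fix z assume "z \<in> orbit G \<phi> (\<phi> g y)"
  then obtain h where "h \<in> carrier G" "z = \<phi> h (\<phi> g y)" by (auto simp: orbit_def)
  then have "z = \<phi> (h \<otimes> g) y" "h \<otimes> g \<in> carrier G" using g act_mult by auto
  then show "z \<in> orbit G \<phi> y" by (auto simp: orbit_def)
next
  assume g: "g \<in> carrier G" "y \<in> E"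
  fix z assume "z \<in> orbit G \<phi> y"
  then obtain h where h: "h \<in> carrier G" "z = \<phi> h y" by (auto simp: orbit_def)
  then have "z = \<phi> (h \<otimes> inv g) (\<phi> g y)" "h \<otimes> inv g \<in> carrier G"
    using g act_mult[of h "inv g" "\<phi> g y"] closed act_inv(1) by auto
  then show "z \<in> orbit G \<phi> (\<phi> g y)" unfolding orbit_def by blast
qed

lemma orbit_eq: "y \<in> E \<Longrightarrow> z \<in> orbit G \<phi> y \<Longrightarrow> orbit G \<phi> z = orbit G \<phi> y"
proof -
  assume y: "y \<in> E" "z \<in> orbit G \<phi> y"
  then obtain g where "g \<in> carrier G" "z = \<phi> g y" unfolding orbit_def by blast
  then show ?thesis using orbit_act y(1) by simp
qed

lemma orbits_mem: "y \<in> E \<Longrightarrow> orbit G \<phi> y \<in> orbits G E \<phi>"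
  by (auto simp: orbits_def)

lemma orbits_elim: "W \<in> orbits G E \<phi> \<Longrightarrow> y \<in> W \<Longrightarrow> y \<in> E \<and> W = orbit G \<phi> y"
  unfolding orbits_def using orbit_eq orbit_subset by blast

lemma orbits_nonempty: "W \<in> orbits G E \<phi> \<Longrightarrow> \<exists>y\<in>E. W = orbit G \<phi> y"
  by (auto simp: orbits_def)

lemma Union_orbits: "\<Union> (orbits G E \<phi>) = E"
  using orbit_refl orbit_subset by (auto simp: orbits_def)

lemma gset_subset:
  assumes "E' \<subseteq> E" "\<And>g y. g \<in> carrier G \<Longrightarrow> y \<in> E' \<Longrightarrow> \<phi> g y \<in> E'"
  shows "gset G E' \<phi>"
proof unfold_locales
  fix g h y assume "g \<in> carrier G" "h \<in> carrier G" "y \<in> E'"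
  then show "\<phi> (g \<otimes> h) y = \<phi> g (\<phi> h y)" using act_mult assms(1) by blast
next
  fix y assume "y \<in> E'"
  then show "\<phi> \<one> y = y" using act_one assms(1) by blast
qed (use assms in auto)

lemma basis_iso:
  assumes f: "gset_basis G E \<phi> X f" and h: "gset_iso G E \<phi> E' \<phi>' h"
  shows "gset_basis G E' \<phi>' X (compose X h f)"
proof -
  have fE: "f \<in> X \<rightarrow>\<^sub>E E" and bf: "bij_betw (\<lambda>(g, x). \<phi> g (f x)) (carrier G \<times> X) E"
    and eqv: "\<And>g h x. g \<in> carrier G \<Longrightarrow> h \<in> carrier G \<Longrightarrow> x \<in> X \<Longrightarrow> \<phi> (g \<otimes> h) (f x) = \<phi> g (\<phi> h (f x))"
    using f act_mult by (auto simp: gset_basis_def gset_iso_def)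
  have bh: "bij_betw h E E'" and hq: "\<And>g y. g \<in> carrier G \<Longrightarrow> y \<in> E \<Longrightarrow> h (\<phi> g y) = \<phi>' g (h y)"
    using h by (auto simp: gset_iso_def)
  have fx: "f x \<in> E" if "x \<in> X" for x using fE that by auto
  have hE: "h y \<in> E'" if "y \<in> E" for y using bh that by (auto dest: bij_betwE)
  have "bij_betw (h \<circ> (\<lambda>(g, x). \<phi> g (f x))) (carrier G \<times> X) E'" by (rule bij_betw_trans[OF bf bh])
  then have "bij_betw (\<lambda>(g, x). \<phi>' g (compose X h f x)) (carrier G \<times> X) E'"
    by (rule bij_betw_cong[THEN iffD1, rotated]) (auto simp: compose_def hq fx)
  moreover have "compose X h f \<in> X \<rightarrow>\<^sub>E E'" using fx hE by (auto simp: compose_def)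
  moreover have "\<phi>' (g \<otimes> k) (compose X h f x) = \<phi>' g (\<phi>' k (compose X h f x))"
    if "g \<in> carrier G" "k \<in> carrier G" "x \<in> X" for g k x
  proof -
    have "\<phi>' (g \<otimes> k) (h (f x)) = h (\<phi> g (\<phi> k (f x)))"
      using that hq[of "g \<otimes> k" "f x"] fx eqv by simp
    also have "\<dots> = \<phi>' g (\<phi>' k (h (f x)))" using that hq fx closed by simp
    finally show ?thesis using that by (simp add: compose_def)
  qed
  ultimately show ?thesis by (auto simp: gset_basis_def gset_iso_def)
qed

end

locale free_gset = gset +
  assumes free: "g \<in> carrier G \<Longrightarrow> y \<in> E \<Longrightarrow> \<phi> g y = y \<Longrightarrow> g = \<one>"
begin

lemma free_eq: "g \<in> carrier G \<Longrightarrow> h \<in> carrier G \<Longrightarrow> y \<in> E \<Longrightarrow> \<phi> g y = \<phi> h y \<Longrightarrow> g = h"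
proof -
  assume gh: "g \<in> carrier G" "h \<in> carrier G" "y \<in> E" "\<phi> g y = \<phi> h y"
  then have "\<phi> (inv h \<otimes> g) y = y" using act_mult[of "inv h" g y] act_inv(1) by simp
  then have "inv h \<otimes> g = \<one>" using free gh by simp
  then show "g = h" using gh by (metis inv_equality inv_inv inv_closed)
qed

lemma free_gset_subset:
  assumes "E' \<subseteq> E" "\<And>g y. g \<in> carrier G \<Longrightarrow> y \<in> E' \<Longrightarrow> \<phi> g y \<in> E'"
  shows "free_gset G E' \<phi>"
proof -
  interpret E': gset G E' \<phi> by (rule gset_subset[OF assms])
  show ?thesis by unfold_locales (use free assms(1) in blast)
qed

text \<open>
  In a free G-set, \<open>g\<close> in \<open>g (f x)\<close> is determined, so being a basis only concerns orbits.  This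
  turns statements about frames into statements about bijections between sets of orbits.
\<close>

lemma basis_iff_orbits:
  "gset_basis G E \<phi> X f \<longleftrightarrow> f \<in> X \<rightarrow>\<^sub>E E \<and> bij_betw (\<lambda>x. orbit G \<phi> (f x)) X (orbits G E \<phi>)"
proof (cases "f \<in> X \<rightarrow>\<^sub>E E")
  case True
  then have fx: "f x \<in> E" if "x \<in> X" for x using that by auto
  have "gset_basis G E \<phi> X f \<longleftrightarrow> bij_betw (\<lambda>(g, x). \<phi> g (f x)) (carrier G \<times> X) E"
    using True act_mult fx by (auto simp: gset_basis_def gset_iso_def)
  also have "\<dots> \<longleftrightarrow> bij_betw (\<lambda>x. orbit G \<phi> (f x)) X (orbits G E \<phi>)"
  proof
    assume b: "bij_betw (\<lambda>(g, x). \<phi> g (f x)) (carrier G \<times> X) E"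
    show "bij_betw (\<lambda>x. orbit G \<phi> (f x)) X (orbits G E \<phi>)"
      unfolding bij_betw_def
    proof (intro conjI inj_onI equalityI subsetI)
      fix x x' assume x: "x \<in> X" "x' \<in> X" "orbit G \<phi> (f x) = orbit G \<phi> (f x')"
      then have "f x \<in> orbit G \<phi> (f x')" using orbit_refl fx by blast
      then obtain g where g: "g \<in> carrier G" "f x = \<phi> g (f x')" by (auto simp: orbit_def)
      then have "(\<lambda>(g, x). \<phi> g (f x)) (\<one>, x) = (\<lambda>(g, x). \<phi> g (f x)) (g, x')" using act_one[OF fx[OF x(1)]] g(2) by (simp only: split)
      then have "(\<one>, x) = (g, x')" using g x by (intro bij_betw_imp_inj_on[OF b, THEN inj_onD]) auto
      then show "x = x'" by simp
    next
      fix W assume "W \<in> orbits G E \<phi>"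
      then obtain y where y: "y \<in> E" "W = orbit G \<phi> y" by (auto simp: orbits_def)
      then obtain g x where gx: "g \<in> carrier G" "x \<in> X" "y = \<phi> g (f x)"
        using bij_betw_imp_surj_on[OF b] by (auto simp: image_iff)
      then show "W \<in> (\<lambda>x. orbit G \<phi> (f x)) ` X" using y orbit_act fx by auto
    qed (use fx orbits_mem in auto)
  next
    assume b: "bij_betw (\<lambda>x. orbit G \<phi> (f x)) X (orbits G E \<phi>)"
    show "bij_betw (\<lambda>(g, x). \<phi> g (f x)) (carrier G \<times> X) E"
      unfolding bij_betw_def
    proof (intro conjI inj_onI equalityI subsetI)
      fix p q assume pq: "p \<in> carrier G \<times> X" "q \<in> carrier G \<times> X"
        and eq: "(\<lambda>(g, x). \<phi> g (f x)) p = (\<lambda>(g, x). \<phi> g (f x)) q"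
      obtain g x h z where p: "p = (g, x)" "q = (h, z)" "g \<in> carrier G" "h \<in> carrier G" "x \<in> X" "z \<in> X"
        using pq by auto
      have e: "\<phi> g (f x) = \<phi> h (f z)" using eq p by simp
      then have "orbit G \<phi> (f x) = orbit G \<phi> (f z)" using orbit_act p fx by metis
      then have "x = z" using p by (intro bij_betw_imp_inj_on[OF b, THEN inj_onD]) auto
      then show "p = q" using free_eq[OF p(3,4) fx[OF p(5)]] e p by auto
    next
      fix y assume y: "y \<in> E"
      then obtain x where x: "x \<in> X" "orbit G \<phi> y = orbit G \<phi> (f x)"
        using bij_betw_imp_surj_on[OF b] orbits_mem by (metis (no_types, lifting) imageE)
      then obtain g where "g \<in> carrier G" "y = \<phi> g (f x)" using orbit_refl[OF y] by (auto simp: orbit_def)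
      then show "y \<in> (\<lambda>(g, x). \<phi> g (f x)) ` (carrier G \<times> X)" using x by auto
    qed (use closed fx in auto)
  qed
  finally show ?thesis using True by simp
qed (simp add: gset_basis_def)

text \<open>
  One representative for each orbit.
\<close>

lemma basis_exists:
  assumes "finite (orbits G E \<phi>)"
  shows "\<exists>f. gset_basis G E \<phi> {..<card (orbits G E \<phi>)} f"
proof -
  obtain h where h: "bij_betw h {..<card (orbits G E \<phi>)} (orbits G E \<phi>)"
    using ex_bij_betw_nat_finite[OF assms] by (auto simp: atLeast0LessThan)
  then have "\<exists>y\<in>E. h i = orbit G \<phi> y" if "i < card (orbits G E \<phi>)" for i
    using that bij_betwE orbits_nonempty by blast
  then obtain f where f: "\<And>i. i < card (orbits G E \<phi>) \<Longrightarrow> f i \<in> E \<and> h i = orbit G \<phi> (f i)" by metis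
  have "bij_betw (\<lambda>i. orbit G \<phi> (restrict f {..<card (orbits G E \<phi>)} i)) {..<card (orbits G E \<phi>)} (orbits G E \<phi>)"
    using h by (rule bij_betw_cong[THEN iffD1, rotated]) (use f in auto)
  then show ?thesis unfolding basis_iff_orbits using f by (intro exI[of _ "restrict f {..<card (orbits G E \<phi>)}"]) auto
qed

lemma basis_permute:
  assumes f: "gset_basis G E \<phi> X f" and g: "g \<in> X \<rightarrow>\<^sub>E carrier G" and \<sigma>: "\<sigma> permutes X"
  shows "gset_basis G E \<phi> X (\<lambda>x\<in>X. \<phi> (g x) (f (inv_into UNIV \<sigma> x)))"
  unfolding basis_iff_orbits
proof
  have fE: "f \<in> X \<rightarrow>\<^sub>E E" and b: "bij_betw (\<lambda>x. orbit G \<phi> (f x)) X (orbits G E \<phi>)"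
    using f by (auto simp: basis_iff_orbits)
  have s: "inv_into UNIV \<sigma> permutes X" using \<sigma> by (rule permutes_inv)
  have sX: "inv_into UNIV \<sigma> x \<in> X" if "x \<in> X" for x using permutes_in_image[OF s] that by simp
  show "(\<lambda>x\<in>X. \<phi> (g x) (f (inv_into UNIV \<sigma> x))) \<in> X \<rightarrow>\<^sub>E E" using fE g sX closed by (auto simp: PiE_iff)
  have "bij_betw ((\<lambda>x. orbit G \<phi> (f x)) \<circ> inv_into UNIV \<sigma>) X (orbits G E \<phi>)"
    by (rule bij_betw_trans[OF permutes_imp_bij[OF s] b])
  then show "bij_betw (\<lambda>x. orbit G \<phi> ((\<lambda>x\<in>X. \<phi> (g x) (f (inv_into UNIV \<sigma> x))) x)) X (orbits G E \<phi>)"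
    by (rule bij_betw_cong[THEN iffD1, rotated]) (use sX fE g orbit_act in \<open>auto simp: PiE_iff\<close>)
qed

end

lemma gset_of_group_action: "group G \<Longrightarrow> group_action G E \<phi> \<Longrightarrow> gset G E \<phi>"
  using group_action_facts[of G E \<phi>] by (simp add: gset_def gset_axioms_def)

lemma orbits_image_iso:
  assumes "gset G E \<phi>" "gset_iso G E \<phi> E' \<phi>' h"
  shows "orbits G E' \<phi>' = (`) h ` orbits G E \<phi>"
proof -
  interpret gset G E \<phi> by fact
  have "orbit G \<phi>' (h y) = h ` orbit G \<phi> y" if "y \<in> E" for y
    using assms(2) that by (force simp: orbit_def gset_iso_def)
  moreover have "E' = h ` E" using assms(2) by (auto simp: gset_iso_def bij_betw_def)
  ultimately show ?thesis unfolding orbits_def by (auto simp: image_iff)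
qed

lemma card_orbits_iso:
  assumes "gset G E \<phi>" "gset_iso G E \<phi> E' \<phi>' h"
  shows "card (orbits G E' \<phi>') = card (orbits G E \<phi>)" "finite (orbits G E \<phi>) \<Longrightarrow> finite (orbits G E' \<phi>')"
proof -
  interpret gset G E \<phi> by fact
  have "inj_on h E" using assms(2) by (auto simp: gset_iso_def bij_betw_def)
  then have "inj_on ((`) h) (orbits G E \<phi>)"
    using Union_orbits by (intro inj_onI) (metis Sup_upper inj_on_image_eq_iff)
  then show "card (orbits G E' \<phi>') = card (orbits G E \<phi>)" "finite (orbits G E \<phi>) \<Longrightarrow> finite (orbits G E' \<phi>')"
    by (simp_all add: orbits_image_iso[OF assms] card_image)
qed

lemma openin_orbit_topology:
  assumes "gset G (topspace T) \<phi>"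
  shows "openin (orbit_topology G T \<phi>) V \<longleftrightarrow> V \<subseteq> orbits G (topspace T) \<phi> \<and> openin T (\<Union>V)"
proof -
  interpret gset G "topspace T" \<phi> by fact
  have "istopology (\<lambda>V. V \<subseteq> orbits G (topspace T) \<phi> \<and> openin T (\<Union>V))"
    unfolding istopology_def
  proof (intro conjI allI impI)
    fix V W assume VW: "V \<subseteq> orbits G (topspace T) \<phi> \<and> openin T (\<Union>V)" "W \<subseteq> orbits G (topspace T) \<phi> \<and> openin T (\<Union>W)"
    show "V \<inter> W \<subseteq> orbits G (topspace T) \<phi>" using VW by blast
    have "\<Union>(V \<inter> W) = \<Union>V \<inter> \<Union>W"
    proof (intro equalityI subsetI)
      fix y assume "y \<in> \<Union>V \<inter> \<Union>W"
      then obtain v w where vw: "v \<in> V" "w \<in> W" "y \<in> v" "y \<in> w" by blast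
      then have "v = w" using orbits_elim VW by (metis subsetD)
      then show "y \<in> \<Union>(V \<inter> W)" using vw by blast
    qed auto
    then show "openin T (\<Union>(V \<inter> W))" using VW by auto
  next
    fix K assume K: "\<forall>V\<in>K. V \<subseteq> orbits G (topspace T) \<phi> \<and> openin T (\<Union>V)"
    show "\<Union>K \<subseteq> orbits G (topspace T) \<phi>" using K by blast
    have "\<Union>(\<Union>K) = \<Union>(Union ` K)" by blast
    then show "openin T (\<Union>(\<Union>K))" using K by (simp only:) (intro openin_Union, auto)
  qed
  then show ?thesis unfolding orbit_topology_def by (simp add: topology_inverse')
qed

lemma topspace_orbit_topology:
  assumes "gset G (topspace T) \<phi>"
  shows "topspace (orbit_topology G T \<phi>) = orbits G (topspace T) \<phi>"
proof -
  interpret gset G "topspace T" \<phi> by fact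
  have "openin (orbit_topology G T \<phi>) (orbits G (topspace T) \<phi>)"
    unfolding openin_orbit_topology[OF assms] Union_orbits by simp
  then show ?thesis using openin_orbit_topology[OF assms] openin_subset openin_topspace by (metis subset_antisym)
qed

lemma smooth_map_on_from_open_submfd:
  assumes N: "smooth_manifold N" and P: "charted P" and U: "openin (mtop N) U"
    and f: "smooth_map (submfd N U (mdim N)) P f"
  shows "smooth_map_on N P U f"
proof -
  note N' = smooth_manifold_charted[OF N]
  have "smooth_map_on N (submfd N U (mdim N)) U (\<lambda>x. x)"
    by (rule smooth_map_on_into_submfd[OF N' N smooth_map_on_id[OF N U]])
  from smooth_map_on_compose[OF N' smooth_manifold_open_submfd[OF N U] P this f]
  show ?thesis using openin_subset[OF U] by auto
qed

text \<open>
  A local trivialization given by two explicit smooth maps on open subsets of the ambient manifolds: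
  \<open>\<phi>\<close> and the fiber coordinate \<open>\<psi>\<close> of its inverse.  All conditions on submanifold structures that
  \<^const>\<open>local_trivialization\<close> contains are equivalent to the smoothness of these two maps.
\<close>

definition local_product ::
    "'m mfd \<Rightarrow> ('m, 'b, 'g, 'f) gbundle \<Rightarrow> 'm set \<Rightarrow> ('m \<times> 'f \<Rightarrow> 'b) \<Rightarrow> ('b \<Rightarrow> 'f) \<Rightarrow> bool" where
  "local_product M B U \<phi> \<psi> \<longleftrightarrow> openin (mtop M) U \<and>
     smooth_map_on (prod_mfd M (fib B)) (tot B) (U \<times> pts (fib B)) \<phi> \<and>
     smooth_map_on (tot B) (fib B) (tot_over B U) \<psi> \<and>
     (\<forall>u\<in>U. \<forall>x\<in>pts (fib B). \<phi> (u, x) \<in> tot_over B {u} \<and> \<psi> (\<phi> (u, x)) = x) \<and>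
     (\<forall>b\<in>tot_over B U. \<psi> b \<in> pts (fib B) \<and> \<phi> (proj B b, \<psi> b) = b) \<and>
     (\<forall>g\<in>carrier (bgrp B). \<forall>u\<in>U. \<forall>x\<in>pts (fib B). \<phi> (u, fibact B g x) = act B g (\<phi> (u, x)))"

lemma local_trivialization_imp_local_product:
  assumes M: "smooth_manifold M" and F: "smooth_manifold (fib B)" and T: "smooth_manifold (tot B)"
    and p: "smooth_map (tot B) M (proj B)" and triv: "local_trivialization M B U \<phi>"
  shows "\<exists>\<psi>. local_product M B U \<phi> \<psi>"
proof -
  let ?F = "fib B" and ?UM = "submfd M U (mdim M)" and ?E = "tot_over B U"
  let ?TE = "submfd (tot B) ?E (mdim (tot B))" and ?D = "U \<times> pts (fib B)"
  note chM = smooth_manifold_charted[OF M] and chF = smooth_manifold_charted[OF F] and chT = smooth_manifold_charted[OF T]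
  have U: "openin (mtop M) U" and dif: "diffeomorphism (prod_mfd ?UM ?F) ?TE \<phi>"
    and pr: "\<And>u x. u \<in> U \<Longrightarrow> x \<in> pts ?F \<Longrightarrow> proj B (\<phi> (u, x)) = u"
    and iso: "\<And>u. u \<in> U \<Longrightarrow> gset_iso (bgrp B) (pts ?F) (fibact B) (tot_over B {u}) (act B) (\<lambda>x. \<phi> (u, x))"
    using triv by (auto simp: local_trivialization_def)
  have UM: "U \<subseteq> pts M" using openin_subset[OF U] by simp
  note UMm = smooth_manifold_open_submfd[OF M U]
  have EO: "openin (mtop (tot B)) ?E"
    using smooth_map_on_preimage[OF p U] by (simp add: tot_over_def)
  note TEm = smooth_manifold_open_submfd[OF T EO]
  have D: "pts (prod_mfd ?UM ?F) = ?D" using UM by auto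
  have E: "pts ?TE = ?E" by (auto simp: tot_over_def)
  have bij: "bij_betw \<phi> ?D ?E" using dif by (simp only: diffeomorphism_def D E)
  have DO: "openin (mtop (prod_mfd M ?F)) ?D" using U by (simp add: openin_prod_Times_iff)
  have "smooth_map_on (prod_mfd M ?F) (prod_mfd ?UM ?F) ?D (\<lambda>p. (fst p, snd p))"
    by (intro smooth_map_on_Pair smooth_map_on_into_submfd[OF charted_prod[OF chM chF] M]
        smooth_map_on_subset[OF smooth_map_fst[OF M chF] DO] smooth_map_on_subset[OF smooth_map_snd[OF F chM] DO])
      (use UM in auto)
  then have "smooth_map_on (prod_mfd M ?F) ?TE ?D (\<lambda>p. \<phi> (fst p, snd p))"
    by (rule smooth_map_on_compose[OF charted_prod[OF chM chF] smooth_manifold_prod[OF UMm F] charted_submfd])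
      (use dif D in \<open>auto simp: diffeomorphism_def\<close>)
  then have "smooth_map_on (prod_mfd M ?F) (tot B) ?D (\<lambda>p. \<phi> (fst p, snd p))"
    by (rule smooth_map_on_compose[OF charted_prod[OF chM chF] TEm chT _ smooth_map_submfd_inclusion[OF chT]])
      (use bij E in \<open>auto dest: bij_betwE\<close>)
  then have s1: "smooth_map_on (prod_mfd M ?F) (tot B) ?D \<phi>" by simp
  define \<psi> where "\<psi> b = snd (inv_into ?D \<phi> b)" for b
  have "smooth_map ?TE (prod_mfd ?UM ?F) (inv_into ?D \<phi>)" using dif by (simp only: diffeomorphism_def D)
  then have "smooth_map ?TE ?F \<psi>"
    unfolding \<psi>_def
    by (rule smooth_map_on_compose[OF charted_submfd smooth_manifold_prod[OF UMm F] chF _ smooth_map_snd[OF F charted_submfd]])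
      (simp only: D E, use bij_betwE[OF bij_betw_inv_into[OF bij]] in blast)
  then have s2: "smooth_map_on (tot B) ?F ?E \<psi>" by (rule smooth_map_on_from_open_submfd[OF T chF EO])
  have i1: "\<phi> (u, x) \<in> tot_over B {u}" if "u \<in> U" "x \<in> pts ?F" for u x
    using bij_betwE[OF bij] that pr by (auto simp: tot_over_def)
  have i2: "\<psi> (\<phi> (u, x)) = x" if "u \<in> U" "x \<in> pts ?F" for u x
    using bij_betw_inv_into_left[OF bij, of "(u, x)"] that by (simp add: \<psi>_def)
  have i3: "\<psi> b \<in> pts ?F" "\<phi> (proj B b, \<psi> b) = b" if b: "b \<in> ?E" for b
  proof -
    have "b \<in> \<phi> ` ?D" using b bij_betw_imp_surj_on[OF bij] by simp
    then obtain u x where ux: "u \<in> U" "x \<in> pts ?F" "b = \<phi> (u, x)" by blast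
    then show "\<psi> b \<in> pts ?F" "\<phi> (proj B b, \<psi> b) = b" using i2 pr by auto
  qed
  show ?thesis
    unfolding local_product_def using U s1 s2 i1 i2 i3 iso by (intro exI[of _ \<psi>]) (auto simp: gset_iso_def)
qed

lemma local_product_imp_local_trivialization:
  assumes M: "smooth_manifold M" and F: "smooth_manifold (fib B)" and T: "smooth_manifold (tot B)"
    and p: "smooth_map (tot B) M (proj B)" and lp: "local_product M B U \<phi> \<psi>"
  shows "local_trivialization M B U \<phi>"
proof -
  let ?F = "fib B" and ?UM = "submfd M U (mdim M)" and ?E = "tot_over B U"
  let ?TE = "submfd (tot B) ?E (mdim (tot B))" and ?D = "U \<times> pts (fib B)"
  note chM = smooth_manifold_charted[OF M] and chF = smooth_manifold_charted[OF F] and chT = smooth_manifold_charted[OF T]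
  have U: "openin (mtop M) U" and s1: "smooth_map_on (prod_mfd M ?F) (tot B) ?D \<phi>"
    and s2: "smooth_map_on (tot B) ?F ?E \<psi>"
    and i1: "\<And>u x. u \<in> U \<Longrightarrow> x \<in> pts ?F \<Longrightarrow> \<phi> (u, x) \<in> tot_over B {u}"
    and i2: "\<And>u x. u \<in> U \<Longrightarrow> x \<in> pts ?F \<Longrightarrow> \<psi> (\<phi> (u, x)) = x"
    and i3: "\<And>b. b \<in> ?E \<Longrightarrow> \<psi> b \<in> pts ?F" "\<And>b. b \<in> ?E \<Longrightarrow> \<phi> (proj B b, \<psi> b) = b"
    and i4: "\<And>g u x. g \<in> carrier (bgrp B) \<Longrightarrow> u \<in> U \<Longrightarrow> x \<in> pts ?F \<Longrightarrow> \<phi> (u, fibact B g x) = act B g (\<phi> (u, x))"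
    using lp unfolding local_product_def by blast+
  have UM: "U \<subseteq> pts M" using openin_subset[OF U] by simp
  note UMm = smooth_manifold_open_submfd[OF M U]
  have EO: "openin (mtop (tot B)) ?E" using smooth_map_on_openin[OF s2] .
  have ET: "?E \<subseteq> pts (tot B)" by (auto simp: tot_over_def)
  have D: "pts (prod_mfd ?UM ?F) = ?D" using UM by auto
  have E: "pts ?TE = ?E" by (auto simp: tot_over_def)
  have i1': "\<phi> (u, x) \<in> ?E" "proj B (\<phi> (u, x)) = u" if "u \<in> U" "x \<in> pts ?F" for u x
    using i1[OF that] that by (auto simp: tot_over_def)
  have pU: "proj B b \<in> U" if "b \<in> ?E" for b using that by (simp add: tot_over_def)
  have bij: "bij_betw \<phi> ?D ?E"
    by (rule bij_betw_byWitness[where f' = "\<lambda>b. (proj B b, \<psi> b)"]) (use i1' i2 i3 pU in auto)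
  have inv: "inv_into ?D \<phi> b = (proj B b, \<psi> b)" if "b \<in> ?E" for b
    by (rule inv_into_f_eq[OF bij_betw_imp_inj_on[OF bij]]) (use that i3 pU in auto)
  have chP: "charted (prod_mfd ?UM ?F)" by (rule charted_prod[OF charted_submfd chF])
  have "smooth_map (prod_mfd ?UM ?F) (prod_mfd M ?F) (\<lambda>p. (fst p, snd p))"
  proof (rule smooth_map_on_Pair)
    show "smooth_map (prod_mfd ?UM ?F) M fst"
      by (rule smooth_map_on_compose[OF chP UMm chM smooth_map_fst[OF UMm chF] smooth_map_submfd_inclusion[OF chM]]) auto
    show "smooth_map (prod_mfd ?UM ?F) ?F snd" by (rule smooth_map_snd[OF F charted_submfd])
  qed
  then have "smooth_map (prod_mfd ?UM ?F) (tot B) (\<lambda>p. \<phi> (fst p, snd p))"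
    by (rule smooth_map_on_compose[OF chP smooth_manifold_prod[OF M F] chT _ s1]) (use D in auto)
  then have "smooth_map (prod_mfd ?UM ?F) ?TE (\<lambda>p. \<phi> (fst p, snd p))"
    by (rule smooth_map_on_into_submfd[OF chP T]) (use i1' D in auto)
  then have d1: "smooth_map (prod_mfd ?UM ?F) ?TE \<phi>" by simp
  have "smooth_map_on ?TE M (?E \<inter> pts (tot B)) (proj B)" "smooth_map_on ?TE ?F (?E \<inter> ?E) \<psi>"
    using smooth_map_on_from_submfd[OF T chM p ET] smooth_map_on_from_submfd[OF T chF s2 ET] by auto
  then have "smooth_map_on ?TE (prod_mfd ?UM ?F) ?E (\<lambda>b. (proj B b, \<psi> b))"
    using ET pU by (intro smooth_map_on_Pair smooth_map_on_into_submfd[OF charted_submfd M]) (auto simp: Int_absorb2)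
  then have d2: "smooth_map_on ?TE (prod_mfd ?UM ?F) ?E (inv_into ?D \<phi>)"
    by (rule smooth_map_on_cong[OF charted_submfd chP]) (simp add: inv)
  have dif: "diffeomorphism (prod_mfd ?UM ?F) ?TE \<phi>"
    unfolding diffeomorphism_def D E using bij d1 d2 by (simp only: D)
  have fiber: "diffeomorphism ?F (submfd (tot B) (tot_over B {u}) (mdim ?F)) (\<lambda>x. \<phi> (u, x)) \<and>
      gset_iso (bgrp B) (pts ?F) (fibact B) (tot_over B {u}) (act B) (\<lambda>x. \<phi> (u, x))" if u: "u \<in> U" for u
  proof -
    let ?A = "tot_over B {u}"
    let ?TA = "submfd (tot B) ?A (mdim ?F)"
    have AE: "?A \<subseteq> ?E" using u by (auto simp: tot_over_def)
    have A: "pts ?TA = ?A" by (auto simp: tot_over_def)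
    have pA: "proj B b = u" if "b \<in> ?A" for b using that by (simp add: tot_over_def)
    have bA: "bij_betw (\<lambda>x. \<phi> (u, x)) (pts ?F) ?A"
    proof (rule bij_betw_byWitness[where f' = \<psi>])
      show "\<forall>b\<in>?A. \<phi> (u, \<psi> b) = b" using i3(2) AE pA by (metis subsetD)
      show "\<psi> ` ?A \<subseteq> pts ?F" using i3(1) AE by blast
    qed (use i1 i2 u in auto)
    have "smooth_map ?F (prod_mfd M ?F) (\<lambda>x. (u, x))"
      by (intro smooth_map_on_Pair smooth_map_on_const smooth_map_on_id[OF F] openin_topspace) (use u UM in auto)
    then have "smooth_map ?F (tot B) (\<lambda>x. \<phi> (u, x))"
      by (rule smooth_map_on_compose[OF chF smooth_manifold_prod[OF M F] chT _ s1]) (use u in auto)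
    then have a1: "smooth_map ?F ?TA (\<lambda>x. \<phi> (u, x))"
      by (rule smooth_map_on_into_submfd[OF chF T]) (use i1 u in auto)
    have "smooth_map_on ?TA ?F (?A \<inter> ?E) \<psi>"
      by (rule smooth_map_on_from_submfd[OF T chF s2]) (use AE ET in auto)
    then have "smooth_map_on ?TA ?F ?A \<psi>" using AE by (simp add: Int_absorb2)
    then have a2: "smooth_map_on ?TA ?F ?A (inv_into (pts ?F) (\<lambda>x. \<phi> (u, x)))"
    proof (rule smooth_map_on_cong[OF charted_submfd chF])
      fix b assume b: "b \<in> ?A"
      show "\<psi> b = inv_into (pts ?F) (\<lambda>x. \<phi> (u, x)) b"
        by (rule inv_into_f_eq[OF bij_betw_imp_inj_on[OF bA], symmetric])
          (use i3[of b] pA[OF b] b AE in auto)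
    qed
    have "diffeomorphism ?F ?TA (\<lambda>x. \<phi> (u, x))"
      unfolding diffeomorphism_def A using bA a1 a2 by simp
    then show ?thesis using bA i4 u by (simp add: gset_iso_def)
  qed
  show ?thesis
    unfolding local_trivialization_def using U dif i1' fiber by blast
qed

locale semi_principal_bundle =
  fixes M :: "'m mfd" and B :: "('m, 'b, 'g, 'f) gbundle"
  assumes base: "smooth_manifold M" and semi_principal: "semi_principal M B"
begin

lemma semi_principal_facts:
  "semi_torsor (sgrp B) (fib B) (fibact B)" "G_manifold (sgrp B) (fib B) (fibact B)"
  "G_manifold (sgrp B) (tot B) (act B)" "smooth_map (tot B) M (proj B)"
  "smooth_manifold (fib B)" "smooth_manifold (tot B)" "lie_group (sgrp B)"
  using semi_principal by (auto simp: semi_principal_def semi_torsor_def G_manifold_def)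

lemma proj_act: "g \<in> carrier (bgrp B) \<Longrightarrow> b \<in> pts (tot B) \<Longrightarrow> proj B (act B g b) = proj B b"
  using semi_principal by (simp add: semi_principal_def)

lemma proj_in: "b \<in> pts (tot B) \<Longrightarrow> proj B b \<in> pts M"
  using smooth_map_on_into[OF semi_principal_facts(4)] .

lemma tot_over_open: "openin (mtop M) U \<Longrightarrow> openin (mtop (tot B)) (tot_over B U)"
  using smooth_map_on_preimage[OF semi_principal_facts(4)] by (simp add: tot_over_def)

lemma local_product_at:
  assumes "m \<in> pts M"
  obtains U \<phi> \<psi> where "m \<in> U" "local_product M B U \<phi> \<psi>"
proof -
  obtain U \<phi> where "m \<in> U" "local_trivialization M B U \<phi>"
    using semi_principal assms unfolding semi_principal_def by blast
  then show thesis
    using local_trivialization_imp_local_product[OF base semi_principal_facts(5,6,4)] that by blast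
qed

sublocale fib: free_gset "bgrp B" "pts (fib B)" "fibact B"
proof -
  interpret gset "bgrp B" "pts (fib B)" "fibact B"
    by (rule gset_of_group_action) (use semi_principal_facts(2) in \<open>auto simp: G_manifold_def lie_group_def\<close>)
  show "free_gset (bgrp B) (pts (fib B)) (fibact B)"
  proof unfold_locales
    fix g y assume g: "g \<in> carrier (bgrp B)" "y \<in> pts (fib B)" "fibact B g y = y"
    then have "g \<in> stabilizer (bgrp B) (fibact B) y" by (simp add: stabilizer_def)
    then show "g = \<one>\<^bsub>bgrp B\<^esub>" using semi_principal_facts(1) g by (simp add: semi_torsor_def)
  qed
qed

sublocale tot: free_gset "bgrp B" "pts (tot B)" "act B"
proof -
  interpret tg: gset "bgrp B" "pts (tot B)" "act B"
    by (rule gset_of_group_action) (use semi_principal_facts(3) in \<open>auto simp: G_manifold_def lie_group_def\<close>)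
  show "free_gset (bgrp B) (pts (tot B)) (act B)"
  proof unfold_locales
    fix g b assume g: "g \<in> carrier (bgrp B)" "b \<in> pts (tot B)" "act B g b = b"
    obtain U \<phi> \<psi> where U: "proj B b \<in> U" "local_product M B U \<phi> \<psi>" using local_product_at[OF proj_in[OF g(2)]] .
    then have b: "b \<in> tot_over B U" using g by (simp add: tot_over_def)
    then have "\<psi> b \<in> pts (fib B)" "b = \<phi> (proj B b, \<psi> b)" using U(2) by (auto simp: local_product_def)
    moreover from this have "\<phi> (proj B b, fibact B g (\<psi> b)) = b"
      using U g unfolding local_product_def by metis
    ultimately have "fibact B g (\<psi> b) = \<psi> b"
      using U g(1) fib.closed unfolding local_product_def by metis
    then show "g = \<one>\<^bsub>bgrp B\<^esub>" using fib.free g(1) \<open>\<psi> b \<in> pts (fib B)\<close> by blast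
  qed
qed

lemma fiber_free_gset: "free_gset (bgrp B) (tot_over B {m}) (act B)"
  by (rule tot.free_gset_subset) (auto simp: tot_over_def proj_act tot.closed)

lemma local_product_gset_iso:
  assumes "local_product M B U \<phi> \<psi>" "u \<in> U"
  shows "gset_iso (bgrp B) (pts (fib B)) (fibact B) (tot_over B {u}) (act B) (\<lambda>x. \<phi> (u, x))"
    "gset_iso (bgrp B) (tot_over B {u}) (act B) (pts (fib B)) (fibact B) \<psi>"
proof -
  have "local_trivialization M B U \<phi>"
    by (rule local_product_imp_local_trivialization[OF base semi_principal_facts(5,6,4) assms(1)])
  then show 1: "gset_iso (bgrp B) (pts (fib B)) (fibact B) (tot_over B {u}) (act B) (\<lambda>x. \<phi> (u, x))"
    using assms(2) by (auto simp: local_trivialization_def)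
  have l: "\<psi> (\<phi> (u, x)) = x" if "x \<in> pts (fib B)" for x
    using assms that unfolding local_product_def by blast
  have r: "\<psi> b \<in> pts (fib B)" "\<phi> (u, \<psi> b) = b" if "b \<in> tot_over B {u}" for b
  proof -
    have "b \<in> tot_over B U" "proj B b = u" using that assms(2) by (auto simp: tot_over_def)
    then show "\<psi> b \<in> pts (fib B)" "\<phi> (u, \<psi> b) = b" using assms(1) unfolding local_product_def by blast+
  qed
  have mem: "\<phi> (u, x) \<in> tot_over B {u}" if "x \<in> pts (fib B)" for x
    using assms that unfolding local_product_def by blast
  have "bij_betw \<psi> (tot_over B {u}) (pts (fib B))"
    by (rule bij_betw_byWitness[where f' = "\<lambda>x. \<phi> (u, x)"]) (use l r mem in auto)
  moreover have "\<psi> (act B g b) = fibact B g (\<psi> b)" if gb: "g \<in> carrier (bgrp B)" "b \<in> tot_over B {u}" for g b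
  proof -
    have "act B g b = \<phi> (u, fibact B g (\<psi> b))"
      using 1 gb r[OF gb(2)] by (auto simp: gset_iso_def)
    then show ?thesis using l fib.closed gb r by simp
  qed
  ultimately show "gset_iso (bgrp B) (tot_over B {u}) (act B) (pts (fib B)) (fibact B) \<psi>"
    by (simp add: gset_iso_def)
qed

lemma card_fiber_orbits:
  assumes "m \<in> pts M"
  shows "card (orbits (bgrp B) (tot_over B {m}) (act B)) = index_size B"
proof -
  obtain U \<phi> \<psi> where U: "m \<in> U" "local_product M B U \<phi> \<psi>" using local_product_at[OF assms] .
  show ?thesis
    using card_orbits_iso(1)[OF fib.gset_axioms local_product_gset_iso(1)[OF U(2,1)]]
    by (simp add: index_size_def fiber_orbits_def)
qed

lemma fib_orbit_open:
  assumes x: "x \<in> pts (fib B)"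
  shows "openin (mtop (fib B)) (orbit (bgrp B) (fibact B) x)"
proof -
  have "openin (orbit_topology (bgrp B) (mtop (fib B)) (fibact B)) {orbit (bgrp B) (fibact B) x}"
    using semi_principal_facts(1) fib.orbits_mem[OF x] by (simp add: semi_torsor_def)
  then show ?thesis unfolding openin_orbit_topology[OF fib.gset_axioms] by simp
qed

lemma fib_free_open_orbit: "x \<in> pts (fib B) \<Longrightarrow> free_open_orbit (sgrp B) (fib B) (fibact B) x"
  by unfold_locales (use semi_principal_facts(2) fib.free fib_orbit_open in auto)

end

section \<open>Orbit bundles and the two categories\<close>

lemma lie_group_facts:
  assumes "lie_group G"
  shows "group (grp G)" "smooth_manifold (gmfd G)" "pts (gmfd G) = carrier (grp G)"
    "smooth_map (prod_mfd (gmfd G) (gmfd G)) (gmfd G) (\<lambda>(g, h). g \<otimes>\<^bsub>grp G\<^esub> h)"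
    "smooth_map (gmfd G) (gmfd G) (\<lambda>g. inv\<^bsub>grp G\<^esub> g)"
  using assms by (auto simp: lie_group_def)

lemma lie_hom_id: "lie_group G \<Longrightarrow> lie_hom G G (\<lambda>g. g)"
  unfolding lie_hom_def using smooth_map_on_id[OF _ openin_topspace, of "gmfd G"]
  by (auto simp: lie_group_def hom_def)

lemma lie_hom_compose:
  assumes G: "lie_group G" and H: "lie_group H" and K: "lie_group K"
    and \<xi>: "lie_hom G H \<xi>" and \<eta>: "lie_hom H K \<eta>"
  shows "lie_hom G K (\<lambda>g. \<eta> (\<xi> g))"
proof -
  have "\<eta> \<circ> \<xi> \<in> hom (grp G) (grp K)" using \<xi> \<eta> hom_compose by (auto simp: lie_hom_def)
  moreover have "smooth_map (gmfd G) (gmfd K) (\<lambda>g. \<eta> (\<xi> g))"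
    by (rule smooth_map_on_compose[OF smooth_manifold_charted[OF lie_group_facts(2)[OF G]] lie_group_facts(2)[OF H]
          smooth_manifold_charted[OF lie_group_facts(2)[OF K]]])
      (use \<xi> \<eta> smooth_map_on_into[of "gmfd G" "gmfd H" "pts (gmfd G)" \<xi>] in \<open>auto simp: lie_hom_def\<close>)
  ultimately show ?thesis by (simp add: lie_hom_def o_def)
qed

lemma lie_hom_closed: "lie_hom G H \<xi> \<Longrightarrow> g \<in> carrier (grp G) \<Longrightarrow> \<xi> g \<in> carrier (grp H)"
  by (auto simp: lie_hom_def hom_def)

lemma equivariant_mapsD:
  assumes "\<alpha> \<in> equivariant_maps A B"
  shows "\<alpha> \<in> extensional (pts (tot A))" "smooth_map (tot A) (tot B) \<alpha>"
    "\<And>b. b \<in> pts (tot A) \<Longrightarrow> proj B (\<alpha> b) = proj A b"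
    "\<And>b. b \<in> pts (tot A) \<Longrightarrow> \<alpha> b \<in> pts (tot B)"
    "\<alpha> \<in> pts (tot A) \<rightarrow> pts (tot B)"
  using assms smooth_map_on_into[of "tot A" "tot B" "pts (tot A)" \<alpha>] by (auto simp: equivariant_maps_def)

lemma equivariant_maps_along:
  assumes "\<alpha> \<in> equivariant_maps A B"
  obtains \<xi> where "lie_hom (sgrp A) (sgrp B) \<xi>"
    "\<And>g b. g \<in> carrier (bgrp A) \<Longrightarrow> b \<in> pts (tot A) \<Longrightarrow> \<alpha> (act A g b) = act B (\<xi> g) (\<alpha> b)"
  using assms by (auto simp: equivariant_maps_def equivariant_along_def)

lemma equivariant_maps_id:
  assumes "semi_principal_bundle M A"
  shows "(\<lambda>b\<in>pts (tot A). b) \<in> equivariant_maps A A"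
proof -
  interpret semi_principal_bundle M A by fact
  have "smooth_map (tot A) (tot A) (\<lambda>b\<in>pts (tot A). b)"
    by (rule smooth_map_on_cong[OF smooth_manifold_charted smooth_manifold_charted smooth_map_on_id])
      (use semi_principal_facts in auto)
  moreover have "equivariant_along A A (\<lambda>g. g) (\<lambda>b\<in>pts (tot A). b)"
    using lie_hom_id[OF semi_principal_facts(7)] tot.closed by (auto simp: equivariant_along_def)
  ultimately show ?thesis unfolding equivariant_maps_def by auto
qed

lemma equivariant_maps_compose:
  assumes "semi_principal_bundle M A" "semi_principal_bundle M B" "semi_principal_bundle M D"
    and \<alpha>: "\<alpha> \<in> equivariant_maps A B" and \<beta>: "\<beta> \<in> equivariant_maps B D"
  shows "compose (pts (tot A)) \<beta> \<alpha> \<in> equivariant_maps A D"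
proof -
  interpret A: semi_principal_bundle M A by fact
  interpret B: semi_principal_bundle M B by fact
  interpret D: semi_principal_bundle M D by fact
  note chA = smooth_manifold_charted[OF A.semi_principal_facts(6)] and chD = smooth_manifold_charted[OF D.semi_principal_facts(6)]
  note aD = equivariant_mapsD[OF \<alpha>] and bD = equivariant_mapsD[OF \<beta>]
  obtain \<xi> where \<xi>: "lie_hom (sgrp A) (sgrp B) \<xi>"
    "\<And>g b. g \<in> carrier (bgrp A) \<Longrightarrow> b \<in> pts (tot A) \<Longrightarrow> \<alpha> (act A g b) = act B (\<xi> g) (\<alpha> b)"
    using equivariant_maps_along[OF \<alpha>] by metis
  obtain \<eta> where \<eta>: "lie_hom (sgrp B) (sgrp D) \<eta>"
    "\<And>g b. g \<in> carrier (bgrp B) \<Longrightarrow> b \<in> pts (tot B) \<Longrightarrow> \<beta> (act B g b) = act D (\<eta> g) (\<beta> b)"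
    using equivariant_maps_along[OF \<beta>] by metis
  have "smooth_map (tot A) (tot D) (\<lambda>b. \<beta> (\<alpha> b))"
    by (rule smooth_map_on_compose[OF chA B.semi_principal_facts(6) chD aD(2) bD(2)]) (rule aD(4))
  then have "smooth_map (tot A) (tot D) (compose (pts (tot A)) \<beta> \<alpha>)"
    by (rule smooth_map_on_cong[OF chA chD]) (simp add: compose_def)
  moreover have "equivariant_along A D (\<lambda>g. \<eta> (\<xi> g)) (compose (pts (tot A)) \<beta> \<alpha>)"
    unfolding equivariant_along_def
    using lie_hom_compose[OF A.semi_principal_facts(7) B.semi_principal_facts(7) D.semi_principal_facts(7) \<xi>(1) \<eta>(1)]
      \<xi>(2) \<eta>(2) A.tot.closed aD(4) lie_hom_closed[OF \<xi>(1)] by (simp add: compose_def)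
  ultimately show ?thesis
    using aD bD unfolding equivariant_maps_def by (auto simp: compose_def)
qed

lemma mtop_orbit_mfd [simp]: "mtop (orbit_mfd M B) = orbit_topology (bgrp B) (mtop (tot B)) (act B)"
  and mdim_orbit_mfd [simp]: "mdim (orbit_mfd M B) = mdim M"
  by (simp_all add: orbit_mfd_def Let_def)

context semi_principal_bundle begin

abbreviation "Orbits \<equiv> orbits (bgrp B) (pts (tot B)) (act B)"
abbreviation "Orbit_top \<equiv> orbit_topology (bgrp B) (mtop (tot B)) (act B)"

lemmas openin_Orbit_top = openin_orbit_topology[OF tot.gset_axioms]
lemmas topspace_Orbit_top [simp] = topspace_orbit_topology[OF tot.gset_axioms]

lemma orbit_proj_mem: "W \<in> Orbits \<Longrightarrow> b \<in> W \<Longrightarrow> orbit_proj B W = proj B b"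
proof -
  assume W: "W \<in> Orbits" "b \<in> W"
  then have b: "b \<in> pts (tot B)" "W = orbit (bgrp B) (act B) b" using tot.orbits_elim by auto
  have "proj B ` W = {proj B b}"
    using proj_act[OF _ b(1)] tot.orbit_refl[OF b(1)] unfolding b(2) orbit_def by (auto simp: image_iff)
  then show ?thesis by (simp add: orbit_proj_def)
qed

lemma orbit_proj_orbit: "b \<in> pts (tot B) \<Longrightarrow> orbit_proj B (orbit (bgrp B) (act B) b) = proj B b"
  using orbit_proj_mem tot.orbits_mem tot.orbit_refl by blast

text \<open>
  Through each point of \<open>B\<close> there is a local section of the projection.
\<close>

lemma proj_open_map: "openin (mtop (tot B)) N \<Longrightarrow> openin (mtop M) (proj B ` N)"
proof (subst openin_subopen, intro ballI)
  fix m assume N: "openin (mtop (tot B)) N" and "m \<in> proj B ` N"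
  then obtain b where b: "b \<in> N" "m = proj B b" by auto
  then have bT: "b \<in> pts (tot B)" using openin_subset[OF N] by blast
  obtain U \<phi> \<psi> where U: "m \<in> U" "local_product M B U \<phi> \<psi>" using local_product_at[OF proj_in[OF bT]] b by metis
  note chM = smooth_manifold_charted[OF base] and chT = smooth_manifold_charted[OF semi_principal_facts(6)]
  have UO: "openin (mtop M) U" using U(2) by (simp add: local_product_def)
  have bU: "b \<in> tot_over B U" using b bT U by (simp add: tot_over_def)
  have x: "\<psi> b \<in> pts (fib B)" "\<phi> (m, \<psi> b) = b" using bU U(2) b unfolding local_product_def by blast+
  have "smooth_map_on M (prod_mfd M (fib B)) U (\<lambda>u. (u, \<psi> b))"
    by (intro smooth_map_on_Pair smooth_map_on_id[OF base UO] smooth_map_on_const UO x)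
  then have "smooth_map_on M (tot B) U (\<lambda>u. \<phi> (u, \<psi> b))"
    by (rule smooth_map_on_compose[OF chM smooth_manifold_prod[OF base semi_principal_facts(5)] chT])
      (use U(2) x in \<open>auto simp: local_product_def\<close>)
  from smooth_map_on_preimage[OF this N]
  have "openin (mtop M) {u \<in> U. \<phi> (u, \<psi> b) \<in> N}" .
  moreover have "{u \<in> U. \<phi> (u, \<psi> b) \<in> N} \<subseteq> proj B ` N"
  proof
    fix u assume u: "u \<in> {u \<in> U. \<phi> (u, \<psi> b) \<in> N}"
    then have "\<phi> (u, \<psi> b) \<in> tot_over B {u}" using U(2) x unfolding local_product_def by blast
    then show "u \<in> proj B ` N" using u by (auto simp: tot_over_def intro!: image_eqI[of u "proj B" "\<phi> (u, \<psi> b)"])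
  qed
  ultimately show "\<exists>T. openin (mtop M) T \<and> m \<in> T \<and> T \<subseteq> proj B ` N"
    using U b x by (intro exI[of _ "{u \<in> U. \<phi> (u, \<psi> b) \<in> N}"]) auto
qed

lemma orbit_map_id: "orbit_map B (\<lambda>b\<in>pts (tot B). b) W = W" if W: "W \<in> Orbits"
proof -
  have "orbit (bgrp B) (act B) ((\<lambda>b\<in>pts (tot B). b) b) = W" if "b \<in> W" for b
    using tot.orbits_elim[OF W that] by simp
  moreover obtain b where "b \<in> W" using tot.orbits_nonempty[OF W] tot.orbit_refl by blast
  ultimately show ?thesis unfolding orbit_map_def by auto
qed

end

text \<open>
  In charts \<open>c \<circ> p\<close> and \<open>c' \<circ> p\<close> induced from \<open>M\<close>, a map over \<open>M\<close> is a transition map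
  of \<open>M\<close>.
\<close>

lemma smooth_map_orbit_mfd:
  assumes "semi_principal_bundle M A" "semi_principal_bundle M B"
    and cont: "continuous_map (mtop (orbit_mfd M A)) (mtop (orbit_mfd M B)) \<beta>"
    and p: "\<And>W. W \<in> pts (orbit_mfd M A) \<Longrightarrow> orbit_proj B (\<beta> W) = orbit_proj A W"
  shows "smooth_map (orbit_mfd M A) (orbit_mfd M B) \<beta>"
  unfolding smooth_map_on_def
proof (intro conjI openin_topspace)
  interpret A: semi_principal_bundle M A by fact
  interpret B: semi_principal_bundle M B by fact
  note chM = smooth_manifold_charted[OF A.base]
  let ?TA = "mtop (orbit_mfd M A)" and ?TB = "mtop (orbit_mfd M B)"
  show "continuous_map (subtopology ?TA (topspace ?TA)) ?TB \<beta>" using cont by (metis subtopology_topspace)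
  show "\<forall>(U, c)\<in>atlas (orbit_mfd M A). \<forall>(V, d)\<in>atlas (orbit_mfd M B).
       smooth_euclidean (mdim (orbit_mfd M A)) (mdim (orbit_mfd M B)) (c ` (U \<inter> topspace ?TA \<inter> \<beta> -` V)) (d \<circ> \<beta> \<circ> inv_into U c)"
  proof clarify
    fix V e V' e' assume "(V, e) \<in> atlas (orbit_mfd M A)" and "(V', e') \<in> atlas (orbit_mfd M B)"
    then obtain U c U' c' where V: "e = c \<circ> orbit_proj A" "(U, c) \<in> atlas M" "openin ?TA V"
        "openin (mtop M) (orbit_proj A ` V)" "orbit_proj A ` V \<subseteq> U"
        "homeomorphic_map (subtopology ?TA V) (subtopology (mtop M) (orbit_proj A ` V)) (orbit_proj A)"
      and V': "e' = c' \<circ> orbit_proj B" "(U', c') \<in> atlas M" "openin ?TB V'" "orbit_proj B ` V' \<subseteq> U'"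
      by (auto simp: orbit_mfd_def Let_def)
    let ?V1 = "V \<inter> topspace ?TA \<inter> \<beta> -` V'"
    have VA: "V \<subseteq> topspace ?TA" by (rule openin_subset[OF V(3)])
    have V1: "openin ?TA ?V1"
    proof -
      have "openin ?TA ({W \<in> topspace ?TA. \<beta> W \<in> V'} \<inter> V)"
        using openin_continuous_map_preimage[OF cont V'(3)] V(3) by blast
      moreover have "{W \<in> topspace ?TA. \<beta> W \<in> V'} \<inter> V = ?V1" by auto
      ultimately show ?thesis by simp
    qed
    have "open_map (subtopology ?TA V) (subtopology (mtop M) (orbit_proj A ` V)) (orbit_proj A)"
      by (rule homeomorphic_imp_open_map[OF V(6)])
    moreover have "openin (subtopology ?TA V) ?V1" using V1 openin_open_subtopology[OF V(3)] by auto
    ultimately have "openin (subtopology (mtop M) (orbit_proj A ` V)) (orbit_proj A ` ?V1)"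
      unfolding open_map_def by blast
    then have pV1: "openin (mtop M) (orbit_proj A ` ?V1)" using openin_open_subtopology[OF V(4)] by auto
    have eV1: "e ` ?V1 = c ` (U \<inter> orbit_proj A ` ?V1)" using V(1,5) by auto
    have O0: "openin (Euclidean_space (mdim M)) (e ` ?V1)"
      unfolding eV1 by (rule is_chart_image_open[OF chartedD[OF chM V(2)] pV1])
    have "topspace (subtopology ?TA V) = V" by (rule topspace_subtopology_subset[OF VA])
    then have pinj: "inj_on (orbit_proj A) V" using homeomorphic_imp_injective_map[OF V(6)] by simp
    have einj: "inj_on e V" unfolding V(1)
      by (rule comp_inj_on[OF pinj inj_on_subset[OF chart_inj[OF chM V(2)] V(5)]])
    note tr = chart_transition[OF A.base V(2) V'(2)]
    have sub: "e ` ?V1 \<subseteq> c ` (U \<inter> U')"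
    proof
      fix z assume "z \<in> e ` ?V1"
      then obtain W where W: "W \<in> ?V1" "z = c (orbit_proj A W)" by (auto simp: V(1))
      have "orbit_proj A W = orbit_proj B (\<beta> W)" using p W(1) by simp
      then have "orbit_proj A W \<in> U \<inter> U'" using W(1) V(5) V'(4) by auto
      then show "z \<in> c ` (U \<inter> U')" using W(2) by blast
    qed
    have "smooth_euclidean (mdim M) (mdim M) (e ` ?V1) (e' \<circ> \<beta> \<circ> inv_into V e)"
    proof (rule smooth_euclidean_cong[OF O0 _ smooth_euclidean_subset[OF tr sub]])
      fix z assume "z \<in> e ` ?V1"
      then obtain W where W: "W \<in> ?V1" "z = e W" by blast
      have "inv_into V e z = W" using einj W by (simp add: inv_into_f_f)
      moreover have "inv_into U c z = orbit_proj A W"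
        using W V(1,5) chart_inj[OF chM V(2)] by (auto simp: inv_into_f_f)
      ultimately show "(c' \<circ> inv_into U c) z = (e' \<circ> \<beta> \<circ> inv_into V e) z"
        using p W(1) by (simp add: V'(1))
    qed
    then show "smooth_euclidean (mdim (orbit_mfd M A)) (mdim (orbit_mfd M B)) (e ` ?V1) (e' \<circ> \<beta> \<circ> inv_into V e)" by simp
  qed
qed

lemma orbit_bundle_iso_iff:
  assumes "semi_principal_bundle M A" "semi_principal_bundle M B"
  shows "orbit_bundle_iso M A B \<beta> \<longleftrightarrow>
    homeomorphic_map (mtop (orbit_mfd M A)) (mtop (orbit_mfd M B)) \<beta> \<and>
    (\<forall>W\<in>pts (orbit_mfd M A). orbit_proj B (\<beta> W) = orbit_proj A W)"
proof -
  let ?A = "orbit_mfd M A" and ?B = "orbit_mfd M B"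
  have "diffeomorphism ?A ?B \<beta> \<longleftrightarrow> homeomorphic_map (mtop ?A) (mtop ?B) \<beta>"
    if p: "\<forall>W\<in>pts ?A. orbit_proj B (\<beta> W) = orbit_proj A W"
  proof
    assume d: "diffeomorphism ?A ?B \<beta>"
    then have b: "bij_betw \<beta> (pts ?A) (pts ?B)" by (simp add: diffeomorphism_def)
    have "homeomorphic_maps (mtop ?A) (mtop ?B) \<beta> (inv_into (pts ?A) \<beta>)"
      unfolding homeomorphic_maps_def
    proof (intro conjI ballI)
      show "continuous_map (mtop ?A) (mtop ?B) \<beta>" "continuous_map (mtop ?B) (mtop ?A) (inv_into (pts ?A) \<beta>)"
        using d by (simp_all only: diffeomorphism_def smooth_map_on_def subtopology_topspace)
    qed (use bij_betw_inv_into_left[OF b] bij_betw_inv_into_right[OF b] in auto)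
    then show "homeomorphic_map (mtop ?A) (mtop ?B) \<beta>" using homeomorphic_map_maps by blast
  next
    assume h: "homeomorphic_map (mtop ?A) (mtop ?B) \<beta>"
    then have b: "bij_betw \<beta> (pts ?A) (pts ?B)"
      by (simp only: bij_betw_def homeomorphic_imp_injective_map homeomorphic_imp_surjective_map)
    obtain \<gamma> where g: "homeomorphic_maps (mtop ?A) (mtop ?B) \<beta> \<gamma>" using h homeomorphic_map_maps by blast
    have eq: "\<gamma> W = inv_into (pts ?A) \<beta> W" if W: "W \<in> pts ?B" for W
    proof -
      have "\<gamma> W \<in> pts ?A" "\<beta> (\<gamma> W) = W" using g W unfolding homeomorphic_maps_def continuous_map_def by auto
      then show ?thesis using inv_into_f_f[OF bij_betw_imp_inj_on[OF b]] by metis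
    qed
    have ci: "continuous_map (mtop ?B) (mtop ?A) (inv_into (pts ?A) \<beta>)"
      by (rule continuous_map_eq[of _ _ \<gamma>]) (use g eq in \<open>simp_all only: homeomorphic_maps_def\<close>)
    show "diffeomorphism ?A ?B \<beta>"
      unfolding diffeomorphism_def
    proof (intro conjI b)
      show "smooth_map ?A ?B \<beta>"
        by (rule smooth_map_orbit_mfd[OF assms homeomorphic_imp_continuous_map[OF h]]) (use p in blast)
      show "smooth_map ?B ?A (inv_into (pts ?A) \<beta>)"
      proof (rule smooth_map_orbit_mfd[OF assms(2,1) ci])
        fix W assume W: "W \<in> pts ?B"
        have "inv_into (pts ?A) \<beta> W \<in> pts ?A" "\<beta> (inv_into (pts ?A) \<beta> W) = W"
          using bij_betwE[OF bij_betw_inv_into[OF b]] bij_betw_inv_into_right[OF b] W by blast+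
        then show "orbit_proj A (inv_into (pts ?A) \<beta> W) = orbit_proj B W" using p by metis
      qed
    qed
  qed
  then show ?thesis unfolding orbit_bundle_iso_def by blast
qed

text \<open>
  Equivariance makes the orbit of \<open>\<alpha> b\<close> independent of the choice of \<open>b\<close> in its orbit.
\<close>

lemma orbit_map_orbit:
  assumes "semi_principal_bundle M A" "semi_principal_bundle M B"
    and \<alpha>: "\<alpha> \<in> equivariant_maps A B" and b: "b \<in> pts (tot A)"
  shows "orbit_map B \<alpha> (orbit (bgrp A) (act A) b) = orbit (bgrp B) (act B) (\<alpha> b)"
proof -
  interpret A: semi_principal_bundle M A by fact
  interpret B: semi_principal_bundle M B by fact
  obtain \<xi> where \<xi>: "lie_hom (sgrp A) (sgrp B) \<xi>"
    "\<And>g b. g \<in> carrier (bgrp A) \<Longrightarrow> b \<in> pts (tot A) \<Longrightarrow> \<alpha> (act A g b) = act B (\<xi> g) (\<alpha> b)"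
    using equivariant_maps_along[OF \<alpha>] by metis
  have "orbit (bgrp B) (act B) (\<alpha> c) = orbit (bgrp B) (act B) (\<alpha> b)" if c: "c \<in> orbit (bgrp A) (act A) b" for c
  proof -
    obtain g where g: "g \<in> carrier (bgrp A)" "c = act A g b" using c unfolding orbit_def by blast
    show ?thesis unfolding g(2) \<xi>(2)[OF g(1) b]
      by (rule B.tot.orbit_act[OF lie_hom_closed[OF \<xi>(1) g(1)] equivariant_mapsD(4)[OF \<alpha> b]])
  qed
  then have "orbit_map B \<alpha> (orbit (bgrp A) (act A) b) = (\<Union>c\<in>orbit (bgrp A) (act A) b. orbit (bgrp B) (act B) (\<alpha> b))"
    unfolding orbit_map_def by (rule SUP_cong[OF refl])
  moreover have "orbit (bgrp A) (act A) b \<noteq> {}" using A.tot.orbit_refl[OF b] by blast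
  ultimately show ?thesis by simp
qed

lemma orbit_bundle_iso_compose:
  assumes A: "semi_principal_bundle M A" and B: "semi_principal_bundle M B" and D: "semi_principal_bundle M D"
    and \<alpha>: "\<alpha> \<in> equivariant_maps A B" "orbit_bundle_iso M A B (orbit_map B \<alpha>)"
    and \<beta>: "\<beta> \<in> equivariant_maps B D" "orbit_bundle_iso M B D (orbit_map D \<beta>)"
  shows "orbit_bundle_iso M A D (orbit_map D (compose (pts (tot A)) \<beta> \<alpha>))"
proof -
  interpret A: semi_principal_bundle M A by fact
  interpret B: semi_principal_bundle M B by fact
  note ha = \<alpha>(2)[unfolded orbit_bundle_iso_iff[OF A B]] and hb = \<beta>(2)[unfolded orbit_bundle_iso_iff[OF B D]]
  have eq: "orbit_map D \<beta> (orbit_map B \<alpha> W) = orbit_map D (compose (pts (tot A)) \<beta> \<alpha>) W"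
    if W: "W \<in> A.Orbits" for W
  proof -
    obtain b where b: "b \<in> pts (tot A)" "W = orbit (bgrp A) (act A) b" using A.tot.orbits_nonempty[OF W] by blast
    show ?thesis
      unfolding b(2) orbit_map_orbit[OF A B \<alpha>(1) b(1)] orbit_map_orbit[OF B D \<beta>(1) equivariant_mapsD(4)[OF \<alpha>(1) b(1)]]
        orbit_map_orbit[OF A D equivariant_maps_compose[OF A B D \<alpha>(1) \<beta>(1)] b(1)]
      using b(1) by (simp add: compose_def)
  qed
  have "homeomorphic_map (mtop (orbit_mfd M A)) (mtop (orbit_mfd M D)) (orbit_map D \<beta> \<circ> orbit_map B \<alpha>)"
    by (rule homeomorphic_map_compose[OF conjunct1[OF ha] conjunct1[OF hb]])
  then have "homeomorphic_map (mtop (orbit_mfd M A)) (mtop (orbit_mfd M D)) (orbit_map D (compose (pts (tot A)) \<beta> \<alpha>))"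
    by (rule homeomorphic_map_eq) (use eq in auto)
  moreover have "orbit_proj D (orbit_map D (compose (pts (tot A)) \<beta> \<alpha>) W) = orbit_proj A W"
    if W: "W \<in> pts (orbit_mfd M A)" for W
  proof -
    have "W \<in> A.Orbits" using W by simp
    moreover have "orbit_map B \<alpha> W \<in> pts (orbit_mfd M B)"
      using homeomorphic_imp_surjective_map[of "mtop (orbit_mfd M A)" "mtop (orbit_mfd M B)" "orbit_map B \<alpha>"] ha W by blast
    ultimately show ?thesis using eq ha hb W by metis
  qed
  ultimately show ?thesis unfolding orbit_bundle_iso_iff[OF A D] by blast
qed

lemma orbit_bundle_iso_id:
  assumes A: "semi_principal_bundle M A"
  shows "orbit_bundle_iso M A A (orbit_map A (\<lambda>b\<in>pts (tot A). b))"
proof -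
  interpret A: semi_principal_bundle M A by fact
  have "homeomorphic_map (mtop (orbit_mfd M A)) (mtop (orbit_mfd M A)) (orbit_map A (\<lambda>b\<in>pts (tot A). b))"
    by (rule homeomorphic_map_eq[of _ _ id]) (use A.orbit_map_id homeomorphic_map_id in auto)
  then show ?thesis unfolding orbit_bundle_iso_iff[OF A A] using A.orbit_map_id by simp
qed

lemma compose_laws:
  assumes "f \<in> equivariant_maps A B"
  shows "compose (pts (tot A)) f (\<lambda>b\<in>pts (tot A). b) = f" "compose (pts (tot A)) (\<lambda>b\<in>pts (tot B). b) f = f"
  using equivariant_mapsD[OF assms] by (auto simp: compose_def fun_eq_iff extensional_def)

lemma category_Prin:
  assumes M: "smooth_manifold M"
  shows "category (Prin M)"
proof -
  have sp: "semi_principal_bundle M A" if "A \<in> Ob (Prin M)" for A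
    using that M by unfold_locales (auto simp: Prin_def principal_def)
  show ?thesis
    unfolding category_def
  proof (intro conjI ballI)
    fix A B D E f g h assume "A \<in> Ob (Prin M)" "B \<in> Ob (Prin M)" "D \<in> Ob (Prin M)" "E \<in> Ob (Prin M)"
      and f: "f \<in> Hom (Prin M) A B" "g \<in> Hom (Prin M) B D" "h \<in> Hom (Prin M) D E"
    show "Comp (Prin M) A D E h (Comp (Prin M) A B D g f) = Comp (Prin M) A B E (Comp (Prin M) B D E h g) f"
      using f equivariant_mapsD(5)[of f A B] by (auto simp: Prin_def intro!: compose_assoc)
  next
    fix A assume "A \<in> Ob (Prin M)"
    then show "Id (Prin M) A \<in> Hom (Prin M) A A"
      using sp equivariant_maps_id by (fastforce simp: Prin_def)
  next
    fix A B D f g assume "A \<in> Ob (Prin M)" "B \<in> Ob (Prin M)" "D \<in> Ob (Prin M)"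
      "f \<in> Hom (Prin M) A B" "g \<in> Hom (Prin M) B D"
    then show "Comp (Prin M) A B D g f \<in> Hom (Prin M) A D"
      using sp[of A] sp[of B] sp[of D] equivariant_maps_compose[of M A B D f g] by (simp add: Prin_def)
  qed (use compose_laws in \<open>auto simp: Prin_def\<close>)
qed

lemma category_SPrin:
  assumes M: "smooth_manifold M"
  shows "category (SPrin M)"
proof -
  have sp: "semi_principal_bundle M A" if "A \<in> Ob (SPrin M)" for A
    using that M by unfold_locales (auto simp: SPrin_def)
  show ?thesis
    unfolding category_def
  proof (intro conjI ballI)
    fix A B D E f g h assume "A \<in> Ob (SPrin M)" "B \<in> Ob (SPrin M)" "D \<in> Ob (SPrin M)" "E \<in> Ob (SPrin M)"
      and f: "f \<in> Hom (SPrin M) A B" "g \<in> Hom (SPrin M) B D" "h \<in> Hom (SPrin M) D E"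
    show "Comp (SPrin M) A D E h (Comp (SPrin M) A B D g f) = Comp (SPrin M) A B E (Comp (SPrin M) B D E h g) f"
      using f equivariant_mapsD(5)[of f A B] by (auto simp: SPrin_def intro!: compose_assoc)
  next
    fix A assume "A \<in> Ob (SPrin M)"
    then show "Id (SPrin M) A \<in> Hom (SPrin M) A A"
      using sp equivariant_maps_id orbit_bundle_iso_id by (fastforce simp: SPrin_def)
  next
    fix A B D f g assume "A \<in> Ob (SPrin M)" "B \<in> Ob (SPrin M)" "D \<in> Ob (SPrin M)"
      "f \<in> Hom (SPrin M) A B" "g \<in> Hom (SPrin M) B D"
    then show "Comp (SPrin M) A B D g f \<in> Hom (SPrin M) A D"
      using sp[of A] sp[of B] sp[of D] equivariant_maps_compose[of M A B D f g] orbit_bundle_iso_compose[of M A B D f g]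
      by (simp add: SPrin_def)
  qed (use compose_laws in \<open>auto simp: SPrin_def\<close>)
qed

locale principal_bundle =
  fixes M :: "'m mfd" and B :: "('m, 'b, 'g, 'f) gbundle"
  assumes base: "smooth_manifold M" and principal: "principal M B"

sublocale principal_bundle \<subseteq> semi_principal_bundle
  by unfold_locales (use base principal in \<open>auto simp: principal_def\<close>)

context principal_bundle begin

lemma fib_transitive: "x \<in> pts (fib B) \<Longrightarrow> y \<in> pts (fib B) \<Longrightarrow> \<exists>g\<in>carrier (bgrp B). fibact B g x = y"
  using principal transitive_action.unique_orbit unfolding principal_def torsor_def by metis

lemma fib_nonempty: "pts (fib B) \<noteq> {}"
  using principal by (simp add: principal_def torsor_def)

lemma fib_orbit: "x \<in> pts (fib B) \<Longrightarrow> orbit (bgrp B) (fibact B) x = pts (fib B)"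
  using fib_transitive fib.orbit_subset by (fastforce simp: orbit_def)

lemma fiber_orbits_eq: "fiber_orbits B = {pts (fib B)}"
proof -
  obtain x where "x \<in> pts (fib B)" using fib_nonempty by blast
  then show ?thesis using fib_orbit unfolding fiber_orbits_def orbits_def by blast
qed

lemma index_size_1: "index_size B = 1"
  by (simp add: index_size_def fiber_orbits_eq)

lemma fiber_transitive:
  assumes b: "b \<in> tot_over B {m}" "b' \<in> tot_over B {m}"
  shows "\<exists>g\<in>carrier (bgrp B). act B g b = b'"
proof -
  have "m \<in> pts M" using b proj_in by (auto simp: tot_over_def)
  then obtain U \<phi> \<psi> where U: "m \<in> U" "local_product M B U \<phi> \<psi>" using local_product_at by blast
  note iso = local_product_gset_iso(2)[OF U(2,1)]
  then have \<psi>: "bij_betw \<psi> (tot_over B {m}) (pts (fib B))"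
    "\<And>g b. g \<in> carrier (bgrp B) \<Longrightarrow> b \<in> tot_over B {m} \<Longrightarrow> \<psi> (act B g b) = fibact B g (\<psi> b)"
    by (auto simp: gset_iso_def)
  obtain g where g: "g \<in> carrier (bgrp B)" "fibact B g (\<psi> b) = \<psi> b'"
    using fib_transitive bij_betwE[OF \<psi>(1)] b by blast
  interpret fm: free_gset "bgrp B" "tot_over B {m}" "act B" by (rule fiber_free_gset)
  have "\<psi> (act B g b) = \<psi> b'" using \<psi>(2)[OF g(1) b(1)] g(2) by simp
  then have "act B g b = b'"
    using bij_betw_imp_inj_on[OF \<psi>(1)] fm.closed[OF g(1) b(1)] b(2) by (auto dest: inj_onD)
  then show ?thesis using g by blast
qed

lemma proj_surj: "m \<in> pts M \<Longrightarrow> \<exists>b. b \<in> tot_over B {m}"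
  using fib_nonempty local_product_at unfolding local_product_def by (metis all_not_in_conv)

text \<open>
  Principal bundles have exactly one orbit in each fiber, and the projection is open.
\<close>

lemma orbit_proj_homeomorphic: "homeomorphic_map Orbit_top (mtop M) (orbit_proj B)"
proof (rule bijective_open_imp_homeomorphic_map)
  have rep: "\<exists>b\<in>pts (tot B). W = orbit (bgrp B) (act B) b \<and> b \<in> W \<and> orbit_proj B W = proj B b" if "W \<in> Orbits" for W
    using tot.orbits_nonempty[OF that] tot.orbit_refl orbit_proj_orbit by blast
  show "continuous_map Orbit_top (mtop M) (orbit_proj B)"
    unfolding continuous_map_def topspace_Orbit_top
  proof (intro conjI allI impI)
    show "orbit_proj B \<in> Orbits \<rightarrow> pts M" using rep proj_in by fastforce
    fix U assume U: "openin (mtop M) U"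
    have "\<Union>{W \<in> Orbits. orbit_proj B W \<in> U} = tot_over B U"
    proof (intro equalityI subsetI)
      fix b assume "b \<in> \<Union>{W \<in> Orbits. orbit_proj B W \<in> U}"
      then obtain W where "W \<in> Orbits" "b \<in> W" "orbit_proj B W \<in> U" by blast
      then show "b \<in> tot_over B U" using orbit_proj_mem tot.orbits_elim by (auto simp: tot_over_def)
    next
      fix b assume "b \<in> tot_over B U"
      then have b: "b \<in> pts (tot B)" "proj B b \<in> U" by (auto simp: tot_over_def)
      then show "b \<in> \<Union>{W \<in> Orbits. orbit_proj B W \<in> U}"
        using tot.orbit_refl[OF b(1)] tot.orbits_mem[OF b(1)] orbit_proj_orbit[OF b(1)] by auto
    qed
    then show "openin Orbit_top {W \<in> Orbits. orbit_proj B W \<in> U}"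
      unfolding openin_Orbit_top using tot_over_open[OF U] by auto
  qed
  show "open_map Orbit_top (mtop M) (orbit_proj B)"
    unfolding open_map_def
  proof (intro allI impI)
    fix V assume "openin Orbit_top V"
    then have V: "V \<subseteq> Orbits" "openin (mtop (tot B)) (\<Union>V)" by (auto simp: openin_Orbit_top)
    have "orbit_proj B ` V = proj B ` \<Union>V"
    proof (intro equalityI subsetI)
      fix m assume "m \<in> orbit_proj B ` V"
      then obtain W where W: "W \<in> V" "m = orbit_proj B W" by blast
      then obtain b where "b \<in> W" "orbit_proj B W = proj B b" using rep[of W] V(1) by blast
      then show "m \<in> proj B ` \<Union>V" using W by blast
    next
      fix m assume "m \<in> proj B ` \<Union>V"
      then obtain W b where W: "W \<in> V" "b \<in> W" "m = proj B b" by blast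
      then have "m = orbit_proj B W" using orbit_proj_mem[of W b] V(1) by auto
      then show "m \<in> orbit_proj B ` V" using W by blast
    qed
    then show "openin (mtop M) (orbit_proj B ` V)" using proj_open_map[OF V(2)] by simp
  qed
  show "orbit_proj B ` topspace Orbit_top = pts M"
    unfolding topspace_Orbit_top
  proof (intro equalityI subsetI)
    fix m assume "m \<in> pts M"
    then obtain b where "b \<in> tot_over B {m}" using proj_surj by blast
    then have b: "b \<in> pts (tot B)" "m = proj B b" by (auto simp: tot_over_def)
    then show "m \<in> orbit_proj B ` Orbits" using orbit_proj_orbit[OF b(1)] tot.orbits_mem[OF b(1)] by (intro image_eqI) auto
  qed (use rep proj_in in fastforce)
  show "inj_on (orbit_proj B) (topspace Orbit_top)"
    unfolding topspace_Orbit_top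
  proof (rule inj_onI)
    fix W W' assume W: "W \<in> Orbits" "W' \<in> Orbits" "orbit_proj B W = orbit_proj B W'"
    obtain b where b: "b \<in> pts (tot B)" "W = orbit (bgrp B) (act B) b" "orbit_proj B W = proj B b" using rep[OF W(1)] by blast
    obtain b' where b': "b' \<in> pts (tot B)" "W' = orbit (bgrp B) (act B) b'" "orbit_proj B W' = proj B b'" using rep[OF W(2)] by blast
    have "b \<in> tot_over B {proj B b}" "b' \<in> tot_over B {proj B b}" using b b' W(3) by (auto simp: tot_over_def)
    then obtain g where "g \<in> carrier (bgrp B)" "act B g b = b'" using fiber_transitive by blast
    then show "W = W'" using tot.orbit_act b b' by metis
  qed
qed

end

text \<open>
  Both orbit bundles are homeomorphic to \<open>M\<close> by their projections, and the map induced by \<open>\<alpha>\<close> is the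
  composite of these homeomorphisms.
\<close>

lemma principal_orbit_bundle_iso:
  assumes A: "principal_bundle M A" and B: "principal_bundle M B" and \<alpha>: "\<alpha> \<in> equivariant_maps A B"
  shows "orbit_bundle_iso M A B (orbit_map B \<alpha>)"
proof -
  interpret A: principal_bundle M A by fact
  interpret B: principal_bundle M B by fact
  have sA: "semi_principal_bundle M A" and sB: "semi_principal_bundle M B" by unfold_locales
  have key: "orbit_map B \<alpha> W \<in> B.Orbits \<and> orbit_proj B (orbit_map B \<alpha> W) = orbit_proj A W" if W: "W \<in> A.Orbits" for W
  proof -
    obtain b where b: "b \<in> pts (tot A)" "W = orbit (bgrp A) (act A) b" using A.tot.orbits_nonempty[OF W] by blast
    show ?thesis
      unfolding b(2) orbit_map_orbit[OF sA sB \<alpha> b(1)]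
      using equivariant_mapsD[OF \<alpha>] b(1) B.tot.orbits_mem B.orbit_proj_orbit A.orbit_proj_orbit by simp
  qed
  obtain q where q: "homeomorphic_maps B.Orbit_top (mtop M) (orbit_proj B) q"
    using B.orbit_proj_homeomorphic homeomorphic_map_maps by blast
  then have "homeomorphic_map (mtop M) B.Orbit_top q" "\<And>W. W \<in> B.Orbits \<Longrightarrow> q (orbit_proj B W) = W"
    by (auto simp: homeomorphic_maps_map)
  then have "homeomorphic_map A.Orbit_top B.Orbit_top (q \<circ> orbit_proj A)"
    and qp: "\<And>W. W \<in> B.Orbits \<Longrightarrow> q (orbit_proj B W) = W"
    using homeomorphic_map_compose[OF A.orbit_proj_homeomorphic] by auto
  then have "homeomorphic_map A.Orbit_top B.Orbit_top (orbit_map B \<alpha>)"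
    by (elim homeomorphic_map_eq) (use key qp in \<open>metis A.topspace_Orbit_top o_apply\<close>)
  then show ?thesis unfolding orbit_bundle_iso_iff[OF sA sB] using key by simp
qed

lemma Prin_full_subcategory:
  assumes M: "smooth_manifold M"
  shows "full_subcategory (Prin M :: (('m, 'b, 'g, 'f) gbundle, 'b \<Rightarrow> 'b) cat) (SPrin M)"
proof -
  have p: "principal_bundle M A" if "A \<in> Ob (Prin M)" for A :: "('m, 'b, 'g, 'f) gbundle"
    using that M by unfold_locales (auto simp: Prin_def)
  have fin: "finite (fiber_orbits A)" if "A \<in> Ob (Prin M)" for A :: "('m, 'b, 'g, 'f) gbundle"
    using principal_bundle.fiber_orbits_eq[OF p[OF that]] by simp
  have "Hom (Prin M) A B = Hom (SPrin M) A B" if "A \<in> Ob (Prin M)" "B \<in> Ob (Prin M)" for A B :: "('m, 'b, 'g, 'f) gbundle"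
    using principal_orbit_bundle_iso[OF p[OF that(1)] p[OF that(2)]] by (auto simp: Prin_def SPrin_def)
  then show ?thesis
    unfolding full_subcategory_def using category_Prin[OF M] category_SPrin[OF M] fin
    by (auto simp: Prin_def SPrin_def principal_def)
qed

section \<open>Wreath products as Lie groups\<close>

text \<open>
  Used for formulas that contain a permutation: permutations are locally constant, and for each
  fixed permutation the formula is smooth.
\<close>

lemma smooth_map_on_locally_constant:
  assumes M: "charted M" and N: "charted N" and S: "openin (mtop M) S"
    and o: "\<And>p. p \<in> S \<Longrightarrow> openin (mtop M) {q \<in> S. k q = k p}"
    and f: "\<And>p. p \<in> S \<Longrightarrow> smooth_map_on M N {q \<in> S. k q = k p} (f (k p))"
  shows "smooth_map_on M N S (\<lambda>p. f (k p) p)"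
proof (rule smooth_map_on_local[OF M N S])
  fix p assume p: "p \<in> S"
  have "smooth_map_on M N {q \<in> S. k q = k p} (\<lambda>q. f (k q) q)"
    by (rule smooth_map_on_cong[OF M N f[OF p], where g = "\<lambda>q. f (k q) q"]) simp
  then show "\<exists>S'. p \<in> S' \<and> smooth_map_on M N S' (\<lambda>p. f (k p) p)"
    using p by (intro exI[of _ "{q \<in> S. k q = k p}"]) simp
qed

lemma group_action_of_gset:
  assumes "gset G E \<phi>" "\<And>g. g \<in> carrier G \<Longrightarrow> \<phi> g \<in> extensional E"
  shows "group_action G E \<phi>"
proof -
  interpret gset G E \<phi> by fact
  have bij: "\<phi> g \<in> Bij E" if g: "g \<in> carrier G" for g
  proof -
    have "bij_betw (\<phi> g) E E"
      by (rule bij_betw_byWitness[where f' = "\<phi> (inv\<^bsub>G\<^esub> g)"]) (use g closed act_inv in auto)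
    then show ?thesis using assms(2)[OF g] by (simp add: Bij_def)
  qed
  have "\<phi> (g \<otimes>\<^bsub>G\<^esub> h) = compose E (\<phi> g) (\<phi> h)" if "g \<in> carrier G" "h \<in> carrier G" for g h
    using that act_mult assms(2)[of "g \<otimes>\<^bsub>G\<^esub> h"] by (auto simp: compose_def fun_eq_iff extensional_def)
  then have "\<phi> \<in> hom G (BijGroup E)" using bij by (auto simp: hom_def BijGroup_def)
  then show ?thesis
    by (simp add: group_action_def group_hom_def group_hom_axioms_def group_BijGroup is_group)
qed

lemma inv_permutes_comp:
  assumes "\<sigma> permutes X" "\<tau> permutes X"
  shows "inv_into UNIV (\<sigma> \<circ> \<tau>) x = inv_into UNIV \<tau> (inv_into UNIV \<sigma> x)"
  using o_inv_distrib[of \<sigma> \<tau>] permutes_bij assms by (metis o_apply)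

lemma inv_permutes_in: "\<sigma> permutes X \<Longrightarrow> inv_into UNIV \<sigma> x \<in> X \<longleftrightarrow> x \<in> X"
  by (rule permutes_in_image[OF permutes_inv])

lemma inv_inv_permutes: "\<sigma> permutes X \<Longrightarrow> inv_into UNIV (inv_into UNIV \<sigma>) = \<sigma>"
  using inv_inv_eq permutes_bij by blast

text \<open>
  The formula \<open>(g, \<sigma>) b = g (b \<circ> \<sigma>\<inverse>)\<close> gives the multiplication of \<open>G wr X\<close>, its action on functions
  \<open>X \<rightarrow> E\<close> and its action on frames; these are treated together.
\<close>

definition wact :: "nat \<Rightarrow> ('g \<Rightarrow> 'a \<Rightarrow> 'a) \<Rightarrow> (nat \<Rightarrow> 'g) \<times> (nat \<Rightarrow> nat) \<Rightarrow> (nat \<Rightarrow> 'a) \<Rightarrow> nat \<Rightarrow> 'a" where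
  "wact n \<phi> w b = (\<lambda>x\<in>{..<n}. \<phi> (fst w x) (b (inv_into UNIV (snd w) x)))"

lemma wreath_group_simps:
  "carrier (wreath_group n G) = ({..<n} \<rightarrow>\<^sub>E carrier G) \<times> {\<sigma>. \<sigma> permutes {..<n}}"
  "v \<otimes>\<^bsub>wreath_group n G\<^esub> w = (wact n (\<lambda>g h. g \<otimes>\<^bsub>G\<^esub> h) v (fst w), snd v \<circ> snd w)"
  "\<one>\<^bsub>wreath_group n G\<^esub> = (\<lambda>x\<in>{..<n}. \<one>\<^bsub>G\<^esub>, id)"
  by (simp_all add: wreath_group_def wact_def case_prod_unfold)

lemma wreath_carrierD:
  assumes "w \<in> carrier (wreath_group n G)"
  shows "snd w permutes {..<n}" "fst w \<in> {..<n} \<rightarrow>\<^sub>E carrier G" "\<And>x. x < n \<Longrightarrow> fst w x \<in> carrier G"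
proof -
  show "snd w permutes {..<n}" "fst w \<in> {..<n} \<rightarrow>\<^sub>E carrier G"
    using assms by (simp_all add: wreath_group_simps(1) mem_Times_iff)
  then show "fst w x \<in> carrier G" if "x < n" for x using that by (simp add: PiE_iff)
qed

context gset begin

lemma wact_closed:
  assumes w: "w \<in> carrier (wreath_group n G)" and b: "b \<in> {..<n} \<rightarrow>\<^sub>E E"
  shows "wact n \<phi> w b \<in> {..<n} \<rightarrow>\<^sub>E E"
proof
  fix x assume x: "x \<in> {..<n}"
  have "snd w permutes {..<n}" "fst w x \<in> carrier G" using wreath_carrierD[OF w] x by simp_all
  then have "b (inv_into UNIV (snd w) x) \<in> E" using inv_permutes_in[of "snd w" "{..<n}" x] x b by auto
  then show "wact n \<phi> w b x \<in> E" using closed \<open>fst w x \<in> carrier G\<close> x by (simp add: wact_def)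
qed (simp add: wact_def)

lemma wact_one: "b \<in> {..<n} \<rightarrow>\<^sub>E E \<Longrightarrow> wact n \<phi> \<one>\<^bsub>wreath_group n G\<^esub> b = b"
  by (auto simp: wact_def wreath_group_simps PiE_iff act_one extensional_def fun_eq_iff)

lemma wact_mult:
  assumes "v \<in> carrier (wreath_group n G)" "w \<in> carrier (wreath_group n G)" "b \<in> {..<n} \<rightarrow>\<^sub>E E"
  shows "wact n \<phi> (v \<otimes>\<^bsub>wreath_group n G\<^esub> w) b = wact n \<phi> v (wact n \<phi> w b)"
proof
  fix x
  have p: "snd v permutes {..<n}" "snd w permutes {..<n}" using wreath_carrierD assms(1,2) by blast+
  show "wact n \<phi> (v \<otimes>\<^bsub>wreath_group n G\<^esub> w) b x = wact n \<phi> v (wact n \<phi> w b) x"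
  proof (cases "x < n")
    case True
    define y where "y = inv_into UNIV (snd v) x"
    define z where "z = inv_into UNIV (snd w) y"
    have yz: "y < n" "z < n"
      using True inv_permutes_in[OF p(1), of x] inv_permutes_in[OF p(2), of y] by (simp_all add: y_def z_def)
    have "inv_into UNIV (snd v \<circ> snd w) x = z" by (simp add: inv_permutes_comp[OF p] y_def z_def)
    moreover have "fst v x \<in> carrier G" "fst w y \<in> carrier G" "b z \<in> E"
      using wreath_carrierD(3)[OF assms(1) True] wreath_carrierD(3)[OF assms(2) yz(1)] assms(3) yz(2)
      by (simp_all add: PiE_iff)
    ultimately show ?thesis
      using True yz by (simp add: wact_def wreath_group_simps act_mult y_def[symmetric] z_def[symmetric])
  qed (simp add: wact_def)
qed

end

lemma left_gset: "group G \<Longrightarrow> gset G (carrier G) (\<lambda>g h. g \<otimes>\<^bsub>G\<^esub> h)"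
  by (simp add: gset_def gset_axioms_def group.is_monoid monoid.m_closed monoid.l_one monoid.m_assoc)

lemma group_wreath:
  assumes "group G"
  shows "group (wreath_group n G)"
    and "w \<in> carrier (wreath_group n G) \<Longrightarrow>
      inv\<^bsub>wreath_group n G\<^esub> w = (\<lambda>x\<in>{..<n}. inv\<^bsub>G\<^esub> (fst w (snd w x)), inv_into UNIV (snd w))"
proof -
  interpret G: group G by fact
  interpret L: gset G "carrier G" "\<lambda>g h. g \<otimes>\<^bsub>G\<^esub> h" by (rule left_gset) fact
  let ?W = "wreath_group n G"
  let ?i = "\<lambda>w. (\<lambda>x\<in>{..<n}. inv\<^bsub>G\<^esub> (fst w (snd w x)), inv_into UNIV (snd w))"
  have inv: "?i w \<in> carrier ?W" "?i w \<otimes>\<^bsub>?W\<^esub> w = \<one>\<^bsub>?W\<^esub>" if w: "w \<in> carrier ?W" for w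
  proof -
    note p = wreath_carrierD(1)[OF w] and g = wreath_carrierD(3)[OF w]
    have px: "snd w x < n" if "x < n" for x using permutes_in_image[OF p] that by simp
    show "?i w \<in> carrier ?W" using g px permutes_inv[OF p] by (auto simp: wreath_group_simps)
    show "?i w \<otimes>\<^bsub>?W\<^esub> w = \<one>\<^bsub>?W\<^esub>"
      using g px inv_inv_permutes[OF p] permutes_inv_o(2)[OF p] by (auto simp: wreath_group_simps wact_def fun_eq_iff)
  qed
  show group: "group ?W"
  proof (rule groupI)
    fix v w assume vw: "v \<in> carrier ?W" "w \<in> carrier ?W"
    show "v \<otimes>\<^bsub>?W\<^esub> w \<in> carrier ?W"
      using L.wact_closed[OF vw(1) wreath_carrierD(2)[OF vw(2)]]
        permutes_compose[OF wreath_carrierD(1)[OF vw(2)] wreath_carrierD(1)[OF vw(1)]]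
      by (simp add: wreath_group_simps(1,2))
  next
    show "\<one>\<^bsub>?W\<^esub> \<in> carrier ?W" by (auto simp: wreath_group_simps permutes_id)
  next
    fix u v w assume uvw: "u \<in> carrier ?W" "v \<in> carrier ?W" "w \<in> carrier ?W"
    show "u \<otimes>\<^bsub>?W\<^esub> v \<otimes>\<^bsub>?W\<^esub> w = u \<otimes>\<^bsub>?W\<^esub> (v \<otimes>\<^bsub>?W\<^esub> w)"
      using L.wact_mult[OF uvw(1,2) wreath_carrierD(2)[OF uvw(3)]] by (simp only: wreath_group_simps(2) fst_conv snd_conv o_assoc)
  next
    fix w assume w: "w \<in> carrier ?W"
    show "\<one>\<^bsub>?W\<^esub> \<otimes>\<^bsub>?W\<^esub> w = w"
      using L.wact_one[OF wreath_carrierD(2)[OF w]] by (simp add: wreath_group_simps(2,3))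
    show "\<exists>v\<in>carrier ?W. v \<otimes>\<^bsub>?W\<^esub> w = \<one>\<^bsub>?W\<^esub>" using inv[OF w] by blast
  qed
  show "inv\<^bsub>?W\<^esub> w = ?i w" if "w \<in> carrier ?W"
    using group.inv_equality[OF group inv(2)[OF that] that inv(1)[OF that]] .
qed

lemma (in gset) wreath_gset: "gset (wreath_group n G) ({..<n} \<rightarrow>\<^sub>E E) (wact n \<phi>)"
  using group_wreath(1)[OF is_group] wact_closed wact_one wact_mult by (simp add: gset_def gset_axioms_def)

lemma wreath_simps [simp]:
  "grp (wreath n G) = wreath_group n (grp G)"
  "gmfd (wreath n G) = prod_mfd (power_mfd n (gmfd G)) (discrete_mfd {\<sigma>. \<sigma> permutes {..<n}})"
  by (simp_all add: wreath_def)

lemma finite_perms: "finite {\<sigma>. \<sigma> permutes {..<n::nat}}"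
  by (simp add: finite_permutations)

lemma smooth_manifold_wreath:
  assumes "smooth_manifold (gmfd G)"
  shows "smooth_manifold (gmfd (wreath n G))"
  using assms by (simp add: smooth_manifold_prod smooth_manifold_power smooth_manifold_discrete finite_perms countable_finite)

lemma pts_wreath: "pts (gmfd G) = carrier (grp G) \<Longrightarrow> pts (gmfd (wreath n G)) = carrier (wreath_group n (grp G))"
  by (simp add: wreath_group_simps discrete_mfd_simps)

lemma open_permutation_part:
  "smooth_map_on M (gmfd (wreath n G)) S f \<Longrightarrow> openin (mtop M) {p \<in> S. snd (f p) = \<sigma>}"
proof -
  assume f: "smooth_map_on M (gmfd (wreath n G)) S f"
  let ?D = "{\<sigma>. \<sigma> permutes {..<n}}"
  have "openin (mtop (gmfd (wreath n G))) (pts (power_mfd n (gmfd G)) \<times> ({\<sigma>} \<inter> ?D))"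
    by (simp add: openin_prod_Times_iff openin_PiE_gen)
  from smooth_map_on_preimage[OF f this]
  have "openin (mtop M) {p \<in> S. f p \<in> pts (power_mfd n (gmfd G)) \<times> ({\<sigma>} \<inter> ?D)}" .
  moreover have "{p \<in> S. f p \<in> pts (power_mfd n (gmfd G)) \<times> ({\<sigma>} \<inter> ?D)} = {p \<in> S. snd (f p) = \<sigma>}"
    using smooth_map_on_into[OF f] by (auto simp: mem_Times_iff)
  ultimately show ?thesis by simp
qed

lemma smooth_wreath_component:
  assumes G: "smooth_manifold (gmfd G)" and M: "charted M"
    and f: "smooth_map_on M (gmfd (wreath n G)) S f" and a: "a < n"
  shows "smooth_map_on M (gmfd G) S (\<lambda>p. fst (f p) a)"
proof -
  note W = smooth_manifold_wreath[OF G, of n] and Pw = smooth_manifold_power[OF G, of n]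
  have "smooth_map_on M (power_mfd n (gmfd G)) S (\<lambda>p. fst (f p))"
    using smooth_map_on_compose[OF M W[unfolded wreath_simps] smooth_manifold_charted[OF Pw] f[unfolded wreath_simps]
        smooth_map_fst[OF Pw charted_discrete] smooth_map_on_into[OF f[unfolded wreath_simps]]] .
  then show ?thesis
    by (rule smooth_map_on_compose[OF M Pw smooth_manifold_charted[OF G] _ smooth_map_power_component[OF G a]])
      (use smooth_map_on_into[OF \<open>smooth_map_on M (power_mfd n (gmfd G)) S (\<lambda>p. fst (f p))\<close>] in simp)
qed

lemma smooth_wact:
  assumes G: "smooth_manifold (gmfd G)" and E: "smooth_manifold E" and P: "charted P"
    and \<phi>: "smooth_map (prod_mfd (gmfd G) E) E (\<lambda>(g, x). \<phi> g x)"
    and w: "smooth_map_on P (gmfd (wreath n G)) S w"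
    and b: "\<And>a. a < n \<Longrightarrow> smooth_map_on P E S (\<lambda>p. b p a)"
  shows "smooth_map_on P (power_mfd n E) S (\<lambda>p. wact n \<phi> (w p) (b p))"
proof (rule smooth_map_on_power)
  note S = smooth_map_on_openin[OF w]
  show "openin (mtop P) S" by (rule S)
  fix a assume a: "a < n"
  note ch = smooth_manifold_charted[OF E]
  have perm: "snd (w p) permutes {..<n}" if "p \<in> S" for p
    using smooth_map_on_into[OF w that] by (auto simp: mem_Times_iff)
  have "smooth_map_on P E S (\<lambda>p. (\<lambda>\<sigma> q. \<phi> (fst (w q) a) (b q (inv_into UNIV \<sigma> a))) (snd (w p)) p)"
  proof (rule smooth_map_on_locally_constant[OF P ch S, where k = "\<lambda>p. snd (w p)"])
    fix p assume p: "p \<in> S"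
    show o: "openin (mtop P) {q \<in> S. snd (w q) = snd (w p)}" by (rule open_permutation_part[OF w])
    have i: "inv_into UNIV (snd (w p)) a < n" using inv_permutes_in[OF perm[OF p], of a] a by simp
    have pr: "smooth_map_on P (prod_mfd (gmfd G) E) {q \<in> S. snd (w q) = snd (w p)} (\<lambda>q. (fst (w q) a, b q (inv_into UNIV (snd (w p)) a)))"
      by (intro smooth_map_on_Pair smooth_map_on_subset[OF smooth_wreath_component[OF G P w a] o] smooth_map_on_subset[OF b[OF i] o]) auto
    from smooth_map_on_compose[OF P smooth_manifold_prod[OF G E] ch pr \<phi> smooth_map_on_into[OF pr]]
    show "smooth_map_on P E {q \<in> S. snd (w q) = snd (w p)} (\<lambda>q. \<phi> (fst (w q) a) (b q (inv_into UNIV (snd (w p)) a)))"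
      by simp
  qed
  then show "smooth_map_on P E S (\<lambda>p. wact n \<phi> (w p) (b p) a)"
    using a by (simp add: wact_def)
qed (simp add: wact_def)

lemma smooth_map_on_into_wreath:
  assumes P: "charted P" and f: "smooth_map_on P (power_mfd n (gmfd G)) S f"
    and \<sigma>: "\<And>p. p \<in> S \<Longrightarrow> \<sigma> p permutes {..<n}" "\<And>p. p \<in> S \<Longrightarrow> openin (mtop P) {q \<in> S. \<sigma> q = \<sigma> p}"
  shows "smooth_map_on P (gmfd (wreath n G)) S (\<lambda>p. (f p, \<sigma> p))"
proof -
  note S = smooth_map_on_openin[OF f]
  have "continuous_map (subtopology (mtop P) S) (discrete_topology {\<sigma>. \<sigma> permutes {..<n}}) \<sigma>"
    unfolding continuous_map_open_domain[OF S]
  proof (intro conjI allI impI)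
    fix V
    show "openin (mtop P) {x \<in> S. \<sigma> x \<in> V}"
    proof (subst openin_subopen, intro ballI)
      fix p assume p: "p \<in> {x \<in> S. \<sigma> x \<in> V}"
      then show "\<exists>T. openin (mtop P) T \<and> p \<in> T \<and> T \<subseteq> {x \<in> S. \<sigma> x \<in> V}"
        using \<sigma>(2)[of p] by (intro exI[of _ "{q \<in> S. \<sigma> q = \<sigma> p}"]) auto
    qed
  qed (use \<sigma>(1) in auto)
  then show ?thesis
    unfolding wreath_simps by (intro smooth_map_on_Pair[OF f] smooth_map_on_discrete S)
qed

lemma lie_group_wreath:
  assumes "lie_group G"
  shows "lie_group (wreath n G)"
proof -
  note G = lie_group_facts[OF assms]
  let ?W = "wreath n G"
  let ?WM = "gmfd ?W"
  note W = smooth_manifold_wreath[OF G(2), of n]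
  note chW = smooth_manifold_charted[OF W] and chG = smooth_manifold_charted[OF G(2)]
  have pts: "pts ?WM = carrier (grp ?W)" using pts_wreath[OF G(3)] by simp
  have carrier: "snd w permutes {..<n}" if "w \<in> pts ?WM" for w
    using wreath_carrierD(1)[of w n "grp G"] that unfolding pts wreath_simps(1) by blast
  note f1 = smooth_map_fst[OF W chW] and f2 = smooth_map_snd[OF W chW]
  note chP = charted_prod[OF chW chW]
  have in12: "fst p \<in> pts ?WM" "snd p \<in> pts ?WM" if "p \<in> pts (prod_mfd ?WM ?WM)" for p
    using that by (simp_all only: prod_mfd_simps(1) topspace_prod_topology mem_Times_iff)
  have "smooth_map (prod_mfd ?WM ?WM) ?WM (\<lambda>p. (wact n (\<lambda>g h. g \<otimes>\<^bsub>grp G\<^esub> h) (fst p) (fst (snd p)), snd (fst p) \<circ> snd (snd p)))"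
  proof (rule smooth_map_on_into_wreath[OF chP])
    show "smooth_map (prod_mfd ?WM ?WM) (power_mfd n (gmfd G)) (\<lambda>p. wact n (\<lambda>g h. g \<otimes>\<^bsub>grp G\<^esub> h) (fst p) (fst (snd p)))"
      by (rule smooth_wact[OF G(2,2) chP G(4) f1]) (rule smooth_wreath_component[OF G(2) chP f2])
    fix p assume p: "p \<in> pts (prod_mfd ?WM ?WM)"
    show "snd (fst p) \<circ> snd (snd p) permutes {..<n}"
      using carrier[OF in12(1)[OF p]] carrier[OF in12(2)[OF p]] by (intro permutes_compose)
    show "openin (mtop (prod_mfd ?WM ?WM)) {q \<in> pts (prod_mfd ?WM ?WM). snd (fst q) \<circ> snd (snd q) = snd (fst p) \<circ> snd (snd p)}"
    proof (subst openin_subopen, intro ballI)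
      fix q assume q: "q \<in> {q \<in> pts (prod_mfd ?WM ?WM). snd (fst q) \<circ> snd (snd q) = snd (fst p) \<circ> snd (snd p)}"
      let ?T = "{r \<in> pts (prod_mfd ?WM ?WM). snd (fst r) = snd (fst q)} \<inter> {r \<in> pts (prod_mfd ?WM ?WM). snd (snd r) = snd (snd q)}"
      have "openin (mtop (prod_mfd ?WM ?WM)) ?T"
        by (intro openin_Int open_permutation_part[OF f1] open_permutation_part[OF f2])
      moreover have "q \<in> ?T" using q by blast
      moreover have "?T \<subseteq> {q \<in> pts (prod_mfd ?WM ?WM). snd (fst q) \<circ> snd (snd q) = snd (fst p) \<circ> snd (snd p)}"
      proof
        fix r assume "r \<in> ?T"
        then have r: "r \<in> pts (prod_mfd ?WM ?WM)" "snd (fst r) = snd (fst q)" "snd (snd r) = snd (snd q)" by blast+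
        have "snd (fst q) \<circ> snd (snd q) = snd (fst p) \<circ> snd (snd p)" using q by blast
        then show "r \<in> {q \<in> pts (prod_mfd ?WM ?WM). snd (fst q) \<circ> snd (snd q) = snd (fst p) \<circ> snd (snd p)}"
          using r by (simp only: mem_Collect_eq)
      qed
      ultimately show "\<exists>T. openin (mtop (prod_mfd ?WM ?WM)) T \<and> q \<in> T \<and>
          T \<subseteq> {q \<in> pts (prod_mfd ?WM ?WM). snd (fst q) \<circ> snd (snd q) = snd (fst p) \<circ> snd (snd p)}"
        by meson
    qed
  qed
  then have mult: "smooth_map (prod_mfd ?WM ?WM) ?WM (\<lambda>(v, w). v \<otimes>\<^bsub>grp ?W\<^esub> w)"
    by (simp add: wreath_group_simps case_prod_unfold del: wreath_simps(2) topspace_prod_topology prod_mfd_simps)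
  have id: "smooth_map ?WM ?WM (\<lambda>w. w)" by (rule smooth_map_on_id[OF W openin_topspace])
  have "smooth_map ?WM ?WM (\<lambda>w. (\<lambda>x\<in>{..<n}. inv\<^bsub>grp G\<^esub> (fst w (snd w x)), inv_into UNIV (snd w)))"
  proof (rule smooth_map_on_into_wreath[OF chW])
    show "smooth_map ?WM (power_mfd n (gmfd G)) (\<lambda>w. \<lambda>x\<in>{..<n}. inv\<^bsub>grp G\<^esub> (fst w (snd w x)))"
    proof (rule smooth_map_on_power[OF openin_topspace])
      fix a assume a: "a < n"
      have "smooth_map ?WM (gmfd G) (\<lambda>w. (\<lambda>\<sigma> w. inv\<^bsub>grp G\<^esub> (fst w (\<sigma> a))) (snd w) w)"
      proof (rule smooth_map_on_locally_constant[OF chW chG openin_topspace, where k = snd])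
        fix w assume w: "w \<in> pts ?WM"
        show o: "openin (mtop ?WM) {v \<in> pts ?WM. snd v = snd w}" by (rule open_permutation_part[OF id])
        have sa: "snd w a < n" using permutes_in_image[OF carrier[OF w], of a] a by simp
        have c: "smooth_map_on ?WM (gmfd G) {v \<in> pts ?WM. snd v = snd w} (\<lambda>v. fst v (snd w a))"
          by (rule smooth_map_on_subset[OF smooth_wreath_component[OF G(2) chW id sa] o]) blast
        show "smooth_map_on ?WM (gmfd G) {v \<in> pts ?WM. snd v = snd w} (\<lambda>v. inv\<^bsub>grp G\<^esub> (fst v (snd w a)))"
          by (rule smooth_map_on_compose[OF chW G(2) chG c G(5)]) (rule smooth_map_on_into[OF c])
      qed
      then show "smooth_map ?WM (gmfd G) (\<lambda>w. (\<lambda>x\<in>{..<n}. inv\<^bsub>grp G\<^esub> (fst w (snd w x))) a)" using a by simp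
    qed simp
    fix w assume w: "w \<in> pts ?WM"
    show "inv_into UNIV (snd w) permutes {..<n}" by (rule permutes_inv[OF carrier[OF w]])
    have "{v \<in> pts ?WM. inv_into UNIV (snd v) = inv_into UNIV (snd w)} = {v \<in> pts ?WM. snd v = snd w}"
      using inv_inv_permutes[OF carrier] w by (intro Collect_cong conj_cong refl) metis
    then show "openin (mtop ?WM) {v \<in> pts ?WM. inv_into UNIV (snd v) = inv_into UNIV (snd w)}"
      using open_permutation_part[OF id] by (simp only:)
  qed
  then have "smooth_map ?WM ?WM (\<lambda>w. inv\<^bsub>grp ?W\<^esub> w)"
  proof (rule smooth_map_on_cong[OF chW chW])
    fix w assume "w \<in> pts ?WM"
    then have "w \<in> carrier (wreath_group n (grp G))" using pts by (simp only: wreath_simps)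
    from group_wreath(2)[OF G(1) this]
    show "(\<lambda>x\<in>{..<n}. inv\<^bsub>grp G\<^esub> (fst w (snd w x)), inv_into UNIV (snd w)) = inv\<^bsub>grp ?W\<^esub> w" by simp
  qed
  then show ?thesis
    unfolding lie_group_def using W pts mult group_wreath(1)[OF G(1), of n] by (simp only: wreath_simps(1))
qed

text \<open>
  The only orbit is the whole group, so the orbit topology has one point and is discrete.
\<close>

lemma torsor_left_multiplication:
  assumes "lie_group H"
  shows "torsor H (gmfd H) (\<lambda>w. \<lambda>v\<in>carrier (grp H). w \<otimes>\<^bsub>grp H\<^esub> v)"
proof -
  note H = lie_group_facts[OF assms]
  let ?C = "carrier (grp H)" and ?a = "\<lambda>w. \<lambda>v\<in>carrier (grp H). w \<otimes>\<^bsub>grp H\<^esub> v"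
  note chH = smooth_manifold_charted[OF H(2)]
  interpret H: group "grp H" by (rule H(1))
  interpret L: gset "grp H" ?C "\<lambda>g h. g \<otimes>\<^bsub>grp H\<^esub> h" by (rule left_gset[OF H(1)])
  interpret A: gset "grp H" ?C ?a
    by unfold_locales (auto simp: H.m_assoc)
  have ga: "group_action (grp H) ?C ?a"
    by (rule group_action_of_gset[OF A.gset_axioms]) auto
  have "smooth_map (prod_mfd (gmfd H) (gmfd H)) (gmfd H) (\<lambda>(w, v). ?a w v)"
    by (rule smooth_map_on_cong[OF charted_prod[OF chH chH] chH H(4)]) (auto simp: H(3))
  then have G: "G_manifold H (gmfd H) ?a" using ga H assms by (simp add: G_manifold_def)
  have orb: "orbit (grp H) ?a v = ?C" if v: "v \<in> ?C" for v
  proof (intro equalityI subsetI)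
    fix w assume w: "w \<in> ?C"
    have "w = ?a (w \<otimes>\<^bsub>grp H\<^esub> inv\<^bsub>grp H\<^esub> v) v" using v w by (simp add: H.m_assoc)
    then show "w \<in> orbit (grp H) ?a v" unfolding orbit_def using v w by blast
  qed (use v in \<open>auto simp: orbit_def\<close>)
  have orbs: "orbits (grp H) ?C ?a = {?C}" using orb H.one_closed unfolding orbits_def by blast
  have "gset (grp H) (topspace (mtop (gmfd H))) ?a" using A.gset_axioms by (simp add: H(3))
  note ot = openin_orbit_topology[OF this]
  have "orbit_topology (grp H) (mtop (gmfd H)) ?a = discrete_topology (orbits (grp H) (pts (gmfd H)) ?a)"
    unfolding topology_eq ot
  proof (intro allI iffI)
    fix V assume V: "openin (discrete_topology (orbits (grp H) (pts (gmfd H)) ?a)) V"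
    then have "V = {} \<or> V = {?C}" by (auto simp: H(3) orbs)
    moreover have "openin (mtop (gmfd H)) ?C" using openin_topspace[of "mtop (gmfd H)"] by (simp add: H(3))
    ultimately show "V \<subseteq> orbits (grp H) (pts (gmfd H)) ?a \<and> openin (mtop (gmfd H)) (\<Union>V)"
      by (auto simp: H(3) orbs)
  qed simp
  moreover have "stabilizer (grp H) ?a v = {\<one>\<^bsub>grp H\<^esub>}" if "v \<in> ?C" for v
    using that by (auto simp: stabilizer_def)
  ultimately have "semi_torsor H (gmfd H) ?a" using G by (simp add: semi_torsor_def H(3))
  moreover have "transitive_action (grp H) ?C ?a"
    unfolding transitive_action_def transitive_action_axioms_def
  proof (intro conjI ga allI impI)
    fix x y assume xy: "x \<in> ?C" "y \<in> ?C"
    then have "y \<in> orbit (grp H) ?a x" using orb by simp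
    then show "\<exists>g\<in>?C. ?a g x = y" unfolding orbit_def by blast
  qed
  moreover have "pts (gmfd H) \<noteq> {}" using H(3) H.one_closed by auto
  ultimately show ?thesis unfolding torsor_def by (simp add: H(3))
qed

section \<open>The frame bundle is principal\<close>

declare wreath_simps(2) [simp del]

locale finite_index_bundle = semi_principal_bundle +
  assumes finite_fiber_orbits: "finite (fiber_orbits B)"
begin

abbreviation n where "n \<equiv> index_size B"
abbreviation F where "F \<equiv> pts (fib B)"
abbreviation C where "C \<equiv> carrier (bgrp B)"
abbreviation N where "N \<equiv> prod_mfd M (power_mfd n (tot B))"
abbreviation Fr where "Fr \<equiv> frames M B"
abbreviation W where "W \<equiv> wreath n (sgrp B)"
abbreviation FB where "FB \<equiv> frame_bundle M B"

lemma frame_bundle_simps [simp]: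
  "tot FB = submfd N Fr (mdim M + n * mdim (fib B))" "proj FB = fst" "sgrp FB = W" "fib FB = gmfd W"
  "fibact FB = (\<lambda>w. \<lambda>v\<in>carrier (wreath_group n (bgrp B)). w \<otimes>\<^bsub>wreath_group n (bgrp B)\<^esub> v)"
  by (simp_all add: frame_bundle_def Let_def)

lemma act_frame_bundle: "act FB = (\<lambda>w. \<lambda>p\<in>Fr. (fst p, wact n (act B) w (snd p)))"
  by (simp add: frame_bundle_def Let_def wact_def case_prod_unfold)

lemma frames_iff:
  "p \<in> Fr \<longleftrightarrow> fst p \<in> pts M \<and> gset_basis (bgrp B) (tot_over B {fst p}) (act B) {..<n} (snd p)"
  by (cases p) (auto simp: frames_def fiber_power_def gset_basis_def)

text \<open>
  The reference basis of the model fiber; all identifications below depend on this choice.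
\<close>

definition e where "e = (SOME f. gset_basis (bgrp B) F (fibact B) {..<n} f)"

lemma e: "gset_basis (bgrp B) F (fibact B) {..<n} e"
  unfolding e_def index_size_def fiber_orbits_def
  by (rule someI_ex[OF fib.basis_exists[OF finite_fiber_orbits[unfolded fiber_orbits_def]]])

lemma e_in: "i < n \<Longrightarrow> e i \<in> F"
  using e by (auto simp: gset_basis_def)

text \<open>
  Every \<open>y\<close> in the model fiber is \<open>g (e i)\<close> for a unique pair \<open>(g, i)\<close>.
\<close>

definition decomposition where
  "decomposition = inv_into (C \<times> {..<n}) (\<lambda>(g, i). fibact B g (e i))"

definition grp_part where "grp_part y = fst (decomposition y)"
definition idx where "idx y = snd (decomposition y)"

lemma decomposition_bij: "bij_betw (\<lambda>(g, i). fibact B g (e i)) (C \<times> {..<n}) F"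
  using e by (simp add: gset_basis_def gset_iso_def)

lemma decomposed:
  assumes "y \<in> F"
  shows "grp_part y \<in> C" "idx y < n" "fibact B (grp_part y) (e (idx y)) = y"
proof -
  have "decomposition y \<in> C \<times> {..<n}"
    using bij_betwE[OF bij_betw_inv_into[OF decomposition_bij]] assms by (simp add: decomposition_def)
  then show "grp_part y \<in> C" "idx y < n" by (auto simp: grp_part_def idx_def)
  show "fibact B (grp_part y) (e (idx y)) = y"
    using bij_betw_inv_into_right[OF decomposition_bij assms]
    by (simp add: decomposition_def grp_part_def idx_def case_prod_unfold)
qed

lemma decomposition_unique:
  assumes "g \<in> C" "i < n"
  shows "grp_part (fibact B g (e i)) = g" "idx (fibact B g (e i)) = i"
  using bij_betw_inv_into_left[OF decomposition_bij, of "(g, i)"] assms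
  by (simp_all add: decomposition_def grp_part_def idx_def)

lemma orbit_idx: "y \<in> F \<Longrightarrow> orbit (bgrp B) (fibact B) y = orbit (bgrp B) (fibact B) (e (idx y))"
  using fib.orbit_act[of "grp_part y" "e (idx y)"] decomposed[of y] e_in[of "idx y"] by simp

lemma orbit_e: "i < n \<Longrightarrow> y \<in> orbit (bgrp B) (fibact B) (e i) \<longleftrightarrow> y \<in> F \<and> idx y = i"
proof
  assume i: "i < n" and "y \<in> orbit (bgrp B) (fibact B) (e i)"
  then obtain g where "g \<in> C" "y = fibact B g (e i)" unfolding orbit_def by blast
  then show "y \<in> F \<and> idx y = i" using i decomposition_unique fib.closed e_in by simp
next
  assume i: "i < n" and "y \<in> F \<and> idx y = i"
  then show "y \<in> orbit (bgrp B) (fibact B) (e i)" using decomposed[of y] unfolding orbit_def by force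
qed

lemmas chart_facts = smooth_manifold_charted[OF base] smooth_manifold_charted[OF semi_principal_facts(5)]
  smooth_manifold_charted[OF semi_principal_facts(6)]
lemmas lg = lie_group_facts[OF semi_principal_facts(7)]
lemmas chG = smooth_manifold_charted[OF lg(2)]

text \<open>
  On the open orbit of \<open>e i\<close> this is the inverse of the orbit map.  Here the analysis of the
  preceding sections enters.
\<close>

lemma smooth_grp_part: "smooth_map (fib B) (gmfd (sgrp B)) grp_part"
proof (rule smooth_map_on_local[OF chart_facts(2) chG openin_topspace])
  fix y assume y: "y \<in> F"
  let ?x = "e (idx y)"
  note d = decomposed[OF y]
  interpret O: free_open_orbit "sgrp B" "fib B" "fibact B" ?x
    by (rule fib_free_open_orbit[OF e_in[OF d(2)]])
  have "smooth_map_on (fib B) (gmfd (sgrp B)) (orbit (bgrp B) (fibact B) ?x) grp_part"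
  proof (rule smooth_map_on_cong[OF chart_facts(2) chG O.smooth_\<tau>])
    fix v assume "v \<in> orbit (bgrp B) (fibact B) ?x"
    then obtain g where g: "g \<in> C" "v = fibact B g ?x" unfolding orbit_def by blast
    show "O.\<tau> v = grp_part v"
      unfolding g(2) O.\<tau>_act[OF g(1)] decomposition_unique(1)[OF g(1) d(2)] ..
  qed
  moreover have "y \<in> orbit (bgrp B) (fibact B) ?x" using orbit_e[OF d(2)] y by simp
  ultimately show "\<exists>S'. y \<in> S' \<and> smooth_map_on (fib B) (gmfd (sgrp B)) S' grp_part" by blast
qed

definition bases where "bases = {y. gset_basis (bgrp B) F (fibact B) {..<n} y}"
definition perm where "perm y = (\<lambda>i. if i < n then idx (y i) else i)"

text \<open>
  A basis meets every orbit once, so its entries lie in the orbits of the entries of \<open>e\<close> in some order.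
\<close>

lemma bases_iff: "y \<in> bases \<longleftrightarrow> y \<in> {..<n} \<rightarrow>\<^sub>E F \<and> perm y permutes {..<n}"
proof (cases "y \<in> {..<n} \<rightarrow>\<^sub>E F")
  case True
  then have yF: "y i \<in> F" if "i < n" for i using that by (simp add: PiE_iff)
  have "y \<in> bases \<longleftrightarrow> bij_betw (\<lambda>i. orbit (bgrp B) (fibact B) (y i)) {..<n} (orbits (bgrp B) F (fibact B))"
    using True by (simp add: bases_def fib.basis_iff_orbits)
  also have "\<dots> \<longleftrightarrow> bij_betw ((\<lambda>i. orbit (bgrp B) (fibact B) (e i)) \<circ> perm y) {..<n} (orbits (bgrp B) F (fibact B))"
    by (rule bij_betw_cong) (use orbit_idx yF in \<open>simp add: perm_def\<close>)
  also have "\<dots> \<longleftrightarrow> bij_betw (perm y) {..<n} {..<n}"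
  proof (rule bij_betw_comp_iff2[symmetric])
    show "bij_betw (\<lambda>i. orbit (bgrp B) (fibact B) (e i)) {..<n} (orbits (bgrp B) F (fibact B))"
      using e by (simp add: fib.basis_iff_orbits)
    show "perm y ` {..<n} \<subseteq> {..<n}" using decomposed(2) yF by (auto simp: perm_def)
  qed
  also have "\<dots> \<longleftrightarrow> perm y permutes {..<n}"
    using bij_imp_permutes[of "perm y" "{..<n}"] permutes_imp_bij[of "perm y" "{..<n}"] by (auto simp: perm_def)
  finally show ?thesis using True by simp
qed (simp add: bases_def gset_basis_def)

text \<open>
  The bases with a given order of orbits form a product of orbits.  Hence the set of all bases is open
  in the power of \<open>F\<close>, and the order is locally constant on it.
\<close>

lemma bases_box:
  assumes y: "y \<in> bases"
  shows "{z \<in> bases. perm z = perm y} = (\<Pi>\<^sub>E i\<in>{..<n}. orbit (bgrp B) (fibact B) (e (perm y i)))"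
proof -
  have p: "perm y permutes {..<n}" using y by (simp add: bases_iff)
  have pn: "perm y i < n" if "i < n" for i using permutes_in_image[OF p, of i] that by simp
  show ?thesis
  proof (intro equalityI subsetI)
    fix z assume "z \<in> {z \<in> bases. perm z = perm y}"
    then have z: "z \<in> {..<n} \<rightarrow>\<^sub>E F" "perm z = perm y" by (simp_all add: bases_iff)
    have "z i \<in> orbit (bgrp B) (fibact B) (e (perm y i))" if i: "i < n" for i
      unfolding orbit_e[OF pn[OF i]] using z(1) fun_cong[OF z(2), of i] i by (simp add: perm_def PiE_iff)
    then show "z \<in> (\<Pi>\<^sub>E i\<in>{..<n}. orbit (bgrp B) (fibact B) (e (perm y i)))" using z(1) by (simp add: PiE_iff)
  next
    fix z assume z: "z \<in> (\<Pi>\<^sub>E i\<in>{..<n}. orbit (bgrp B) (fibact B) (e (perm y i)))"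
    have zi: "z i \<in> F" "idx (z i) = perm y i" if i: "i < n" for i
    proof -
      have "z i \<in> orbit (bgrp B) (fibact B) (e (perm y i))" using z i by (simp add: PiE_iff)
      then show "z i \<in> F" "idx (z i) = perm y i" unfolding orbit_e[OF pn[OF i]] by auto
    qed
    have "perm z = perm y"
    proof
      fix i show "perm z i = perm y i" using zi(2)[of i] by (cases "i < n") (simp_all add: perm_def)
    qed
    then show "z \<in> {z \<in> bases. perm z = perm y}" using p z zi(1) by (simp add: bases_iff PiE_iff)
  qed
qed

lemma bases_box_open: "y \<in> bases \<Longrightarrow> openin (mtop (power_mfd n (fib B))) {z \<in> bases. perm z = perm y}"
proof -
  assume y: "y \<in> bases"
  then have p: "perm y permutes {..<n}" by (simp add: bases_iff)
  have "openin (mtop (fib B)) (orbit (bgrp B) (fibact B) (e (perm y i)))" if "i < n" for i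
    using fib_orbit_open e_in permutes_in_image[OF p, of i] that by simp
  then show ?thesis unfolding bases_box[OF y] by (simp add: openin_PiE_gen)
qed

lemma bases_open: "openin (mtop (power_mfd n (fib B))) bases"
proof (subst openin_subopen, intro ballI)
  fix y assume y: "y \<in> bases"
  then show "\<exists>T. openin (mtop (power_mfd n (fib B))) T \<and> y \<in> T \<and> T \<subseteq> bases"
    using bases_box_open[OF y] by (intro exI[of _ "{z \<in> bases. perm z = perm y}"]) auto
qed

text \<open>
  Entry \<open>i\<close> of \<open>(g, \<sigma>) e\<close> is \<open>g i (e (\<sigma>\<inverse> i))\<close>, so the permutation that belongs to a basis \<open>y\<close> is
  the inverse of \<open>perm y\<close>.
\<close>

definition basis_to_wreath where
  "basis_to_wreath y = (\<lambda>i\<in>{..<n}. grp_part (y i), inv_into UNIV (perm y))"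
definition wreath_to_basis where "wreath_to_basis w = wact n (fibact B) w e"

lemma wreath_to_basis: "w \<in> carrier (wreath_group n (bgrp B)) \<Longrightarrow> wreath_to_basis w \<in> bases"
  unfolding bases_def wreath_to_basis_def wact_def
  using fib.basis_permute[OF e wreath_carrierD(2,1)] by blast

lemma basis_to_wreath_to_basis: "y \<in> bases \<Longrightarrow> wreath_to_basis (basis_to_wreath y) = y"
proof
  fix i assume y: "y \<in> bases"
  then have p: "perm y permutes {..<n}" and yE: "y \<in> {..<n} \<rightarrow>\<^sub>E F" by (simp_all add: bases_iff)
  show "wreath_to_basis (basis_to_wreath y) i = y i"
  proof (cases "i < n")
    case True
    then have "y i \<in> F" using yE by (simp add: PiE_iff)
    then show ?thesis using True inv_inv_permutes[OF p] decomposed(3)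
      by (simp add: wreath_to_basis_def basis_to_wreath_def wact_def) (simp add: perm_def)
  next
    case False
    then show ?thesis using yE by (simp add: wreath_to_basis_def wact_def PiE_iff extensional_def)
  qed
qed

lemma wreath_to_basis_to_wreath:
  assumes w: "w \<in> carrier (wreath_group n (bgrp B))"
  shows "basis_to_wreath (wreath_to_basis w) = w"
proof -
  note wD = wreath_carrierD[OF w]
  have i: "inv_into UNIV (snd w) i < n" if "i < n" for i using inv_permutes_in[OF wD(1), of i] that by simp
  have "perm (wreath_to_basis w) = inv_into UNIV (snd w)"
  proof
    fix j show "perm (wreath_to_basis w) j = inv_into UNIV (snd w) j"
    proof (cases "j < n")
      case True
      then show ?thesis using decomposition_unique(2)[OF wD(3)[OF True] i[OF True]]
        by (simp add: perm_def wreath_to_basis_def wact_def)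
    next
      case False
      then show ?thesis using permutes_not_in[OF permutes_inv[OF wD(1)], of j] by (simp add: perm_def)
    qed
  qed
  moreover have "(\<lambda>j\<in>{..<n}. grp_part (wreath_to_basis w j)) = fst w"
  proof
    fix j show "(\<lambda>j\<in>{..<n}. grp_part (wreath_to_basis w j)) j = fst w j"
    proof (cases "j < n")
      case True
      then show ?thesis using decomposition_unique(1)[OF wD(3)[OF True] i[OF True]]
        by (simp add: wreath_to_basis_def wact_def)
    next
      case False
      then show ?thesis using wD(2) by (simp add: PiE_iff extensional_def)
    qed
  qed
  ultimately show ?thesis using inv_inv_permutes[OF wD(1)] by (simp add: basis_to_wreath_def prod_eq_iff)
qed

lemma W_facts: "lie_group W" "smooth_manifold (gmfd W)" "charted (gmfd W)" "pts (gmfd W) = carrier (wreath_group n (bgrp B))"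
  using lie_group_wreath[OF semi_principal_facts(7), of n] lie_group_facts[of W] smooth_manifold_charted by auto

lemma power_facts: "smooth_manifold (power_mfd n (fib B))" "smooth_manifold (power_mfd n (tot B))"
  "charted (power_mfd n (fib B))" "charted (power_mfd n (tot B))" "smooth_manifold N" "charted N"
  "smooth_manifold (prod_mfd M (power_mfd n (fib B)))" "charted (prod_mfd M (power_mfd n (fib B)))"
  using base semi_principal_facts(5,6) smooth_manifold_power smooth_manifold_prod smooth_manifold_charted by blast+

lemma smooth_basis_to_wreath: "smooth_map_on (power_mfd n (fib B)) (gmfd W) bases basis_to_wreath"
  unfolding basis_to_wreath_def
proof (rule smooth_map_on_into_wreath[OF power_facts(3)])
  show "smooth_map_on (power_mfd n (fib B)) (power_mfd n (gmfd (sgrp B))) bases (\<lambda>y. \<lambda>i\<in>{..<n}. grp_part (y i))"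
  proof (rule smooth_map_on_power[OF bases_open])
    fix a assume a: "a < n"
    have c: "smooth_map_on (power_mfd n (fib B)) (fib B) bases (\<lambda>y. y a)"
      by (rule smooth_map_on_subset[OF smooth_map_power_component[OF semi_principal_facts(5) a] bases_open openin_subset[OF bases_open]])
    have "smooth_map_on (power_mfd n (fib B)) (gmfd (sgrp B)) bases (\<lambda>y. grp_part (y a))"
      by (rule smooth_map_on_compose[OF power_facts(3) semi_principal_facts(5) chG c smooth_grp_part])
        (rule smooth_map_on_into[OF c])
    then show "smooth_map_on (power_mfd n (fib B)) (gmfd (sgrp B)) bases (\<lambda>y. (\<lambda>i\<in>{..<n}. grp_part (y i)) a)"
      using a by simp
  qed simp
  fix y assume y: "y \<in> bases"
  then show "inv_into UNIV (perm y) permutes {..<n}" by (simp add: bases_iff permutes_inv)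
  have "{q \<in> bases. inv_into UNIV (perm q) = inv_into UNIV (perm y)} = {q \<in> bases. perm q = perm y}"
  proof (intro Collect_cong conj_cong refl)
    fix q assume q: "q \<in> bases"
    have "perm q permutes {..<n}" "perm y permutes {..<n}" using q y by (simp_all add: bases_iff)
    note ii = inv_inv_permutes[OF this(1)] inv_inv_permutes[OF this(2)]
    show "inv_into UNIV (perm q) = inv_into UNIV (perm y) \<longleftrightarrow> perm q = perm y" by (metis ii)
  qed
  then show "openin (mtop (power_mfd n (fib B))) {q \<in> bases. inv_into UNIV (perm q) = inv_into UNIV (perm y)}"
    using bases_box_open[OF y] by (simp only:)
qed

lemma smooth_wreath_to_basis: "smooth_map (gmfd W) (power_mfd n (fib B)) wreath_to_basis"
  unfolding wreath_to_basis_def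
  by (rule smooth_wact[OF lg(2) semi_principal_facts(5) W_facts(3) G_manifold_facts(7)[OF semi_principal_facts(2)]
        smooth_map_on_id[OF W_facts(2) openin_topspace] smooth_map_on_const[OF openin_topspace e_in]])

text \<open>
  A trivialization with inverse \<open>(proj B, \<psi>)\<close> is applied entrywise: \<open>coords\<close> takes a frame to a
  basis of the model fiber and \<open>frame_of\<close> goes back.  \<open>coords\<close> is smooth on the open set \<open>S U\<close>
  of all tuples over \<open>U\<close>, whether or not their entries lie in a single fiber; this provides the
  smooth left inverse by which the frames are recognized as a submanifold.
\<close>

definition coords where "coords \<psi> p = (\<lambda>i\<in>{..<n}. \<psi> (snd p i))" for \<psi> :: "'b \<Rightarrow> 'f" and p :: "'m \<times> (nat \<Rightarrow> 'b)"
definition frame_of where "frame_of \<phi> q = (fst q, \<lambda>i\<in>{..<n}. \<phi> (fst q, snd q i))"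
  for \<phi> :: "'m \<times> 'f \<Rightarrow> 'b" and q :: "'m \<times> (nat \<Rightarrow> 'f)"
definition S where "S U = U \<times> ({..<n} \<rightarrow>\<^sub>E tot_over B U)"

lemma Fr_subset: "Fr \<subseteq> pts N"
proof
  fix p assume "p \<in> Fr"
  then have p: "fst p \<in> pts M" "snd p \<in> {..<n} \<rightarrow>\<^sub>E tot_over B {fst p}" by (simp_all add: frames_iff gset_basis_def)
  have "snd p \<in> {..<n} \<rightarrow>\<^sub>E pts (tot B)" using p(2) by (simp add: PiE_iff tot_over_def)
  with p(1) show "p \<in> pts N" by (simp add: mem_Times_iff)
qed

lemma fst_N: "smooth_map N M fst" and component_N: "i < n \<Longrightarrow> smooth_map N (tot B) (\<lambda>p. snd p i)"
proof -
  show "smooth_map N M fst" by (rule smooth_map_fst[OF base power_facts(4)])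
  assume i: "i < n"
  have s: "smooth_map N (power_mfd n (tot B)) snd" by (rule smooth_map_snd[OF power_facts(2) chart_facts(1)])
  show "smooth_map N (tot B) (\<lambda>p. snd p i)"
    by (rule smooth_map_on_compose[OF power_facts(6) power_facts(2) chart_facts(3) s
          smooth_map_power_component[OF semi_principal_facts(6) i] smooth_map_on_into[OF s]])
qed

lemma S_iff: "p \<in> S U \<longleftrightarrow> fst p \<in> U \<and> snd p \<in> {..<n} \<rightarrow>\<^sub>E tot_over B U"
  by (simp add: S_def mem_Times_iff)

context
  fixes U \<phi> \<psi> assumes lp: "local_product M B U \<phi> \<psi>"
begin

lemma lpD: "openin (mtop M) U" "smooth_map_on (prod_mfd M (fib B)) (tot B) (U \<times> F) \<phi>"
  "smooth_map_on (tot B) (fib B) (tot_over B U) \<psi>"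
  "\<And>u x. u \<in> U \<Longrightarrow> x \<in> F \<Longrightarrow> \<phi> (u, x) \<in> tot_over B {u}" "\<And>u x. u \<in> U \<Longrightarrow> x \<in> F \<Longrightarrow> \<psi> (\<phi> (u, x)) = x"
  "\<And>b. b \<in> tot_over B U \<Longrightarrow> \<psi> b \<in> F" "\<And>b. b \<in> tot_over B U \<Longrightarrow> \<phi> (proj B b, \<psi> b) = b"
  "\<And>g u x. g \<in> C \<Longrightarrow> u \<in> U \<Longrightarrow> x \<in> F \<Longrightarrow> \<phi> (u, fibact B g x) = act B g (\<phi> (u, x))"
  using lp unfolding local_product_def by blast+

lemma S_open: "openin (mtop N) (S U)"
  using tot_over_open[OF lpD(1)] lpD(1) by (simp add: S_def openin_prod_Times_iff openin_PiE_gen)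

lemma S_subset: "S U \<subseteq> pts N" using openin_subset[OF S_open] .

lemma smooth_coords: "smooth_map_on N (power_mfd n (fib B)) (S U) (coords \<psi>)"
proof (rule smooth_map_on_power[OF S_open])
  fix a assume a: "a < n"
  have "smooth_map_on N (fib B) (S U) (\<lambda>p. \<psi> (snd p a))"
    by (rule smooth_map_on_compose[OF power_facts(6) semi_principal_facts(6) chart_facts(2)
          smooth_map_on_subset[OF component_N[OF a] S_open S_subset] lpD(3)]) (use a in \<open>simp add: S_iff PiE_iff\<close>)
  then show "smooth_map_on N (fib B) (S U) (\<lambda>p. coords \<psi> p a)" using a by (simp add: coords_def)
qed (simp add: coords_def)

lemma UQ_open: "openin (mtop (prod_mfd M (power_mfd n (fib B)))) (U \<times> bases)"
  using lpD(1) bases_open by (simp add: openin_prod_Times_iff)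

lemma bases_component: "y \<in> bases \<Longrightarrow> i < n \<Longrightarrow> y i \<in> F"
  by (auto simp: bases_iff)

lemma smooth_frame_of: "smooth_map_on (prod_mfd M (power_mfd n (fib B))) N (U \<times> bases) (frame_of \<phi>)"
proof -
  note sub = openin_subset[OF UQ_open]
  let ?P = "prod_mfd M (power_mfd n (fib B))"
  have f: "smooth_map_on ?P M (U \<times> bases) fst"
    by (rule smooth_map_on_subset[OF smooth_map_fst[OF base power_facts(3)] UQ_open sub])
  have s: "smooth_map_on ?P (power_mfd n (fib B)) (U \<times> bases) snd"
    by (rule smooth_map_on_subset[OF smooth_map_snd[OF power_facts(1) chart_facts(1)] UQ_open sub])
  have c: "smooth_map_on ?P (fib B) (U \<times> bases) (\<lambda>q. snd q a)" if a: "a < n" for a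
    by (rule smooth_map_on_compose[OF power_facts(8) power_facts(1) chart_facts(2) s
          smooth_map_power_component[OF semi_principal_facts(5) a] smooth_map_on_into[OF s]])
  have "smooth_map_on ?P (power_mfd n (tot B)) (U \<times> bases) (\<lambda>q. \<lambda>i\<in>{..<n}. \<phi> (fst q, snd q i))"
  proof (rule smooth_map_on_power[OF UQ_open])
    fix a assume a: "a < n"
    have "smooth_map_on ?P (tot B) (U \<times> bases) (\<lambda>q. \<phi> (fst q, snd q a))"
      by (rule smooth_map_on_compose[OF power_facts(8) smooth_manifold_prod[OF base semi_principal_facts(5)] chart_facts(3)
            smooth_map_on_Pair[OF f c[OF a]] lpD(2)]) (use a bases_component in auto)
    then show "smooth_map_on ?P (tot B) (U \<times> bases) (\<lambda>q. (\<lambda>i\<in>{..<n}. \<phi> (fst q, snd q i)) a)" using a by simp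
  qed simp
  from smooth_map_on_Pair[OF f this] show ?thesis unfolding frame_of_def .
qed

lemma frame_of_in: "u \<in> U \<Longrightarrow> y \<in> bases \<Longrightarrow> frame_of \<phi> (u, y) \<in> Fr"
proof -
  assume u: "u \<in> U" and y: "y \<in> bases"
  have "gset_basis (bgrp B) (tot_over B {u}) (act B) {..<n} (compose {..<n} (\<lambda>x. \<phi> (u, x)) y)"
    by (rule fib.basis_iso[OF _ local_product_gset_iso(1)[OF lp u]]) (use y in \<open>simp add: bases_def\<close>)
  moreover have "u \<in> pts M" using openin_subset[OF lpD(1)] u by blast
  ultimately show ?thesis by (simp add: frames_iff frame_of_def compose_def)
qed

lemma Fr_over:
  assumes p: "p \<in> Fr" "fst p \<in> U"
  shows "p \<in> S U" "coords \<psi> p \<in> bases" "frame_of \<phi> (fst p, coords \<psi> p) = p"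
proof -
  let ?m = "fst p" and ?b = "snd p"
  have b: "gset_basis (bgrp B) (tot_over B {?m}) (act B) {..<n} ?b" using p by (simp add: frames_iff)
  then have bE: "?b \<in> {..<n} \<rightarrow>\<^sub>E tot_over B {?m}" by (simp add: gset_basis_def)
  then have bi: "?b i \<in> tot_over B U" "proj B (?b i) = ?m" if "i < n" for i
    using that p(2) by (auto simp: PiE_iff tot_over_def)
  show "p \<in> S U" using bE bi p(2) by (simp add: S_iff PiE_iff)
  interpret fm: free_gset "bgrp B" "tot_over B {?m}" "act B" by (rule fiber_free_gset)
  have "gset_basis (bgrp B) F (fibact B) {..<n} (compose {..<n} \<psi> ?b)"
    by (rule fm.basis_iso[OF b local_product_gset_iso(2)[OF lp p(2)]])
  then show "coords \<psi> p \<in> bases" by (simp add: bases_def coords_def compose_def)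
  have "(\<lambda>i\<in>{..<n}. \<phi> (?m, coords \<psi> p i)) = ?b"
  proof
    fix i show "(\<lambda>i\<in>{..<n}. \<phi> (?m, coords \<psi> p i)) i = ?b i"
    proof (cases "i < n")
      case True
      then show ?thesis using lpD(7)[OF bi(1)[OF True]] bi(2)[OF True] by (simp add: coords_def)
    qed (use bE in \<open>simp add: PiE_iff extensional_def\<close>)
  qed
  then show "frame_of \<phi> (fst p, coords \<psi> p) = p" by (simp add: frame_of_def prod_eq_iff)
qed

lemma coords_frame_of: "u \<in> U \<Longrightarrow> y \<in> bases \<Longrightarrow> coords \<psi> (frame_of \<phi> (u, y)) = y"
  using lpD(5) bases_component by (auto simp: coords_def frame_of_def fun_eq_iff bases_iff PiE_iff extensional_def)

end

lemma smooth_manifold_frames: "smooth_manifold (tot FB)"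
  unfolding frame_bundle_simps
proof (rule submfd_smooth_manifold[OF power_facts(5) Fr_subset power_facts(7)])
  show "mdim (prod_mfd M (power_mfd n (fib B))) = mdim M + n * mdim (fib B)" by simp
  fix p assume p: "p \<in> Fr"
  then have "fst p \<in> pts M" by (simp add: frames_iff)
  then obtain U \<phi> \<psi> where U: "fst p \<in> U" "local_product M B U \<phi> \<psi>" using local_product_at by blast
  note lp = U(2)
  have s: "smooth_map_on N (prod_mfd M (power_mfd n (fib B))) (S U) (\<lambda>p. (fst p, coords \<psi> p))"
    by (rule smooth_map_on_Pair[OF smooth_map_on_subset[OF fst_N S_open[OF lp] S_subset[OF lp]] smooth_coords[OF lp]])
  have im: "frame_of \<phi> ` (U \<times> bases) = S U \<inter> Fr"
  proof (intro equalityI subsetI)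
    fix q assume "q \<in> frame_of \<phi> ` (U \<times> bases)"
    then obtain u y where uy: "u \<in> U" "y \<in> bases" "q = frame_of \<phi> (u, y)" by blast
    have "q \<in> Fr" unfolding uy(3) by (rule frame_of_in[OF lp uy(1,2)])
    moreover have "fst q \<in> U" using uy by (simp add: frame_of_def)
    ultimately show "q \<in> S U \<inter> Fr" using Fr_over(1)[OF lp] by blast
  next
    fix q assume q: "q \<in> S U \<inter> Fr"
    then have "fst q \<in> U" by (simp add: S_iff)
    then have "(fst q, coords \<psi> q) \<in> U \<times> bases" "frame_of \<phi> (fst q, coords \<psi> q) = q"
      using Fr_over(2,3)[OF lp, of q] q by simp_all
    then show "q \<in> frame_of \<phi> ` (U \<times> bases)" by (metis image_eqI)
  qed
  have l: "\<forall>q\<in>U \<times> bases. (fst (frame_of \<phi> q), coords \<psi> (frame_of \<phi> q)) = q"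
  proof
    fix q assume "q \<in> U \<times> bases"
    then show "(fst (frame_of \<phi> q), coords \<psi> (frame_of \<phi> q)) = q"
      using coords_frame_of[OF lp, of "fst q" "snd q"] by (simp add: mem_Times_iff prod_eq_iff) (simp add: frame_of_def)
  qed
  show "\<exists>bases' \<theta> \<psi>' W'. p \<in> W' \<and> smooth_map_on (prod_mfd M (power_mfd n (fib B))) N bases' \<theta> \<and>
      smooth_map_on N (prod_mfd M (power_mfd n (fib B))) W' \<psi>' \<and> \<theta> ` bases' = W' \<inter> Fr \<and> (\<forall>q\<in>bases'. \<psi>' (\<theta> q) = q)"
    using Fr_over(1)[OF lp p U(1)] smooth_frame_of[OF lp] s im l by blast
qed

lemma pts_frames: "pts (tot FB) = Fr"
  using Fr_subset by (simp add: Int_absorb1 del: topspace_prod_topology prod_mfd_simps)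

lemma frame_wact:
  assumes p: "p \<in> Fr" and w: "w \<in> carrier (wreath_group n (bgrp B))"
  shows "(fst p, wact n (act B) w (snd p)) \<in> Fr"
proof -
  interpret fm: free_gset "bgrp B" "tot_over B {fst p}" "act B" by (rule fiber_free_gset)
  have "gset_basis (bgrp B) (tot_over B {fst p}) (act B) {..<n} (snd p)" using p by (simp add: frames_iff)
  from fm.basis_permute[OF this wreath_carrierD(2,1)[OF w]] show ?thesis
    using p by (simp add: frames_iff wact_def)
qed

lemma snd_Fr: "p \<in> Fr \<Longrightarrow> snd p \<in> {..<n} \<rightarrow>\<^sub>E pts (tot B)"
  using subsetD[OF Fr_subset, of p] by (simp add: mem_Times_iff)

lemma frame_gset: "gset (wreath_group n (bgrp B)) Fr (act FB)"
proof -
  interpret P: gset "wreath_group n (bgrp B)" "{..<n} \<rightarrow>\<^sub>E pts (tot B)" "wact n (act B)" by (rule tot.wreath_gset)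
  show ?thesis
  proof unfold_locales
    fix w p assume w: "w \<in> carrier (wreath_group n (bgrp B))" and p: "p \<in> Fr"
    show "act FB w p \<in> Fr" using frame_wact[OF p w] p by (simp add: act_frame_bundle)
    fix v assume v: "v \<in> carrier (wreath_group n (bgrp B))"
    show "act FB (v \<otimes>\<^bsub>wreath_group n (bgrp B)\<^esub> w) p = act FB v (act FB w p)"
      using frame_wact[OF p w] p P.act_mult[OF v w snd_Fr[OF p]] by (simp add: act_frame_bundle)
  next
    fix p assume p: "p \<in> Fr"
    then show "act FB \<one>\<^bsub>wreath_group n (bgrp B)\<^esub> p = p" using P.act_one[OF snd_Fr[OF p]] by (simp add: act_frame_bundle)
  qed
qed

lemma G_manifold_frames: "G_manifold W (tot FB) (act FB)"
proof -
  have ga: "group_action (grp W) (pts (tot FB)) (act FB)"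
    unfolding pts_frames wreath_simps(1) by (rule group_action_of_gset[OF frame_gset]) (simp add: act_frame_bundle)
  let ?P = "prod_mfd (gmfd W) (tot FB)"
  note chT = charted_submfd[of N Fr "mdim M + n * mdim (fib B)", folded frame_bundle_simps(1)]
  note chP = charted_prod[OF W_facts(3) chT]
  have f: "smooth_map ?P (gmfd W) fst" by (rule smooth_map_fst[OF W_facts(2) chT])
  have s0: "smooth_map ?P (tot FB) snd" by (rule smooth_map_snd[OF smooth_manifold_frames W_facts(3)])
  have incl: "smooth_map (tot FB) N (\<lambda>p. p)" unfolding frame_bundle_simps by (rule smooth_map_submfd_inclusion[OF power_facts(6)])
  have s: "smooth_map ?P N snd"
    by (rule smooth_map_on_compose[OF chP smooth_manifold_frames power_facts(6) s0 incl smooth_map_on_into[OF s0]])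
  have "smooth_map ?P N (\<lambda>q. (fst (snd q), wact n (act B) (fst q) (snd (snd q))))"
  proof (rule smooth_map_on_Pair)
    show "smooth_map ?P M (\<lambda>q. fst (snd q))"
      by (rule smooth_map_on_compose[OF chP power_facts(5) chart_facts(1) s fst_N smooth_map_on_into[OF s]])
    show "smooth_map ?P (power_mfd n (tot B)) (\<lambda>q. wact n (act B) (fst q) (snd (snd q)))"
      by (rule smooth_wact[OF lg(2) semi_principal_facts(6) chP G_manifold_facts(7)[OF semi_principal_facts(3)] f])
        (rule smooth_map_on_compose[OF chP power_facts(5) chart_facts(3) s component_N smooth_map_on_into[OF s]])
  qed
  then have "smooth_map ?P (tot FB) (\<lambda>q. (fst (snd q), wact n (act B) (fst q) (snd (snd q))))"
    unfolding frame_bundle_simps(1)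
  proof (rule smooth_map_on_into_submfd[OF chP[unfolded frame_bundle_simps(1)] power_facts(5)])
    fix q assume "q \<in> pts (prod_mfd (gmfd W) (submfd N Fr (mdim M + n * mdim (fib B))))"
    then have "fst q \<in> pts (gmfd W)" "snd q \<in> pts (tot FB)" by (simp_all add: mem_Times_iff)
    then show "(fst (snd q), wact n (act B) (fst q) (snd (snd q))) \<in> Fr"
      unfolding pts_frames W_facts(4) by (intro frame_wact)
  qed
  then have "smooth_map ?P (tot FB) (\<lambda>(w, p). act FB w p)"
  proof (rule smooth_map_on_cong[OF chP chT])
    fix q assume "q \<in> pts ?P"
    then have "snd q \<in> pts (tot FB)" by (simp add: mem_Times_iff)
    then have "snd q \<in> Fr" unfolding pts_frames .
    then show "(fst (snd q), wact n (act B) (fst q) (snd (snd q))) = (case q of (w, p) \<Rightarrow> act FB w p)"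
      by (simp add: act_frame_bundle case_prod_unfold)
  qed
  then show ?thesis using ga W_facts(1) smooth_manifold_frames unfolding G_manifold_def by blast
qed

lemma smooth_proj_frames: "smooth_map (tot FB) M (proj FB)"
proof -
  have "smooth_map_on (submfd N Fr (mdim M + n * mdim (fib B))) M (Fr \<inter> pts N) fst"
    by (rule smooth_map_on_from_submfd[OF power_facts(5) chart_facts(1) fst_N Fr_subset])
  then show ?thesis using pts_frames Fr_subset unfolding frame_bundle_simps by (simp only: Int_absorb2)
qed

text \<open>
  Frames over \<open>U\<close> correspond to pairs of a point of \<open>U\<close> and a basis of the model fiber, and bases of
  the model fiber correspond to elements of the wreath product.
\<close>

lemma local_product_frames:
  assumes lp: "local_product M B U \<phi> \<psi>"
  shows "local_product M FB U (\<lambda>(u, w). frame_of \<phi> (u, wreath_to_basis w)) (\<lambda>p. basis_to_wreath (coords \<psi> p))"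
proof -
  let ?\<Phi> = "\<lambda>(u, w). frame_of \<phi> (u, wreath_to_basis w)" and ?\<Psi> = "\<lambda>p. basis_to_wreath (coords \<psi> p)"
  let ?CW = "carrier (wreath_group n (bgrp B))"
  note U = lpD(1)[OF lp]
  note chT = charted_submfd[of N Fr "mdim M + n * mdim (fib B)"]
  have over: "tot_over FB V = {p \<in> Fr. fst p \<in> V}" for V
    unfolding tot_over_def pts_frames frame_bundle_simps(2) ..
  have fibFB: "pts (fib FB) = ?CW" using W_facts(4) by simp
  let ?P = "prod_mfd M (gmfd W)" and ?D = "U \<times> pts (gmfd W)"
  note chP = charted_prod[OF chart_facts(1) W_facts(3)]
  have DO: "openin (mtop ?P) ?D" using U by (simp add: openin_prod_Times_iff)
  have sD: "smooth_map_on ?P (gmfd W) ?D snd"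
    by (rule smooth_map_on_subset[OF smooth_map_snd[OF W_facts(2) chart_facts(1)] DO openin_subset[OF DO]])
  have fD: "smooth_map_on ?P M ?D fst"
    by (rule smooth_map_on_subset[OF smooth_map_fst[OF base W_facts(3)] DO openin_subset[OF DO]])
  have bD: "smooth_map_on ?P (power_mfd n (fib B)) ?D (\<lambda>q. wreath_to_basis (snd q))"
    by (rule smooth_map_on_compose[OF chP W_facts(2) power_facts(3) sD smooth_wreath_to_basis smooth_map_on_into[OF sD]])
  have inD: "fst q \<in> U" "wreath_to_basis (snd q) \<in> bases" if "q \<in> ?D" for q
    using that wreath_to_basis W_facts(4) by (simp_all add: mem_Times_iff)
  have "smooth_map_on ?P N ?D (\<lambda>q. frame_of \<phi> (fst q, wreath_to_basis (snd q)))"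
    by (rule smooth_map_on_compose[OF chP power_facts(7,6) smooth_map_on_Pair[OF fD bD] smooth_frame_of[OF lp]])
      (use inD in \<open>simp add: mem_Times_iff\<close>)
  then have "smooth_map_on ?P (tot FB) ?D (\<lambda>q. frame_of \<phi> (fst q, wreath_to_basis (snd q)))"
    unfolding frame_bundle_simps(1)
    by (rule smooth_map_on_into_submfd[OF chP power_facts(5)]) (use inD in \<open>intro frame_of_in[OF lp]\<close>)
  then have 1: "smooth_map_on (prod_mfd M (fib FB)) (tot FB) (U \<times> pts (fib FB)) ?\<Phi>"
    unfolding frame_bundle_simps(4) by (simp add: case_prod_unfold)
  let ?S = "{p \<in> S U. coords \<psi> p \<in> bases}"
  have SO: "openin (mtop N) ?S" by (rule smooth_map_on_preimage[OF smooth_coords[OF lp] bases_open])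
  have "smooth_map_on N (gmfd W) ?S ?\<Psi>"
    by (rule smooth_map_on_compose[OF power_facts(6) power_facts(1) W_facts(3)
          smooth_map_on_subset[OF smooth_coords[OF lp] SO] smooth_basis_to_wreath]) auto
  from smooth_map_on_from_submfd[OF power_facts(5) W_facts(3) this Fr_subset]
  have "smooth_map_on (tot FB) (gmfd W) (Fr \<inter> ?S) ?\<Psi>" unfolding frame_bundle_simps(1) .
  moreover have "Fr \<inter> ?S = tot_over FB U"
  proof (intro equalityI subsetI)
    fix p assume "p \<in> tot_over FB U"
    then have p: "p \<in> Fr" "fst p \<in> U" by (simp_all add: over)
    then show "p \<in> Fr \<inter> ?S" using Fr_over(1,2)[OF lp p] by simp
  qed (simp add: over S_iff)
  ultimately have 2: "smooth_map_on (tot FB) (fib FB) (tot_over FB U) ?\<Psi>" by simp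
  have 3: "?\<Phi> (u, w) \<in> tot_over FB {u}" "?\<Psi> (?\<Phi> (u, w)) = w" if u: "u \<in> U" and w: "w \<in> ?CW" for u w
    using frame_of_in[OF lp u wreath_to_basis[OF w]] coords_frame_of[OF lp u wreath_to_basis[OF w]]
      wreath_to_basis_to_wreath[OF w] unfolding over by (simp_all add: frame_of_def)
  have 4: "?\<Psi> p \<in> ?CW" "?\<Phi> (proj FB p, ?\<Psi> p) = p" if p: "p \<in> tot_over FB U" for p
  proof -
    have pF: "p \<in> Fr" "fst p \<in> U" using p by (simp_all add: over)
    note o = Fr_over[OF lp pF]
    show "?\<Psi> p \<in> ?CW" using smooth_map_on_into[OF smooth_basis_to_wreath o(2)] W_facts(4) by simp
    show "?\<Phi> (proj FB p, ?\<Psi> p) = p" using basis_to_wreath_to_basis[OF o(2)] o(3) by simp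
  qed
  have 5: "?\<Phi> (u, fibact FB v w) = act FB v (?\<Phi> (u, w))" if v: "v \<in> ?CW" and u: "u \<in> U" and w: "w \<in> ?CW" for v u w
  proof -
    have eE: "e \<in> {..<n} \<rightarrow>\<^sub>E F" using e by (simp add: gset_basis_def)
    have fv: "fibact FB v w = v \<otimes>\<^bsub>wreath_group n (bgrp B)\<^esub> w" using w by simp
    have m: "wreath_to_basis (v \<otimes>\<^bsub>wreath_group n (bgrp B)\<^esub> w) = wact n (fibact B) v (wreath_to_basis w)"
      unfolding wreath_to_basis_def by (rule fib.wact_mult[OF v w eE])
    note wQ = wreath_to_basis[OF w]
    have "(\<lambda>i\<in>{..<n}. \<phi> (u, wact n (fibact B) v (wreath_to_basis w) i))
        = wact n (act B) v (\<lambda>i\<in>{..<n}. \<phi> (u, wreath_to_basis w i))"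
    proof
      fix i show "(\<lambda>i\<in>{..<n}. \<phi> (u, wact n (fibact B) v (wreath_to_basis w) i)) i
        = wact n (act B) v (\<lambda>i\<in>{..<n}. \<phi> (u, wreath_to_basis w i)) i"
      proof (cases "i < n")
        case True
        then have j: "inv_into UNIV (snd v) i < n" using inv_permutes_in[OF wreath_carrierD(1)[OF v], of i] by simp
        show ?thesis
          using True j lpD(8)[OF lp wreath_carrierD(3)[OF v True] u bases_component[OF lp wQ j]] by (simp add: wact_def)
      qed (simp add: wact_def)
    qed
    then show ?thesis unfolding fv
      using frame_of_in[OF lp u wQ] by (simp add: m act_frame_bundle) (simp add: frame_of_def)
  qed
  show ?thesis
    unfolding local_product_def fibFB
    using U 1 2 3 4 5 fibFB by simp
qed

lemma principal_frame_bundle: "principal M FB"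
proof -
  have t: "torsor W (gmfd W) (fibact FB)"
    using torsor_left_multiplication[OF W_facts(1)] by simp
  have "semi_principal M FB"
    unfolding semi_principal_def
  proof (intro conjI ballI)
    show "semi_torsor (sgrp FB) (fib FB) (fibact FB)" using t by (simp add: torsor_def)
    show "G_manifold (sgrp FB) (tot FB) (act FB)" using G_manifold_frames by (simp only: frame_bundle_simps(3))
    show "smooth_map (tot FB) M (proj FB)" by (rule smooth_proj_frames)
    fix w p assume "w \<in> carrier (bgrp FB)" "p \<in> pts (tot FB)"
    then have "p \<in> Fr" unfolding pts_frames by blast
    then show "proj FB (act FB w p) = proj FB p" by (simp add: act_frame_bundle)
  next
    fix m assume "m \<in> pts M"
    then obtain U \<phi> \<psi> where U: "m \<in> U" "local_product M B U \<phi> \<psi>" using local_product_at by blast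
    have "smooth_manifold (fib FB)" using W_facts(2) by simp
    from local_product_imp_local_trivialization[OF base this smooth_manifold_frames smooth_proj_frames local_product_frames[OF U(2)]]
    show "\<exists>U \<phi>. m \<in> U \<and> local_trivialization M FB U \<phi>" using U(1) by blast
  qed
  then show ?thesis unfolding principal_def using t by (simp only: frame_bundle_simps(3,4))
qed

end

section \<open>The functor, and frames of principal bundles\<close>

text \<open>
  Bundles over an empty manifold may have index sets of different size although they are
  isomorphic; the frame map is then a map between empty manifolds.
\<close>

lemma smooth_map_empty: "pts M = {} \<Longrightarrow> smooth_map M N f"
proof -
  assume M: "pts M = {}"
  have "Ck m k {} g" for m k g
    by (rule Ck_cong[of m "{}" "\<lambda>_. 0"]) (auto intro: Ck_const)
  then show ?thesis
    unfolding smooth_map_on_def smooth_euclidean_def M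
    using openin_topspace[of "mtop M"] by (auto simp: M continuous_map_def)
qed

lemma lie_hom_trivial:
  assumes G: "lie_group G" and H: "lie_group H"
  shows "lie_hom G H (\<lambda>_. \<one>\<^bsub>grp H\<^esub>)"
proof -
  interpret H: group "grp H" using lie_group_facts(1)[OF H] .
  show ?thesis
    unfolding lie_hom_def using lie_group_facts(3)[OF H]
    by (auto simp: hom_def intro!: smooth_map_on_const)
qed

definition wreath_map where "wreath_map n \<xi> w = (\<lambda>x\<in>{..<n}. \<xi> (fst w x), snd w)"
  for n :: nat and \<xi> :: "'g \<Rightarrow> 'h" and w :: "(nat \<Rightarrow> 'g) \<times> (nat \<Rightarrow> nat)"

lemma lie_hom_wreath_map:
  assumes G: "lie_group G" and H: "lie_group H" and \<xi>: "lie_hom G H \<xi>"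
  shows "lie_hom (wreath n G) (wreath n H) (wreath_map n \<xi>)"
proof -
  note gG = lie_group_facts[OF G] and gH = lie_group_facts[OF H]
  note wG = lie_group_facts[OF lie_group_wreath[OF G, of n]]
  note chW = smooth_manifold_charted[OF wG(2)] and chH = smooth_manifold_charted[OF gH(2)]
  have \<xi>h: "\<And>g. g \<in> carrier (grp G) \<Longrightarrow> \<xi> g \<in> carrier (grp H)"
    "\<And>g h. g \<in> carrier (grp G) \<Longrightarrow> h \<in> carrier (grp G) \<Longrightarrow> \<xi> (g \<otimes>\<^bsub>grp G\<^esub> h) = \<xi> g \<otimes>\<^bsub>grp H\<^esub> \<xi> h"
    "smooth_map (gmfd G) (gmfd H) \<xi>"
    using \<xi> by (auto simp: lie_hom_def hom_def)
  have "wreath_map n \<xi> \<in> hom (wreath_group n (grp G)) (wreath_group n (grp H))"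
  proof (rule homI)
    fix w assume w: "w \<in> carrier (wreath_group n (grp G))"
    show "wreath_map n \<xi> w \<in> carrier (wreath_group n (grp H))"
      using wreath_carrierD[OF w] \<xi>h(1) by (simp add: wreath_map_def wreath_group_simps(1))
    fix v assume v: "v \<in> carrier (wreath_group n (grp G))"
    have "(\<lambda>x\<in>{..<n}. \<xi> (wact n (\<lambda>g h. g \<otimes>\<^bsub>grp G\<^esub> h) w (fst v) x))
       = wact n (\<lambda>g h. g \<otimes>\<^bsub>grp H\<^esub> h) (wreath_map n \<xi> w) (\<lambda>x\<in>{..<n}. \<xi> (fst v x))"
    proof
      fix x show "(\<lambda>x\<in>{..<n}. \<xi> (wact n (\<lambda>g h. g \<otimes>\<^bsub>grp G\<^esub> h) w (fst v) x)) x
        = wact n (\<lambda>g h. g \<otimes>\<^bsub>grp H\<^esub> h) (wreath_map n \<xi> w) (\<lambda>x\<in>{..<n}. \<xi> (fst v x)) x"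
      proof (cases "x < n")
        case True
        then have "inv_into UNIV (snd w) x < n" using inv_permutes_in[OF wreath_carrierD(1)[OF w], of x] by simp
        then show ?thesis
          using True \<xi>h(2)[OF wreath_carrierD(3)[OF w True] wreath_carrierD(3)[OF v]] by (simp add: wact_def wreath_map_def)
      qed (simp add: wact_def)
    qed
    then show "wreath_map n \<xi> (w \<otimes>\<^bsub>wreath_group n (grp G)\<^esub> v)
       = wreath_map n \<xi> w \<otimes>\<^bsub>wreath_group n (grp H)\<^esub> wreath_map n \<xi> v"
      by (simp add: wreath_group_simps(2)) (simp add: wreath_map_def)
  qed
  moreover have "smooth_map (gmfd (wreath n G)) (gmfd (wreath n H)) (wreath_map n \<xi>)"
    unfolding wreath_map_def
  proof (rule smooth_map_on_into_wreath[OF chW])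
    have id: "smooth_map (gmfd (wreath n G)) (gmfd (wreath n G)) (\<lambda>w. w)"
      by (rule smooth_map_on_id[OF wG(2) openin_topspace])
    show "smooth_map (gmfd (wreath n G)) (power_mfd n (gmfd H)) (\<lambda>w. \<lambda>x\<in>{..<n}. \<xi> (fst w x))"
    proof (rule smooth_map_on_power[OF openin_topspace])
      fix a assume a: "a < n"
      note c = smooth_wreath_component[OF gG(2) chW id a]
      have "smooth_map (gmfd (wreath n G)) (gmfd H) (\<lambda>w. \<xi> (fst w a))"
        by (rule smooth_map_on_compose[OF chW gG(2) chH c \<xi>h(3)]) (rule smooth_map_on_into[OF c])
      then show "smooth_map (gmfd (wreath n G)) (gmfd H) (\<lambda>w. (\<lambda>x\<in>{..<n}. \<xi> (fst w x)) a)" using a by simp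
    qed simp
    fix w assume "w \<in> pts (gmfd (wreath n G))"
    then have "w \<in> carrier (wreath_group n (grp G))" using wG(3) by simp
    then show "snd w permutes {..<n}" by (rule wreath_carrierD)
    show "openin (mtop (gmfd (wreath n G))) {v \<in> pts (gmfd (wreath n G)). snd v = snd w}"
      by (rule open_permutation_part[OF id])
  qed
  ultimately show ?thesis by (simp add: lie_hom_def)
qed

context semi_principal_bundle begin

lemma fiber_orbits_over:
  "orbits (bgrp B) (tot_over B {m}) (act B) = {W \<in> Orbits. orbit_proj B W = m}"
proof (intro equalityI subsetI)
  fix W assume "W \<in> orbits (bgrp B) (tot_over B {m}) (act B)"
  then obtain b where b: "b \<in> tot_over B {m}" "W = orbit (bgrp B) (act B) b" unfolding orbits_def by blast
  then have "b \<in> pts (tot B)" "proj B b = m" by (simp_all add: tot_over_def)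
  then show "W \<in> {W \<in> Orbits. orbit_proj B W = m}"
    using tot.orbits_mem orbit_proj_orbit b(2) by simp
next
  fix W assume W: "W \<in> {W \<in> Orbits. orbit_proj B W = m}"
  then obtain b where b: "b \<in> pts (tot B)" "W = orbit (bgrp B) (act B) b" using tot.orbits_nonempty by blast
  then have "b \<in> tot_over B {m}" using orbit_proj_orbit W by (simp add: tot_over_def)
  then show "W \<in> orbits (bgrp B) (tot_over B {m}) (act B)" using b(2) unfolding orbits_def by blast
qed

end

locale SPrin_morphism = A: finite_index_bundle M A + B: finite_index_bundle M B
  for M :: "'m mfd" and A :: "('m, 'b, 'g, 'f) gbundle" and B :: "('m, 'c, 'h, 'e) gbundle" +
  fixes \<alpha> :: "'b \<Rightarrow> 'c"
  assumes map: "\<alpha> \<in> equivariant_maps A B"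
    and orbit_iso: "orbit_bundle_iso M A B (orbit_map B \<alpha>)"
begin

lemmas spA = A.semi_principal_bundle_axioms and spB = B.semi_principal_bundle_axioms

text \<open>
  A bijection over \<open>M\<close> restricts to bijections of fibers.
\<close>

lemma orbit_map_fiber_bij:
  "bij_betw (orbit_map B \<alpha>) (orbits (bgrp A) (tot_over A {m}) (act A)) (orbits (bgrp B) (tot_over B {m}) (act B))"
proof -
  have h: "homeomorphic_map A.Orbit_top B.Orbit_top (orbit_map B \<alpha>)"
    and p: "\<And>W. W \<in> A.Orbits \<Longrightarrow> orbit_proj B (orbit_map B \<alpha> W) = orbit_proj A W"
    using orbit_iso unfolding orbit_bundle_iso_iff[OF spA spB] by simp_all
  have inj: "inj_on (orbit_map B \<alpha>) A.Orbits" and im: "orbit_map B \<alpha> ` A.Orbits = B.Orbits"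
    using homeomorphic_imp_injective_map[OF h] homeomorphic_imp_surjective_map[OF h] by simp_all
  show ?thesis
    unfolding A.fiber_orbits_over B.fiber_orbits_over bij_betw_def
  proof
    show "inj_on (orbit_map B \<alpha>) {W \<in> A.Orbits. orbit_proj A W = m}" by (rule inj_on_subset[OF inj]) blast
    show "orbit_map B \<alpha> ` {W \<in> A.Orbits. orbit_proj A W = m} = {W \<in> B.Orbits. orbit_proj B W = m}"
    proof (intro equalityI subsetI)
      fix V assume V: "V \<in> {W \<in> B.Orbits. orbit_proj B W = m}"
      then obtain W where "W \<in> A.Orbits" "V = orbit_map B \<alpha> W" using im by blast
      then show "V \<in> orbit_map B \<alpha> ` {W \<in> A.Orbits. orbit_proj A W = m}" using p V by auto
    qed (use im p in auto)
  qed
qed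

lemma index_size_eq: "m \<in> pts M \<Longrightarrow> index_size B = index_size A"
  using bij_betw_same_card[OF orbit_map_fiber_bij[of m]] A.card_fiber_orbits B.card_fiber_orbits by simp

text \<open>
  The orbits of the entries of \<open>\<alpha> \<circ> b\<close> are the images of the orbits of the entries of \<open>b\<close> under
  the bijection induced by \<open>\<alpha>\<close>.
\<close>

lemma frame_map_basis:
  assumes p: "p \<in> frames M A"
  shows "(fst p, compose {..<index_size A} \<alpha> (snd p)) \<in> frames M B"
proof -
  let ?m = "fst p" and ?n = "index_size A"
  have m: "?m \<in> pts M" and b: "gset_basis (bgrp A) (tot_over A {?m}) (act A) {..<?n} (snd p)"
    using p by (simp_all add: A.frames_iff)
  interpret fA: free_gset "bgrp A" "tot_over A {?m}" "act A" by (rule A.fiber_free_gset)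
  interpret fB: free_gset "bgrp B" "tot_over B {?m}" "act B" by (rule B.fiber_free_gset)
  have bE: "snd p i \<in> tot_over A {?m}" "snd p i \<in> pts (tot A)" if "i < ?n" for i
  proof -
    show "snd p i \<in> tot_over A {?m}" using b that by (auto simp: gset_basis_def)
    then show "snd p i \<in> pts (tot A)" by (simp add: tot_over_def)
  qed
  have aE: "\<alpha> (snd p i) \<in> tot_over B {?m}" if "i < ?n" for i
    using equivariant_mapsD(3,4)[OF map bE(2)[OF that]] bE(1)[OF that] by (simp add: tot_over_def)
  have "bij_betw (orbit_map B \<alpha> \<circ> (\<lambda>i. orbit (bgrp A) (act A) (snd p i))) {..<?n} (orbits (bgrp B) (tot_over B {?m}) (act B))"
    using b unfolding fA.basis_iff_orbits by (intro bij_betw_trans[OF _ orbit_map_fiber_bij]) blast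
  then have "bij_betw (\<lambda>i. orbit (bgrp B) (act B) (compose {..<?n} \<alpha> (snd p) i)) {..<?n} (orbits (bgrp B) (tot_over B {?m}) (act B))"
    by (rule bij_betw_cong[THEN iffD1, rotated])
      (simp add: compose_def orbit_map_orbit[OF spA spB map bE(2)])
  then have "gset_basis (bgrp B) (tot_over B {?m}) (act B) {..<?n} (compose {..<?n} \<alpha> (snd p))"
    unfolding fB.basis_iff_orbits using aE by (simp add: compose_def)
  then show ?thesis using m by (simp add: B.frames_iff index_size_eq[OF m])
qed

lemma frame_map_apply: "p \<in> frames M A \<Longrightarrow> frame_map M A B \<alpha> p = (fst p, compose {..<index_size A} \<alpha> (snd p))"
  by (simp add: frame_map_def case_prod_unfold)

lemma frame_map_in: "p \<in> frames M A \<Longrightarrow> frame_map M A B \<alpha> p \<in> frames M B"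
  using frame_map_basis frame_map_apply by simp

lemma smooth_frame_map: "smooth_map (tot A.FB) (tot B.FB) (frame_map M A B \<alpha>)"
proof (cases "pts M = {}")
  case True
  then have "frames M A = {}" using A.frames_iff by blast
  then show ?thesis by (intro smooth_map_empty) (simp only: A.pts_frames)
next
  case False
  then obtain m where m: "m \<in> pts M" by blast
  let ?n = "index_size A"
  note n = index_size_eq[OF m]
  have "smooth_map A.N B.N (\<lambda>p. (fst p, \<lambda>i\<in>{..<?n}. \<alpha> (snd p i)))"
    unfolding n
  proof (intro smooth_map_on_Pair[OF A.fst_N] smooth_map_on_power openin_topspace)
    fix a assume a: "a < ?n"
    note c = A.component_N[OF a]
    have "smooth_map A.N (tot B) (\<lambda>p. \<alpha> (snd p a))"
      by (rule smooth_map_on_compose[OF A.power_facts(6) A.semi_principal_facts(6) B.chart_facts(3) c equivariant_mapsD(2)[OF map]])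
        (rule smooth_map_on_into[OF c])
    then show "smooth_map A.N (tot B) (\<lambda>p. (\<lambda>i\<in>{..<?n}. \<alpha> (snd p i)) a)" using a by simp
  qed simp
  from smooth_map_on_from_submfd[OF A.power_facts(5) B.power_facts(6) this A.Fr_subset]
  have "smooth_map (tot A.FB) B.N (\<lambda>p. (fst p, \<lambda>i\<in>{..<?n}. \<alpha> (snd p i)))"
    unfolding A.pts_frames Int_absorb2[OF A.Fr_subset] by (simp only: A.frame_bundle_simps(1))
  then have "smooth_map (tot A.FB) B.N (frame_map M A B \<alpha>)"
    by (rule smooth_map_on_cong[OF smooth_manifold_charted[OF A.smooth_manifold_frames] B.power_facts(6)])
      (simp only: A.pts_frames frame_map_apply compose_def)
  then show ?thesis
    unfolding B.frame_bundle_simps(1)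
    by (rule smooth_map_on_into_submfd[OF smooth_manifold_charted[OF A.smooth_manifold_frames] B.power_facts(5)])
      (simp only: A.pts_frames frame_map_in)
qed

text \<open>
  Over a nonempty base the homomorphism is \<open>\<xi>!\<close>, applying \<open>\<xi>\<close> to every entry and keeping the
  permutation.
\<close>

lemma frame_map_equivariant: "\<exists>\<xi>. equivariant_along A.FB B.FB \<xi> (frame_map M A B \<alpha>)"
proof (cases "pts M = {}")
  case True
  then have "pts (tot A.FB) = {}" unfolding A.pts_frames using A.frames_iff by blast
  then show ?thesis
    unfolding equivariant_along_def using lie_hom_trivial[OF A.W_facts(1) B.W_facts(1)]
    by (intro exI[of _ "\<lambda>_. \<one>\<^bsub>grp (wreath (index_size B) (sgrp B))\<^esub>"]) simp
next
  case False
  then obtain m where m: "m \<in> pts M" by blast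
  let ?n = "index_size A"
  note n = index_size_eq[OF m]
  obtain \<xi> where \<xi>: "lie_hom (sgrp A) (sgrp B) \<xi>"
    "\<And>g b. g \<in> carrier (bgrp A) \<Longrightarrow> b \<in> pts (tot A) \<Longrightarrow> \<alpha> (act A g b) = act B (\<xi> g) (\<alpha> b)"
    using equivariant_maps_along[OF map] by metis
  have "frame_map M A B \<alpha> (act A.FB w p) = act B.FB (wreath_map ?n \<xi> w) (frame_map M A B \<alpha> p)"
    if w: "w \<in> carrier (wreath_group ?n (bgrp A))" and p: "p \<in> frames M A" for w p
  proof -
    have "compose {..<?n} \<alpha> (wact ?n (act A) w (snd p)) = wact ?n (act B) (wreath_map ?n \<xi> w) (compose {..<?n} \<alpha> (snd p))"
    proof
      fix x show "compose {..<?n} \<alpha> (wact ?n (act A) w (snd p)) x = wact ?n (act B) (wreath_map ?n \<xi> w) (compose {..<?n} \<alpha> (snd p)) x"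
      proof (cases "x < ?n")
        case True
        then have j: "inv_into UNIV (snd w) x < ?n" using inv_permutes_in[OF wreath_carrierD(1)[OF w], of x] by simp
        have "snd p (inv_into UNIV (snd w) x) \<in> pts (tot A)" using A.snd_Fr[OF p] j by (simp add: PiE_iff)
        then show ?thesis
          using True j \<xi>(2)[OF wreath_carrierD(3)[OF w True]] by (simp add: compose_def wact_def wreath_map_def)
      qed (simp add: compose_def wact_def)
    qed
    then show ?thesis
      using A.frame_wact[OF p w] frame_map_in[OF p] p
      by (simp add: A.act_frame_bundle B.act_frame_bundle frame_map_apply n)
  qed
  then have "equivariant_along A.FB B.FB (wreath_map ?n \<xi>) (frame_map M A B \<alpha>)"
    unfolding equivariant_along_def A.pts_frames
    using lie_hom_wreath_map[OF A.semi_principal_facts(7) B.semi_principal_facts(7) \<xi>(1), of ?n] by (simp add: n)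
  then show ?thesis by blast
qed

lemma frame_map_equivariant_maps: "frame_map M A B \<alpha> \<in> equivariant_maps A.FB B.FB"
proof -
  have "frame_map M A B \<alpha> \<in> extensional A.Fr" by (simp add: frame_map_def)
  moreover have "proj B.FB (frame_map M A B \<alpha> p) = proj A.FB p" if "p \<in> A.Fr" for p
    using frame_map_apply[OF that] by simp
  ultimately show ?thesis
    unfolding equivariant_maps_def A.pts_frames
    using smooth_frame_map[unfolded A.pts_frames] frame_map_equivariant by blast
qed

end

context principal_bundle begin

text \<open>
  Each fiber is a single orbit, which every one-element family meets once.
\<close>

lemma frames_principal: "frames M B = fiber_power M B (index_size B)"
proof (intro equalityI subsetI)
  fix p assume p: "p \<in> fiber_power M B (index_size B)"
  let ?m = "fst p" and ?b = "snd p"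
  have m: "?m \<in> pts M" and b: "?b \<in> {..<1} \<rightarrow>\<^sub>E tot_over B {?m}"
    using p by (simp_all add: fiber_power_def index_size_1 case_prod_unfold)
  interpret fm: free_gset "bgrp B" "tot_over B {?m}" "act B" by (rule fiber_free_gset)
  have b0: "?b 0 \<in> tot_over B {?m}" using b by auto
  have "orbit (bgrp B) (act B) (?b 0) = tot_over B {?m}"
  proof (intro equalityI subsetI)
    fix c assume "c \<in> tot_over B {?m}"
    then show "c \<in> orbit (bgrp B) (act B) (?b 0)" using fiber_transitive[OF b0] unfolding orbit_def by blast
  qed (use fm.orbit_subset[OF b0] in blast)
  moreover have "orbit (bgrp B) (act B) c = orbit (bgrp B) (act B) (?b 0)" if "c \<in> tot_over B {?m}" for c
    using fm.orbit_eq[OF b0, of c] that calculation by simp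
  ultimately have "orbits (bgrp B) (tot_over B {?m}) (act B) = {orbit (bgrp B) (act B) (?b 0)}"
    using b0 unfolding orbits_def by blast
  then have "gset_basis (bgrp B) (tot_over B {?m}) (act B) {..<1} ?b"
    unfolding fm.basis_iff_orbits using b by (simp add: bij_betw_def lessThan_Suc)
  then show "p \<in> frames M B" using p by (simp add: frames_def index_size_1 case_prod_unfold)
qed (simp add: frames_def case_prod_unfold)

end

sublocale principal_bundle \<subseteq> finite_index_bundle
  by unfold_locales (simp add: fiber_orbits_eq)

context principal_bundle begin

lemma frame_eval_apply: "p \<in> Fr \<Longrightarrow> frame_eval M B p = snd p 0"
  by (simp add: frame_eval_def case_prod_unfold)

lemma zero_less_n: "0 < n" by (simp add: index_size_1)

lemma frame_point: "b \<in> pts (tot B) \<Longrightarrow> (proj B b, \<lambda>i\<in>{..<1}. b) \<in> Fr"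
  using proj_in unfolding frames_principal by (simp add: fiber_power_def index_size_1 tot_over_def)

lemma Fr_eta:
  assumes "p \<in> Fr"
  shows "proj B (snd p 0) = fst p" "snd p 0 \<in> pts (tot B)" "(\<lambda>i\<in>{..<1}. snd p 0) = snd p"
proof -
  have b: "snd p \<in> {..<1} \<rightarrow>\<^sub>E tot_over B {fst p}"
    using assms unfolding frames_principal by (simp add: fiber_power_def index_size_1 case_prod_unfold)
  then have "snd p 0 \<in> tot_over B {fst p}" by auto
  then show "proj B (snd p 0) = fst p" "snd p 0 \<in> pts (tot B)" by (simp_all add: tot_over_def)
  show "(\<lambda>i\<in>{..<1}. snd p 0) = snd p" using b by (auto simp: PiE_iff extensional_def fun_eq_iff)
qed

lemma frame_eval_equivariant_maps: "frame_eval M B \<in> equivariant_maps FB B"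
proof -
  note chT = smooth_manifold_charted[OF smooth_manifold_frames]
  from smooth_map_on_from_submfd[OF power_facts(5) chart_facts(3) component_N[OF zero_less_n] Fr_subset]
  have "smooth_map (tot FB) (tot B) (\<lambda>p. snd p 0)"
    unfolding pts_frames Int_absorb2[OF Fr_subset] by (simp only: frame_bundle_simps(1))
  then have s: "smooth_map (tot FB) (tot B) (frame_eval M B)"
    by (rule smooth_map_on_cong[OF chT chart_facts(3)]) (simp only: pts_frames frame_eval_apply)
  have "lie_hom W (sgrp B) (\<lambda>w. fst w 0)"
  proof -
    have "(\<lambda>w. fst w 0) \<in> hom (wreath_group n (bgrp B)) (bgrp B)"
    proof (rule homI)
      fix w assume w: "w \<in> carrier (wreath_group n (bgrp B))"
      show "fst w 0 \<in> carrier (bgrp B)" by (rule wreath_carrierD(3)[OF w zero_less_n])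
      fix v assume v: "v \<in> carrier (wreath_group n (bgrp B))"
      have "inv_into UNIV (snd w) 0 < n" using inv_permutes_in[OF wreath_carrierD(1)[OF w], of 0] zero_less_n by simp
      then show "fst (w \<otimes>\<^bsub>wreath_group n (bgrp B)\<^esub> v) 0 = fst w 0 \<otimes>\<^bsub>bgrp B\<^esub> fst v 0"
        by (simp add: wreath_group_simps(2) wact_def index_size_1)
    qed
    moreover have "smooth_map (gmfd W) (gmfd (sgrp B)) (\<lambda>w. fst w 0)"
      by (rule smooth_wreath_component[OF lg(2) W_facts(3) smooth_map_on_id[OF W_facts(2) openin_topspace] zero_less_n])
    ultimately show ?thesis by (simp add: lie_hom_def)
  qed
  moreover have "frame_eval M B (act FB w p) = act B (fst w 0) (frame_eval M B p)"
    if w: "w \<in> carrier (wreath_group n (bgrp B))" and p: "p \<in> Fr" for w p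
  proof -
    have "inv_into UNIV (snd w) 0 < n" using inv_permutes_in[OF wreath_carrierD(1)[OF w], of 0] zero_less_n by simp
    then have "inv_into UNIV (snd w) 0 = 0" by (simp add: index_size_1)
    then show ?thesis using p frame_wact[OF p w] zero_less_n by (simp add: act_frame_bundle frame_eval_apply wact_def)
  qed
  ultimately have "equivariant_along FB B (\<lambda>w. fst w 0) (frame_eval M B)"
    unfolding equivariant_along_def pts_frames by simp
  moreover have "frame_eval M B \<in> extensional Fr" by (simp add: frame_eval_def)
  moreover have "proj B (frame_eval M B p) = proj FB p" if "p \<in> Fr" for p
    using Fr_eta(1)[OF that] frame_eval_apply[OF that] by simp
  ultimately show ?thesis unfolding equivariant_maps_def pts_frames using s[unfolded pts_frames] by blast
qed

text \<open>
  The inverse of the canonical map from the frame bundle to the bundle itself.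
\<close>

definition point_frame where "point_frame = (\<lambda>b\<in>pts (tot B). (proj B b, \<lambda>i\<in>{..<1::nat}. b))"

lemma point_frame_equivariant_maps: "point_frame \<in> equivariant_maps B FB"
proof -
  have "smooth_map (tot B) N (\<lambda>b. (proj B b, \<lambda>i\<in>{..<1}. b))"
    unfolding index_size_1
  proof (intro smooth_map_on_Pair[OF semi_principal_facts(4)] smooth_map_on_power openin_topspace)
    fix a :: nat assume "a < 1"
    then show "smooth_map (tot B) (tot B) (\<lambda>b. (\<lambda>i\<in>{..<1}. b) a)"
      using smooth_map_on_id[OF semi_principal_facts(6) openin_topspace] by simp
  qed simp
  then have "smooth_map (tot B) (tot FB) (\<lambda>b. (proj B b, \<lambda>i\<in>{..<1}. b))"
    unfolding frame_bundle_simps(1)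
    by (rule smooth_map_on_into_submfd[OF chart_facts(3) power_facts(5)]) (rule frame_point)
  then have s: "smooth_map (tot B) (tot FB) point_frame"
    by (rule smooth_map_on_cong[OF chart_facts(3) smooth_manifold_charted[OF smooth_manifold_frames]]) (simp add: point_frame_def)
  let ?\<xi> = "\<lambda>g. (\<lambda>i\<in>{..<1::nat}. g, id :: nat \<Rightarrow> nat)"
  have c: "?\<xi> g \<in> carrier (wreath_group n (bgrp B))" if "g \<in> C" for g
    using that by (simp add: wreath_group_simps(1) index_size_1 permutes_id)
  have "lie_hom (sgrp B) W ?\<xi>"
  proof -
    have "?\<xi> \<in> hom (bgrp B) (wreath_group n (bgrp B))"
      by (rule homI) (use c in \<open>auto simp: wreath_group_simps(2) wact_def index_size_1 fun_eq_iff\<close>)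
    moreover have "smooth_map (gmfd (sgrp B)) (gmfd W) ?\<xi>"
    proof (rule smooth_map_on_into_wreath[OF chG])
      show "smooth_map (gmfd (sgrp B)) (power_mfd n (gmfd (sgrp B))) (\<lambda>g. \<lambda>i\<in>{..<1}. g)"
        unfolding index_size_1
      proof (rule smooth_map_on_power[OF openin_topspace])
        fix a :: nat assume "a < 1"
        then show "smooth_map (gmfd (sgrp B)) (gmfd (sgrp B)) (\<lambda>b. (\<lambda>i\<in>{..<1}. b) a)"
          using smooth_map_on_id[OF lg(2) openin_topspace] by simp
      qed simp
    qed (simp_all add: permutes_id)
    ultimately show ?thesis by (simp add: lie_hom_def)
  qed
  moreover have "point_frame (act B g b) = act FB (?\<xi> g) (point_frame b)" if "g \<in> C" "b \<in> pts (tot B)" for g b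
    using that tot.closed proj_act frame_point
    by (auto simp: point_frame_def act_frame_bundle wact_def index_size_1 fun_eq_iff)
  ultimately have "equivariant_along B FB ?\<xi> point_frame" unfolding equivariant_along_def by simp
  then show ?thesis
    unfolding equivariant_maps_def using s by (auto simp: point_frame_def)
qed

lemma bundle_iso_frame_eval: "bundle_iso FB B (frame_eval M B)"
  unfolding bundle_iso_def
proof (intro conjI bexI)
  show "compose (pts (tot FB)) point_frame (frame_eval M B) = (\<lambda>p\<in>pts (tot FB). p)"
    unfolding pts_frames
  proof
    fix p show "compose Fr point_frame (frame_eval M B) p = (\<lambda>p\<in>Fr. p) p"
      using Fr_eta[of p] by (simp add: compose_def point_frame_def frame_eval_apply prod_eq_iff)
  qed
  show "compose (pts (tot B)) (frame_eval M B) point_frame = (\<lambda>b\<in>pts (tot B). b)"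
    using frame_point by (auto simp: compose_def point_frame_def frame_eval_apply fun_eq_iff)
qed (rule frame_eval_equivariant_maps point_frame_equivariant_maps)+

end

lemma frame_map_id:
  assumes "finite_index_bundle M A"
  shows "frame_map M A A (\<lambda>b\<in>pts (tot A). b) = (\<lambda>p\<in>pts (tot (frame_bundle M A)). p)"
proof
  interpret finite_index_bundle M A by fact
  fix p
  show "frame_map M A A (\<lambda>b\<in>pts (tot A). b) p = (\<lambda>p\<in>pts (tot (frame_bundle M A)). p) p"
  proof (cases "p \<in> frames M A")
    case True
    then have "compose {..<index_size A} (\<lambda>b\<in>pts (tot A). b) (snd p) = snd p"
      using snd_Fr[OF True] by (auto simp: compose_def fun_eq_iff PiE_iff extensional_def)
    then show ?thesis using True unfolding pts_frames by (simp add: frame_map_def case_prod_unfold)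
  next
    case False
    then show ?thesis unfolding pts_frames by (simp add: frame_map_def)
  qed
qed

lemma frame_map_compose:
  assumes "SPrin_morphism M A B \<alpha>" "SPrin_morphism M B D \<beta>"
  shows "frame_map M A D (compose (pts (tot A)) \<beta> \<alpha>)
    = compose (pts (tot (frame_bundle M A))) (frame_map M B D \<beta>) (frame_map M A B \<alpha>)"
proof
  interpret a: SPrin_morphism M A B \<alpha> by fact
  interpret b: SPrin_morphism M B D \<beta> by fact
  fix p
  show "frame_map M A D (compose (pts (tot A)) \<beta> \<alpha>) p
    = compose (pts (tot (frame_bundle M A))) (frame_map M B D \<beta>) (frame_map M A B \<alpha>) p"
  proof (cases "p \<in> frames M A")
    case True
    then have "fst p \<in> pts M" by (simp add: a.A.frames_iff)
    then have n: "index_size B = index_size A" by (rule a.index_size_eq)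
    have "compose {..<index_size A} (compose (pts (tot A)) \<beta> \<alpha>) (snd p) =
        compose {..<index_size B} \<beta> (compose {..<index_size A} \<alpha> (snd p))"
      using a.A.snd_Fr[OF True] by (auto simp: compose_def fun_eq_iff PiE_iff n)
    moreover have "frame_map M A D (compose (pts (tot A)) \<beta> \<alpha>) p
        = (fst p, compose {..<index_size A} (compose (pts (tot A)) \<beta> \<alpha>) (snd p))"
      using True by (simp add: frame_map_def case_prod_unfold)
    moreover have "frame_map M B D \<beta> (frame_map M A B \<alpha> p)
        = (fst p, compose {..<index_size B} \<beta> (compose {..<index_size A} \<alpha> (snd p)))"
      unfolding b.frame_map_apply[OF a.frame_map_in[OF True]] unfolding a.frame_map_apply[OF True] by simp
    moreover have "compose a.A.Fr (frame_map M B D \<beta>) (frame_map M A B \<alpha>) p = frame_map M B D \<beta> (frame_map M A B \<alpha> p)"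
      using True by (rule compose_eq)
    ultimately show ?thesis unfolding a.A.pts_frames by simp
  qed (simp add: frame_map_def compose_def a.A.pts_frames del: a.A.frame_bundle_simps)
qed

theorem theorem4p8:
  fixes M :: "'m mfd"
  assumes "smooth_manifold M"
  shows "covariant_functor
           (SPrin M :: (('m, 'b, 'g, 'f) gbundle, 'b \<Rightarrow> 'b) cat) (Prin M)
           (frame_bundle M) (frame_map M)
    \<and> full_subcategory (Prin M :: (('m, 'b, 'g, 'f) gbundle, 'b \<Rightarrow> 'b) cat) (SPrin M)
    \<and> (\<forall>B \<in> Ob (Prin M :: (('m, 'b, 'g, 'f) gbundle, 'b \<Rightarrow> 'b) cat).
          {..<index_size B} = {0} \<and>
          frames M B = fiber_power M B (index_size B) \<and>
          bundle_iso (frame_bundle M B) B (frame_eval M B))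
    \<and> (\<forall>A \<in> Ob (Prin M :: (('m, 'b, 'g, 'f) gbundle, 'b \<Rightarrow> 'b) cat).
        \<forall>B \<in> Ob (Prin M). \<forall>\<alpha> \<in> Hom (Prin M) A B.
          compose (frames M A) (frame_eval M B) (frame_map M A B \<alpha>)
            = compose (frames M A) \<alpha> (frame_eval M A))"
proof (intro conjI ballI)
  have fi: "finite_index_bundle M A" if "A \<in> Ob (SPrin M)" for A :: "('m, 'b, 'g, 'f) gbundle"
    using that assms by unfold_locales (simp_all add: SPrin_def)
  have pr: "principal_bundle M A" if "A \<in> Ob (Prin M)" for A :: "('m, 'b, 'g, 'f) gbundle"
    using that assms by unfold_locales (simp_all add: Prin_def)
  have mor: "SPrin_morphism M A B f" if "A \<in> Ob (SPrin M)" "B \<in> Ob (SPrin M)" "f \<in> Hom (SPrin M) A B"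
    for A B :: "('m, 'b, 'g, 'f) gbundle" and f
    using fi[OF that(1)] fi[OF that(2)] that(3)
    by (simp add: SPrin_morphism_def SPrin_morphism_axioms_def SPrin_def)
  show "covariant_functor (SPrin M :: (('m, 'b, 'g, 'f) gbundle, 'b \<Rightarrow> 'b) cat) (Prin M) (frame_bundle M) (frame_map M)"
    unfolding covariant_functor_def
  proof (intro conjI ballI category_SPrin category_Prin assms)
    fix A :: "('m, 'b, 'g, 'f) gbundle" assume A: "A \<in> Ob (SPrin M)"
    show "frame_bundle M A \<in> Ob (Prin M)"
      using finite_index_bundle.principal_frame_bundle[OF fi[OF A]] by (simp add: Prin_def)
    show "frame_map M A A (Id (SPrin M) A) = Id (Prin M) (frame_bundle M A)"
      using frame_map_id[OF fi[OF A]] by (simp add: Prin_def SPrin_def)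
    fix B :: "('m, 'b, 'g, 'f) gbundle" and f assume B: "B \<in> Ob (SPrin M)" and f: "f \<in> Hom (SPrin M) A B"
    show "frame_map M A B f \<in> Hom (Prin M) (frame_bundle M A) (frame_bundle M B)"
      using SPrin_morphism.frame_map_equivariant_maps[OF mor[OF A B f]] by (simp add: Prin_def)
    fix D :: "('m, 'b, 'g, 'f) gbundle" and g assume D: "D \<in> Ob (SPrin M)" and g: "g \<in> Hom (SPrin M) B D"
    show "frame_map M A D (Comp (SPrin M) A B D g f) =
        Comp (Prin M) (frame_bundle M A) (frame_bundle M B) (frame_bundle M D) (frame_map M B D g) (frame_map M A B f)"
      using frame_map_compose[OF mor[OF A B f] mor[OF B D g]] by (simp add: Prin_def SPrin_def)
  qed
  show "full_subcategory (Prin M :: (('m, 'b, 'g, 'f) gbundle, 'b \<Rightarrow> 'b) cat) (SPrin M)"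
    by (rule Prin_full_subcategory[OF assms])
  fix A :: "('m, 'b, 'g, 'f) gbundle" assume A: "A \<in> Ob (Prin M)"
  interpret A: principal_bundle M A by (rule pr[OF A])
  show "{..<index_size A} = {0}" by (auto simp: A.index_size_1)
  show "frames M A = fiber_power M A (index_size A)" by (rule A.frames_principal)
  show "bundle_iso (frame_bundle M A) A (frame_eval M A)" by (rule A.bundle_iso_frame_eval)
  fix B :: "('m, 'b, 'g, 'f) gbundle" and \<alpha> assume B: "B \<in> Ob (Prin M)" and \<alpha>: "\<alpha> \<in> Hom (Prin M) A B"
  interpret B: principal_bundle M B by (rule pr[OF B])
  have "\<alpha> \<in> equivariant_maps A B" using \<alpha> by (simp add: Prin_def)
  then interpret f: SPrin_morphism M A B \<alpha>
    using principal_orbit_bundle_iso[OF pr[OF A] pr[OF B]] by unfold_locales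
  show "compose (frames M A) (frame_eval M B) (frame_map M A B \<alpha>) = compose (frames M A) \<alpha> (frame_eval M A)"
  proof
    fix p show "compose (frames M A) (frame_eval M B) (frame_map M A B \<alpha>) p = compose (frames M A) \<alpha> (frame_eval M A) p"
    proof (cases "p \<in> frames M A")
      case True
      then show ?thesis
        using B.frame_eval_apply[OF f.frame_map_in[OF True]] A.frame_eval_apply[OF True] f.frame_map_apply[OF True]
        by (simp add: compose_def A.index_size_1)
    qed (simp add: compose_def)
  qed
qed

end
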